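(* There is a data structure for (partial) lattices on $n$ elements that requires $O(n^{3/2})$ words of space, answers order-testing queries (given elements $x,y$, decide whether $x \le y$) in $O(1)$ time, and computes the meet or join of two elements (or reports that it does not exist) in $O(n^{3/4})$ time. The preprocessing time starting from the transitive reduction graph of the lattice is $O(n^2)$.
   Context: Model: word RAM with $\Theta(\log n)$-bit words; space is measured in words. A partial lattice is a finite partially ordered set in which, whenever $x_1,x_2<y_1,y_2$, there exists $z$ with $x_1,x_2\le z\le y_1,y_2$; equivalently, any two elements with a common lower bound have a unique meet (greatest common lower bound) and any two with a common upper bound have a unique join (least common upper bound); otherwise the meet (resp. join) is said not to exist. The transitive reduction graph of the lattice is the directed graph with one node per element and an edge $(u,v)$ whenever $u<v$ and there is no $w$ with $u<w<v$; the lattice is given initially in this form. *)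

theory Defs
  imports Complex_Main "HOL-Library.Landau_Symbols"
begin

section \<open>Partial lattices\<close>

definition less_rel :: "'a rel \<Rightarrow> 'a \<Rightarrow> 'a \<Rightarrow> bool" where
  "less_rel r x y \<longleftrightarrow> (x, y) \<in> r \<and> x \<noteq> y"

definition partial_lattice_on :: "'a set \<Rightarrow> 'a rel \<Rightarrow> bool" where
  "partial_lattice_on A r \<longleftrightarrow>
     finite A \<and> partial_order_on A r \<and>
     (\<forall>x1\<in>A. \<forall>x2\<in>A. \<forall>y1\<in>A. \<forall>y2\<in>A.
        less_rel r x1 y1 \<and> less_rel r x1 y2 \<and> less_rel r x2 y1 \<and> less_rel r x2 y2 \<longrightarrow>
        (\<exists>z\<in>A. (x1, z) \<in> r \<and> (x2, z) \<in> r \<and> (z, y1) \<in> r \<and> (z, y2) \<in> r))"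

definition transitive_reduction :: "'a set \<Rightarrow> 'a rel \<Rightarrow> 'a rel" where
  "transitive_reduction A r =
     {(u, v). u \<in> A \<and> v \<in> A \<and> less_rel r u v \<and> \<not> (\<exists>w\<in>A. less_rel r u w \<and> less_rel r w v)}"

definition is_meet :: "'a set \<Rightarrow> 'a rel \<Rightarrow> 'a \<Rightarrow> 'a \<Rightarrow> 'a \<Rightarrow> bool" where
  "is_meet A r x y z \<longleftrightarrow> z \<in> A \<and> (z, x) \<in> r \<and> (z, y) \<in> r \<and>
     (\<forall>w\<in>A. (w, x) \<in> r \<and> (w, y) \<in> r \<longrightarrow> (w, z) \<in> r)"

definition is_join :: "'a set \<Rightarrow> 'a rel \<Rightarrow> 'a \<Rightarrow> 'a \<Rightarrow> 'a \<Rightarrow> bool" where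
  "is_join A r x y z \<longleftrightarrow> z \<in> A \<and> (x, z) \<in> r \<and> (y, z) \<in> r \<and>
     (\<forall>w\<in>A. (x, w) \<in> r \<and> (y, w) \<in> r \<longrightarrow> (z, w) \<in> r)"


section \<open>A word RAM\<close>

text \<open>
  Three-address programs over finitely many registers (a program mentions only finitely many) and
  an array of words. Control flow is structured: every statement is a constant number of
  machine instructions and is charged accordingly. A program is one fixed finite object, so its
  constants cannot depend on the input. All stored results are reduced to \<open>w\<close> bits.
\<close>

datatype binop = Plus | Minus | Times | Div | Mod | BitAnd | BitOr | BitXor | ShiftL | ShiftR

datatype operand = Imm nat | Reg nat

datatype cmp = Eq | Neq | Less | Leq

datatype com =
    Skip
  | Move nat operand
  | Op nat binop operand operand
  | Load nat operand
  | Store operand operand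
  | Seq com com
  | If cmp operand operand com com
  | While cmp operand operand com

text \<open>Subtraction wraps around; division and remainder by zero follow the conventions on
  natural numbers.\<close>

fun word_op :: "nat \<Rightarrow> binop \<Rightarrow> nat \<Rightarrow> nat \<Rightarrow> nat" where
  "word_op w Plus a b = take_bit w (a + b)"
| "word_op w Minus a b = take_bit w (a + 2 ^ w - b)"
| "word_op w Times a b = take_bit w (a * b)"
| "word_op w Div a b = take_bit w (a div b)"
| "word_op w Mod a b = take_bit w (a mod b)"
| "word_op w BitAnd a b = take_bit w (and a b)"
| "word_op w BitOr a b = take_bit w (or a b)"
| "word_op w BitXor a b = take_bit w (xor a b)"
| "word_op w ShiftL a b = take_bit w (push_bit b a)"
| "word_op w ShiftR a b = take_bit w (drop_bit b a)"

fun compare :: "cmp \<Rightarrow> nat \<Rightarrow> nat \<Rightarrow> bool" where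
  "compare Eq a b \<longleftrightarrow> a = b"
| "compare Neq a b \<longleftrightarrow> a \<noteq> b"
| "compare Less a b \<longleftrightarrow> a < b"
| "compare Leq a b \<longleftrightarrow> a \<le> b"

type_synonym regs = "nat \<Rightarrow> nat"
type_synonym mem = "nat list"

fun val :: "nat \<Rightarrow> regs \<Rightarrow> operand \<Rightarrow> nat" where
  "val w R (Imm c) = take_bit w c"
| "val w R (Reg i) = R i"

text \<open>\<open>exec w c (R, M) t (R', M')\<close>: with words of \<open>w\<close> bits, \<open>c\<close> started in \<open>(R, M)\<close> halts
  after \<open>t\<close> steps in \<open>(R', M')\<close>. The length of the memory never changes; an access outside
  it has no rule, so such a computation does not halt.\<close>

inductive exec :: "nat \<Rightarrow> com \<Rightarrow> regs \<times> mem \<Rightarrow> nat \<Rightarrow> regs \<times> mem \<Rightarrow> bool" for w where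
  Skip: "exec w Skip s 1 s"
| Move: "exec w (Move i a) (R, M) 1 (R(i := val w R a), M)"
| Op: "exec w (Op i f a b) (R, M) 1 (R(i := word_op w f (val w R a) (val w R b)), M)"
| Load: "val w R a < length M \<Longrightarrow>
    exec w (Load i a) (R, M) 1 (R(i := M ! val w R a), M)"
| Store: "val w R a < length M \<Longrightarrow>
    exec w (Store a b) (R, M) 1 (R, M[val w R a := val w R b])"
| Seq: "exec w c s t s' \<Longrightarrow> exec w d s' u s'' \<Longrightarrow> exec w (Seq c d) s (t + u) s''"
| IfTrue: "compare p (val w (fst s) a) (val w (fst s) b) \<Longrightarrow> exec w c s t s' \<Longrightarrow>
    exec w (If p a b c d) s (Suc t) s'"
| IfFalse: "\<not> compare p (val w (fst s) a) (val w (fst s) b) \<Longrightarrow> exec w d s t s' \<Longrightarrow>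
    exec w (If p a b c d) s (Suc t) s'"
| WhileFalse: "\<not> compare p (val w (fst s) a) (val w (fst s) b) \<Longrightarrow>
    exec w (While p a b c) s 1 s"
| WhileTrue: "compare p (val w (fst s) a) (val w (fst s) b) \<Longrightarrow> exec w c s t s' \<Longrightarrow>
    exec w (While p a b c) s' u s'' \<Longrightarrow> exec w (While p a b c) s (Suc (t + u)) s''"

text \<open>Programs are deterministic, so \<open>\<exists>t s'. exec w c s t s' \<and> \<dots>\<close> expresses total correctness.\<close>

inductive_cases exec_SkipE: "exec w Skip s t s'"
inductive_cases exec_MoveE: "exec w (Move i a) s t s'"
inductive_cases exec_OpE: "exec w (Op i f a b) s t s'"
inductive_cases exec_LoadE: "exec w (Load i a) s t s'"
inductive_cases exec_StoreE: "exec w (Store a b) s t s'"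
inductive_cases exec_SeqE: "exec w (Seq c d) s t s'"
inductive_cases exec_IfE: "exec w (If p a b c d) s t s'"
inductive_cases exec_WhileE: "exec w (While p a b c) s t s'"

lemma exec_deterministic:
  "exec w c s t s' \<Longrightarrow> exec w c s u s'' \<Longrightarrow> t = u \<and> s' = s''"
proof (induction arbitrary: u s'' rule: exec.induct)
  case Skip then show ?case by (auto elim: exec_SkipE)
next
  case Move then show ?case by (auto elim: exec_MoveE)
next
  case Op then show ?case by (auto elim: exec_OpE)
next
  case Load then show ?case by (auto elim: exec_LoadE)
next
  case Store then show ?case by (auto elim: exec_StoreE)
next
  case Seq
  from Seq.prems show ?case by (rule exec_SeqE) (metis Seq.IH)
next
  case IfTrue
  from IfTrue.prems show ?case by (rule exec_IfE) (use IfTrue.hyps IfTrue.IH in blast)+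
next
  case IfFalse
  from IfFalse.prems show ?case by (rule exec_IfE) (use IfFalse.hyps IfFalse.IH in blast)+
next
  case WhileFalse
  from WhileFalse.prems show ?case by (rule exec_WhileE) (use WhileFalse.hyps in auto)
next
  case WhileTrue
  from WhileTrue.prems show ?case
    by (rule exec_WhileE) (use WhileTrue.hyps in blast, metis WhileTrue.IH)
qed


section \<open>Preprocessing and queries\<close>

text \<open>The elements are named \<open>0, \<dots>, n - 1\<close>, and the graph is a list of its edges in an arbitrary
  order. Its words are followed by \<open>p\<close> zeroed words of work space.\<close>

definition input_state :: "nat \<Rightarrow> (nat \<times> nat) list \<Rightarrow> nat \<Rightarrow> regs \<times> mem" where
  "input_state n es p =
     ((\<lambda>_. 0)(0 := n, 1 := length es), concat (map (\<lambda>(u, v). [u, v]) es) @ replicate p 0)"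

text \<open>A query sees only its two arguments and the memory of the data structure, which it may also
  use as scratch space.\<close>

definition query_state :: "nat \<Rightarrow> nat \<Rightarrow> mem \<Rightarrow> regs \<times> mem" where
  "query_state x y M = ((\<lambda>_. 0)(0 := x, 1 := y), M)"

text \<open>The memory contents that can arise from \<open>D\<close> by a sequence of queries; changes made
  by a query persist.\<close>

inductive_set reachable :: "nat \<Rightarrow> nat \<Rightarrow> com set \<Rightarrow> mem \<Rightarrow> mem set" for w n Q D where
  initial: "D \<in> reachable w n Q D"
| query: "M \<in> reachable w n Q D \<Longrightarrow> c \<in> Q \<Longrightarrow> x < n \<Longrightarrow> y < n \<Longrightarrow>
    exec w c (query_state x y M) t (R, M') \<Longrightarrow> M' \<in> reachable w n Q D"

definition answers_within ::
    "nat \<Rightarrow> com \<Rightarrow> nat \<Rightarrow> nat \<Rightarrow> mem \<Rightarrow> nat \<Rightarrow> (regs \<Rightarrow> bool) \<Rightarrow> bool" where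
  "answers_within w c x y M b ok \<longleftrightarrow>
     (\<exists>t R M'. exec w c (query_state x y M) t (R, M') \<and> t \<le> b \<and> ok R)"

definition decides :: "bool \<Rightarrow> regs \<Rightarrow> bool" where
  "decides P R \<longleftrightarrow> R 0 = (if P then 1 else 0)"

definition finds :: "(nat \<Rightarrow> bool) \<Rightarrow> regs \<Rightarrow> bool" where
  "finds P R \<longleftrightarrow> (if \<exists>z. P z then R 0 = 1 \<and> P (R 1) else R 0 = 0)"

text \<open>\<open>D\<close> serves all query sequences on \<open>r\<close>, within \<open>u\<close> steps per order test and \<open>v\<close> steps per
  meet or join.\<close>

definition represents ::
    "nat \<Rightarrow> com \<Rightarrow> com \<Rightarrow> com \<Rightarrow> nat \<Rightarrow> nat rel \<Rightarrow> nat \<Rightarrow> nat \<Rightarrow> mem \<Rightarrow> bool" where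
  "represents w leq_query meet_query join_query n r u v D \<longleftrightarrow>
     (\<forall>M \<in> reachable w n {leq_query, meet_query, join_query} D. \<forall>x<n. \<forall>y<n.
        answers_within w leq_query x y M u (decides ((x, y) \<in> r)) \<and>
        answers_within w meet_query x y M v (finds (is_meet {..<n} r x y)) \<and>
        answers_within w join_query x y M v (finds (is_join {..<n} r x y)))"

text \<open>Word lengths \<open>W n = \<Theta>(log n)\<close>, large enough that \<open>(n + 2) ^ k\<close> is at most the
  number of distinct words; the shift by 2 only matters for \<open>n \<le> 1\<close>.\<close>

definition word_length :: "nat \<Rightarrow> (nat \<Rightarrow> nat) \<Rightarrow> bool" where
  "word_length k W \<longleftrightarrow>
     (\<lambda>n. real (W n)) \<in> \<Theta>(\<lambda>n. log 2 (real n)) \<and>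
     (\<forall>n. real k * log 2 (real n + 2) \<le> real (W n))"

end

theory Submission
  imports Defs
begin

text \<open>
  Elements are renumbered along a linear extension, so that a set of elements with a greatest member
  has it as its member of largest number. The order is cut into principal ideals of at least
  \<open>\<surd>n\<close> elements, the blocks, and a residual block; each of them is cut again into ideals of at least
  \<open>n\<^sup>1\<^sup>/\<^sup>4\<close> elements and singletons. The set of elements of a block (or subblock) below a given element
  is directed, hence has a greatest member, which is tabulated. Rows of the second table have fewer than \<open>\<surd>n\<close>
  entries and are stored by double displacement hashing (Tarjan and Yao). A meet is the largest
  of the candidates obtained from the \<open>O(n\<^sup>3\<^sup>/\<^sup>4)\<close> large subblocks and from the singletons below the
  representatives. Since the covering graph has no cycle of length four, it has \<open>O(n\<^sup>3\<^sup>/\<^sup>2)\<close> edges.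
  Joins are meets of the reversed order.
\<close>

text \<open>With \<open>q\<close> about n^(1/2) and \<open>s\<close> about n^(1/4), the proper
  blocks number at most \<open>q\<close>, the large subblocks at most n / s <= q * s, and below an
  element other than a block top fewer than \<open>s\<close> singletons of its block are left; this
  balance makes a meet query cost O(q * s). The tops of blocks, the headers, have too many elements
  below them for a row of the second table, but need none: everything in a block is below its
  header. The directed sets are all obtained in one way: two members have two common upper bounds,
  and the interpolating element of a partial lattice stays in the set because blocks and subblocks
  are convex. Space is the other obstacle, since preprocessing within O(n^2) time uses n^2 words of
  scratch. The arrays are interleaved, so that the first O(n^(3/2)) cells of all of them form one
  contiguous stretch and the rest can be cut off; the structure for joins is built over the scratch
  of the one for meets.\<close>

section \<open>A loop language over bounded naturals and its compilation to the word RAM\<close>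

datatype expr = Num nat | Var nat | Arr nat expr | Inp expr | Bin binop expr expr

datatype cmd = Nop | Asg nat expr | Upd nat expr expr | Sq cmd cmd
  | IfC cmp expr expr cmd cmd | For nat nat cmd

text \<open>Registers below 64 hold the program variables, register 64 holds the base address of the
  arrays, and those above it hold intermediate values of expressions and addresses.\<close>

definition nV :: nat where "nV = 64"
text \<open>Array \<open>a\<close> keeps its cell \<open>i\<close> at base + i * 40 + a. Interleaved
  like this, the first m cells of all arrays fill one stretch of 40 * m words, so dropping the
  scratch cells is a truncation of the memory.\<close>

definition nA :: nat where "nA = 40"

fun nat_op :: "binop \<Rightarrow> nat \<Rightarrow> nat \<Rightarrow> nat" where
  "nat_op Plus a b = a + b"
| "nat_op Minus a b = a - b"
| "nat_op Times a b = a * b"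
| "nat_op Div a b = a div b"
| "nat_op Mod a b = a mod b"
| "nat_op _ a b = 0"

type_synonym vars = "nat \<Rightarrow> nat"
type_synonym arrs = "nat \<Rightarrow> nat \<Rightarrow> nat"

text \<open>The registers from \<open>d\<close> upwards serve as an evaluation stack: compiling into
  \<open>d\<close> leaves all registers below \<open>d\<close> intact, so the first operand can wait
  in \<open>d\<close> while the second is evaluated above it.\<close>

fun cE :: "expr \<Rightarrow> nat \<Rightarrow> com" where
  "cE (Num c) d = Move d (Imm c)"
| "cE (Var v) d = Move d (Reg v)"
| "cE (Arr a e) d = Seq (cE e d) (Seq (Op d Times (Reg d) (Imm nA)) (Seq (Op d Plus (Reg d) (Imm a))
     (Seq (Op d Plus (Reg d) (Reg nV)) (Load d (Reg d)))))"
| "cE (Inp e) d = Seq (cE e d) (Load d (Reg d))"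
| "cE (Bin f a b) d = Seq (cE a d) (Seq (cE b (Suc d)) (Op d f (Reg d) (Reg (Suc d))))"

fun tE :: "expr \<Rightarrow> nat" where
  "tE (Num c) = 1"
| "tE (Var v) = 1"
| "tE (Arr a e) = tE e + 4"
| "tE (Inp e) = tE e + 1"
| "tE (Bin f a b) = tE a + tE b + 1"

text \<open>A value of an expression is below \<open>H ^ dg e\<close> if all variables and cells are below \<open>H\<close>.\<close>

fun dg :: "expr \<Rightarrow> nat" where
  "dg (Bin f a b) = (if f \<in> {Plus, Times} then dg a + dg b else dg a)"
| "dg _ = 1"

fun cC :: "cmd \<Rightarrow> com" where
  "cC Nop = Skip"
| "cC (Asg v e) = Seq (cE e (Suc nV)) (Move v (Reg (Suc nV)))"
| "cC (Upd a i e) = Seq (cE i (Suc nV)) (Seq (Op (Suc nV) Times (Reg (Suc nV)) (Imm nA))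
     (Seq (Op (Suc nV) Plus (Reg (Suc nV)) (Imm a)) (Seq (Op (Suc nV) Plus (Reg (Suc nV)) (Reg nV))
     (Seq (cE e (Suc (Suc nV))) (Store (Reg (Suc nV)) (Reg (Suc (Suc nV))))))))"
| "cC (Sq c d) = Seq (cC c) (cC d)"
| "cC (IfC p a b c d) = Seq (cE a (Suc nV)) (Seq (cE b (Suc (Suc nV)))
     (If p (Reg (Suc nV)) (Reg (Suc (Suc nV))) (cC c) (cC d)))"
| "cC (For v b c) = Seq (Move v (Imm 0))
     (While Less (Reg v) (Reg b) (Seq (cC c) (Op v Plus (Reg v) (Imm 1))))"

text \<open>The assigned variables and, in \<open>ma\<close>, the assigned arrays are read off the
  program text. Assertions then only mention what a command changes, and \<open>frame\<close>
  supplies the rest.\<close>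

fun mv :: "cmd \<Rightarrow> nat set" where
  "mv (Asg v e) = {v}"
| "mv (Sq c d) = mv c \<union> mv d"
| "mv (IfC p a b c d) = mv c \<union> mv d"
| "mv (For v b c) = insert v (mv c)"
| "mv _ = {}"

fun ma :: "cmd \<Rightarrow> nat set" where
  "ma (Upd a i e) = {a}"
| "ma (Sq c d) = ma c \<union> ma d"
| "ma (IfC p a b c d) = ma c \<union> ma d"
| "ma (For v b c) = ma c"
| "ma _ = {}"

definition frame :: "nat set \<Rightarrow> nat set \<Rightarrow> vars \<Rightarrow> arrs \<Rightarrow> vars \<Rightarrow> arrs \<Rightarrow> bool" where
  "frame X Y V A V' A' \<longleftrightarrow> (\<forall>v. v \<notin> X \<longrightarrow> V' v = V v) \<and> (\<forall>a. a \<notin> Y \<longrightarrow> A' a = A a)"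

lemma frame_refl: "frame X Y V A V A"
  by (simp add: frame_def)

lemma frame_trans:
  "frame X Y V A V' A' \<Longrightarrow> frame X' Y' V' A' V'' A'' \<Longrightarrow> frame (X \<union> X') (Y \<union> Y') V A V'' A''"
  by (simp add: frame_def)

lemma frame_mono: "frame X Y V A V' A' \<Longrightarrow> X \<subseteq> X' \<Longrightarrow> Y \<subseteq> Y' \<Longrightarrow> frame X' Y' V A V' A'"
  by (auto simp: frame_def)

lemma exec_mem_length: "exec w c s t s' \<Longrightarrow> length (snd s') = length (snd s)"
  by (induction rule: exec.induct) auto

text \<open>\<open>H\<close> strictly bounds all variables and cells; its eighth power leaves room
  for expressions of degree up to 8 before a word overflows, and 64 < H admits the literals.
  \<open>N\<close> is the length of each array. \<open>pre\<close> is the memory in front of the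
  arrays, which programs read but never write: the input, and for the second structure also the
  first one.\<close>

locale machine =
  fixes w H N :: nat and pre :: mem
  assumes H_word: "H ^ 8 \<le> 2 ^ w" and H_large: "64 < H"
begin

fun ev :: "expr \<Rightarrow> vars \<Rightarrow> arrs \<Rightarrow> nat" where
  "ev (Num c) V A = c"
| "ev (Var v) V A = V v"
| "ev (Arr a e) V A = A a (ev e V A)"
| "ev (Inp e) V A = pre ! ev e V A"
| "ev (Bin f a b) V A = nat_op f (ev a V A) (ev b V A)"

fun okE :: "expr \<Rightarrow> vars \<Rightarrow> arrs \<Rightarrow> bool" where
  "okE (Num c) V A \<longleftrightarrow> c \<le> 64"
| "okE (Var v) V A \<longleftrightarrow> v < 64"
| "okE (Arr a e) V A \<longleftrightarrow> a < 40 \<and> okE e V A \<and> ev e V A < N"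
| "okE (Inp e) V A \<longleftrightarrow> okE e V A \<and> ev e V A < length pre"
| "okE (Bin f a b) V A \<longleftrightarrow> okE a V A \<and> okE b V A \<and> f \<in> {Plus, Minus, Times, Div, Mod} \<and>
     (f = Minus \<longrightarrow> ev b V A \<le> ev a V A) \<and> dg (Bin f a b) \<le> 8"

text \<open>Every cell, not only the modelled ones, and the length of the memory are below
  \<open>H\<close>: the former keeps loaded values bounded, the latter keeps addresses from
  overflowing.\<close>

definition rel :: "vars \<Rightarrow> arrs \<Rightarrow> regs \<Rightarrow> mem \<Rightarrow> bool" where
  "rel V A R M \<longleftrightarrow> (\<forall>v<nV. R v = V v \<and> V v < H) \<and> R nV = length pre \<and>
     take (length pre) M = pre \<and> length pre + N * nA \<le> length M \<and> length M < H \<and>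
     (\<forall>x\<in>set M. x < H) \<and> (\<forall>a<nA. \<forall>i<N. M ! (length pre + i * nA + a) = A a i)"

lemma small: "x < H \<Longrightarrow> x < 2 ^ w"
proof -
  assume "x < H"
  moreover have "H ^ 1 \<le> H ^ 8" using H_large by (intro power_increasing) auto
  ultimately show ?thesis using H_word by simp
qed

lemma w_pos: "0 < w"
proof (rule ccontr)
  assume "\<not> 0 < w"
  then have "H ^ 8 \<le> 1" using H_word by simp
  moreover have "H ^ 1 \<le> H ^ 8" using H_large by (intro power_increasing) auto
  ultimately show False using H_large by simp
qed

lemma word_id: "x < H \<Longrightarrow> take_bit w x = x"
  using small by (simp add: take_bit_nat_eq_self_iff)

lemma pow8: "d \<le> 8 \<Longrightarrow> x < H ^ d \<Longrightarrow> x < 2 ^ w"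
proof -
  assume "d \<le> 8" "x < H ^ d"
  moreover have "H ^ d \<le> H ^ 8" using H_large \<open>d \<le> 8\<close> by (intro power_increasing) auto
  ultimately show ?thesis using H_word by linarith
qed

lemma dg_pos: "1 \<le> dg e"
  by (induction e) auto

text \<open>A sum is given the degree of a product, because a + b <= a * b once both are at least 2.
  The degree thus depends on the shape of the expression alone.\<close>

lemma nat_op_bound:
  assumes "x < H ^ i" "y < H ^ j" "1 \<le> i" "1 \<le> j" "f \<in> {Plus, Minus, Times, Div, Mod}"
  shows "nat_op f x y < H ^ (if f \<in> {Plus, Times} then i + j else i)"
proof -
  have pw: "2 \<le> H ^ k" if "1 \<le> k" for k
  proof -
    have "H ^ 1 \<le> H ^ k" using H_large that by (intro power_increasing) auto
    then show ?thesis using H_large by simp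
  qed
  have 1: "x + y < H ^ (i + j)"
  proof -
    have "x + y + 2 \<le> H ^ i + H ^ j" using assms by linarith
    also have "H ^ i + H ^ j \<le> H ^ i * H ^ j + 0"
    proof -
      obtain a where a: "H ^ i = 2 + a" using pw[OF assms(3)] le_Suc_ex by blast
      obtain b where b: "H ^ j = 2 + b" using pw[OF assms(4)] le_Suc_ex by blast
      show ?thesis by (simp add: a b algebra_simps)
    qed
    finally show ?thesis by (simp add: power_add)
  qed
  have 2: "x * y < H ^ (i + j)"
  proof (cases "y = 0")
    case True then show ?thesis using H_large by simp
  next
    case False
    then have "x * y < H ^ i * H ^ j" using assms(1,2) H_large by (intro mult_strict_mono) auto
    then show ?thesis by (simp add: power_add)
  qed
  have 3: "x div y < H ^ i" using assms(1) div_le_dividend le_less_trans by blast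
  have 4: "x mod y < H ^ i" using assms(1) mod_less_eq_dividend le_less_trans by blast
  show ?thesis using assms 1 2 3 4 by auto
qed

lemma cell_lt: "rel V A R M \<Longrightarrow> a < nA \<Longrightarrow> i < N \<Longrightarrow> length pre + i * nA + a < length M"
proof -
  assume *: "rel V A R M" "a < nA" "i < N"
  have "i * nA + a < Suc i * nA" using *(2) by simp
  also have "\<dots> \<le> N * nA" using *(3) by (intro mult_le_mono1) simp
  finally show ?thesis using *(1) by (simp add: rel_def)
qed

lemma rel_cell: "rel V A R M \<Longrightarrow> a < nA \<Longrightarrow> i < N \<Longrightarrow> A a i < H"
  using cell_lt unfolding rel_def by (metis nth_mem)

lemma rel_temp: "rel V A R M \<Longrightarrow> \<forall>i\<le>nV. R' i = R i \<Longrightarrow> rel V A R' M"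
  by (simp add: rel_def)

lemma op_exec:
  assumes "nat_op f (val w R a) (val w R b) = x" "x < 2 ^ w" "f \<in> {Plus, Minus, Times, Div, Mod}"
    "f = Minus \<longrightarrow> val w R b \<le> val w R a" "x < 2 ^ w"
  shows "exec w (Op i f a b) (R, M) 1 (R(i := x), M)"
proof -
  have "word_op w f (val w R a) (val w R b) = x"
  proof (cases "f = Minus")
    case True
    \<comment> \<open>Without underflow the wrap-around difference exceeds the true one by exactly
      one modulus.\<close>
    have "val w R a + 2 ^ w - val w R b = x + 1 * 2 ^ w" using assms(1,4) True by simp
    then have "take_bit w (val w R a + 2 ^ w - val w R b) = x"
      using assms(2) by (simp add: take_bit_eq_mod)
    then show ?thesis using True by simp
  next
    case False
    then show ?thesis using assms by (auto simp: take_bit_nat_eq_self_iff)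
  qed
  then show ?thesis using exec.Op[of w i f a b R M] by simp
qed

lemma addr_exec:
  assumes rel: "rel V A R M" and d: "nV < d" and x: "R' d = x" "x < N" "R' nV = R nV" and a: "a < nA"
  shows "\<exists>R''. exec w (Seq (Op d Times (Reg d) (Imm nA)) (Seq (Op d Plus (Reg d) (Imm a))
            (Op d Plus (Reg d) (Reg nV)))) (R', M) 3 (R'', M) \<and>
          R'' d = length pre + x * nA + a \<and> (\<forall>i. i \<noteq> d \<longrightarrow> R'' i = R' i)"
proof -
  have *: "length pre + x * nA + a < H" using cell_lt[OF rel a x(2)] rel by (simp add: rel_def)
  have nAH: "nA < H" "a < H" using H_large a by (auto simp: nA_def)
  have base: "R nV = length pre" using rel by (simp add: rel_def)
  let ?R1 = "R'(d := x * nA)" and ?R2 = "R'(d := x * nA + a)" and ?R3 = "R'(d := x * nA + a + length pre)"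
  have 1: "exec w (Op d Times (Reg d) (Imm nA)) (R', M) 1 (?R1, M)"
    using * x nAH small by (intro op_exec) (auto simp: word_id)
  have 2: "exec w (Op d Plus (Reg d) (Imm a)) (?R1, M) 1 (?R2, M)"
    using op_exec[of Plus ?R1 "Reg d" "Imm a" "x * nA + a" d M] * x nAH small by (auto simp: word_id)
  have 3: "exec w (Op d Plus (Reg d) (Reg nV)) (?R2, M) 1 (?R3, M)"
    using op_exec[of Plus ?R2 "Reg d" "Reg nV" "x * nA + a + length pre" d M] * x nAH d base small
    by (auto simp: add_ac)
  have "exec w (Seq (Op d Times (Reg d) (Imm nA)) (Seq (Op d Plus (Reg d) (Imm a))
            (Op d Plus (Reg d) (Reg nV)))) (R', M) 3 (?R3, M)"
    using exec.Seq[OF 1 exec.Seq[OF 2 3]] by (simp add: numeral_3_eq_3)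
  then show ?thesis by (intro exI[of _ ?R3]) auto
qed

text \<open>The address computation is verified as a closed unit of three instructions, while the
  compiler nests sequences to the right; this appends the load or store that follows.\<close>

lemma exec_Seq3:
  assumes "exec w (Seq a (Seq b c)) s t s'" "exec w d s' u s''"
  shows "exec w (Seq a (Seq b (Seq c d))) s (t + u) s''"
proof -
  from assms(1) obtain t1 s1 t2 where 1: "exec w a s t1 s1" "exec w (Seq b c) s1 t2 s'" "t = t1 + t2"
    by (rule exec_SeqE)
  from 1(2) obtain t3 s3 t4 where 2: "exec w b s1 t3 s3" "exec w c s3 t4 s'" "t2 = t3 + t4"
    by (rule exec_SeqE)
  show ?thesis
    using exec.Seq[OF 1(1) exec.Seq[OF 2(1) exec.Seq[OF 2(2) assms(2)]]] 1(3) 2(3) by (simp add: add.assoc)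
qed

lemma cE_exec:
  assumes "rel V A R M" "okE e V A" "nV < d" "\<forall>i\<le>nV. R' i = R i"
  shows "\<exists>R''. exec w (cE e d) (R', M) (tE e) (R'', M) \<and> R'' d = ev e V A \<and>
     (\<forall>i<d. R'' i = R' i) \<and> ev e V A < H ^ dg e"
  using assms(2-4)
proof (induction e arbitrary: d R')
  case (Num c)
  have "c < H" using Num H_large by simp
  then show ?case using exec.Move[of w d "Imm c" R' M] by (auto simp: word_id)
next
  case (Var v)
  have "V v < H" "R' v = V v" using Var assms(1) by (auto simp: rel_def nV_def)
  then show ?case using exec.Move[of w d "Reg v" R' M] by auto
next
  case (Arr a e)
  from Arr.prems have a: "a < nA" "ev e V A < N" by (auto simp: nA_def)
  obtain R1 where R1: "exec w (cE e d) (R', M) (tE e) (R1, M)" "R1 d = ev e V A" "\<forall>i<d. R1 i = R' i"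
    using Arr.IH[OF _ Arr.prems(2,3)] Arr.prems(1) by force
  obtain R2 where R2: "exec w (Seq (Op d Times (Reg d) (Imm nA)) (Seq (Op d Plus (Reg d) (Imm a))
            (Op d Plus (Reg d) (Reg nV)))) (R1, M) 3 (R2, M)"
    "R2 d = length pre + ev e V A * nA + a" "\<forall>i. i \<noteq> d \<longrightarrow> R2 i = R1 i"
    using addr_exec[where R = R and R' = R1, OF assms(1) Arr.prems(2) R1(2) a(2) _ a(1)] R1(3) Arr.prems by auto
  have lt: "val w R2 (Reg d) < length M" using cell_lt[OF assms(1) a] R2 by simp
  have "M ! R2 d = A a (ev e V A)" using assms(1) a R2(2) by (simp add: rel_def)
  then have L: "exec w (Load d (Reg d)) (R2, M) 1 (R2(d := A a (ev e V A)), M)"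
    using exec.Load[OF lt, where i = d] by simp
  have "exec w (Seq (Op d Times (Reg d) (Imm nA)) (Seq (Op d Plus (Reg d) (Imm a))
     (Seq (Op d Plus (Reg d) (Reg nV)) (Load d (Reg d))))) (R1, M) (3 + 1) (R2(d := A a (ev e V A)), M)"
    using exec_Seq3[OF R2(1) L] .
  from exec.Seq[OF R1(1) this] have ex:
    "exec w (cE (Arr a e) d) (R', M) (tE (Arr a e)) (R2(d := A a (ev e V A)), M)" by simp
  have "A a (ev e V A) < H" using rel_cell[OF assms(1) a] .
  then show ?case
    by (intro exI[of _ "R2(d := A a (ev e V A))"] conjI, intro ex) (use R1 R2 in auto)
next
  case (Inp e)
  obtain R1 where R1: "exec w (cE e d) (R', M) (tE e) (R1, M)" "R1 d = ev e V A" "\<forall>i<d. R1 i = R' i"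
    using Inp.IH[OF _ Inp.prems(2,3)] Inp.prems(1) by force
  have len: "ev e V A < length pre" using Inp by simp
  have tk: "take (length pre) M = pre" "length pre \<le> length M" using assms(1) by (auto simp: rel_def)
  have nth: "M ! ev e V A = pre ! ev e V A" using tk len by (metis nth_take)
  have "exec w (Load d (Reg d)) (R1, M) 1 (R1(d := pre ! ev e V A), M)"
    using exec.Load[of w R1 "Reg d" M d] R1 nth len tk by simp
  from exec.Seq[OF R1(1) this] have ex:
    "exec w (cE (Inp e) d) (R', M) (tE (Inp e)) (R1(d := pre ! ev e V A), M)" by simp
  have "pre ! ev e V A < H" using assms(1) len tk nth unfolding rel_def
    by (metis nth_mem order_less_le_trans)
  then show ?case by (intro exI[of _ "R1(d := pre ! ev e V A)"] conjI, intro ex) (use R1 in auto)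
next
  case (Bin f a b)
  obtain R1 where R1: "exec w (cE a d) (R', M) (tE a) (R1, M)" "R1 d = ev a V A" "\<forall>i<d. R1 i = R' i"
    "ev a V A < H ^ dg a"
    using Bin.IH(1)[OF _ Bin.prems(2,3)] Bin.prems(1) by force
  obtain R2 where R2: "exec w (cE b (Suc d)) (R1, M) (tE b) (R2, M)" "R2 (Suc d) = ev b V A"
    "\<forall>i<Suc d. R2 i = R1 i" "ev b V A < H ^ dg b"
  proof -
    have "\<forall>i\<le>nV. R1 i = R i" using R1(3) Bin.prems by auto
    then show ?thesis using Bin.IH(2)[of "Suc d" R1] Bin.prems(1,2) that by force
  qed
  let ?x = "nat_op f (ev a V A) (ev b V A)"
  have f: "f \<in> {Plus, Minus, Times, Div, Mod}" using Bin by simp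
  have b: "?x < H ^ dg (Bin f a b)" using nat_op_bound[OF R1(4) R2(4) dg_pos dg_pos f] by simp
  then have bw: "?x < 2 ^ w" using pow8 Bin.prems(1) by auto
  have "exec w (Op d f (Reg d) (Reg (Suc d))) (R2, M) 1 (R2(d := ?x), M)"
    using R1 R2 bw f Bin.prems(1) by (intro op_exec) auto
  from exec.Seq[OF R1(1) exec.Seq[OF R2(1) this]]
  have ex: "exec w (cE (Bin f a b) d) (R', M) (tE (Bin f a b)) (R2(d := ?x), M)" by (simp add: add_ac)
  show ?case by (intro exI[of _ "R2(d := ?x)"] conjI, intro ex) (use R1 R2 b in auto)
qed

section \<open>Total correctness with time bounds\<close>

text \<open>Correctness and time are claimed from one given abstract state, for all concrete states
  representing it. With a fixed initial state a postcondition may itself be a \<open>runs\<close>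
  statement, so a program is executed symbolically from left to right.\<close>

definition runs :: "cmd \<Rightarrow> vars \<Rightarrow> arrs \<Rightarrow> nat \<Rightarrow> (vars \<Rightarrow> arrs \<Rightarrow> bool) \<Rightarrow> bool" where
  "runs c V A T Q \<longleftrightarrow> (\<forall>R M. rel V A R M \<longrightarrow>
     (\<exists>t R' M' V' A'. exec w (cC c) (R, M) t (R', M') \<and> t \<le> T \<and> rel V' A' R' M' \<and>
        frame (mv c) (ma c) V A V' A' \<and> Q V' A'))"

lemma runsI:
  assumes "\<And>R M. rel V A R M \<Longrightarrow> \<exists>t R' M' V' A'. exec w (cC c) (R, M) t (R', M') \<and> t \<le> T \<and>
    rel V' A' R' M' \<and> frame (mv c) (ma c) V A V' A' \<and> Q V' A'"
  shows "runs c V A T Q"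
  using assms by (simp add: runs_def)

lemma runsE:
  assumes "runs c V A T Q" "rel V A R M"
  obtains t R' M' V' A' where "exec w (cC c) (R, M) t (R', M')" "t \<le> T" "rel V' A' R' M'"
    "frame (mv c) (ma c) V A V' A'" "Q V' A'"
  using assms unfolding runs_def by blast

lemma runs_conseq:
  assumes "runs c V A T Q" "T \<le> T'"
    "\<And>V' A'. frame (mv c) (ma c) V A V' A' \<Longrightarrow> Q V' A' \<Longrightarrow> Q' V' A'"
  shows "runs c V A T' Q'"
  using assms unfolding runs_def by (meson order_trans)

lemma runs_use:
  assumes "runs c V A T Q"
    "\<And>V' A'. frame (mv c) (ma c) V A V' A' \<Longrightarrow> Q V' A' \<Longrightarrow> Q' V' A'"
  shows "runs c V A T Q'"
  using runs_conseq[OF assms(1) order_refl assms(2)] .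

lemma runs_time: "runs c V A T Q \<Longrightarrow> T \<le> T' \<Longrightarrow> runs c V A T' Q"
  using runs_conseq by blast

lemma runs_Nop: "Q V A \<Longrightarrow> runs Nop V A 1 Q"
  by (rule runsI) (auto intro!: exI exec.Skip simp: frame_refl)

lemma runs_Asg:
  assumes "okE e V A" "v < 64" "ev e V A < H" "Q (V(v := ev e V A)) A"
  shows "runs (Asg v e) V A (tE e + 1) Q"
proof (rule runsI)
  fix R M assume rel: "rel V A R M"
  obtain R1 where R1: "exec w (cE e (Suc nV)) (R, M) (tE e) (R1, M)" "R1 (Suc nV) = ev e V A"
    "\<forall>i<Suc nV. R1 i = R i"
    using cE_exec[OF rel assms(1), of "Suc nV" R] by auto
  have "exec w (Move v (Reg (Suc nV))) (R1, M) 1 (R1(v := ev e V A), M)"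
    using exec.Move[of w v "Reg (Suc nV)" R1 M] R1 by simp
  from exec.Seq[OF R1(1) this] have "exec w (cC (Asg v e)) (R, M) (tE e + 1) (R1(v := ev e V A), M)" by simp
  moreover have "rel (V(v := ev e V A)) A (R1(v := ev e V A)) M"
    using rel R1 assms(2,3) by (auto simp: rel_def nV_def)
  moreover have "frame (mv (Asg v e)) (ma (Asg v e)) V A (V(v := ev e V A)) A"
    by (simp add: frame_def)
  ultimately show "\<exists>t R' M' V' A'. exec w (cC (Asg v e)) (R, M) t (R', M') \<and> t \<le> tE e + 1 \<and>
    rel V' A' R' M' \<and> frame (mv (Asg v e)) (ma (Asg v e)) V A V' A' \<and> Q V' A'"
    using assms(4) by blast
qed

text \<open>Interleaving is injective, so a store changes exactly one abstract cell.\<close>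

lemma addr_inj:
  assumes "i * nA + a = j * nA + b" "a < nA" "b < nA"
  shows "i = j \<and> a = b"
proof -
  have "(i * nA + a) div nA = i" "(j * nA + b) div nA = j"
    "(i * nA + a) mod nA = a" "(j * nA + b) mod nA = b" using assms(2,3) by auto
  then show ?thesis using assms(1) by simp
qed

lemma runs_Upd:
  assumes "okE i V A" "okE e V A" "a < 40" "ev i V A < N" "ev e V A < H"
    "Q V (A(a := (A a)(ev i V A := ev e V A)))"
  shows "runs (Upd a i e) V A (tE i + tE e + 4) Q"
proof (rule runsI)
  fix R M assume rel: "rel V A R M"
  let ?t = "Suc nV" and ?u = "Suc (Suc nV)" and ?x = "ev i V A" and ?y = "ev e V A"
  let ?ad = "length pre + ?x * nA + a"
  have a: "a < nA" using assms(3) by (simp add: nA_def)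
  obtain R1 where R1: "exec w (cE i ?t) (R, M) (tE i) (R1, M)" "R1 ?t = ?x" "\<forall>i<?t. R1 i = R i"
    using cE_exec[OF rel assms(1), of ?t R] by auto
  obtain R2 where R2: "exec w (Seq (Op ?t Times (Reg ?t) (Imm nA)) (Seq (Op ?t Plus (Reg ?t) (Imm a))
            (Op ?t Plus (Reg ?t) (Reg nV)))) (R1, M) 3 (R2, M)"
    "R2 ?t = ?ad" "\<forall>i. i \<noteq> ?t \<longrightarrow> R2 i = R1 i"
    using addr_exec[where d = ?t and R = R and R' = R1, OF rel _ R1(2) assms(4) _ a] R1(3) by auto
  obtain R3 where R3: "exec w (cE e ?u) (R2, M) (tE e) (R3, M)" "R3 ?u = ?y" "\<forall>i<?u. R3 i = R2 i"
    using cE_exec[OF rel assms(2), of ?u R2] R1 R2 by auto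
  have lt: "?ad < length M" using cell_lt[OF rel a assms(4)] .
  let ?M = "M[?ad := ?y]"
  have st: "exec w (Store (Reg ?t) (Reg ?u)) (R3, M) 1 (R3, ?M)"
    using exec.Store[of w R3 "Reg ?t" M "Reg ?u"] R3 R2 lt by simp
  have "exec w (cC (Upd a i e)) (R, M) (tE i + tE e + 4) (R3, ?M)"
  proof -
    have "exec w (Seq (cE e ?u) (Store (Reg ?t) (Reg ?u))) (R2, M) (tE e + 1) (R3, ?M)"
      using exec.Seq[OF R3(1) st] .
    note exec_Seq3[OF R2(1) this]
    from exec.Seq[OF R1(1) this] show ?thesis by (simp add: add_ac)
  qed
  moreover have "rel V (A(a := (A a)(?x := ?y))) R3 ?M"
  proof -
    have s: "\<forall>x\<in>set ?M. x < H"
      using rel assms(5) set_update_subset_insert[of M ?ad ?y] by (auto simp: rel_def)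
    have tk: "take (length pre) ?M = pre" using rel by (simp add: rel_def)
    have nth: "?M ! (length pre + j * nA + b) = (A(a := (A a)(?x := ?y))) b j" if "b < nA" "j < N" for b j
    proof (cases "b = a \<and> j = ?x")
      case True then show ?thesis using lt by simp
    next
      case False
      then have "length pre + j * nA + b \<noteq> ?ad" using addr_inj[of j b ?x a] a that by auto
      moreover have "M ! (length pre + j * nA + b) = A b j" using rel that by (simp add: rel_def)
      ultimately show ?thesis using False by auto
    qed
    show ?thesis using rel R1 R2 R3 s tk nth unfolding rel_def by (auto simp: nV_def)
  qed
  moreover have "frame (mv (Upd a i e)) (ma (Upd a i e)) V A V (A(a := (A a)(?x := ?y)))"
    by (simp add: frame_def)
  ultimately show "\<exists>t R' M' V' A'. exec w (cC (Upd a i e)) (R, M) t (R', M') \<and> t \<le> tE i + tE e + 4 \<and>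
    rel V' A' R' M' \<and> frame (mv (Upd a i e)) (ma (Upd a i e)) V A V' A' \<and> Q V' A'"
    using assms(6) by blast
qed

lemma runs_Sq:
  assumes "runs c V A T1 (\<lambda>V' A'. runs d V' A' T2 Q)"
  shows "runs (Sq c d) V A (T1 + T2) Q"
proof (rule runsI)
  fix R M assume rel: "rel V A R M"
  from assms rel obtain t R1 M1 V1 A1 where 1: "exec w (cC c) (R, M) t (R1, M1)" "t \<le> T1"
    "rel V1 A1 R1 M1" "frame (mv c) (ma c) V A V1 A1" "runs d V1 A1 T2 Q" by (rule runsE)
  from 1(5,3) obtain u R2 M2 V2 A2 where 2: "exec w (cC d) (R1, M1) u (R2, M2)" "u \<le> T2"
    "rel V2 A2 R2 M2" "frame (mv d) (ma d) V1 A1 V2 A2" "Q V2 A2" by (rule runsE)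
  have "exec w (cC (Sq c d)) (R, M) (t + u) (R2, M2)" using exec.Seq[OF 1(1) 2(1)] by simp
  moreover have "frame (mv (Sq c d)) (ma (Sq c d)) V A V2 A2" using frame_trans[OF 1(4) 2(4)] by simp
  ultimately show "\<exists>t R' M' V' A'. exec w (cC (Sq c d)) (R, M) t (R', M') \<and> t \<le> T1 + T2 \<and>
    rel V' A' R' M' \<and> frame (mv (Sq c d)) (ma (Sq c d)) V A V' A' \<and> Q V' A'"
    using 1(2) 2 by (meson add_mono)
qed

lemma runs_If:
  assumes "okE a V A" "okE b V A"
    "compare p (ev a V A) (ev b V A) \<Longrightarrow> runs c V A T1 Q"
    "\<not> compare p (ev a V A) (ev b V A) \<Longrightarrow> runs d V A T2 Q"
  shows "runs (IfC p a b c d) V A (tE a + tE b + 1 + max T1 T2) Q"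
proof (rule runsI)
  fix R M assume rel: "rel V A R M"
  let ?t = "Suc nV" and ?u = "Suc (Suc nV)"
  obtain R1 where R1: "exec w (cE a ?t) (R, M) (tE a) (R1, M)" "R1 ?t = ev a V A" "\<forall>i<?t. R1 i = R i"
    using cE_exec[OF rel assms(1), of ?t R] by auto
  obtain R2 where R2: "exec w (cE b ?u) (R1, M) (tE b) (R2, M)" "R2 ?u = ev b V A" "\<forall>i<?u. R2 i = R1 i"
    using cE_exec[OF rel assms(2), of ?u R1] R1 by auto
  have rel2: "rel V A R2 M" by (rule rel_temp[OF rel]) (use R1 R2 in auto)
  let ?c = "compare p (ev a V A) (ev b V A)"
  have "\<exists>t R' M' V' A'. exec w (If p (Reg ?t) (Reg ?u) (cC c) (cC d)) (R2, M) (Suc t) (R', M') \<and>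
    t \<le> max T1 T2 \<and> rel V' A' R' M' \<and> frame (mv c \<union> mv d) (ma c \<union> ma d) V A V' A' \<and> Q V' A'"
  proof (cases ?c)
    case True
    from assms(3)[OF True] rel2 obtain t R' M' V' A' where *: "exec w (cC c) (R2, M) t (R', M')" "t \<le> T1"
      "rel V' A' R' M'" "frame (mv c) (ma c) V A V' A'" "Q V' A'" by (rule runsE)
    have "exec w (If p (Reg ?t) (Reg ?u) (cC c) (cC d)) (R2, M) (Suc t) (R', M')"
      using True R1 R2 *(1) by (intro exec.IfTrue) auto
    moreover have "frame (mv c \<union> mv d) (ma c \<union> ma d) V A V' A'" by (rule frame_mono[OF *(4)]) auto
    ultimately show ?thesis using * by (meson max.coboundedI1)
  next
    case False
    from assms(4)[OF False] rel2 obtain t R' M' V' A' where *: "exec w (cC d) (R2, M) t (R', M')" "t \<le> T2"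
      "rel V' A' R' M'" "frame (mv d) (ma d) V A V' A'" "Q V' A'" by (rule runsE)
    have "exec w (If p (Reg ?t) (Reg ?u) (cC c) (cC d)) (R2, M) (Suc t) (R', M')"
      using False R1 R2 *(1) by (intro exec.IfFalse) auto
    moreover have "frame (mv c \<union> mv d) (ma c \<union> ma d) V A V' A'" by (rule frame_mono[OF *(4)]) auto
    ultimately show ?thesis using * by (meson max.coboundedI2)
  qed
  then obtain t R' M' V' A' where *: "exec w (If p (Reg ?t) (Reg ?u) (cC c) (cC d)) (R2, M) (Suc t) (R', M')"
    "t \<le> max T1 T2" "rel V' A' R' M'" "frame (mv c \<union> mv d) (ma c \<union> ma d) V A V' A'" "Q V' A'" by blast
  have "exec w (cC (IfC p a b c d)) (R, M) (tE a + (tE b + Suc t)) (R', M')"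
    using exec.Seq[OF R1(1) exec.Seq[OF R2(1) *(1)]] by simp
  moreover have "tE a + (tE b + Suc t) \<le> tE a + tE b + 1 + max T1 T2" using *(2) by simp
  ultimately show "\<exists>t R' M' V' A'. exec w (cC (IfC p a b c d)) (R, M) t (R', M') \<and>
    t \<le> tE a + tE b + 1 + max T1 T2 \<and> rel V' A' R' M' \<and>
    frame (mv (IfC p a b c d)) (ma (IfC p a b c d)) V A V' A' \<and> Q V' A'"
    unfolding mv.simps ma.simps using *(3-5) by blast
qed

text \<open>Each round has its own bound \<open>f i\<close>, because several loops are cheap only on
  average. The 2 in each summand pays for the loop test and the increment, the leading 2 for the
  initialisation and the final test. The invariant is restored only after the counter has
  advanced.\<close>

lemma runs_For_sum:
  assumes vb: "v < 64" "b < 64" "v \<noteq> b" "v \<notin> mv c" "b \<notin> mv c" and m: "V b = m"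
    and init: "I 0 (V(v := 0)) A"
    and step: "\<And>i V' A'. i < m \<Longrightarrow> frame (insert v (mv c)) (ma c) V A V' A' \<Longrightarrow> V' v = i \<Longrightarrow> I i V' A' \<Longrightarrow>
      runs c V' A' (f i) (\<lambda>V'' A''. I (Suc i) (V''(v := Suc i)) A'')"
    and fin: "\<And>V' A'. frame (insert v (mv c)) (ma c) V A V' A' \<Longrightarrow> V' v = m \<Longrightarrow> I m V' A' \<Longrightarrow> Q V' A'"
  shows "runs (For v b c) V A (2 + (\<Sum>i<m. f i + 2)) Q"
proof (rule runsI)
  fix R M assume rel: "rel V A R M"
  let ?b = "Seq (cC c) (Op v Plus (Reg v) (Imm 1))"
  let ?w = "While Less (Reg v) (Reg b) ?b"
  have mH: "m < H" using rel m vb(2) by (auto simp: rel_def nV_def)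
  \<comment> \<open>Generalised to a start at any counter value \<open>j\<close>, with the budget of
    the remaining rounds.\<close>
  have loop: "\<exists>t R'' M'' V'' A''. exec w ?w (R', M') t (R'', M'') \<and> t \<le> 1 + (\<Sum>i=j..<m. f i + 2) \<and>
      rel V'' A'' R'' M'' \<and> frame (insert v (mv c)) (ma c) V A V'' A'' \<and> V'' v = m \<and> I m V'' A''"
    if "j \<le> m" "rel V' A' R' M'" "frame (insert v (mv c)) (ma c) V A V' A'" "V' v = j" "I j V' A'" for j R' M' V' A'
    using that
  proof (induction "m - j" arbitrary: j R' M' V' A')
    case 0
    then have j: "j = m" by simp
    have "R' v = j" "R' b = m" using 0 vb m by (auto simp: rel_def frame_def nV_def)
    then have "exec w ?w (R', M') 1 (R', M')" using j by (intro exec.WhileFalse) auto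
    then show ?case using 0 j by fastforce
  next
    case (Suc k)
    then have jm: "j < m" by simp
    have rb: "R' v = j" "R' b = m" using Suc.prems vb m by (auto simp: rel_def frame_def nV_def)
    from step[OF jm Suc.prems(3,4,5)] Suc.prems(2) obtain t R1 M1 V1 A1 where
      1: "exec w (cC c) (R', M') t (R1, M1)" "t \<le> f j" "rel V1 A1 R1 M1" "frame (mv c) (ma c) V' A' V1 A1"
        "I (Suc j) (V1(v := Suc j)) A1" by (rule runsE)
    have V1v: "V1 v = j" using 1(4) vb Suc.prems(4) by (simp add: frame_def)
    have R1v: "R1 v = j" using 1(3) V1v vb by (simp add: rel_def nV_def)
    have SjH: "Suc j < H" using jm mH by simp
    have "exec w (Op v Plus (Reg v) (Imm 1)) (R1, M1) 1 (R1(v := Suc j), M1)"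
      using R1v SjH small w_pos by (intro op_exec) auto
    from exec.Seq[OF 1(1) this] have b: "exec w ?b (R', M') (t + 1) (R1(v := Suc j), M1)" by simp
    have rel2: "rel (V1(v := Suc j)) A1 (R1(v := Suc j)) M1"
      using 1(3) SjH vb by (auto simp: rel_def nV_def)
    have fr2: "frame (insert v (mv c)) (ma c) V A (V1(v := Suc j)) A1"
      using Suc.prems(3) 1(4) by (auto simp: frame_def)
    obtain u R2 M2 V2 A2 where 2: "exec w ?w (R1(v := Suc j), M1) u (R2, M2)"
      "u \<le> 1 + (\<Sum>i=Suc j..<m. f i + 2)" "rel V2 A2 R2 M2" "frame (insert v (mv c)) (ma c) V A V2 A2"
      "V2 v = m" "I m V2 A2"
    proof -
      have "k = m - Suc j" "Suc j \<le> m" "(V1(v := Suc j)) v = Suc j" using Suc.hyps(2) jm by auto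
      from Suc.hyps(1)[OF this(1,2) rel2 fr2 this(3) 1(5)] show ?thesis using that by blast
    qed
    have "exec w ?w (R', M') (Suc ((t + 1) + u)) (R2, M2)"
      using rb jm by (intro exec.WhileTrue[OF _ b 2(1)]) auto
    moreover have "Suc ((t + 1) + u) \<le> 1 + (\<Sum>i=j..<m. f i + 2)"
      using 1(2) 2(2) jm by (simp add: sum.atLeast_Suc_lessThan)
    ultimately show ?case using 2 by blast
  qed
  have m0: "exec w (Move v (Imm 0)) (R, M) 1 (R(v := 0), M)"
    using exec.Move[of w v "Imm 0" R M] by simp
  have rel0: "rel (V(v := 0)) A (R(v := 0)) M"
    using rel vb H_large by (auto simp: rel_def nV_def)
  have fr0: "frame (insert v (mv c)) (ma c) V A (V(v := 0)) A" by (simp add: frame_def)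
  obtain t R' M' V' A' where *: "exec w ?w (R(v := 0), M) t (R', M')" "t \<le> 1 + (\<Sum>i=0..<m. f i + 2)"
    "rel V' A' R' M'" "frame (insert v (mv c)) (ma c) V A V' A'" "V' v = m" "I m V' A'"
    using loop[OF _ rel0 fr0 _ init] by auto
  have "exec w (cC (For v b c)) (R, M) (1 + t) (R', M')" using exec.Seq[OF m0 *(1)] by simp
  moreover have "1 + t \<le> 2 + (\<Sum>i<m. f i + 2)" using *(2) by (simp add: lessThan_atLeast0)
  moreover have "Q V' A'" by (rule fin[OF *(4,5,6)])
  ultimately show "\<exists>t R' M' V' A'. exec w (cC (For v b c)) (R, M) t (R', M') \<and>
    t \<le> 2 + (\<Sum>i<m. f i + 2) \<and> rel V' A' R' M' \<and> frame (mv (For v b c)) (ma (For v b c)) V A V' A' \<and> Q V' A'"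
    unfolding mv.simps ma.simps using *(3,4) by (intro exI conjI)
qed

lemma runs_For:
  assumes "v < 64" "b < 64" "v \<noteq> b" "v \<notin> mv c" "b \<notin> mv c" "V b = m" "I 0 (V(v := 0)) A"
    and "\<And>i V' A'. i < m \<Longrightarrow> frame (insert v (mv c)) (ma c) V A V' A' \<Longrightarrow> V' v = i \<Longrightarrow> I i V' A' \<Longrightarrow>
      runs c V' A' B (\<lambda>V'' A''. I (Suc i) (V''(v := Suc i)) A'')"
    and "\<And>V' A'. frame (insert v (mv c)) (ma c) V A V' A' \<Longrightarrow> V' v = m \<Longrightarrow> I m V' A' \<Longrightarrow> Q V' A'"
  shows "runs (For v b c) V A (2 + m * (B + 2)) Q"
proof -
  have "runs (For v b c) V A (2 + (\<Sum>i<m. B + 2)) Q"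
    by (rule runs_For_sum[where f = "\<lambda>_. B" and I = I and Q = Q]) (fact assms)+
  then show ?thesis by simp
qed


end

section \<open>Labelled partial lattices and their decomposition\<close>

text \<open>An optional maximum packed into one word: 0 for the empty set, the maximum plus one
  otherwise. All tables store their entries in this form, and larger codes mean larger
  labels.\<close>

definition mxs :: "nat set \<Rightarrow> nat" where
  "mxs S = (if S = {} then 0 else Suc (Max S))"

lemma mxs_le: "finite S \<Longrightarrow> mxs S \<le> k \<longleftrightarrow> (\<forall>x\<in>S. Suc x \<le> k)"
  by (auto simp: mxs_def Suc_le_eq)

lemma mxs_ge: "finite S \<Longrightarrow> x \<in> S \<Longrightarrow> Suc x \<le> mxs S"
  by (auto simp: mxs_def)

lemma mxs_eqI:
  assumes "finite S" "\<forall>x\<in>S. Suc x \<le> k" "k = 0 \<or> k - 1 \<in> S"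
  shows "mxs S = k"
proof (cases "k = 0")
  case True then show ?thesis using assms by (auto simp: mxs_def)
next
  case False
  then have "k - 1 \<in> S" using assms by auto
  then have "Suc (k - 1) \<le> mxs S" using mxs_ge assms(1) by blast
  moreover have "mxs S \<le> k" using assms mxs_le by blast
  ultimately show ?thesis using False by simp
qed

lemma mxs_in: "finite S \<Longrightarrow> mxs S \<noteq> 0 \<Longrightarrow> mxs S - 1 \<in> S"
  by (auto simp: mxs_def split: if_splits)

lemma mxs_0: "finite S \<Longrightarrow> mxs S = 0 \<longleftrightarrow> S = {}"
  by (auto simp: mxs_def)

lemma mxs_Suc: "finite S \<Longrightarrow> mxs S = Suc m \<longleftrightarrow> m \<in> S \<and> (\<forall>x\<in>S. x \<le> m)"
  by (auto simp: mxs_def intro: Max_eqI Max_in)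

text \<open>The order after renumbering: by \<open>le_mono\<close> the labels form a linear
  extension. Interpolation is stated for the reflexive order, so that it also covers the degenerate
  cases in which an upper element is one of the lower ones.\<close>

locale plat =
  fixes n :: nat and le :: "nat \<Rightarrow> nat \<Rightarrow> bool"
  assumes le_lt: "le x y \<Longrightarrow> x < n \<and> y < n"
    and le_refl: "x < n \<Longrightarrow> le x x"
    and le_trans: "le x y \<Longrightarrow> le y z \<Longrightarrow> le x z"
    and le_mono: "le x y \<Longrightarrow> x \<le> y"
    and le_mid: "le x1 y1 \<Longrightarrow> le x1 y2 \<Longrightarrow> le x2 y1 \<Longrightarrow> le x2 y2 \<Longrightarrow>
      \<exists>z. le x1 z \<and> le x2 z \<and> le z y1 \<and> le z y2"
begin

definition cov :: "nat \<Rightarrow> nat \<Rightarrow> bool" where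
  "cov u v \<longleftrightarrow> le u v \<and> u \<noteq> v \<and> \<not> (\<exists>w. le u w \<and> le w v \<and> w \<noteq> u \<and> w \<noteq> v)"

lemma le_fin: "finite {w. le w x \<and> P w}" "finite {w. P w \<and> le w x}"
  by (rule finite_subset[of _ "{..<n}"]; use le_lt in auto)+

lemma cov_lt: "cov u v \<Longrightarrow> u < v" "cov u v \<Longrightarrow> v < n" "cov u v \<Longrightarrow> u < n" "cov u v \<Longrightarrow> le u v"
  using le_mono le_lt unfolding cov_def by (fastforce simp: less_le)+

text \<open>Among the elements above \<open>w\<close> and strictly below \<open>v\<close>, the one
  of largest label is a lower cover of \<open>v\<close>: anything between it and \<open>v\<close>
  would have a larger label still.\<close>

lemma cov_ex: assumes "le w v" "w \<noteq> v" shows "\<exists>u. le w u \<and> cov u v"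
proof -
  let ?S = "{u. le u v \<and> (le w u \<and> u \<noteq> v)}"
  have fin: "finite ?S" by (rule le_fin)
  have "w \<in> ?S" using assms le_refl le_lt by blast
  then have m: "Max ?S \<in> ?S" using Max_in[OF fin] by blast
  have "cov (Max ?S) v"
    unfolding cov_def
  proof (intro conjI notI)
    assume "\<exists>z. le (Max ?S) z \<and> le z v \<and> z \<noteq> Max ?S \<and> z \<noteq> v"
    then obtain z where z: "le (Max ?S) z" "le z v" "z \<noteq> Max ?S" "z \<noteq> v" by blast
    then have "z \<in> ?S" using m le_trans by blast
    then have "z \<le> Max ?S" using fin by (intro Max_ge) auto
    then show False using z le_mono[OF z(1)] by simp
  qed (use m in auto)
  then show ?thesis using m by blast
qed

text \<open>The covering graph contains no cycle of length four, so pairs of distinct lower covers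
  belong to distinct elements.\<close>

lemma cov_unique: assumes "cov u y" "cov u' y" "cov u z" "cov u' z" "u \<noteq> u'" shows "y = z"
proof (rule ccontr)
  assume "y \<noteq> z"
  obtain m where m: "le u m" "le u' m" "le m y" "le m z"
    using le_mid[of u y z u'] assms unfolding cov_def by blast
  then have "m = u \<or> m = y" "m = u \<or> m = z" "m = u' \<or> m = y" "m = u' \<or> m = z"
    using assms unfolding cov_def by blast+
  then show False using \<open>y \<noteq> z\<close> assms(5) by auto
qed

text \<open>Double counting. By \<open>cov_unique\<close> an ordered pair of distinct lower covers
  determines the element covering both, so the numbers d(d - 1), with d the number of lower covers,
  sum to at most n^2. Comparing them with q * d bounds the sum of all d by 2nq.\<close>

lemma cov_count: assumes "n \<le> q * q" "0 < q" shows "card {(u, v). cov u v} \<le> 2 * n * q"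
proof -
  let ?C = "\<lambda>v. {u. cov u v}"
  let ?P = "SIGMA v:{..<n}. {(u, u'). u \<in> ?C v \<and> u' \<in> ?C v \<and> u \<noteq> u'}"
  have finC: "finite (?C v)" for v by (rule finite_subset[of _ "{..<n}"]) (use cov_lt in auto)
  have cP: "card {(u, u'). u \<in> ?C v \<and> u' \<in> ?C v \<and> u \<noteq> u'} = card (?C v) * card (?C v) - card (?C v)" for v
  proof -
    have "{(u, u'). u \<in> ?C v \<and> u' \<in> ?C v \<and> u \<noteq> u'} = ?C v \<times> ?C v - (\<lambda>u. (u, u)) ` ?C v" by auto
    moreover have "card ((\<lambda>u. (u, u)) ` ?C v) = card (?C v)" by (rule card_image) (simp add: inj_on_def)
    ultimately show ?thesis using finC
      by (subst \<open>{(u, u'). _ u u'} = _\<close>) (auto simp: card_Diff_subset card_cartesian_product image_subset_iff)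
  qed
  have "inj_on snd ?P" using cov_unique by (fastforce simp: inj_on_def)
  moreover have "snd ` ?P \<subseteq> {..<n} \<times> {..<n}" using cov_lt by auto
  ultimately have "card ?P \<le> card ({..<n} \<times> {..<n})" by (intro card_inj_on_le[of snd]) auto
  moreover have "card ?P = (\<Sum>v<n. card (?C v) * card (?C v) - card (?C v))"
  proof -
    have "finite {(u, u'). u \<in> ?C v \<and> u' \<in> ?C v \<and> u \<noteq> u'}" for v
      by (rule finite_subset[of _ "?C v \<times> ?C v"]) (use finC in auto)
    then show ?thesis by (subst card_SigmaI) (auto simp: cP[simplified])
  qed
  ultimately have pairs: "(\<Sum>v<n. card (?C v) * card (?C v) - card (?C v)) \<le> n * n"
    by (simp add: card_cartesian_product)
  \<comment> \<open>Either d <= q, or d - 1 >= q and d(d - 1) alone is large enough.\<close>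
  have "q * card (?C v) \<le> q * q + (card (?C v) * card (?C v) - card (?C v))" for v
  proof (cases "card (?C v) \<le> q")
    case True
    then have "q * card (?C v) \<le> q * q" by simp
    then show ?thesis by (rule trans_le_add1)
  next
    case False
    then obtain k where k: "card (?C v) = q + Suc k" by (metis add_Suc_right less_imp_Suc_add not_le)
    show ?thesis by (simp add: k algebra_simps)
  qed
  then have "(\<Sum>v<n. q * card (?C v)) \<le> (\<Sum>v<n. q * q + (card (?C v) * card (?C v) - card (?C v)))"
    by (rule sum_mono)
  also have "\<dots> \<le> n * (q * q) + n * n" using pairs by (subst sum.distrib) simp
  also have "\<dots> \<le> n * (q * q) + n * (q * q)" using assms(1) by simp
  finally have "q * (\<Sum>v<n. card (?C v)) \<le> q * (2 * n * q)" by (simp add: sum_distrib_left algebra_simps)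
  then have "(\<Sum>v<n. card (?C v)) \<le> 2 * n * q" using assms(2) by simp
  moreover have "card {(u, v). cov u v} = (\<Sum>v<n. card (?C v))"
  proof -
    have "{(u, v). cov u v} = (\<lambda>(v, u). (u, v)) ` (SIGMA v:{..<n}. ?C v)" using cov_lt by force
    then have "card {(u, v). cov u v} = card (SIGMA v:{..<n}. ?C v)"
      by (simp add: card_image inj_on_def split_beta prod_eq_iff)
    then show ?thesis using finC by simp
  qed
  ultimately show ?thesis by simp
qed

text \<open>A common upper bound in \<open>S\<close> of \<open>x\<close> and of the member with the
  largest label can only be that member, since labels grow along the order.\<close>

lemma dir_max:
  assumes "finite S" "x \<in> S" "\<And>a b. a \<in> S \<Longrightarrow> b \<in> S \<Longrightarrow> \<exists>c\<in>S. le a c \<and> le b c"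
  shows "le x (mxs S - 1)"
proof -
  have m: "mxs S - 1 \<in> S" "\<forall>c\<in>S. c \<le> mxs S - 1"
    using assms mxs_in[of S] mxs_0[of S] mxs_ge[of S] by fastforce+
  obtain c where "c \<in> S" "le x c" "le (mxs S - 1) c" using assms m by blast
  then show ?thesis using m le_mono by (metis le_antisym)
qed

end

section \<open>Blocks, subblocks and the correctness of table look-ups\<close>

text \<open>Block 0 is the residual block. The numbers of the other blocks record the order in which
  they are split off, so going down never leads to a later one (\<open>B3\<close>).
  \<open>sub\<close> maps an element to the top of its subblock and \<open>sg\<close> marks
  singleton subblocks; \<open>S3\<close> is the counterpart of \<open>B3\<close> inside a block,
  with the labels of the tops as order of creation.\<close>

locale deco = plat +
  fixes blk hd sub :: "nat \<Rightarrow> nat" and sg :: "nat \<Rightarrow> bool"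
  assumes B2: "x < n \<Longrightarrow> blk x \<noteq> 0 \<Longrightarrow> le x (hd (blk x)) \<and> blk (hd (blk x)) = blk x"
    and B3: "le w x \<Longrightarrow> blk x \<noteq> 0 \<Longrightarrow> blk w \<noteq> 0 \<and> blk w \<le> blk x"
    and S1: "x < n \<Longrightarrow> le x (sub x) \<and> blk (sub x) = blk x \<and> sub (sub x) = sub x"
    and S2: "x < n \<Longrightarrow> sg (sub x) \<Longrightarrow> sub x = x"
    and S3: "le w u \<Longrightarrow> blk w = blk u \<Longrightarrow> \<not> sg u \<Longrightarrow> \<not> sg w \<and> sub w \<le> sub u"
begin

definition isH :: "nat \<Rightarrow> bool" where
  "isH x \<longleftrightarrow> blk x \<noteq> 0 \<and> hd (blk x) = x"

text \<open>The sets behind the three tables: the greatest member of \<open>rp\<close> is the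
  representative of \<open>x\<close> in a block, that of \<open>dk\<close> the representative of
  \<open>z\<close> in a subblock of its own block, and that of \<open>pm\<close> a meet inside a
  subblock.\<close>

definition rp :: "nat \<Rightarrow> nat \<Rightarrow> nat set" where
  "rp i x = {w. le w x \<and> blk w = i}"

definition dk :: "nat \<Rightarrow> nat \<Rightarrow> nat set" where
  "dk z c = {w. le w z \<and> (blk w = blk z \<and> sub w = c)}"

definition pm :: "nat \<Rightarrow> nat \<Rightarrow> nat set" where
  "pm a b = {u. le u a \<and> (le u b \<and> sub u = sub a)}"

lemma fin [simp]: "finite (rp i x)" "finite (dk z c)" "finite (pm a b)"
  unfolding rp_def dk_def pm_def by (rule le_fin)+

text \<open>Blocks are convex: numbers of proper blocks cannot grow on the way down, and whatever
  lies above a residual element is residual too.\<close>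

lemma blk_between: "le w u \<Longrightarrow> le u x \<Longrightarrow> blk w = blk x \<Longrightarrow> blk u = blk x"
  by (metis B3 le_antisym)

text \<open>\<open>S3\<close>, applied below and above \<open>u\<close>, squeezes the top of its
  subblock between two equal values; a singleton leaves no room in between.\<close>

lemma sub_between:
  assumes "le w u" "le u (sub w)" "blk w = blk u" shows "sub u = sub w"
proof (cases "sg (sub w)")
  case True
  then have "sub w = w" using S2 le_lt assms by blast
  then show ?thesis using assms le_mono by (metis le_antisym)
next
  case False
  have w: "w < n" "u < n" using assms le_lt by auto
  have "\<not> sg u \<and> sub u \<le> sub (sub w)" using S3[OF assms(2)] False S1[OF w(1)] assms(3) by simp
  then have "sub u \<le> sub w" "sub w \<le> sub u" using S3[OF assms(1,3)] S1[OF w(1)] by auto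
  then show ?thesis by simp
qed

text \<open>In a proper block the header and \<open>x\<close> are two common upper bounds, so
  interpolation applies and convexity keeps the result in the block. If the residual block has a
  member below \<open>x\<close>, then \<open>x\<close> is residual itself and is the greatest
  one.\<close>

lemma rp_max: assumes "w \<in> rp i x" shows "le w (mxs (rp i x) - 1)"
proof (rule dir_max[OF _ assms])
  fix a b assume ab: "a \<in> rp i x" "b \<in> rp i x"
  show "\<exists>c\<in>rp i x. le a c \<and> le b c"
  proof (cases "i = 0")
    case True
    then have "blk x = 0" using ab B3 unfolding rp_def by blast
    then have "x \<in> rp i x" using True ab le_lt le_refl unfolding rp_def by blast
    then show ?thesis using ab unfolding rp_def by blast
  next
    case False
    have "le a (hd i)" "le b (hd i)" "blk (hd i) = i"
      using ab False B2[of a] B2[of b] le_lt[of a x] le_lt[of b x] unfolding rp_def by auto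
    then obtain u where u: "le a u" "le b u" "le u (hd i)" "le u x"
      using le_mid[of a "hd i" x b] ab unfolding rp_def by blast
    have "blk u = i" using blk_between[OF u(1,3)] ab \<open>blk (hd i) = i\<close> by (simp add: rp_def)
    then show ?thesis using u unfolding rp_def by blast
  qed
qed simp

text \<open>As in \<open>rp_max\<close>, with the top of the subblock in the role of the
  header.\<close>

lemma dk_max: assumes "w \<in> dk z c" shows "le w (mxs (dk z c) - 1)"
proof (rule dir_max[OF _ assms])
  fix a b assume ab: "a \<in> dk z c" "b \<in> dk z c"
  have "le a c" "le b c" using ab S1[of a] S1[of b] le_lt[of a z] le_lt[of b z] unfolding dk_def by auto
  then obtain u where u: "le a u" "le b u" "le u c" "le u z"
    using le_mid[of a c z b] ab unfolding dk_def by blast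
  have b: "blk u = blk z" using blk_between[OF u(1,4)] ab by (simp add: dk_def)
  have "sub u = c" using sub_between[OF u(1)] u(3) ab b by (simp add: dk_def)
  then show "\<exists>u\<in>dk z c. le a u \<and> le b u" using u b unfolding dk_def by blast
qed simp

lemma sub_blk: "x < n \<Longrightarrow> y < n \<Longrightarrow> sub x = sub y \<Longrightarrow> blk x = blk y"
  by (metis S1)

text \<open>Here \<open>x\<close> and \<open>y\<close> themselves are the two upper bounds, and the
  interpolating element stays below the common top of their subblock.\<close>

lemma pm_max: assumes "w \<in> pm x y" "sub x = sub y" shows "le w (mxs (pm x y) - 1)"
proof (rule dir_max[OF _ assms(1)])
  fix a b assume ab: "a \<in> pm x y" "b \<in> pm x y"
  then obtain u where u: "le a u" "le b u" "le u x" "le u y"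
    using le_mid[of a x y b] unfolding pm_def by blast
  have lt: "x < n" "a < n" using ab le_lt unfolding pm_def by blast+
  have sa: "sub a = sub x" using ab unfolding pm_def by blast
  have "blk a = blk x" using sub_blk[OF lt(2,1) sa] .
  then have b: "blk u = blk x" using blk_between[OF u(1,3)] by simp
  have "le u (sub a)" using u(3) S1[OF lt(1)] sa le_trans by metis
  then have "sub u = sub x" using sub_between[OF u(1)] sa b \<open>blk a = blk x\<close> by simp
  then show "\<exists>u\<in>pm x y. le a u \<and> le b u" using u unfolding pm_def by blast
qed simp

text \<open>The candidate that subblock \<open>c\<close> contributes to a meet: the tabulated meet
  of the representatives of \<open>z1\<close> and \<open>z2\<close> in it, or 0 if one of them is
  missing.\<close>

definition lkp :: "nat \<Rightarrow> nat \<Rightarrow> nat \<Rightarrow> nat" where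
  "lkp c z1 z2 = (if mxs (dk z1 c) = 0 \<or> mxs (dk z2 c) = 0 then 0
     else mxs (pm (mxs (dk z1 c) - 1) (mxs (dk z2 c) - 1)))"

lemma dk_in: "mxs (dk z c) \<noteq> 0 \<Longrightarrow> mxs (dk z c) - 1 \<in> dk z c"
  by (rule mxs_in) simp_all

lemma lkp_sound: assumes "lkp c z1 z2 = Suc u" shows "le u z1 \<and> le u z2"
proof -
  let ?a = "mxs (dk z1 c) - 1" and ?b = "mxs (dk z2 c) - 1"
  have nz: "mxs (dk z1 c) \<noteq> 0" "mxs (dk z2 c) \<noteq> 0" "mxs (pm ?a ?b) = Suc u"
    using assms by (auto simp: lkp_def split: if_splits)
  have "u \<in> pm ?a ?b" using nz(3) mxs_in[of "pm ?a ?b"] by simp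
  moreover have "?a \<in> dk z1 c" "?b \<in> dk z2 c" using dk_in nz by blast+
  ultimately show ?thesis unfolding pm_def dk_def using le_trans by blast
qed

text \<open>Both representatives are above \<open>m\<close> by \<open>dk_max\<close> and belong to
  the subblock of \<open>m\<close>, so \<open>m\<close> is among the elements whose maximum the meet
  table holds for this pair.\<close>

lemma lkp_complete:
  assumes "le m z1" "le m z2" "blk m = blk z1" "blk m = blk z2"
  shows "\<exists>u. lkp (sub m) z1 z2 = Suc u \<and> le m u"
proof -
  let ?c = "sub m"
  let ?a = "mxs (dk z1 ?c) - 1" and ?b = "mxs (dk z2 ?c) - 1"
  have m: "m \<in> dk z1 ?c" "m \<in> dk z2 ?c" using assms by (auto simp: dk_def)
  then have nz: "mxs (dk z1 ?c) \<noteq> 0" "mxs (dk z2 ?c) \<noteq> 0" by (auto simp: mxs_0)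
  have ab: "?a \<in> dk z1 ?c" "?b \<in> dk z2 ?c" using dk_in nz by blast+
  have le: "le m ?a" "le m ?b" using dk_max m by blast+
  have s: "sub ?a = sub ?b" "sub ?a = ?c" using ab unfolding dk_def by auto
  then have mp: "m \<in> pm ?a ?b" using le unfolding pm_def by auto
  then have "le m (mxs (pm ?a ?b) - 1)" "mxs (pm ?a ?b) \<noteq> 0" using pm_max s by (auto simp: mxs_0)
  then show ?thesis using nz by (intro exI[of _ "mxs (pm ?a ?b) - 1"]) (simp add: lkp_def)
qed

text \<open>The representative \<open>z\<close> of \<open>x\<close> in the block of \<open>w\<close>
  reduces the test to w <= z. If \<open>z\<close> is the header this holds automatically, so the row
  of a header is never consulted. Otherwise the representative \<open>v\<close> of \<open>z\<close>
  in the subblock of \<open>w\<close> reduces it further to w <= v, that is, to \<open>w\<close>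
  being the meet of the two.\<close>

lemma leq_test:
  assumes "w < n" "x < n"
  defines "z \<equiv> mxs (rp (blk w) x) - 1"
  defines "v \<equiv> mxs (dk z (sub w)) - 1"
  shows "le w x \<longleftrightarrow> mxs (rp (blk w) x) \<noteq> 0 \<and>
     (isH z \<or> mxs (dk z (sub w)) \<noteq> 0 \<and> mxs (pm w v) = Suc w)"
proof
  assume "le w x"
  then have w: "w \<in> rp (blk w) x" by (simp add: rp_def)
  then have nz: "mxs (rp (blk w) x) \<noteq> 0" by (auto simp: mxs_0)
  then have z: "z \<in> rp (blk w) x" unfolding z_def by (intro mxs_in) simp_all
  have wz: "le w z" using rp_max[OF w] by (simp add: z_def)
  have dk: "w \<in> dk z (sub w)" using wz z by (simp add: dk_def rp_def)
  then have nz2: "mxs (dk z (sub w)) \<noteq> 0" by (auto simp: mxs_0)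
  have wv: "le w v" using dk_max[OF dk] by (simp add: v_def)
  have "w \<in> pm w v" using wv le_refl assms(1) by (simp add: pm_def)
  moreover have "\<forall>u\<in>pm w v. u \<le> w" using le_mono by (auto simp: pm_def)
  ultimately have "mxs (pm w v) = Suc w" by (simp add: mxs_Suc)
  then show "mxs (rp (blk w) x) \<noteq> 0 \<and> (isH z \<or> mxs (dk z (sub w)) \<noteq> 0 \<and> mxs (pm w v) = Suc w)"
    using nz nz2 by blast
next
  assume *: "mxs (rp (blk w) x) \<noteq> 0 \<and> (isH z \<or> mxs (dk z (sub w)) \<noteq> 0 \<and> mxs (pm w v) = Suc w)"
  then have "z \<in> rp (blk w) x" unfolding z_def by (intro mxs_in) simp_all
  then have z: "le z x" "blk z = blk w" by (auto simp: rp_def)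
  have "le w z"
  proof (cases "isH z")
    case True
    then show ?thesis using B2[OF assms(1)] z(2) by (simp add: isH_def)
  next
    case False
    then have **: "mxs (dk z (sub w)) \<noteq> 0" "mxs (pm w v) = Suc w" using * by auto
    have "v \<in> dk z (sub w)" using dk_in[OF **(1)] by (simp add: v_def)
    moreover have "w \<in> pm w v" using **(2) by (simp add: mxs_Suc)
    ultimately show ?thesis unfolding dk_def pm_def using le_trans by blast
  qed
  then show "le w x" using z le_trans by blast
qed

text \<open>If one representative is the header of the block, the other one lies below it and is a
  common lower bound of \<open>x\<close> and \<open>y\<close>; being above the meet, it is the meet.
  Otherwise the candidate of the subblock of \<open>m\<close> is available: it is a common lower
  bound above \<open>m\<close>, hence \<open>m\<close>.\<close>

lemma meet_complete:
  assumes m: "le m x" "le m y" "\<And>w. le w x \<Longrightarrow> le w y \<Longrightarrow> le w m"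
  defines "z1 \<equiv> mxs (rp (blk m) x) - 1" and "z2 \<equiv> mxs (rp (blk m) y) - 1"
  shows "mxs (rp (blk m) x) \<noteq> 0" "mxs (rp (blk m) y) \<noteq> 0" "blk z1 = blk m" "blk z2 = blk m"
    "isH z1 \<Longrightarrow> z2 = m" "isH z2 \<Longrightarrow> z1 = m" "lkp (sub m) z1 z2 = Suc m"
proof -
  have mx: "m \<in> rp (blk m) x" "m \<in> rp (blk m) y" using m by (auto simp: rp_def)
  then show nz: "mxs (rp (blk m) x) \<noteq> 0" "mxs (rp (blk m) y) \<noteq> 0" by (auto simp: mxs_0)
  then have z: "z1 \<in> rp (blk m) x" "z2 \<in> rp (blk m) y" unfolding z1_def z2_def by (auto intro!: mxs_in simp del: One_nat_def)
  then show b: "blk z1 = blk m" "blk z2 = blk m" by (auto simp: rp_def)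
  have le: "le m z1" "le m z2" using rp_max mx unfolding z1_def z2_def by blast+
  have zl: "le z1 x" "le z2 y" using z by (auto simp: rp_def)
  show "z2 = m" if "isH z1"
  proof -
    have "le z2 z1" using that B2[of z2] b le_lt[OF le(2)] by (auto simp: isH_def)
    then have "le z2 m" using m(3) zl le_trans by blast
    then show ?thesis using le(2) le_mono le_antisym by blast
  qed
  show "z1 = m" if "isH z2"
  proof -
    have "le z1 z2" using that B2[of z1] b le_lt[OF le(1)] by (auto simp: isH_def)
    then have "le z1 m" using m(3) zl le_trans by blast
    then show ?thesis using le(1) le_mono le_antisym by blast
  qed
  obtain u where u: "lkp (sub m) z1 z2 = Suc u" "le m u" using lkp_complete[OF le b[symmetric]] by blast
  then have "le u m" using lkp_sound[OF u(1)] m(3) zl le_trans by blast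
  then show "lkp (sub m) z1 z2 = Suc m" using u le_mono le_antisym by metis
qed

lemma big_sub: "x < n \<Longrightarrow> \<not> sg x \<Longrightarrow> \<not> sg (sub x)"
  using S2 by force

end

section \<open>Double displacement of a sparse row\<close>

lemma mod_shift_inj:
  fixes a b e p :: nat
  assumes "a < p" "b < p" "(a + e) mod p = (b + e) mod p" shows "a = b"
  using assms
proof (induction a b rule: linorder_wlog)
  case (le a b)
  then have "p dvd (b + e) - (a + e)" using mod_eq_dvd_iff_nat[of "a + e" "b + e" p] by simp
  then have "p dvd b - a" by simp
  then have "b - a = 0" using le.prems(2) by (meson dvd_imp_le gr0I leD less_imp_diff_less)
  then show ?case using le by simp
qed simp

lemma sum_rotate: fixes a :: "nat \<Rightarrow> nat" assumes "0 < p"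
  shows "(\<Sum>d<p. a ((x + d) mod p)) = (\<Sum>d<p. a d)"
proof -
  have inj: "inj_on (\<lambda>d. (x + d) mod p) {..<p}"
  proof (rule inj_onI)
    fix d e assume "d \<in> {..<p}" "e \<in> {..<p}" "(x + d) mod p = (x + e) mod p"
    then show "d = e"
      using mod_shift_inj[of d p e x] by (simp add: add.commute)
  qed
  have "(\<lambda>d. (x + d) mod p) ` {..<p} = {..<p}"
    by (rule card_subset_eq) (use assms card_image[OF inj] in auto)
  then show ?thesis using sum.reindex[OF inj, of a] by simp
qed

text \<open>The load \<open>a\<close> that \<open>m\<close> items at positions \<open>X\<close> meet
  after a cyclic shift by \<open>d\<close>. With \<open>a\<close> counting the earlier items in each
  cell, it is the number of collisions caused.\<close>

definition cost :: "nat \<Rightarrow> nat \<Rightarrow> (nat \<Rightarrow> nat) \<Rightarrow> (nat \<Rightarrow> nat) \<Rightarrow> nat \<Rightarrow> nat" where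
  "cost p m X a d = (\<Sum>b<m. a ((X b + d) mod p))"

text \<open>A best shift is at most the average, and over all \<open>p\<close> shifts every item
  meets every cell exactly once.\<close>

lemma cost_avg:
  assumes "\<forall>d<p. cost p m X a e \<le> cost p m X a d"
  shows "p * cost p m X a e \<le> m * (\<Sum>d<p. a d)"
proof (cases "p = 0")
  case False
  have "p * cost p m X a e = (\<Sum>d<p. cost p m X a e)" by simp
  also have "\<dots> \<le> (\<Sum>d<p. cost p m X a d)" using assms by (intro sum_mono) auto
  also have "\<dots> = (\<Sum>b<m. \<Sum>d<p. a ((X b + d) mod p))" unfolding cost_def by (rule sum.swap)
  also have "\<dots> = m * (\<Sum>d<p. a d)" using False by (simp add: sum_rotate)
  finally show ?thesis .
qed simp

text \<open>Keys are positions of a \<open>p\<close> by \<open>p\<close> matrix, with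
  \<open>c\<close> in row c div p and column c mod p. The first displacement moves row h cyclically
  by \<open>E h\<close>; the column reached is the bucket.\<close>

definition bkt :: "nat \<Rightarrow> (nat \<Rightarrow> nat) \<Rightarrow> nat \<Rightarrow> nat" where
  "bkt p E c = (c mod p + E (c div p)) mod p"

definition cntf :: "nat \<Rightarrow> (nat \<Rightarrow> nat) \<Rightarrow> nat set \<Rightarrow> nat \<Rightarrow> nat \<Rightarrow> nat" where
  "cntf p E K h b = card {c\<in>K. c div p < h \<and> bkt p E c = b}"

text \<open>The number of ordered pairs of distinct keys from the first \<open>h\<close> rows that
  share a bucket.\<close>

definition pot :: "nat \<Rightarrow> (nat \<Rightarrow> nat) \<Rightarrow> nat set \<Rightarrow> nat \<Rightarrow> nat" where
  "pot p E K h = (\<Sum>b<p. cntf p E K h b * (cntf p E K h b - 1))"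

lemma card_fibres:
  assumes "finite S" "\<And>x. x \<in> S \<Longrightarrow> f x < (p::nat)"
  shows "(\<Sum>b<p. card {x\<in>S. f x = b}) = card S"
proof -
  have "S = (\<Union>b\<in>{..<p}. {x\<in>S. f x = b})" using assms by auto
  then have "card S = card (\<Union>b\<in>{..<p}. {x\<in>S. f x = b})" by simp
  also have "\<dots> = (\<Sum>b<p. card {x\<in>S. f x = b})" using assms(1) by (intro card_UN_disjoint) auto
  finally show ?thesis by simp
qed

lemma cntf_sum: assumes "finite K" "0 < p"
  shows "(\<Sum>b<p. cntf p E K h b) = card {c\<in>K. c div p < h}"
  using card_fibres[of "{c\<in>K. c div p < h}" "bkt p E" p] assms by (simp add: cntf_def bkt_def conj_assoc)

text \<open>A row puts at most one key into each bucket, so displacing it creates two ordered pairs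
  for each collision with an earlier key. For P earlier keys and B keys in the row, the averaged
  collision bound turns P^2 into P^2 + 2BP <= (P + B)^2.\<close>

lemma pot_step:
  assumes fin: "finite K" and p: "0 < p"
    and inv: "p * pot p E K h \<le> (card {c\<in>K. c div p < h})\<^sup>2"
    and sm: "p * (\<Sum>c\<in>{c\<in>K. c div p = h}. cntf p E K h (bkt p E c)) \<le>
      card {c\<in>K. c div p = h} * card {c\<in>K. c div p < h}"
  shows "p * pot p E K (Suc h) \<le> (card {c\<in>K. c div p < Suc h})\<^sup>2"
proof -
  let ?B = "{c\<in>K. c div p = h}" and ?P = "{c\<in>K. c div p < h}"
  define g where "g b = card {c\<in>?B. bkt p E c = b}" for b
  have finB: "finite ?B" "finite ?P" using fin by auto
  have step: "cntf p E K (Suc h) b = cntf p E K h b + g b" for b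
  proof -
    have "{c\<in>K. c div p < Suc h \<and> bkt p E c = b} =
      {c\<in>K. c div p < h \<and> bkt p E c = b} \<union> {c\<in>?B. bkt p E c = b}" by auto
    moreover have "{c\<in>K. c div p < h \<and> bkt p E c = b} \<inter> {c\<in>?B. bkt p E c = b} = {}" by auto
    ultimately show ?thesis unfolding cntf_def g_def using fin by (simp add: card_Un_disjoint)
  qed
  \<comment> \<open>Keys of one row are moved by the same shift, so equal buckets force equal
    columns.\<close>
  have g1: "g b \<le> 1" for b
  proof -
    have "c = d" if "c \<in> {c\<in>?B. bkt p E c = b}" "d \<in> {c\<in>?B. bkt p E c = b}" for c d
    proof -
      have "c div p = d div p" using that by simp
      moreover have "(c mod p + E h) mod p = (d mod p + E h) mod p" using that by (auto simp: bkt_def)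
      then have "c mod p = d mod p" by (rule mod_shift_inj[rotated 2]) (use p in auto)
      ultimately show ?thesis by (metis div_mult_mod_eq)
    qed
    moreover have "finite {c\<in>?B. bkt p E c = b}" using fin by simp
    ultimately show ?thesis unfolding g_def One_nat_def using card_le_Suc0_iff_eq by blast
  qed
  have sq: "(x + y) * (x + y - 1) = x * (x - 1) + 2 * (x * y)" if "y \<le> 1" for x y :: nat
  proof -
    have "y = 0 \<or> y = 1" using that by auto
    then show ?thesis by (cases x) auto
  qed
  have "pot p E K (Suc h) = (\<Sum>b<p. cntf p E K h b * (cntf p E K h b - 1) + 2 * (cntf p E K h b * g b))"
    unfolding pot_def step by (intro sum.cong refl sq g1)
  also have "\<dots> = pot p E K h + 2 * (\<Sum>b<p. cntf p E K h b * g b)"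
    by (simp add: pot_def sum.distrib sum_distrib_left)
  also have "(\<Sum>b<p. cntf p E K h b * g b) = (\<Sum>c\<in>?B. cntf p E K h (bkt p E c))"
  proof -
    have "(\<Sum>c\<in>?B. cntf p E K h (bkt p E c)) = (\<Sum>b<p. \<Sum>c\<in>{c\<in>?B. bkt p E c = b}. cntf p E K h (bkt p E c))"
      by (rule sum.group[symmetric]) (use finB p in \<open>auto simp: bkt_def\<close>)
    also have "\<dots> = (\<Sum>b<p. cntf p E K h b * g b)" by (intro sum.cong) (auto simp: g_def)
    finally show ?thesis by simp
  qed
  finally have "p * pot p E K (Suc h) \<le> (card ?P)\<^sup>2 + 2 * (card ?B * card ?P)"
    using inv sm by (simp add: algebra_simps)
  also have "\<dots> \<le> (card ?P + card ?B)\<^sup>2" by (simp add: power2_eq_square algebra_simps)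
  also have "card ?P + card ?B = card {c\<in>K. c div p < Suc h}"
  proof -
    have "{c\<in>K. c div p < Suc h} = ?P \<union> ?B" "?P \<inter> ?B = {}" by auto
    then show ?thesis using finB by (simp add: card_Un_disjoint)
  qed
  finally show ?thesis .
qed

text \<open>The reason why the second displacement never fails when buckets are placed by decreasing
  size. The placed buckets have at least \<open>k\<close> keys each, and few colliding pairs mean
  that such large buckets hold few keys. Then a shift of a bucket of \<open>k\<close> keys meets
  fewer than one occupied cell on average, so some shift meets none. That the table has twice as
  many cells as keys are allowed makes the inequality strict.\<close>

lemma displacement_room:
  fixes cnt :: "nat \<Rightarrow> nat"
  assumes p: "p = 2 * q" and t: "(\<Sum>b<p. cnt b) = t" "t < q"
    and pt: "p * (\<Sum>b<p. cnt b * (cnt b - 1)) \<le> t\<^sup>2"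
    and PB: "PB \<subseteq> {..<p}" "\<forall>b\<in>PB. k \<le> cnt b" and k: "1 \<le> k"
  shows "k * (\<Sum>b\<in>PB. cnt b) < p"
proof -
  have F: "(\<Sum>b\<in>PB. cnt b) \<le> t" unfolding t(1)[symmetric] using PB by (intro sum_mono2) auto
  show ?thesis
  proof (cases "k = 1")
    \<comment> \<open>For single keys the number of pairs says nothing, but the bound on all keys is
      enough.\<close>
    case True then show ?thesis using F t(2) p by simp
  next
    case False
    \<comment> \<open>\<open>Suc j\<close> is k - 1: a bucket of size c >= k accounts for c(c - 1)
      >= c(k - 1) pairs, and k <= 2(k - 1) since k >= 2.\<close>
    then obtain j where j: "k = Suc (Suc j)" using k by (metis One_nat_def Suc_le_D not0_implies_Suc)
    have "(\<Sum>b\<in>PB. cnt b * Suc j) \<le> (\<Sum>b\<in>PB. cnt b * (cnt b - 1))"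
      using PB(2) j by (intro sum_mono mult_le_mono2) (fastforce dest!: bspec)
    also have "\<dots> \<le> (\<Sum>b<p. cnt b * (cnt b - 1))" using PB(1) by (intro sum_mono2) auto
    finally have "(\<Sum>b\<in>PB. cnt b) * Suc j \<le> (\<Sum>b<p. cnt b * (cnt b - 1))" by (subst sum_distrib_right)
    then have "p * ((\<Sum>b\<in>PB. cnt b) * Suc j) \<le> t\<^sup>2" using pt by (meson le_trans mult_le_mono2)
    moreover have "k * (\<Sum>b\<in>PB. cnt b) \<le> 2 * ((\<Sum>b\<in>PB. cnt b) * Suc j)" by (simp add: j algebra_simps)
    then have "p * (k * (\<Sum>b\<in>PB. cnt b)) \<le> p * (2 * ((\<Sum>b\<in>PB. cnt b) * Suc j))"
      by (rule mult_le_mono2)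
    ultimately have "p * (k * (\<Sum>b\<in>PB. cnt b)) \<le> 2 * t\<^sup>2" by linarith
    also have "\<dots> < p * p"
    proof -
      have "t\<^sup>2 < q * q" using t(2) by (simp add: power2_eq_square mult_strict_mono)
      then show ?thesis using p by simp
    qed
    finally show ?thesis by simp
  qed
qed

section \<open>Notation for programs\<close>

abbreviation sq_syn (infixr ";;" 60) where "c ;; d \<equiv> Sq c d"
abbreviation plus_syn (infixl "|+|" 65) where "a |+| b \<equiv> Bin Plus a b"
abbreviation minus_syn (infixl "|-|" 65) where "a |-| b \<equiv> Bin Minus a b"
abbreviation times_syn (infixl "|*|" 70) where "a |*| b \<equiv> Bin Times a b"
abbreviation div_syn (infixl "|div|" 70) where "a |div| b \<equiv> Bin Div a b"
abbreviation mod_syn (infixl "|mod|" 70) where "a |mod| b \<equiv> Bin Mod a b"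
abbreviation "When p a b c \<equiv> IfC p a b c Nop"

abbreviation (input) "vn \<equiv> 2 :: nat"
abbreviation (input) "ve \<equiv> 3 :: nat"
abbreviation (input) "vq \<equiv> 4 :: nat"
abbreviation (input) "vp \<equiv> 5 :: nat"
abbreviation (input) "vs \<equiv> 6 :: nat"
abbreviation (input) "vN \<equiv> 7 :: nat"
abbreviation (input) "vr \<equiv> 8 :: nat"
abbreviation (input) "vnb \<equiv> 9 :: nat"
abbreviation (input) "vne \<equiv> 10 :: nat"
abbreviation (input) "vz \<equiv> 11 :: nat"
abbreviation (input) "vu \<equiv> 12 :: nat"
abbreviation (input) "vw \<equiv> 13 :: nat"
abbreviation (input) "vi \<equiv> 14 :: nat"
abbreviation (input) "vj \<equiv> 15 :: nat"
abbreviation (input) "vm \<equiv> 16 :: nat"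
abbreviation (input) "vd \<equiv> 17 :: nat"
abbreviation (input) "vb \<equiv> 18 :: nat"
abbreviation (input) "vc \<equiv> 19 :: nat"
abbreviation (input) "vbc \<equiv> 20 :: nat"
abbreviation (input) "vbest \<equiv> 21 :: nat"
abbreviation (input) "vk \<equiv> 22 :: nat"
abbreviation (input) "vh \<equiv> 23 :: nat"
abbreviation (input) "vl \<equiv> 24 :: nat"
abbreviation (input) "vt \<equiv> 25 :: nat"
abbreviation (input) "vx \<equiv> 26 :: nat"
abbreviation (input) "vy \<equiv> 27 :: nat"

text \<open>\<open>aLAB\<close> and \<open>aINV\<close> hold the labels plus one and the inverse
  numbering; \<open>aADJ\<close> is the matrix of the covering graph, and the rows of
  \<open>aLE\<close> record elements below a given one. Of a dictionary, \<open>aEE\<close> and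
  \<open>aDD\<close> are the two displacements, \<open>aTT\<close> the keys plus one and
  \<open>aVL\<close> the values. \<open>aREP\<close>, \<open>aPM\<close> and \<open>aSL\<close> hold
  representatives, meets inside subblocks and lists of singletons, \<open>aPAR\<close> the
  parameters. The others describe blocks and subblocks or are work space.\<close>

abbreviation (input) "aPAR \<equiv> 2 :: nat"
abbreviation (input) "aLAB \<equiv> 3 :: nat"
abbreviation (input) "aINV \<equiv> 4 :: nat"
abbreviation (input) "aADJ \<equiv> 5 :: nat"
abbreviation (input) "aDEG \<equiv> 6 :: nat"
abbreviation (input) "aEU \<equiv> 7 :: nat"
abbreviation (input) "aEV \<equiv> 8 :: nat"
abbreviation (input) "aLE \<equiv> 9 :: nat"
abbreviation (input) "aLL \<equiv> 10 :: nat"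
abbreviation (input) "aCD \<equiv> 11 :: nat"
abbreviation (input) "aBLK \<equiv> 12 :: nat"
abbreviation (input) "aISH \<equiv> 14 :: nat"
abbreviation (input) "aREP \<equiv> 15 :: nat"
abbreviation (input) "aSUB \<equiv> 16 :: nat"
abbreviation (input) "aIDX \<equiv> 17 :: nat"
abbreviation (input) "aMEM \<equiv> 18 :: nat"
abbreviation (input) "aGS \<equiv> 19 :: nat"
abbreviation (input) "aSG \<equiv> 20 :: nat"
abbreviation (input) "aBL \<equiv> 21 :: nat"
abbreviation (input) "aPM \<equiv> 22 :: nat"
abbreviation (input) "aSL \<equiv> 23 :: nat"
abbreviation (input) "aNSL \<equiv> 24 :: nat"
abbreviation (input) "aEE \<equiv> 25 :: nat"
abbreviation (input) "aDD \<equiv> 26 :: nat"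
abbreviation (input) "aTT \<equiv> 27 :: nat"
abbreviation (input) "aVL \<equiv> 28 :: nat"
abbreviation (input) "aCNT \<equiv> 29 :: nat"
abbreviation (input) "aOCC \<equiv> 30 :: nat"
abbreviation (input) "aKL \<equiv> 31 :: nat"
abbreviation (input) "aMX \<equiv> 32 :: nat"
abbreviation (input) "aXX \<equiv> 33 :: nat"
abbreviation (input) "aYY \<equiv> 34 :: nat"

abbreviation ix :: "expr \<Rightarrow> expr \<Rightarrow> expr" where
  "ix a b \<equiv> a |*| Var vp |+| b"

text \<open>Table rows have length p = 2q. \<open>N1\<close> is the number of cells per array that
  survive preprocessing; its surplus over n * p accommodates the parameters and the end of a list
  that runs past its row.\<close>

locale pmachine = machine +
  fixes n q p s N1 :: nat
  assumes p_def: "p = 2 * q" and q_pos: "0 < q" and n_le: "n \<le> q * q"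
    and s_pos: "0 < s" and q_le: "q \<le> s * s" and s_le: "s \<le> q"
    and N1_def: "N1 = n * p + n + p + 10" and N1_le: "N1 \<le> N" and N_lt: "N < H"
begin

lemma pos: "0 < p" "q < p" using p_def q_pos by auto

lemma ltH: "x \<le> N \<Longrightarrow> x < H" using N_lt by simp

lemma ix_lt: "z < n \<Longrightarrow> j < p \<Longrightarrow> z * p + j < N1"
proof -
  assume "z < n" "j < p"
  then have "z * p + j < Suc z * p" by simp
  also have "\<dots> \<le> n * p" using \<open>z < n\<close> by (intro mult_le_mono1) simp
  finally show ?thesis by (simp add: N1_def)
qed

lemma ix_ltN: "z < n \<Longrightarrow> j < p \<Longrightarrow> z * p + j < N"
  using ix_lt N1_le by (meson order_less_le_trans)

lemma n_ltN: "x \<le> n \<Longrightarrow> x < N" "x \<le> p \<Longrightarrow> x < N" "x \<le> n * p \<Longrightarrow> x < N"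
  using N1_def N1_le by auto

lemma small_ltH: "x \<le> n \<Longrightarrow> x < H" "x \<le> p \<Longrightarrow> x < H" "x \<le> n * p \<Longrightarrow> x < H" "x \<le> Suc n \<Longrightarrow> x < H"
    "x \<le> q \<Longrightarrow> x < H" "x \<le> 64 \<Longrightarrow> x < H"
  using N1_def N1_le N_lt pos H_large by auto

lemma div_p: "c < n \<Longrightarrow> c div p < p"
proof -
  assume "c < n"
  moreover have "q * q \<le> p * p" using p_def by (intro mult_le_mono) auto
  ultimately have "c < p * p" using n_le by linarith
  then show ?thesis by (simp add: less_mult_imp_div_less)
qed

text \<open>The time bound of a composed command is given in advance and spent along the symbolic execution,
  so the rules below never have to guess it.\<close>

fun tm :: "cmd \<Rightarrow> nat" where
  "tm Nop = 1"
| "tm (Asg v e) = tE e + 1"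
| "tm (Upd a i e) = tE i + tE e + 4"
| "tm (Sq c d) = tm c + tm d"
| "tm (IfC cp a b c d) = tE a + tE b + 1 + max (tm c) (tm d)"
| "tm (For v b c) = 0"

lemma vAsg: "Q (V(v := ev e V A)) A \<Longrightarrow> ev e V A < H \<Longrightarrow> okE e V A \<Longrightarrow> v < 64 \<Longrightarrow> tE e + 1 \<le> T \<Longrightarrow>
    runs (Asg v e) V A T Q"
  by (rule runs_time[OF runs_Asg])

lemma vUpd: "Q V (A(a := (A a)(ev i V A := ev e V A))) \<Longrightarrow> ev e V A < H \<Longrightarrow> ev i V A < N \<Longrightarrow>
    okE i V A \<Longrightarrow> okE e V A \<Longrightarrow> a < 40 \<Longrightarrow> tE i + tE e + 4 \<le> T \<Longrightarrow> runs (Upd a i e) V A T Q"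
  by (rule runs_time[OF runs_Upd])

lemma vIf: "(compare cp (ev a V A) (ev b V A) \<Longrightarrow> runs c V A (T - (tE a + tE b + 1)) Q) \<Longrightarrow>
    (\<not> compare cp (ev a V A) (ev b V A) \<Longrightarrow> runs d V A (T - (tE a + tE b + 1)) Q) \<Longrightarrow> okE a V A \<Longrightarrow> okE b V A \<Longrightarrow>
    tE a + tE b + 1 \<le> T \<Longrightarrow> runs (IfC cp a b c d) V A T Q"
  by (rule runs_time[OF runs_If]) auto

lemma vNop: "Q V A \<Longrightarrow> 1 \<le> T \<Longrightarrow> runs Nop V A T Q"
  by (rule runs_time[OF runs_Nop])

lemma vcut: "(\<And>V' A'. frame (mv c) (ma c) V A V' A' \<Longrightarrow> P V' A' \<Longrightarrow> runs d V' A' (T - Tc) Q) \<Longrightarrow>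
    Tc \<le> T \<Longrightarrow> runs c V A Tc P \<Longrightarrow> runs (Sq c d) V A T Q"
  by (rule runs_time[OF runs_Sq[OF runs_use[where Q = P]]]) auto

lemma vSq: "runs c V A Tc (\<lambda>V' A'. runs d V' A' (T - Tc) Q) \<Longrightarrow> Tc \<le> T \<Longrightarrow> runs (Sq c d) V A T Q"
  by (rule runs_time[OF runs_Sq]) auto

text \<open>Applied as introduction rules these execute straight-line and conditional code, each
  first command receiving its own bound \<open>tm\<close>. Loops and named programs match none of
  them and are handled by \<open>vFor\<close> and \<open>vcut\<close>.\<close>

lemmas vs = vSq[where c = "Asg v e" and Tc = "tm (Asg v e)" for v e]
  vSq[where c = "Upd a i e" and Tc = "tm (Upd a i e)" for a i e]
  vSq[where c = "IfC cp a b c d" and Tc = "tm (IfC cp a b c d)" for cp a b c d]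
  vAsg vUpd vIf vNop

lemma vFor:
  assumes "\<And>i V' A'. i < m \<Longrightarrow> frame (insert v (mv c)) (ma c) V A V' A' \<Longrightarrow> V' v = i \<Longrightarrow> I i V' A' \<Longrightarrow>
      runs c V' A' B (\<lambda>V'' A''. I (Suc i) (V''(v := Suc i)) A'')"
    and "\<And>V' A'. frame (insert v (mv c)) (ma c) V A V' A' \<Longrightarrow> V' v = m \<Longrightarrow> I m V' A' \<Longrightarrow> Q V' A'"
    and "I 0 (V(v := 0)) A" "V b = m" "v < 64" "b < 64" "v \<noteq> b" "v \<notin> mv c" "b \<notin> mv c"
    and "2 + m * (B + 2) \<le> T"
  shows "runs (For v b c) V A T Q"
  using runs_time[OF runs_For[where I = I and B = B and Q = Q, OF assms(5-9,4,3,1,2)] assms(10)] .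

lemma vFor_sum:
  assumes "\<And>i V' A'. i < m \<Longrightarrow> frame (insert v (mv c)) (ma c) V A V' A' \<Longrightarrow> V' v = i \<Longrightarrow> I i V' A' \<Longrightarrow>
      runs c V' A' (f i) (\<lambda>V'' A''. I (Suc i) (V''(v := Suc i)) A'')"
    and "\<And>V' A'. frame (insert v (mv c)) (ma c) V A V' A' \<Longrightarrow> V' v = m \<Longrightarrow> I m V' A' \<Longrightarrow> Q V' A'"
    and "I 0 (V(v := 0)) A" "V b = m" "v < 64" "b < 64" "v \<noteq> b" "v \<notin> mv c" "b \<notin> mv c"
    and "2 + (\<Sum>i<m. f i + 2) \<le> T"
  shows "runs (For v b c) V A T Q"
  using runs_time[OF runs_For_sum[where I = I and f = f and Q = Q, OF assms(5-9,4,3,1,2)] assms(10)] .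

lemma vuse: "(\<And>V' A'. frame (mv c) (ma c) V A V' A' \<Longrightarrow> P V' A' \<Longrightarrow> Q V' A') \<Longrightarrow> Tc \<le> T \<Longrightarrow>
    runs c V A Tc P \<Longrightarrow> runs c V A T Q"
  by (rule runs_conseq)

end

text \<open>Preprocessing has n^2 further cells per array, for the two matrices. Queries are
  verified in \<open>pmachine\<close>, which later allows \<open>N\<close> to shrink to
  \<open>N1\<close>.\<close>

locale bmachine = pmachine +
  assumes N_ge: "n * n + N1 \<le> N"
begin

lemma nn_ltN: "u < n \<Longrightarrow> v < n \<Longrightarrow> u * n + v < N"
proof -
  assume "u < n" "v < n"
  then have "u * n + v < Suc u * n" by simp
  also have "\<dots> \<le> n * n" using \<open>u < n\<close> by (intro mult_le_mono1) simp
  finally show ?thesis using N_ge by simp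
qed

section \<open>The best displacement\<close>

definition amin :: "nat \<Rightarrow> cmd" where
  "amin a = For vd vp (
     Asg vc (Num 0) ;;
     For vb vm (Asg vc (Var vc |+| Arr a ((Arr aXX (Var vb) |+| Var vd) |mod| Var vp))) ;;
     IfC Eq (Var vd) (Num 0) (Asg vbest (Var vd) ;; Asg vbc (Var vc))
       (When Less (Var vc) (Var vbc) (Asg vbest (Var vd) ;; Asg vbc (Var vc))))"

lemma mods_amin [simp]: "mv (amin a) = {vd, vc, vb, vbest, vbc}" "ma (amin a) = {}"
  by (auto simp: amin_def)

lemma runs_amin:
  assumes pars: "V vp = p" and m: "V vm = m" "m \<le> q" "m \<le> n" and a: "a < 40"
    and cells: "\<And>b. b < p \<Longrightarrow> A a b \<le> m'" "m * m' \<le> N"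
  shows "runs (amin a) V A (2 + p * (18 * m + 30))
    (\<lambda>V' A'. V' vbest < p \<and> (\<forall>d<p. cost p m (A aXX) (A a) (V' vbest) \<le> cost p m (A aXX) (A a) d))"
proof -
  \<comment> \<open>The running sum has to stay below \<open>H\<close> as well: at most
    \<open>m\<close> items, each meeting a load of at most \<open>m'\<close>.\<close>
  have cost_lt: "(\<Sum>b<i. A a ((A aXX b + d) mod p)) < H" if "i \<le> m" for d i
  proof -
    have "(\<Sum>b<i. A a ((A aXX b + d) mod p)) \<le> (\<Sum>b<i. m')"
      by (rule sum_mono) (use cells pos in auto)
    also have "\<dots> \<le> m * m'" using that by simp
    finally show ?thesis using cells(2) ltH by simp
  qed
  have inner: "runs (For vb vm (Asg vc (Var vc |+| Arr a ((Arr aXX (Var vb) |+| Var vd) |mod| Var vp)))) V A'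
      (2 + m * 18) (\<lambda>V' A'. V' vc = cost p m (A aXX) (A a) d)"
    if "V vp = p" "V vm = m" "V vc = 0" "V vd = d" "A' aXX = A aXX" "A' a = A a" for V A' d
    apply (rule vFor[where m = m and B = 16 and I = "\<lambda>i V A'. V vc = (\<Sum>b<i. A a ((A aXX b + d) mod p))"])
             apply (intro vs)
    using cost_lt[of "Suc _" d]
    by (simp_all add: frame_def cost_def that a m(1) pos n_ltN order.strict_trans2[OF _ m(3)] less_imp_le)
  show ?thesis
    unfolding amin_def
    apply (rule vFor[where m = p and B = "18 * m + 28" and
      I = "\<lambda>i V A'. 0 < i \<longrightarrow> V vbest < i \<and> V vbc = cost p m (A aXX) (A a) (V vbest) \<and>
        (\<forall>d<i. cost p m (A aXX) (A a) (V vbest) \<le> cost p m (A aXX) (A a) d)"])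
             apply (intro vs)
    apply (rule vcut[OF _ _ inner])
    apply (intro vs)
    apply (simp_all add: frame_def pars m pos small_ltH cost_lt[of m, folded cost_def])
    by (auto simp: less_Suc_eq)
qed

end

lemma sum_nth: "distinct xs \<Longrightarrow> (\<Sum>i<length xs. g (xs ! i)) = (\<Sum>c\<in>set xs. (g c :: nat))"
  by (metis (no_types, lifting) atLeast0LessThan length_map nth_map sum.cong sum_list_distinct_conv_sum_set
      sum_list_sum_nth lessThan_iff)

lemma take_filter_Suc:
  "i < length xs \<Longrightarrow> filter P (take (Suc i) xs) = filter P (take i xs) @ (if P (xs ! i) then [xs ! i] else [])"
  by (simp add: take_Suc_conv_app_nth)

text \<open>Counts over the first \<open>h\<close> rows involve only the displacements of these
  rows, so they remain valid when row \<open>h\<close> receives its shift.\<close>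

lemma cntf_cong: "\<forall>h'<h. E h' = E' h' \<Longrightarrow> cntf p E K h b = cntf p E' K h b"
  unfolding cntf_def bkt_def by (intro arg_cong[where f = card]) auto

lemma pot_cong: "\<forall>h'<h. E h' = E' h' \<Longrightarrow> pot p E K h = pot p E' K h"
  unfolding pot_def using cntf_cong[of h E E' p K] by simp

lemma card_Suc_filter: "card {j. j < Suc i \<and> P j} = card {j. j < i \<and> P j} + (if P i then 1 else 0)"
proof -
  have "{j. j < Suc i \<and> P j} = {j. j < i \<and> P j} \<union> (if P i then {i} else {})"
    by (auto simp: less_Suc_eq)
  then show ?thesis by simp
qed

lemma card_nth: "distinct xs \<Longrightarrow> card {j. j < length xs \<and> P (xs ! j)} = card {c \<in> set xs. P c}"
proof -
  assume d: "distinct xs"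
  have "{c \<in> set xs. P c} = (!) xs ` {j. j < length xs \<and> P (xs ! j)}" by (auto simp: in_set_conv_nth)
  moreover have "inj_on ((!) xs) {j. j < length xs \<and> P (xs ! j)}"
    using d by (auto simp: inj_on_def nth_eq_iff_index_eq)
  ultimately show ?thesis by (simp add: card_image)
qed

context bmachine
begin

lemma ix_eq [simp]: "j < p \<Longrightarrow> j' < p \<Longrightarrow> z * p + j = z' * p + j' \<longleftrightarrow> z = z' \<and> j = j'"
proof
  assume *: "j < p" "j' < p" "z * p + j = z' * p + j'"
  from *(3) have "(z * p + j) div p = (z' * p + j') div p" "(z * p + j) mod p = (z' * p + j') mod p"
    by (simp_all only:)
  then show "z = z' \<and> j = j'" using *(1,2) pos by simp
qed simp

text \<open>The dictionaries of different elements are rows of the same arrays and are built one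
  after the other; this records that work on row \<open>z\<close> spares the others.\<close>

definition row_eq :: "nat \<Rightarrow> (nat \<Rightarrow> nat) \<Rightarrow> (nat \<Rightarrow> nat) \<Rightarrow> bool" where
  "row_eq z X X' \<longleftrightarrow> (\<forall>z' j. z' \<noteq> z \<longrightarrow> j < p \<longrightarrow> X' (z' * p + j) = X (z' * p + j))"

lemma row_eq_refl [simp]: "row_eq z X X" by (simp add: row_eq_def)

lemma row_eq_upd [simp]: "j < p \<Longrightarrow> row_eq z X (X'(z * p + j := y)) \<longleftrightarrow> row_eq z X X'"
  by (auto simp: row_eq_def)

lemma row_eq_trans: "row_eq z X X' \<Longrightarrow> row_eq z X' X'' \<Longrightarrow> row_eq z X X''"
  by (auto simp: row_eq_def)

section \<open>Collecting keys\<close>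

text \<open>Both displacement phases start by collecting keys: \<open>aXX\<close> receives the
  coordinate \<open>f\<close> that is going to be shifted, \<open>aYY\<close> the key
  itself.\<close>

definition gath :: "expr \<Rightarrow> expr \<Rightarrow> expr \<Rightarrow> cmd" where
  "gath e1 e2 f = Asg vm (Num 0) ;; For vj vk (
     Asg vt (Arr aKL (Var vj)) ;;
     When Eq e1 e2 (Upd aXX (Var vm) f ;; Upd aYY (Var vm) (Var vt) ;; Asg vm (Var vm |+| Num 1)))"

lemma mods_gath [simp]: "mv (gath e1 e2 f) = {vm, vj, vt}" "ma (gath e1 e2 f) = {aXX, aYY}"
  by (auto simp: gath_def)

lemma runs_gath:
  assumes k: "V vk = length ks" "length ks \<le> n" and ks: "\<forall>i<length ks. A aKL i = ks ! i" "\<forall>c\<in>set ks. c < n"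
    and e: "\<And>V' A' c. c \<in> set ks \<Longrightarrow> V' vt = c \<Longrightarrow> frame {vm, vj, vt} {aXX, aYY} V A V' A' \<Longrightarrow>
      okE e1 V' A' \<and> okE e2 V' A' \<and> okE f V' A' \<and> (ev e1 V' A' = ev e2 V' A' \<longleftrightarrow> P c) \<and> ev f V' A' = F c \<and> F c < H"
    and t: "tE e1 + tE e2 + tE f \<le> 40"
  shows "runs (gath e1 e2 f) V A (4 + length ks * 80) (\<lambda>V' A'. V' vm = length (filter P ks) \<and>
    (\<forall>i<length (filter P ks). A' aXX i = F (filter P ks ! i) \<and> A' aYY i = filter P ks ! i))"
  unfolding gath_def
  apply (intro vs)
  apply (rule vFor[where m = "length ks" and B = 70 and I = "\<lambda>i V A. V vm = length (filter P (take i ks)) \<and>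
    (\<forall>j<V vm. A aXX j = F (filter P (take i ks) ! j) \<and> A aYY j = filter P (take i ks) ! j)"])
  subgoal premises pr for i V' A'
  proof -
    let ?V = "V'(vt := ks ! i)" and ?A = "A'(aXX := (A' aXX)(V' vm := F (ks ! i)))"
    have fr: "frame {vm, vj, vt} {aXX, aYY} V A ?V A'" "frame {vm, vj, vt} {aXX, aYY} V A ?V ?A"
      using pr(2) by (simp_all add: frame_def)
    have mem: "ks ! i \<in> set ks" using pr(1) by simp
    have vt: "?V vt = ks ! i" by simp
    note e1 = e[OF mem vt fr(1)] and e2 = e[OF mem vt fr(2)]
    have kl: "A' aKL i = ks ! i" "i < N" using pr(1-3) ks k(2) n_ltN by (simp_all add: frame_def)
    have vm: "V' vm < n" "V' vm < N" "ks ! i < n"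
      using pr(1,4) k(2) length_filter_le[of P "take i ks"] n_ltN ks(2) by simp_all
    show ?thesis
      apply (intro vs)
      by (use t in \<open>simp_all add: e1 e2 kl vm pr(3) small_ltH less_imp_le\<close>)
        (use pr(1,3,4) in \<open>simp_all add: take_filter_Suc nth_append less_Suc_eq\<close>)
  qed
  using k by (simp_all add: frame_def small_ltH)

section \<open>Displacing the columns\<close>

definition bump :: cmd where
  "bump = For vj vm (Asg vt ((Arr aXX (Var vj) |+| Var vbest) |mod| Var vp) ;;
     Upd aCNT (Var vt) (Arr aCNT (Var vt) |+| Num 1))"

lemma mods_bump [simp]: "mv bump = {vj, vt}" "ma bump = {aCNT}"
  by (auto simp: bump_def)

lemma runs_bump:
  assumes "V vp = p" "V vm = length bs" "length bs \<le> n" "\<forall>i<length bs. A aXX i = F (bs ! i)"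
    "distinct bs" "\<forall>b<p. A aCNT b + length bs \<le> n"
  shows "runs bump V A (2 + length bs * 30)
    (\<lambda>V' A'. \<forall>b<p. A' aCNT b = A aCNT b + card {c\<in>set bs. (F c + V vbest) mod p = b})"
proof -
  let ?g = "\<lambda>i b. card {j. j < i \<and> (F (bs ! j) + V vbest) mod p = b}"
  have g: "?g i b \<le> i" for i b
    using card_mono[of "{..<i}" "{j. j < i \<and> (F (bs ! j) + V vbest) mod p = b}"] by auto
  show ?thesis
    unfolding bump_def card_nth[OF assms(5), symmetric]
    apply (rule vFor[where m = "length bs" and B = 28 and I = "\<lambda>i V' A'. \<forall>b<p. A' aCNT b = A aCNT b + ?g i b"])
    subgoal premises pr for i V' A'
    proof -
      have x: "A' aXX i = F (bs ! i)" "V' vbest = V vbest" "V' vp = p" "V' vj = i" "i < N"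
        using pr assms n_ltN by (auto simp: frame_def)
      let ?t = "(F (bs ! i) + V vbest) mod p"
      have t: "?t < p" "?t < N" using pos n_ltN mod_less_divisor by (auto intro: less_imp_le)
      have "A' aCNT ?t + 1 \<le> n" using pr(4) t(1) g[of i ?t] assms(6) pr(1) by fastforce
      then have H: "A' aCNT ?t + 1 < H" using small_ltH(1) by blast
      have I: "\<forall>b<p. A' aCNT b = A aCNT b + ?g i b" using pr(4) .
      have H': "Suc (A aCNT ?t + ?g i ?t) < H" using H I t(1) by simp
      show ?thesis
        apply (intro vs)
        by (simp_all add: x t H' I card_Suc_filter small_ltH(2) less_imp_le)
    qed
    using assms by simp_all
qed

definition phase1 :: cmd where
  "phase1 = For vh vp (gath (Var vt |div| Var vp) (Var vh) (Var vt |mod| Var vp) ;; amin aCNT ;;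
     Upd aEE (ix (Var vz) (Var vh)) (Var vbest) ;; bump)"

lemma mods_phase1 [simp]: "mv phase1 = {vh, vm, vj, vt, vd, vc, vb, vbest, vbc}"
  "ma phase1 = {aXX, aYY, aEE, aCNT}"
  by (auto simp: phase1_def)

abbreviation rowf :: "arrs \<Rightarrow> nat \<Rightarrow> nat \<Rightarrow> nat \<Rightarrow> nat" where
  "rowf A a z \<equiv> \<lambda>h. A a (z * p + h)"

text \<open>Each of the \<open>p\<close> rounds scans all keys, and the search for a shift costs
  O(p) plus O(p) per key of the row. The rows share fewer than \<open>q\<close> keys in total, so
  the sum of all rounds is O(q^2), although a single round may be expensive.\<close>

lemma runs_phase1:
  assumes V: "V vp = p" "V vz = z" "z < n" "V vk = length ks" "length ks < q" "length ks \<le> n"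
    and ks: "\<forall>i<length ks. A aKL i = ks ! i" "\<forall>c\<in>set ks. c < n" "distinct ks"
    and cnt: "\<forall>b<p. A aCNT b = 0"
  shows "runs phase1 V A (2000 * (q * q)) (\<lambda>V' A'. (\<forall>b<p. A' aCNT b = cntf p (rowf A' aEE z) (set ks) p b) \<and>
    p * pot p (rowf A' aEE z) (set ks) p \<le> (length ks)\<^sup>2 \<and> row_eq z (A aEE) (A' aEE) \<and>
    (\<forall>h<p. A' aEE (z * p + h) < p))"
proof -
  let ?K = "set ks" and ?bs = "\<lambda>h. filter (\<lambda>c. c div p = h) ks"
  let ?B = "\<lambda>h. {c\<in>set ks. c div p = h}" and ?P = "\<lambda>h. {c\<in>set ks. c div p < h}"
  let ?m = "\<lambda>h. length (?bs h)"
  define f where "f h = length ks * 80 + p * (18 * ?m h + 30) + ?m h * 30 + 30" for h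
  have len: "?m h = card (?B h)" for h
    using distinct_card[of "?bs h"] ks(3) by (simp add: distinct_card)
  have mle: "?m h \<le> length ks" for h by simp
  have summ: "(\<Sum>h<p. ?m h) = length ks"
    unfolding len using card_fibres[of "set ks" "\<lambda>c. c div p" p] div_p ks distinct_card[OF ks(3)] by auto
  have time: "2 + (\<Sum>h<p. f h + 2) \<le> 2000 * (q * q)"
  proof -
    have "(\<Sum>h<p. f h + 2) = p * (length ks * 80 + p * 30 + 32) + (18 * p + 30) * (\<Sum>h<p. ?m h)"
      unfolding f_def by (simp add: sum.distrib sum_distrib_left algebra_simps)
    also have "\<dots> = p * (length ks * 80 + p * 30 + 32) + (18 * p + 30) * length ks" using summ by simp
    also have "\<dots> \<le> p * (q * 80 + p * 30 + 32) + (18 * p + 30) * q"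
      using V(5) by (intro add_mono mult_le_mono) auto
    also have "\<dots> \<le> 410 * (q * q)"
    proof -
      have "q \<le> q * q" by simp
      then show ?thesis unfolding p_def by (simp add: algebra_simps)
    qed
    finally have "2 + (\<Sum>h<p. f h + 2) \<le> 2 + 410 * (q * q)" by simp
    moreover have "1 \<le> q * q" using q_pos by simp
    ultimately show ?thesis by linarith
  qed
  show ?thesis
    unfolding phase1_def
    apply (rule vFor_sum[where m = p and f = f and I = "\<lambda>h V' A'.
       (\<forall>b<p. A' aCNT b = cntf p (rowf A' aEE z) ?K h b) \<and>
       p * pot p (rowf A' aEE z) ?K h \<le> (card (?P h))\<^sup>2 \<and> row_eq z (A aEE) (A' aEE) \<and>
       (\<forall>h'<h. A' aEE (z * p + h') < p)"])
    subgoal premises pr for h V' A'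
    proof -
      note fr = pr(2)[simplified]
      have v: "V' vp = p" "V' vz = z" "V' vk = length ks" "V' vh = h" "\<forall>i<length ks. A' aKL i = ks ! i"
        using fr V ks pr(3) by (auto simp: frame_def)
      have sP: "(\<Sum>b<p. A' aCNT b) = card (?P h)" using cntf_sum[of ?K p "rowf A' aEE z" h] pos pr(4) by simp
      have PB: "card (?P h) + card (?B h) \<le> length ks"
      proof -
        have "card (?P h) + card (?B h) = card (?P h \<union> ?B h)" by (rule card_Un_disjoint[symmetric]) auto
        also have "\<dots> \<le> card ?K" by (rule card_mono) auto
        finally show ?thesis using distinct_card[OF ks(3)] by simp
      qed
      have cb: "A' aCNT b \<le> card (?P h)" if "b < p" for b
        unfolding sP[symmetric] using that by (intro member_le_sum) auto
      \<comment> \<open>Room for the collision cost, since the counters never exceed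
        \<open>n\<close>.\<close>
      have mN: "?m h * n \<le> N"
      proof -
        have "?m h \<le> p" using mle[of h] V(5) pos by linarith
        then have "?m h * n \<le> n * p" by (metis mult.commute mult_le_mono1)
        then show ?thesis using n_ltN(3) less_imp_le by blast
      qed
      have mlen: "?m h \<le> n" using mle[of h] V(6) by (rule order_trans)
      have mq: "?m h \<le> q" using mle[of h] V(5) by linarith
      have cbn: "A' aCNT b \<le> n" if "b < p" for b using cb[OF that] PB V(6) by linarith
      show ?thesis
        apply (rule vcut[OF _ _ runs_gath[where ks = ks and P = "\<lambda>c. c div p = h" and F = "\<lambda>c. c mod p"]])
        subgoal premises p1 for V1 A1
        proof -
          note f1 = p1(1)[simplified]
          have v1: "V1 vp = p" "V1 vz = z" "V1 vh = h" "V1 vm = ?m h" "A1 aCNT = A' aCNT" "A1 aEE = A' aEE"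
            "A1 aKL = A' aKL"
            using f1 p1(2) v by (auto simp: frame_def)
          show ?thesis
            apply (rule vcut[OF _ _ runs_amin[where m = "?m h" and m' = n]])
            subgoal premises p2 for V2 A2
            proof -
              have b1: "\<forall>i<?m h. A1 aXX i = ?bs h ! i mod p" using p1(2) v1 by simp
              have b2: "\<forall>b<p. A' aCNT b + ?m h \<le> n"
              proof (intro allI impI)
                fix b assume "b < p"
                then show "A' aCNT b + ?m h \<le> n" using cb[of b] PB len[of h] V(6) by simp
              qed
              note f2 = p2(1)[simplified]
              let ?e = "V2 vbest"
              have v2: "V2 vp = p" "V2 vz = z" "V2 vh = h" "V2 vm = ?m h" "A2 = A1" "?e < p"
                using f2 p2(2) v1 by (auto simp: frame_def)
              let ?E = "(rowf A' aEE z)(h := ?e)"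
              \<comment> \<open>The averaging bound for the shift just found, rewritten from
                positions in the collected list to keys, as \<open>pot_step\<close> expects
                it.\<close>
              have cst: "p * (\<Sum>c\<in>?B h. A' aCNT ((c mod p + ?e) mod p)) \<le> card (?B h) * card (?P h)"
              proof -
                have "cost p (?m h) (A1 aXX) (A1 aCNT) ?e = (\<Sum>c\<in>?B h. A' aCNT ((c mod p + ?e) mod p))"
                proof -
                  have "cost p (?m h) (A1 aXX) (A1 aCNT) ?e = (\<Sum>i<?m h. A' aCNT ((?bs h ! i mod p + ?e) mod p))"
                    unfolding cost_def using p1(2) v1 by (intro sum.cong) auto
                  also have "\<dots> = (\<Sum>c\<in>set (?bs h). A' aCNT ((c mod p + ?e) mod p))"
                    by (rule sum_nth) (use ks in simp)
                  finally show ?thesis by simp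
                qed
                then show ?thesis using cost_avg[of p "?m h" "A1 aXX" "A1 aCNT" ?e] p2(2) v1 sP len by simp
              qed
              have cc: "cntf p ?E ?K h b = cntf p (rowf A' aEE z) ?K h b" "pot p ?E ?K h = pot p (rowf A' aEE z) ?K h" for b
                by (rule cntf_cong pot_cong; simp)+
              have bk: "bkt p ?E c = (c mod p + ?e) mod p" if "c \<in> ?B h" for c
                using that by (simp add: bkt_def)
              have pt: "p * pot p ?E ?K (Suc h) \<le> (card (?P (Suc h)))\<^sup>2"
              proof (rule pot_step)
                have "(\<Sum>c\<in>?B h. cntf p ?E ?K h (bkt p ?E c)) = (\<Sum>c\<in>?B h. A' aCNT ((c mod p + ?e) mod p))"
                proof (rule sum.cong[OF refl])
                  fix c assume "c \<in> ?B h"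
                  then have "bkt p ?E c = (c mod p + ?e) mod p" by (rule bk)
                  then show "cntf p ?E ?K h (bkt p ?E c) = A' aCNT ((c mod p + ?e) mod p)"
                    using cc pr(4) pos by simp
                qed
                then show "p * (\<Sum>c\<in>?B h. cntf p ?E ?K h (bkt p ?E c)) \<le> card (?B h) * card (?P h)" using cst by simp
              qed (use pos pr(4) cc in auto)
              have cs: "cntf p ?E ?K (Suc h) b = A' aCNT b + card {c\<in>set (?bs h). (c mod p + ?e) mod p = b}" if "b < p" for b
              proof -
                have "{c\<in>?K. c div p < Suc h \<and> bkt p ?E c = b} =
                  {c\<in>?K. c div p < h \<and> bkt p ?E c = b} \<union> {c\<in>set (?bs h). (c mod p + ?e) mod p = b}"
                  using bk by (auto simp: less_Suc_eq)
                then have "cntf p ?E ?K (Suc h) b = cntf p ?E ?K h b + card {c\<in>set (?bs h). (c mod p + ?e) mod p = b}"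
                  unfolding cntf_def by (simp only:) (rule card_Un_disjoint; auto)
                then show ?thesis using cc pr(4) that by simp
              qed
              show ?thesis
                apply (intro vs)
                apply (rule vuse[OF _ _ runs_bump[where bs = "?bs h" and F = "\<lambda>c. c mod p"]])
                subgoal premises p3 for V3 A3
                proof -
                  note f3 = p3(1)[simplified]
                  have A3: "A3 aEE = (A' aEE)(z * p + h := ?e)" using f3 v1 v2 by (simp add: frame_def)
                  have E3: "\<forall>h'<Suc h. rowf A3 aEE z h' = ?E h'" using pr(1) unfolding A3 by (auto simp: less_Suc_eq)
                  have "cntf p (rowf A3 aEE z) ?K (Suc h) b = cntf p ?E ?K (Suc h) b"
                    "pot p (rowf A3 aEE z) ?K (Suc h) = pot p ?E ?K (Suc h)" for b
                    by (rule cntf_cong pot_cong; rule E3)+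
                  moreover have "row_eq z (A aEE) (A3 aEE)" unfolding A3 using pr(1,4) by simp
                  moreover have "\<forall>h'<Suc h. A3 aEE (z * p + h') < p"
                    unfolding A3 using pr(1,4) v2(6) by (auto simp: less_Suc_eq)
                  ultimately show ?thesis using p3(2) cs pt v1 v2 by simp
                qed
                by (simp_all add: v1 v2 b1 b2 mlen ks(3) V(3) pr(1) ix_ltN f_def less_imp_le small_ltH(2))
            qed
            by (simp_all add: v1 mq mlen cbn mN f_def)
        qed
        by (simp_all add: v V(4,6) ks f_def) (simp_all add: frame_def v pos small_ltH(2) less_imp_le)
    qed
    subgoal premises pr for V' A'
    proof -
      have "{c\<in>set ks. c div p < p} = set ks" using div_p ks(2) by auto
      then show ?thesis using pr(3) distinct_card[OF ks(3)] by simp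
    qed
    by (simp_all add: cnt V(1) cntf_def pot_def time[simplified])
qed

end

context bmachine
begin

lemma ltb: "x < n \<Longrightarrow> x < H" "x < p \<Longrightarrow> x < H" "x < n \<Longrightarrow> Suc x < H" "x < n \<Longrightarrow> x < N" "x < p \<Longrightarrow> x < N"
    "x < n \<Longrightarrow> Suc x < N" "x < p \<Longrightarrow> Suc x < H"
  using n_ltN small_ltH N1_def N1_le N_lt by (auto intro: less_imp_le simp: Suc_le_eq[symmetric])

section \<open>Displacing the buckets\<close>

definition fill :: cmd where
  "fill = For vj vm (Asg vt ((Arr aXX (Var vj) |+| Var vbest) |mod| Var vp) ;;
     Upd aOCC (Var vt) (Num 1) ;;
     Upd aTT (ix (Var vz) (Var vt)) (Arr aYY (Var vj) |+| Num 1) ;;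
     Upd aVL (ix (Var vz) (Var vt)) (Arr aMX (Arr aYY (Var vj))))"

lemma mods_fill [simp]: "mv fill = {vj, vt}" "ma fill = {aOCC, aTT, aVL}"
  by (auto simp: fill_def)

lemma runs_fill:
  assumes V: "V vp = p" "V vz = z" "z < n" "V vm = length bs" "length bs \<le> n"
    and bs: "\<forall>i<length bs. A aXX i = F (bs ! i) \<and> A aYY i = bs ! i" "distinct bs" "\<forall>c\<in>set bs. c < n \<and> A aMX c < H"
    and \<sigma>: "\<And>c. \<sigma> c = (F c + V vbest) mod p" "inj_on \<sigma> (set bs)"
  shows "runs fill V A (2 + length bs * 60) (\<lambda>V' A'.
    (\<forall>x<p. A' aOCC x = (if x \<in> \<sigma> ` set bs then 1 else A aOCC x)) \<and>
    (\<forall>c\<in>set bs. A' aTT (z * p + \<sigma> c) = Suc c \<and> A' aVL (z * p + \<sigma> c) = A aMX c) \<and>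
    (\<forall>x<p. x \<notin> \<sigma> ` set bs \<longrightarrow> A' aTT (z * p + x) = A aTT (z * p + x) \<and> A' aVL (z * p + x) = A aVL (z * p + x)) \<and>
    row_eq z (A aTT) (A' aTT) \<and> row_eq z (A aVL) (A' aVL))"
  unfolding fill_def
  apply (rule vFor[where m = "length bs" and B = 58 and I = "\<lambda>i V' A'.
    (\<forall>x<p. A' aOCC x = (if x \<in> \<sigma> ` set (take i bs) then 1 else A aOCC x)) \<and>
    (\<forall>c\<in>set (take i bs). A' aTT (z * p + \<sigma> c) = Suc c \<and> A' aVL (z * p + \<sigma> c) = A aMX c) \<and>
    (\<forall>x<p. x \<notin> \<sigma> ` set (take i bs) \<longrightarrow> A' aTT (z * p + x) = A aTT (z * p + x) \<and> A' aVL (z * p + x) = A aVL (z * p + x)) \<and>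
    row_eq z (A aTT) (A' aTT) \<and> row_eq z (A aVL) (A' aVL)"])
  subgoal premises pr for i V' A'
  proof -
    let ?c = "bs ! i"
    have x: "A' aXX i = F ?c" "A' aYY i = ?c" "A' aMX = A aMX" "V' vbest = V vbest" "V' vp = p" "V' vj = i" "V' vz = z" "i < N"
      using pr(1-3) V bs n_ltN by (auto simp: frame_def)
    have \<sigma>c: "(F ?c + V vbest) mod p = \<sigma> ?c" by (simp add: \<sigma>)
    have lt: "\<sigma> c < p" for c using pos by (simp add: \<sigma>)
    have c: "?c < n" "A aMX ?c < H" using bs(3) pr(1) by auto
    note N = c ltb(1,3,4)[OF c(1)] ltb(2,5)[OF lt[of ?c]] ix_ltN[OF V(3) lt[of ?c]]
    have tk: "set (take (Suc i) bs) = insert ?c (set (take i bs))" using pr(1) by (simp add: take_Suc_conv_app_nth)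
    have sub: "set (take i bs) \<subseteq> set bs" by (rule set_take_subset)
    have nin: "?c \<notin> set (take i bs)" using bs(2) pr(1) by (metis distinct_take not_distinct_conv_prefix
      take_Suc_conv_app_nth)
    have ne: "\<sigma> ?c \<notin> \<sigma> ` set (take i bs)"
      using \<sigma>(2) nin sub pr(1) by (auto simp: inj_on_def dest!: subsetD)
    have ne': "\<sigma> c \<noteq> \<sigma> ?c" if "c \<in> set (take i bs)" for c using ne that by (metis imageI)
    show ?thesis
      apply (intro vs)
      by (simp_all add: x \<sigma>c N lt tk ne' small_ltH) (use pr(4) lt ne' in auto)
  qed
  by (simp_all add: V)

text \<open>Keys of one bucket lie in different matrix rows. The second displacement uses the row as
  position and shifts it by an offset chosen for the bucket.\<close>

definition slot :: "arrs \<Rightarrow> nat \<Rightarrow> nat \<Rightarrow> nat" where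
  "slot A z c = (c div p + A aDD (z * p + bkt p (rowf A aEE z) c)) mod p"

text \<open>\<open>PB\<close> is the set of buckets already placed. The occupied cells are as many
  as the keys of these buckets, which is the load bounded by \<open>displacement_room\<close>. The
  last conjunct ensures that a key outside \<open>K\<close> finds no match.\<close>

definition pinv :: "arrs \<Rightarrow> nat \<Rightarrow> nat set \<Rightarrow> nat set \<Rightarrow> bool" where
  "pinv A z K PB \<longleftrightarrow> (\<forall>x<p. A aOCC x \<le> 1) \<and> (\<Sum>x<p. A aOCC x) = (\<Sum>b\<in>PB. A aCNT b) \<and>
    (\<forall>c\<in>K. bkt p (rowf A aEE z) c \<in> PB \<longrightarrow> A aOCC (slot A z c) = 1 \<and>
       A aTT (z * p + slot A z c) = Suc c \<and> A aVL (z * p + slot A z c) = A aMX c) \<and>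
    (\<forall>x<p. A aTT (z * p + x) = 0 \<or> (\<exists>c\<in>K. A aTT (z * p + x) = Suc c))"

definition place :: cmd where
  "place = gath ((Var vt |mod| Var vp |+| Arr aEE (ix (Var vz) (Var vt |div| Var vp))) |mod| Var vp) (Var vl)
     (Var vt |div| Var vp) ;; amin aOCC ;; Upd aDD (ix (Var vz) (Var vl)) (Var vbest) ;; fill"

lemma mods_place [simp]: "mv place = {vm, vj, vt, vd, vc, vb, vbest, vbc}"
  "ma place = {aXX, aYY, aDD, aOCC, aTT, aVL}"
  by (auto simp: place_def)

lemma bkt_lt: "bkt p E c < p" using pos by (simp add: bkt_def)
lemma slot_lt: "slot A z c < p" using pos by (simp add: slot_def)

text \<open>Keys in the same matrix row receive the same shift, hence share a bucket only if they
  are equal. This is what lets the second coordinate tell the keys of a bucket apart.\<close>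

lemma bkt_inj:
  assumes "bkt p E c = bkt p E d" "c div p = d div p" shows "c = d"
proof -
  have "c mod p = d mod p"
    by (rule mod_shift_inj[of _ p _ "E (c div p)"]) (use pos assms in \<open>auto simp: bkt_def\<close>)
  then show ?thesis using assms(2) by (metis div_mult_mod_eq)
qed

lemma runs_place:
  assumes V: "V vp = p" "V vz = z" "z < n" "V vk = length ks" "length ks < q" "length ks \<le> n" "V vl = l" "l < p"
    and ks: "\<forall>i<length ks. A aKL i = ks ! i" "\<forall>c\<in>set ks. c < n \<and> A aMX c < H" "distinct ks"
    and cnt: "\<forall>b<p. A aCNT b = cntf p (rowf A aEE z) (set ks) p b" "\<forall>h<p. A aEE (z * p + h) < p"
    and pt: "p * pot p (rowf A aEE z) (set ks) p \<le> (length ks)\<^sup>2"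
    and PB: "PB \<subseteq> {..<p}" "l \<notin> PB" "1 \<le> A aCNT l" "\<forall>b\<in>PB. A aCNT l \<le> A aCNT b"
    and inv: "pinv A z (set ks) PB"
  shows "runs place V A (length ks * 80 + p * (18 * A aCNT l + 30) + A aCNT l * 60 + 60)
    (\<lambda>V' A'. pinv A' z (set ks) (insert l PB) \<and> row_eq z (A aDD) (A' aDD) \<and>
       row_eq z (A aTT) (A' aTT) \<and> row_eq z (A aVL) (A' aVL))"
proof -
  let ?E = "rowf A aEE z"
  let ?bs = "filter (\<lambda>c. bkt p ?E c = l) ks"
  let ?m = "length ?bs"
  have dv: "c div p < p" if "c \<in> set ks" for c using div_p ks(2) that by blast
  have m: "?m = A aCNT l"
  proof -
    have "?m = card (set ?bs)" by (rule distinct_card[symmetric]) (use ks(3) in simp)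
    also have "set ?bs = {c\<in>set ks. c div p < p \<and> bkt p ?E c = l}" using dv by auto
    finally show ?thesis using cnt(1) V(8) by (simp add: cntf_def)
  qed
  have mle: "?m \<le> n" "?m \<le> q"
    using length_filter_le[of "\<lambda>c. bkt p ?E c = l" ks] V(5,6) by linarith+
  have sumcnt: "(\<Sum>b<p. A aCNT b) = length ks"
  proof -
    have "{c\<in>set ks. c div p < p} = set ks" using dv by auto
    then show ?thesis using cntf_sum[of "set ks" p ?E p] pos cnt(1) distinct_card[OF ks(3)] by simp
  qed
  have room: "A aCNT l * (\<Sum>b\<in>PB. A aCNT b) < p"
  proof (rule displacement_room[OF p_def sumcnt V(5) _ PB(1,4,3)])
    have "(\<Sum>b<p. A aCNT b * (A aCNT b - 1)) = pot p ?E (set ks) p"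
      unfolding pot_def using cnt(1) by (intro sum.cong) auto
    then show "p * (\<Sum>b<p. A aCNT b * (A aCNT b - 1)) \<le> (length ks)\<^sup>2" using pt by simp
  qed
  have ii: "\<forall>c\<in>set ks. bkt p ?E c \<in> PB \<longrightarrow> A aOCC (slot A z c) = 1 \<and>
       A aTT (z * p + slot A z c) = Suc c \<and> A aVL (z * p + slot A z c) = A aMX c"
    using inv unfolding pinv_def by (elim conjE)
  have occ1: "A aOCC b \<le> 1" if "b < p" for b using inv that by (simp add: pinv_def)
  have m1: "?m * 1 \<le> N" using mle(1) n_ltN(1)[of ?m] by simp
  show ?thesis
    unfolding place_def
    apply (rule vcut[OF _ _ runs_gath[where ks = ks and P = "\<lambda>c. bkt p ?E c = l" and F = "\<lambda>c. c div p"]])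
    subgoal premises p1 for V1 A1
    proof -
      note f1 = p1(1)[simplified]
      have v1: "V1 vp = p" "V1 vz = z" "V1 vl = l" "V1 vm = ?m" "A1 aOCC = A aOCC" "A1 aDD = A aDD"
        "A1 aMX = A aMX" "A1 aCNT = A aCNT" "A1 aEE = A aEE" "A1 aTT = A aTT" "A1 aVL = A aVL"
        using f1 p1(2) V by (auto simp: frame_def)
      have xy: "\<forall>i<?m. A1 aXX i = ?bs ! i div p \<and> A1 aYY i = ?bs ! i" using p1(2) by simp
      show ?thesis
        apply (rule vcut[OF _ _ runs_amin[where m = ?m and m' = 1]])
        subgoal premises p2 for V2 A2
        proof -
          note f2 = p2(1)[simplified]
          let ?e = "V2 vbest"
          define \<sigma> where "\<sigma> c = (c div p + ?e) mod p" for c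
          have v2: "V2 vp = p" "V2 vz = z" "V2 vl = l" "V2 vm = ?m" "A2 = A1" "?e < p"
            using f2 p2(2) v1 by (auto simp: frame_def)
          \<comment> \<open>Fewer than one collision on average, so the minimum found by
            \<open>amin\<close> is 0.\<close>
          have "p * cost p ?m (A1 aXX) (A aOCC) ?e \<le> ?m * (\<Sum>d<p. A aOCC d)"
            using cost_avg[of p ?m "A1 aXX" "A1 aOCC" ?e] p2(2) v1 by simp
          also have "\<dots> < p" using room m inv by (simp add: pinv_def)
          finally have "cost p ?m (A1 aXX) (A aOCC) ?e = 0" by simp
          then have "\<forall>i<?m. A aOCC ((?bs ! i div p + ?e) mod p) = 0"
            unfolding cost_def using xy by simp
          then have free: "A aOCC (\<sigma> c) = 0" if "c \<in> set ?bs" for c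
            unfolding \<sigma>_def using that by (metis in_set_conv_nth)
          \<comment> \<open>The new keys do not collide with each other either, as they lie in
            different matrix rows.\<close>
          have inj: "inj_on \<sigma> (set ?bs)"
          proof (rule inj_onI)
            fix c d assume cd: "c \<in> set ?bs" "d \<in> set ?bs" "\<sigma> c = \<sigma> d"
            then have "c div p = d div p"
              using mod_shift_inj[of "c div p" p "d div p" ?e] dv by (simp add: \<sigma>_def)
            then show "c = d" using bkt_inj[of ?E c d] cd by simp
          qed
          show ?thesis
            apply (intro vs)
            apply (rule vuse[OF _ _ runs_fill[where z = z and bs = ?bs and F = "\<lambda>c. c div p" and \<sigma> = \<sigma>]])
            subgoal premises p3 for V3 A3
            proof -
              note f3 = p3(1)[simplified]
              have A3: "A3 aDD = (A aDD)(z * p + l := ?e)" "A3 aMX = A aMX" "A3 aCNT = A aCNT" "A3 aEE = A aEE"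
                using f3 v1 v2 by (simp_all add: frame_def)
              have occ: "\<forall>x<p. A3 aOCC x = (if x \<in> \<sigma> ` set ?bs then 1 else A aOCC x)"
                and new: "\<forall>c\<in>set ?bs. A3 aTT (z * p + \<sigma> c) = Suc c \<and> A3 aVL (z * p + \<sigma> c) = A aMX c"
                and old: "\<forall>x<p. x \<notin> \<sigma> ` set ?bs \<longrightarrow> A3 aTT (z * p + x) = A aTT (z * p + x) \<and> A3 aVL (z * p + x) = A aVL (z * p + x)"
                and rws: "row_eq z (A aTT) (A3 aTT)" "row_eq z (A aVL) (A3 aVL)"
                using p3(2) v1 v2 by auto
              have sl: "slot A3 z c = (if bkt p ?E c = l then \<sigma> c else slot A z c)" for c
                using bkt_lt[of ?E c] V(8) by (simp add: slot_def A3 \<sigma>_def)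
              have "(\<Sum>x<p. A3 aOCC x) = (\<Sum>x<p. A aOCC x + (if x \<in> \<sigma> ` set ?bs then 1 else 0))"
                using occ free by (intro sum.cong) auto
              also have "\<dots> = (\<Sum>x<p. A aOCC x) + card ({..<p} \<inter> \<sigma> ` set ?bs)"
                by (simp add: sum.distrib sum.If_cases)
              also have "{..<p} \<inter> \<sigma> ` set ?bs = \<sigma> ` set ?bs" using pos by (auto simp: \<sigma>_def)
              also have "card (\<sigma> ` set ?bs) = A aCNT l"
                using card_image[OF inj] distinct_card[of ?bs] ks(3) m by simp
              finally have sm: "(\<Sum>x<p. A3 aOCC x) = (\<Sum>b\<in>insert l PB. A3 aCNT b)"
                using inv PB(2) finite_subset[OF PB(1)] by (simp add: pinv_def A3)
              have main: "A3 aOCC (slot A3 z c) = 1 \<and> A3 aTT (z * p + slot A3 z c) = Suc c \<and>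
                  A3 aVL (z * p + slot A3 z c) = A3 aMX c" if c: "c \<in> set ks" "bkt p ?E c \<in> insert l PB" for c
              proof (cases "bkt p ?E c = l")
                case True
                then have "c \<in> set ?bs" using c by simp
                then have nw: "A3 aTT (z * p + \<sigma> c) = Suc c" "A3 aVL (z * p + \<sigma> c) = A aMX c" "\<sigma> c \<in> \<sigma> ` set ?bs"
                  using new by blast+
                have "\<sigma> c < p" using pos by (simp add: \<sigma>_def)
                then have "A3 aOCC (\<sigma> c) = 1" using occ nw(3) by simp
                moreover have "slot A3 z c = \<sigma> c" using True sl by simp
                ultimately show ?thesis using nw A3(2) by (simp only:)
              next
                case False
                then have o: "A aOCC (slot A z c) = 1" "A aTT (z * p + slot A z c) = Suc c"
                  "A aVL (z * p + slot A z c) = A aMX c" using ii c by simp_all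
                have nin: "slot A z c \<notin> \<sigma> ` set ?bs"
                proof
                  assume "slot A z c \<in> \<sigma> ` set ?bs"
                  then obtain d where "d \<in> set ?bs" "slot A z c = \<sigma> d" by (rule imageE)
                  then show False using free[of d] o(1) by simp
                qed
                have s1: "slot A3 z c = slot A z c" using sl[of c] False by (simp only: if_False)
                have s2: "A3 aOCC (slot A z c) = 1"
                  using occ[rule_format, OF slot_lt[of A z c]] nin o(1) by (simp only: if_False)
                from s1 s2 show ?thesis using old[rule_format, OF slot_lt nin] o A3(2) by (simp only:)
              qed
              have tt: "A3 aTT (z * p + x) = 0 \<or> (\<exists>c\<in>set ks. A3 aTT (z * p + x) = Suc c)" if "x < p" for x
              proof (cases "x \<in> \<sigma> ` set ?bs")
                case True
                then show ?thesis using new by auto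
              next
                case False
                have "A aTT (z * p + x) = 0 \<or> (\<exists>c\<in>set ks. A aTT (z * p + x) = Suc c)"
                  using inv that unfolding pinv_def by blast
                then show ?thesis using old[rule_format, OF that False] by (simp only:)
              qed
              have "pinv A3 z (set ks) (insert l PB)"
                unfolding pinv_def
              proof (intro conjI)
                show "\<forall>x<p. A3 aOCC x \<le> 1" using occ occ1 by simp
                show "(\<Sum>x<p. A3 aOCC x) = (\<Sum>b\<in>insert l PB. A3 aCNT b)" by (rule sm)
                show "\<forall>c\<in>set ks. bkt p (rowf A3 aEE z) c \<in> insert l PB \<longrightarrow> A3 aOCC (slot A3 z c) = 1 \<and>
                  A3 aTT (z * p + slot A3 z c) = Suc c \<and> A3 aVL (z * p + slot A3 z c) = A3 aMX c"
                  unfolding A3(4) using main by blast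
                show "\<forall>x<p. A3 aTT (z * p + x) = 0 \<or> (\<exists>c\<in>set ks. A3 aTT (z * p + x) = Suc c)" using tt by blast
              qed
              moreover have "row_eq z (A aDD) (A3 aDD)" using V(8) by (simp add: A3)
              ultimately show ?thesis using rws by blast
            qed
            by (simp_all add: v1 v2 m[symmetric] \<sigma>_def inj[simplified] xy ks V(3,8) mle ix_ltN small_ltH(2) less_imp_le)
        qed
        by (simp_all add: v1 mle occ1[simplified] m1[simplified] m[symmetric])
    qed
    subgoal by simp
    subgoal by (rule V)
    subgoal by (rule V)
    subgoal by (rule ks)
    subgoal using ks by blast
    subgoal premises pr for V' A' c
    proof -
      have "V' vp = p" "V' vz = z" "V' vl = l" "A' aEE = A aEE" using pr(3) V by (auto simp: frame_def)
      then show ?thesis using dv[OF pr(1)] V(3) pr(2)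
        by (simp add: ix_ltN small_ltH(2) less_imp_le bkt_def)
    qed
    by simp
qed

text \<open>Round \<open>i\<close> places the buckets with exactly q - i keys. This yields the
  decreasing order without sorting, and empty buckets are never placed because i < q.\<close>

definition phase2 :: cmd where
  "phase2 = For vi vq (For vl vp (When Eq (Arr aCNT (Var vl) |+| Var vi) (Var vq) place))"

lemma mods_phase2 [simp]: "mv phase2 = {vi, vl, vm, vj, vt, vd, vc, vb, vbest, vbc}"
  "ma phase2 = {aXX, aYY, aDD, aOCC, aTT, aVL}"
  by (auto simp: phase2_def)

text \<open>The buckets already placed when round \<open>i\<close> has come to bucket
  \<open>l\<close>.\<close>

definition dset :: "(nat \<Rightarrow> nat) \<Rightarrow> nat \<Rightarrow> nat \<Rightarrow> nat set" where
  "dset cn i l = {b. b < p \<and> (q < cn b + i \<or> cn b + i = q \<and> b < l)}"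

definition tpl :: "nat \<Rightarrow> nat \<Rightarrow> nat" where
  "tpl k m = k * 80 + p * (18 * m + 30) + m * 60 + 60"

lemma runs_round:
  assumes V: "V vp = p" "V vz = z" "z < n" "V vk = length ks" "length ks < q" "length ks \<le> n" "V vq = q" "V vi = i" "i < q"
    and ks: "\<forall>i<length ks. A aKL i = ks ! i" "\<forall>c\<in>set ks. c < n \<and> A aMX c < H" "distinct ks"
    and cnt: "\<forall>b<p. A aCNT b = cntf p (rowf A aEE z) (set ks) p b" "\<forall>h<p. A aEE (z * p + h) < p"
    and pt: "p * pot p (rowf A aEE z) (set ks) p \<le> (length ks)\<^sup>2"
    and le: "\<forall>b<p. A aCNT b \<le> n"
    and inv: "pinv A z (set ks) (dset (A aCNT) i 0)"
  shows "runs (For vl vp (When Eq (Arr aCNT (Var vl) |+| Var vi) (Var vq) place)) V A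
    (2 + (\<Sum>l<p. (if A aCNT l + i = q then tpl (length ks) (A aCNT l) else 0) + 22))
    (\<lambda>V' A'. pinv A' z (set ks) (dset (A aCNT) (Suc i) 0) \<and> row_eq z (A aDD) (A' aDD) \<and>
       row_eq z (A aTT) (A' aTT) \<and> row_eq z (A aVL) (A' aVL))"
  apply (rule vFor_sum[where m = p and f = "\<lambda>l. (if A aCNT l + i = q then tpl (length ks) (A aCNT l) else 0) + 20" and
      I = "\<lambda>l V' A'. pinv A' z (set ks) (dset (A aCNT) i l) \<and> row_eq z (A aDD) (A' aDD) \<and>
       row_eq z (A aTT) (A' aTT) \<and> row_eq z (A aVL) (A' aVL)"])
  subgoal premises pr for l V' A'
  proof -
    have v: "V' vp = p" "V' vz = z" "V' vk = length ks" "V' vq = q" "V' vi = i" "V' vl = l"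
      "A' aCNT = A aCNT" "A' aEE = A aEE" "A' aKL = A aKL" "A' aMX = A aMX"
      using pr(2)[simplified] pr(3) V by (simp_all add: frame_def)
    have lp: "l < p" by (rule pr(1))
    have c: "A aCNT l \<le> n" using le lp by simp
    have eq: "dset (A aCNT) i (Suc l) = (if A aCNT l + i = q then insert l (dset (A aCNT) i l) else dset (A aCNT) i l)"
      using lp by (auto simp: dset_def less_Suc_eq)
    show ?thesis
    proof (cases "A aCNT l + i = q")
      case True
      have dl: "dset (A aCNT) i l \<subseteq> {..<p}" "l \<notin> dset (A aCNT) i l" using True by (auto simp: dset_def)
      have "1 \<le> A' aCNT l" using True V(9) v by simp
      moreover have "\<forall>b\<in>dset (A aCNT) i l. A' aCNT l \<le> A' aCNT b"
        using True by (auto simp: dset_def v)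
      ultimately have pl: "runs place V' A' (tpl (length ks) (A aCNT l)) (\<lambda>V'' A''.
        pinv A'' z (set ks) (insert l (dset (A aCNT) i l)) \<and> row_eq z (A' aDD) (A'' aDD) \<and>
        row_eq z (A' aTT) (A'' aTT) \<and> row_eq z (A' aVL) (A'' aVL))"
        apply (intro runs_conseq[OF runs_place[where V = V' and A = A' and z = z and ks = ks and l = l and PB = "dset (A aCNT) i l"]])
        using v lp V ks cnt pt pr(4) dl by (simp_all only: tpl_def not_False_eq_True)
      show ?thesis
        apply (intro vs)
        apply (rule vuse[OF _ _ pl])
        using pr(4) by (simp_all add: v True c lp ltb small_ltH n_ltN less_imp_le eq) (blast intro: row_eq_trans)
    next
      case False
      show ?thesis
        apply (intro vs)
        using pr(4) False by (simp_all add: v c lp ltb eq)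
    qed
  qed
  subgoal premises pr for V' A'
  proof -
    have "dset (A aCNT) i p = dset (A aCNT) (Suc i) 0" by (auto simp: dset_def)
    then show ?thesis using pr(3) by simp
  qed
  using inv by (simp_all add: V add.commute)

text \<open>The rounds scan q * p sizes. Beyond that each nonempty bucket is placed once, at a cost
  of O(q) per key in it, and there are fewer than \<open>q\<close> keys; this gives O(q^2).\<close>

lemma runs_phase2:
  assumes V: "V vp = p" "V vz = z" "z < n" "V vk = length ks" "length ks < q" "length ks \<le> n" "V vq = q"
    and ks: "\<forall>i<length ks. A aKL i = ks ! i" "\<forall>c\<in>set ks. c < n \<and> A aMX c < H" "distinct ks"
    and cnt: "\<forall>b<p. A aCNT b = cntf p (rowf A aEE z) (set ks) p b" "\<forall>h<p. A aEE (z * p + h) < p"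
    and pt: "p * pot p (rowf A aEE z) (set ks) p \<le> (length ks)\<^sup>2"
    and z0: "\<forall>x<p. A aOCC x = 0 \<and> A aTT (z * p + x) = 0"
  shows "runs phase2 V A (2000 * (q * q)) (\<lambda>V' A'. pinv A' z (set ks) {b. b < p \<and> 0 < A aCNT b} \<and>
    row_eq z (A aDD) (A' aDD) \<and> row_eq z (A aTT) (A' aTT) \<and> row_eq z (A aVL) (A' aVL))"
proof -
  let ?cn = "A aCNT" and ?k = "length ks"
  have dv: "c div p < p" if "c \<in> set ks" for c using div_p ks(2) that by blast
  have sumcnt: "(\<Sum>b<p. ?cn b) = ?k"
  proof -
    have "{c\<in>set ks. c div p < p} = set ks" using dv by auto
    then show ?thesis using cntf_sum[of "set ks" p "rowf A aEE z" p] pos cnt(1) distinct_card[OF ks(3)] by simp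
  qed
  have le: "?cn b \<le> ?k" if "b < p" for b
    unfolding sumcnt[symmetric] using that by (intro member_le_sum) auto
  \<comment> \<open>No bucket has more than \<open>q\<close> keys, because there are fewer than
    \<open>q\<close> keys altogether.\<close>
  have d0: "dset ?cn 0 0 = {}" using le V(5) by (fastforce simp: dset_def)
  have dq: "dset ?cn q 0 = {b. b < p \<and> 0 < ?cn b}" by (auto simp: dset_def)
  define f where "f i = 2 + (\<Sum>l<p. (if ?cn l + i = q then tpl ?k (?cn l) else 0) + 22)" for i
  have time: "2 + (\<Sum>i<q. f i + 2) \<le> 2000 * (q * q)"
  proof -
    have one: "(\<Sum>i<q. if ?cn l + i = q then tpl ?k (?cn l) else 0) \<le> ?cn l * (?k * 80 + p * 48 + 120)" (is "?L \<le> ?R")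
      for l
    proof (cases "?cn l = 0")
      case True
      then have "?L = 0" by (simp cong: sum.cong)
      then show ?thesis by simp
    next
      case False
      have "?L \<le> tpl ?k (?cn l)"
      proof (cases "?cn l \<le> q")
        case True
        have "?L = (\<Sum>i<q. if i = q - ?cn l then tpl ?k (?cn l) else 0)"
          using True by (intro sum.cong) auto
        also have "\<dots> \<le> tpl ?k (?cn l)" by simp
        finally show ?thesis .
      next
        case False
        then have "?L = 0" by simp
        then show ?thesis by simp
      qed
      also have "\<dots> \<le> ?R"
      proof -
        \<comment> \<open>A nonempty bucket has a key to which the fixed part of the cost can be
          charged.\<close>
        obtain m where m: "?cn l = Suc m" using False not0_implies_Suc by blast
        show ?thesis unfolding tpl_def m by (simp add: algebra_simps)
      qed
      finally show ?thesis .
    qed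
    have "(\<Sum>i<q. \<Sum>l<p. if ?cn l + i = q then tpl ?k (?cn l) else 0) =
      (\<Sum>l<p. \<Sum>i<q. if ?cn l + i = q then tpl ?k (?cn l) else 0)" by (rule sum.swap)
    also have "\<dots> \<le> (\<Sum>l<p. ?cn l * (?k * 80 + p * 48 + 120))" by (intro sum_mono one)
    also have "\<dots> = ?k * (?k * 80 + p * 48 + 120)" by (simp add: sum_distrib_right[symmetric] sumcnt)
    also have "\<dots> \<le> q * (q * 80 + p * 48 + 120)" using V(5) by (intro mult_le_mono) auto
    finally have S: "(\<Sum>i<q. \<Sum>l<p. if ?cn l + i = q then tpl ?k (?cn l) else 0) \<le> q * (q * 80 + p * 48 + 120)" .
    have fi: "f i + 2 = (\<Sum>l<p. if ?cn l + i = q then tpl ?k (?cn l) else 0) + (4 + p * 22)" for i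
      by (simp add: f_def sum.distrib)
    have "(\<Sum>i<q. f i + 2) \<le> q * (q * 80 + p * 48 + 120) + q * (4 + p * 22)"
      using S by (simp only: fi sum.distrib sum_constant card_lessThan add_mult_distrib2 of_nat_id)
    moreover have "q * (q * 80 + p * 48 + 120) + q * (4 + p * 22) = 220 * (q * q) + 124 * q"
      by (simp add: p_def algebra_simps)
    moreover have "1 \<le> q * q" "q \<le> q * q" using q_pos by simp_all
    ultimately show ?thesis by linarith
  qed
  show ?thesis
    unfolding phase2_def
    apply (rule vFor_sum[where m = q and f = f and I = "\<lambda>i V' A'. pinv A' z (set ks) (dset ?cn i 0) \<and>
      row_eq z (A aDD) (A' aDD) \<and> row_eq z (A aTT) (A' aTT) \<and> row_eq z (A aVL) (A' aVL)"])
    subgoal premises pr for i V' A'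
    proof -
      have v: "V' vp = p" "V' vz = z" "V' vk = length ks" "V' vq = q" "V' vi = i"
        "A' aCNT = A aCNT" "A' aEE = A aEE" "A' aKL = A aKL" "A' aMX = A aMX"
        using pr(2)[simplified] pr(3) V by (simp_all add: frame_def)
      have I: "pinv A' z (set ks) (dset ?cn i 0)" "row_eq z (A aDD) (A' aDD)" "row_eq z (A aTT) (A' aTT)"
        "row_eq z (A aVL) (A' aVL)" using pr(4) by simp_all
      have le': "\<forall>b<p. ?cn b \<le> n" using le V(6) by (meson order_trans)
      show ?thesis
        apply (rule runs_conseq[OF runs_round[where z = z and ks = ks and i = i]])
        subgoal by (rule v) subgoal by (rule v) subgoal by (rule V) subgoal by (rule v) subgoal by (rule V)
        subgoal by (rule V) subgoal by (rule v) subgoal by (rule v) subgoal by (rule pr(1))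
        subgoal unfolding v by (rule ks) subgoal unfolding v by (rule ks) subgoal by (rule ks)
        subgoal unfolding v by (rule cnt) subgoal unfolding v by (rule cnt) subgoal unfolding v by (rule pt)
        subgoal unfolding v by (rule le') subgoal unfolding v by (rule I) subgoal unfolding f_def v by (rule order_refl)
        subgoal for V'' A'' using I row_eq_trans[OF I(2), of "A'' aDD"] row_eq_trans[OF I(3), of "A'' aTT"]
          row_eq_trans[OF I(4), of "A'' aVL"] by (simp add: v)
        done
    qed
    using z0 by (simp_all add: V d0 dq time[simplified] pinv_def)
qed

section \<open>The dictionary of a row\<close>

text \<open>Keys are stored plus one, so an empty cell matches no key. The answer 0 for a missing
  key agrees with \<open>mxs\<close> of the empty set.\<close>

definition dlook :: "arrs \<Rightarrow> nat \<Rightarrow> nat \<Rightarrow> nat" where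
  "dlook A z c = (if A aTT (z * p + slot A z c) = Suc c then A aVL (z * p + slot A z c) else 0)"

lemma dlook_pinv:
  assumes "pinv A z K PB" "c \<in> K \<Longrightarrow> bkt p (rowf A aEE z) c \<in> PB"
  shows "dlook A z c = (if c \<in> K then A aMX c else 0)"
  using assms slot_lt[of A z c] unfolding dlook_def pinv_def by (cases "c \<in> K") force+

lemma dlook_row_eq:
  assumes "row_eq z (A aEE) (A' aEE)" "row_eq z (A aDD) (A' aDD)" "row_eq z (A aTT) (A' aTT)"
    "row_eq z (A aVL) (A' aVL)" "z' \<noteq> z" "c < n"
  shows "dlook A' z' c = dlook A z' c"
proof -
  have "rowf A' aEE z' (c div p) = rowf A aEE z' (c div p)" using assms div_p by (simp add: row_eq_def)
  then have b: "bkt p (rowf A' aEE z') c = bkt p (rowf A aEE z') c" by (simp add: bkt_def)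
  then have "slot A' z' c = slot A z' c" using assms bkt_lt by (simp add: slot_def row_eq_def)
  then show ?thesis using assms slot_lt by (simp add: dlook_def row_eq_def)
qed

text \<open>Elements are visited by increasing label, so the last value written for a subblock is
  its maximum, and a zero in \<open>aMX\<close> shows that the subblock is not yet in the key
  list.\<close>

definition collect :: cmd where
  "collect = Asg vk (Num 0) ;; For vw vn (
     When Eq (Arr aLE (Var vz |*| Var vn |+| Var vw)) (Num 1) (
     When Eq (Arr aBLK (Var vw)) (Arr aBLK (Var vz)) (
       Asg vt (Arr aSUB (Var vw) |-| Num 1) ;;
       When Eq (Arr aMX (Var vt)) (Num 0) (Upd aKL (Var vk) (Var vt) ;; Asg vk (Var vk |+| Num 1)) ;;
       Upd aMX (Var vt) (Var vw |+| Num 1))))"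

lemma mods_collect [simp]: "mv collect = {vk, vw, vt}" "ma collect = {aKL, aMX}"
  by (auto simp: collect_def)

lemma runs_collect:
  assumes V: "V vn = n" "V vz = z" "z < n"
    and S: "\<forall>w<n. P w \<longleftrightarrow> A aLE (z * n + w) = 1 \<and> A aBLK w = A aBLK z" "\<forall>w<n. P w \<longrightarrow> A aSUB w = Suc (sb w) \<and> sb w < n"
    and mx: "\<forall>c<n. A aMX c = 0"
  shows "runs collect V A (4 + n * 100) (\<lambda>V' A'. \<exists>ks. distinct ks \<and> V' vk = length ks \<and>
    set ks = sb ` {w. w < n \<and> P w} \<and> (\<forall>i<length ks. A' aKL i = ks ! i) \<and>
    (\<forall>c<n. A' aMX c = mxs {w. w < n \<and> P w \<and> sb w = c}))"
  unfolding collect_def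
  apply (intro vs)
  apply (rule vFor[where m = n and B = 90 and I = "\<lambda>i V' A'. \<exists>ks. distinct ks \<and> V' vk = length ks \<and>
    set ks = sb ` {w. w < i \<and> P w} \<and> (\<forall>i<length ks. A' aKL i = ks ! i) \<and>
    (\<forall>c<n. A' aMX c = mxs {w. w < i \<and> P w \<and> sb w = c})"])
  subgoal premises pr for i V' A'
  proof -
    note f = pr(2)[simplified]
    have v: "V' vn = n" "V' vz = z" "V' vw = i" "A' aLE = A aLE" "A' aBLK = A aBLK" "A' aSUB = A aSUB"
      using f pr(3) V by (simp_all add: frame_def)
    obtain ks where ks: "distinct ks" "V' vk = length ks" "set ks = sb ` {w. w < i \<and> P w}"
      "\<forall>i<length ks. A' aKL i = ks ! i" "\<forall>c<n. A' aMX c = mxs {w. w < i \<and> P w \<and> sb w = c}"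
      using pr(4) by blast
    have idx: "i < n" "i < N" "z * n + i < N" "z < N" "Suc i < H"
      using pr(1) nn_ltN[OF V(3) pr(1)] ltb V(3) by blast+
    have "card (set ks) \<le> card {w. w < i \<and> P w}" unfolding ks(3) by (rule card_image_le) simp
    also have "\<dots> \<le> card {..<i}" by (rule card_mono) auto
    finally have len: "length ks < n" "length ks < N" "Suc (length ks) < H" using distinct_card[OF ks(1)] pr(1) ltb by auto
    show ?thesis
    proof (cases "P i")
      case False
      have "{w. w < Suc i \<and> P w} = {w. w < i \<and> P w}" "\<And>c. {w. w < Suc i \<and> P w \<and> sb w = c} = {w. w < i \<and> P w \<and> sb w = c}"
        using False less_Suc_eq by auto
      note eqs = this
      have nP: "A aLE (z * n + i) = 1 \<Longrightarrow> A aBLK i \<noteq> A aBLK z" using S(1) False pr(1) by blast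
      show ?thesis
        apply (intro vs)
        using nP by (simp_all add: v idx ltb(4)[OF V(3)] eqs, auto intro!: exI[of _ ks] simp: ks)
    next
      case True
      have sb: "A aSUB i = Suc (sb i)" "sb i < n" "sb i < N" "sb i < H" "A aLE (z * n + i) = 1" "A aBLK i = A aBLK z"
        using S True pr(1) ltb by auto
      have e1: "sb ` {w. w < Suc i \<and> P w} = insert (sb i) (sb ` {w. w < i \<and> P w})"
        using True by (auto simp: less_Suc_eq)
      have e2: "mxs {w. w < Suc i \<and> P w \<and> sb w = c} = (if c = sb i then Suc i else mxs {w. w < i \<and> P w \<and> sb w = c})" for c
      proof (cases "c = sb i")
        case c: True
        have "mxs {w. w < Suc i \<and> P w \<and> sb w = c} = Suc i" by (rule mxs_eqI) (use c True in auto)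
        then show ?thesis using c by simp
      next
        case c: False
        have "{w. w < Suc i \<and> P w \<and> sb w = c} = {w. w < i \<and> P w \<and> sb w = c}" using c by (auto simp: less_Suc_eq)
        then show ?thesis using c by simp
      qed
      have m0: "A' aMX (sb i) = 0 \<longleftrightarrow> sb i \<notin> set ks"
      proof -
        have "A' aMX (sb i) = mxs {w. w < i \<and> P w \<and> sb w = sb i}" using ks(5) sb(2) by blast
        then have "A' aMX (sb i) = 0 \<longleftrightarrow> {w. w < i \<and> P w \<and> sb w = sb i} = {}" by (simp add: mxs_0)
        also have "\<dots> \<longleftrightarrow> (\<forall>w. w < i \<and> P w \<longrightarrow> sb i \<noteq> sb w)" by auto
        also have "\<dots> \<longleftrightarrow> sb i \<notin> set ks" unfolding ks(3) image_iff by blast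
        finally show ?thesis .
      qed
      show ?thesis
      proof (cases "sb i \<in> set ks")
        case in_: True
        have ne: "A' aMX (sb i) \<noteq> 0" using m0 in_ by simp
        have "set ks = sb ` {w. w < Suc i \<and> P w}" using in_ e1 ks(3) by auto
        moreover have "\<forall>c<n. ((A' aMX)(sb i := Suc i)) c = mxs {w. w < Suc i \<and> P w \<and> sb w = c}"
          using ks(5) e2 by simp
        ultimately have fin: "\<exists>ks'. distinct ks' \<and> length ks = length ks' \<and> set ks' = sb ` {w. w < Suc i \<and> P w} \<and>
          (\<forall>j<length ks'. A' aKL j = ks' ! j) \<and>
          (\<forall>c<n. ((A' aMX)(sb i := Suc i)) c = mxs {w. w < Suc i \<and> P w \<and> sb w = c})"
          using ks(1,4) by blast
        show ?thesis
          apply (intro vs)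
          using fin ne by (simp_all add: v idx sb ltb(4)[OF V(3)] len ks(2))
      next
        case out: False
        have z0: "A' aMX (sb i) = 0" using m0 out by simp
        have s1: "set (ks @ [sb i]) = sb ` {w. w < Suc i \<and> P w}" using e1 ks(3) by auto
        have s2: "\<forall>c<n. ((A' aMX)(sb i := Suc i)) c = mxs {w. w < Suc i \<and> P w \<and> sb w = c}"
          using ks(5) e2 by simp
        have s3: "\<forall>j<length (ks @ [sb i]). ((A' aKL)(length ks := sb i)) j = (ks @ [sb i]) ! j"
          using ks(4) by (simp add: nth_append less_Suc_eq)
        have s4: "distinct (ks @ [sb i])" using ks(1) out by simp
        have fin: "\<exists>ks'. distinct ks' \<and> Suc (length ks) = length ks' \<and> set ks' = sb ` {w. w < Suc i \<and> P w} \<and>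
          (\<forall>j<length ks'. ((A' aKL)(length ks := sb i)) j = ks' ! j) \<and>
          (\<forall>c<n. ((A' aMX)(sb i := Suc i)) c = mxs {w. w < Suc i \<and> P w \<and> sb w = c})"
          by (intro exI[of _ "ks @ [sb i]"] conjI s1 s2 s3 s4) simp
        show ?thesis
          apply (intro vs)
          using fin z0 by (simp_all add: v idx sb ltb(4)[OF V(3)] len ks(2))
      qed
    qed
  qed
  using mx ltb by (auto simp: V small_ltH mxs_def)

definition drow :: cmd where
  "drow = For vw vn (Upd aMX (Var vw) (Num 0)) ;;
     For vb vp (Upd aCNT (Var vb) (Num 0) ;; Upd aOCC (Var vb) (Num 0) ;; Upd aTT (ix (Var vz) (Var vb)) (Num 0)) ;;
     collect ;; phase1 ;; phase2"

lemma mods_drow [simp]: "mv drow = {vw, vb, vk, vt, vh, vm, vj, vd, vc, vbest, vbc, vi, vl}"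
  "ma drow = {aMX, aCNT, aOCC, aTT, aKL, aXX, aYY, aEE, aDD, aVL}"
  by (auto simp: drow_def)

lemma runs_drow:
  assumes V: "V vn = n" "V vp = p" "V vq = q" "V vz = z" "z < n"
    and S: "\<forall>w<n. P w \<longleftrightarrow> A aLE (z * n + w) = 1 \<and> A aBLK w = A aBLK z" "\<forall>w<n. P w \<longrightarrow> A aSUB w = Suc (sb w) \<and> sb w < n"
    and card: "card {w. w < n \<and> P w} < q"
  shows "runs drow V A (5000 * (q * q)) (\<lambda>V' A'. (\<forall>c<n. dlook A' z c = mxs {w. w < n \<and> P w \<and> sb w = c}) \<and>
    row_eq z (A aEE) (A' aEE) \<and> row_eq z (A aDD) (A' aDD) \<and> row_eq z (A aTT) (A' aTT) \<and> row_eq z (A aVL) (A' aVL))"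
proof -
  have qq: "1 \<le> q * q" "q \<le> q * q" "n \<le> q * q" using q_pos n_le by simp_all
  show ?thesis
    unfolding drow_def
    apply (rule vcut[where Tc = "2 + n * 10" and P = "\<lambda>V' A'. \<forall>c<n. A' aMX c = 0"])
    subgoal premises p1 for V1 A1
      apply (rule vcut[where Tc = "2 + p * 40" and P = "\<lambda>V' A'. \<forall>b<p. A' aCNT b = 0 \<and> A' aOCC b = 0 \<and> A' aTT (z * p + b) = 0 \<and>
        row_eq z (A1 aTT) (A' aTT)"])
      subgoal premises p2 for V2 A2
      proof -
        have v2: "V2 vn = n" "V2 vp = p" "V2 vq = q" "V2 vz = z" "A2 aLE = A aLE" "A2 aBLK = A aBLK" "A2 aSUB = A aSUB"
          "A2 aMX = A1 aMX" "A2 aEE = A aEE" "A2 aDD = A aDD" "A2 aVL = A aVL" "A1 aTT = A aTT"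
          using p1(1)[simplified] p2(1)[simplified] V by (simp_all add: frame_def)
        have r2: "row_eq z (A aTT) (A2 aTT)" using p2(2) pos v2 by auto
        show ?thesis
          apply (rule vcut[OF _ _ runs_collect[where z = z and P = P and sb = sb]])
          subgoal premises p3 for V3 A3
          proof -
            obtain ks where ks: "distinct ks" "V3 vk = length ks" "set ks = sb ` {w. w < n \<and> P w}"
              "\<forall>i<length ks. A3 aKL i = ks ! i" "\<forall>c<n. A3 aMX c = mxs {w. w < n \<and> P w \<and> sb w = c}"
              using p3(2) by blast
            have v3: "V3 vn = n" "V3 vp = p" "V3 vq = q" "V3 vz = z" "A3 aCNT = A2 aCNT" "A3 aOCC = A2 aOCC" "A3 aTT = A2 aTT"
              "A3 aEE = A aEE" "A3 aDD = A aDD" "A3 aVL = A aVL"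
              using p3(1)[simplified] v2 by (simp_all add: frame_def)
            have p20: "\<forall>b<p. A2 aCNT b = 0" using p2(2) by simp
            have kn: "\<forall>c\<in>set ks. c < n" using ks(3) S(2) by auto
            have "card (set ks) \<le> card {w. w < n \<and> P w}" unfolding ks(3) by (rule card_image_le) simp
            then have kq: "length ks < q" using card distinct_card[OF ks(1)] by simp
            have "card (set ks) \<le> card {..<n}" by (rule card_mono) (use kn in auto)
            then have kl: "length ks \<le> n" using distinct_card[OF ks(1)] by simp
            have mH: "A3 aMX c < H" if "c < n" for c
            proof -
              have "mxs {w. w < n \<and> P w \<and> sb w = c} \<le> n" by (subst mxs_le) auto
              then show ?thesis using ks(5) that small_ltH(1) by simp
            qed
            show ?thesis
              apply (rule vcut[OF _ _ runs_phase1[where z = z and ks = ks]])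
              subgoal premises p4 for V4 A4
              proof -
                have v4: "V4 vn = n" "V4 vp = p" "V4 vq = q" "V4 vz = z" "V4 vk = length ks" "A4 aKL = A3 aKL"
                  "A4 aMX = A3 aMX" "A4 aOCC = A2 aOCC" "A4 aTT = A2 aTT" "A4 aDD = A aDD" "A4 aVL = A aVL"
                  using p4(1)[simplified] v3 ks(2) by (simp_all add: frame_def)
                have v4': "\<forall>b<p. A4 aCNT b = cntf p (rowf A4 aEE z) (set ks) p b" 
                  "p * pot p (rowf A4 aEE z) (set ks) p \<le> (length ks)\<^sup>2" "row_eq z (A aEE) (A4 aEE)"
                  "\<forall>h<p. A4 aEE (z * p + h) < p" using p4(2) v3 by simp_all
                show ?thesis
                  apply (rule runs_conseq[OF runs_phase2[where z = z and ks = ks]])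
                  subgoal by (rule v4) subgoal by (rule v4) subgoal by (rule V) subgoal by (rule v4)
                  subgoal by (rule kq) subgoal by (rule kl) subgoal by (rule v4) subgoal using ks(4) v4 by simp
                  subgoal using kn mH v4 by simp
                  subgoal by (rule ks) subgoal by (rule v4') subgoal by (rule v4') subgoal by (rule v4')
                  subgoal using p2(2) v4 by simp
                  subgoal unfolding p_def by (simp, use qq in linarith)
                  subgoal premises p5 for V5 A5
                  proof -
                    have e5: "A5 aEE = A4 aEE" "A5 aMX = A3 aMX" using p5(1)[simplified] v4 by (simp_all add: frame_def)
                    have "dlook A5 z c = mxs {w. w < n \<and> P w \<and> sb w = c}" if c: "c < n" for c
                    proof -
                      have "dlook A5 z c = (if c \<in> set ks then A5 aMX c else 0)"
                      proof (rule dlook_pinv)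
                        show "pinv A5 z (set ks) {b. b < p \<and> 0 < A4 aCNT b}" using p5(2) by blast
                        assume ck: "c \<in> set ks"
                        let ?b = "bkt p (rowf A5 aEE z) c"
                        have "c \<in> {c\<in>set ks. c div p < p \<and> bkt p (rowf A4 aEE z) c = ?b}"
                          using ck div_p kn e5 by simp
                        then have "0 < cntf p (rowf A4 aEE z) (set ks) p ?b" unfolding cntf_def
                          by (intro card_gt_0_iff[THEN iffD2]) auto
                        then show "?b \<in> {b. b < p \<and> 0 < A4 aCNT b}" using v4'(1) bkt_lt by simp
                      qed
                      moreover have "mxs {w. w < n \<and> P w \<and> sb w = c} = 0" if "c \<notin> set ks"
                        using that unfolding ks(3) by (subst mxs_0) auto
                      ultimately show ?thesis using e5(2) ks(5) c by auto
                    qed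
                    moreover have "row_eq z (A aTT) (A5 aTT)" using row_eq_trans[OF r2, of "A5 aTT"] p5(2) v4 by simp
                    ultimately show ?thesis using p5(2) v4 v4'(3) e5 by simp
                  qed
                  done
              qed
              by (simp_all add: v3 V(5) kq kl ks(1,2,4) kn p20) (use qq p_def in linarith)
          qed
          using p1(2) by (simp_all add: v2 V(5) S) (use qq p_def in linarith)
      qed
      subgoal unfolding p_def by (simp, use qq in linarith)
      apply (rule vFor[where m = p and B = 38 and I = "\<lambda>i V' A'. (\<forall>b<i. A' aCNT b = 0 \<and> A' aOCC b = 0 \<and> A' aTT (z * p + b) = 0) \<and>
        row_eq z (A1 aTT) (A' aTT)"])
      subgoal premises pr for i V' A'
      proof -
        have v: "V' vp = p" "V' vz = z" "V' vb = i"
          using pr(2)[simplified] pr(3) p1(1)[simplified] V by (simp_all add: frame_def)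
        show ?thesis
          apply (intro vs)
          using pr(1,4) H_large by (simp_all add: v ltb ix_ltN V(5) less_Suc_eq)
      qed
      using p1(1)[simplified] V by (simp_all add: frame_def)
    subgoal using qq by linarith
    apply (rule vFor[where m = n and B = 8 and I = "\<lambda>i V' A'. \<forall>c<i. A' aMX c = 0"])
    subgoal premises pr for i V' A'
      apply (intro vs)
      using pr(1,3,4) H_large by (simp_all add: ltb less_Suc_eq)
    using V by simp_all
qed

definition dpass :: cmd where
  "dpass = For vz vn (When Neq (Arr aISH (Var vz)) (Num 1) drow)"

lemma mods_dpass [simp]: "mv dpass = {vz, vw, vb, vk, vt, vh, vm, vj, vd, vc, vbest, vbc, vi, vl}"
  "ma dpass = {aMX, aCNT, aOCC, aTT, aKL, aXX, aYY, aEE, aDD, aVL}"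
  by (auto simp: dpass_def)

text \<open>A row costs O(n) for clearing and scanning and O(q^2) for the two displacements, and n
  <= q^2. Headers are skipped: only for the other elements is it known that fewer than
  \<open>q\<close> elements of their block lie below them.\<close>

lemma runs_dpass:
  assumes V: "V vn = n" "V vp = p" "V vq = q"
    and S: "\<forall>z<n. \<forall>w<n. P z w \<longleftrightarrow> A aLE (z * n + w) = 1 \<and> A aBLK w = A aBLK z" "\<forall>w<n. A aSUB w = Suc (sb w) \<and> sb w < n"
    and card: "\<forall>z<n. A aISH z \<noteq> 1 \<longrightarrow> card {w. w < n \<and> P z w} < q"
  shows "runs dpass V A (2 + n * (5000 * (q * q) + 20)) (\<lambda>V' A'. \<forall>z<n. A aISH z \<noteq> 1 \<longrightarrow>
    (\<forall>c<n. dlook A' z c = mxs {w. w < n \<and> P z w \<and> sb w = c}))"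
  unfolding dpass_def
  apply (rule vFor[where m = n and B = "5000 * (q * q) + 18" and I = "\<lambda>i V' A'. \<forall>z<i. A aISH z \<noteq> 1 \<longrightarrow>
    (\<forall>c<n. dlook A' z c = mxs {w. w < n \<and> P z w \<and> sb w = c})"])
  subgoal premises pr for z V' A'
  proof -
    have v: "V' vn = n" "V' vp = p" "V' vq = q" "V' vz = z" "A' aLE = A aLE" "A' aBLK = A aBLK" "A' aSUB = A aSUB"
      "A' aISH = A aISH"
      using pr(2)[simplified] pr(3) V by (simp_all add: frame_def)
    show ?thesis
    proof (cases "A aISH z = 1")
      case True
      show ?thesis
        apply (intro vs)
        using pr(1,4) True by (simp_all add: v ltb less_Suc_eq)
    next
      case False
      show ?thesis
        apply (intro vs)
        apply (rule vuse[OF _ _ runs_drow[where z = z and P = "P z" and sb = sb]])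
        subgoal premises p1 for V1 A1
        proof -
          have "dlook A1 z' c = dlook A' z' c" if "z' \<noteq> z" "c < n" for z' c
            using p1(3) that by (intro dlook_row_eq) auto
          then show ?thesis using pr(4) p1(3) by (simp add: less_Suc_eq)
        qed
        using pr(1) False S card by (simp_all add: v ltb)
    qed
  qed
  using V by simp_all

end

context bmachine
begin

section \<open>Reading the graph and numbering it topologically\<close>

fun clr :: "nat list \<Rightarrow> cmd" where
  "clr [] = Nop"
| "clr (a # as) = For vw vN (Upd a (Var vw) (Num 0)) ;; clr as"

lemma mods_clr [simp]: "mv (clr as) \<subseteq> {vw}" "ma (clr as) = set as"
  by (induction as) auto

lemma runs_clr:
  assumes "V vN = N" "\<forall>a\<in>set as. a < 40" "distinct as"
  shows "runs (clr as) V A (1 + length as * (2 + N * 10)) (\<lambda>V' A'. \<forall>a\<in>set as. \<forall>j<N. A' a j = 0)"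
  using assms
proof (induction as arbitrary: V A)
  case Nil
  show ?case unfolding clr.simps by (intro vs) simp_all
next
  case (Cons a as)
  show ?case
    unfolding clr.simps
    apply (rule vcut[where Tc = "2 + N * 10" and P = "\<lambda>V' A'. \<forall>j<N. A' a j = 0"])
    subgoal premises p for V1 A1
      apply (rule runs_conseq[OF Cons.IH])
      using p Cons.prems by (simp_all add: frame_def)
    subgoal by simp
    apply (rule vFor[where m = N and B = 8 and I = "\<lambda>i V' A'. \<forall>j<i. A' a j = 0"])
    subgoal premises pr for i V' A'
      apply (intro vs)
      using pr(1,3,4) H_large Cons.prems(2) by (simp_all add: less_Suc_eq)
    using Cons.prems by simp_all
qed

text \<open>Clearing is explicit because the second structure is built over the scratch left behind
  by the first.\<close>

definition clear :: cmd where
  "clear = clr [aADJ, aDEG, aLAB, aLE, aBLK, aISH, aSUB, aSG, aPM]"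

lemma mods_clear [simp]: "mv clear = {vw}"
  "ma clear = {aADJ, aDEG, aLAB, aLE, aBLK, aISH, aSUB, aSG, aPM}"
  by (auto simp: clear_def)

definition zeroed :: "arrs \<Rightarrow> nat \<Rightarrow> bool" where
  "zeroed A i \<longleftrightarrow> (\<forall>j<i. A aADJ j = 0 \<and> A aDEG j = 0 \<and> A aLAB j = 0 \<and> A aLE j = 0 \<and> A aBLK j = 0 \<and>
     A aISH j = 0 \<and> A aSUB j = 0 \<and> A aSG j = 0 \<and> A aPM j = 0)"

lemma runs_clear: "V vN = N \<Longrightarrow> runs clear V A (19 + N * 90) (\<lambda>V' A'. zeroed A' N)"
  unfolding clear_def
  by (rule runs_conseq[OF runs_clr]) (simp_all add: zeroed_def)

text \<open>The offsets of the two ends of an edge are parameters: exchanging them reads the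
  reversed graph, and with it the order for joins.\<close>

definition rdg :: "nat \<Rightarrow> nat \<Rightarrow> cmd" where
  "rdg d d' = For vj ve (
     Asg vx (Inp (Num 2 |*| Var vj |+| Num d)) ;; Asg vy (Inp (Num 2 |*| Var vj |+| Num d')) ;;
     Upd aADJ (Var vx |*| Var vn |+| Var vy) (Num 1) ;; Upd aDEG (Var vy) (Arr aDEG (Var vy) |+| Num 1))"

lemma mods_rdg [simp]: "mv (rdg d d') = {vj, vx, vy}" "ma (rdg d d') = {aADJ, aDEG}"
  by (auto simp: rdg_def)

lemma nn_eq: "b < n \<Longrightarrow> b' < n \<Longrightarrow> a * n + b = a' * n + b' \<longleftrightarrow> a = a' \<and> b = b'"
proof
  assume *: "b < n" "b' < n" "a * n + b = a' * n + b'"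
  from *(3) have "(a * n + b) div n = (a' * n + b') div n" "(a * n + b) mod n = (a' * n + b') mod n"
    by (simp_all only:)
  then show "a = a' \<and> b = b'" using *(1,2) by simp
qed simp

text \<open>Distinctness of the edges matters for \<open>aDEG\<close>: an edge listed twice would be
  counted twice.\<close>

lemma runs_rdg:
  assumes V: "V vn = n" "V ve = length es" and d: "d \<le> 1" "d' \<le> 1"
    and es: "distinct es" "\<forall>i<length es. 2 * i + 1 < length pre \<and> es ! i = (pre ! (2 * i + d), pre ! (2 * i + d'))"
      "\<forall>(u, v)\<in>set es. u < n \<and> v < n"
    and z: "zeroed A N"
  shows "runs (rdg d d') V A (2 + length es * 60) (\<lambda>V' A'.
    (\<forall>u<n. \<forall>v<n. A' aADJ (u * n + v) = (if (u, v) \<in> set es then 1 else 0)) \<and>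
    (\<forall>v<n. A' aDEG v = card {u. (u, v) \<in> set es}))"
  unfolding rdg_def
  apply (rule vFor[where m = "length es" and B = 58 and I = "\<lambda>i V' A'.
    (\<forall>u<n. \<forall>v<n. A' aADJ (u * n + v) = (if (u, v) \<in> set (take i es) then 1 else 0)) \<and>
    (\<forall>v<n. A' aDEG v = card {u. (u, v) \<in> set (take i es)})"])
  subgoal premises pr for i V' A'
  proof -
    have v: "V' vn = n" "V' vj = i" using pr(2)[simplified] pr(3) V by (simp_all add: frame_def)
    obtain a b where ab: "es ! i = (a, b)" by force
    have p: "2 * i + 1 < length pre" "pre ! (2 * i + d) = a" "pre ! (2 * i + d') = b" using es(2) pr(1) ab by auto
    have lt: "a < n" "b < n" using es(3) pr(1) ab nth_mem by fastforce+
    have tk: "set (take (Suc i) es) = insert (a, b) (set (take i es))"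
      using pr(1) ab by (simp add: take_Suc_conv_app_nth)
    have nin: "(a, b) \<notin> set (take i es)"
      using es(1) pr(1) ab by (metis distinct_take not_distinct_conv_prefix take_Suc_conv_app_nth)
    have fin: "finite {u. (u, v) \<in> set (take i es)}" for v
      by (rule finite_subset[of _ "fst ` set (take i es)"]) force+
    have cd: "card {u. (u, v) \<in> set (take (Suc i) es)} = card {u. (u, v) \<in> set (take i es)} + (if v = b then 1 else 0)" for v
    proof (cases "v = b")
      case True
      have "{u. (u, v) \<in> set (take (Suc i) es)} = insert a {u. (u, v) \<in> set (take i es)}" using tk True by auto
      then show ?thesis using True nin fin by simp
    next
      case False
      then have "{u. (u, v) \<in> set (take (Suc i) es)} = {u. (u, v) \<in> set (take i es)}" using tk by auto
      then show ?thesis using False by simp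
    qed
    have le: "card {u. (u, v) \<in> set (take i es)} \<le> n" for v
    proof -
      have "{u. (u, v) \<in> set (take i es)} \<subseteq> {..<n}" using es(3) set_take_subset by fastforce
      then show ?thesis using card_mono[of "{..<n}"] by fastforce
    qed
    have dH: "Suc (A' aDEG b) < H" using pr(4) lt le small_ltH(4) by simp
    have idx: "2 * i + d < length pre" "2 * i + d' < length pre" "a * n + b < N"
      using p(1) d nn_ltN lt by auto
    have I1: "\<And>u v. u < n \<Longrightarrow> v < n \<Longrightarrow> A' aADJ (u * n + v) = (if (u, v) \<in> set (take i es) then 1 else 0)"
      and I2: "\<And>v. v < n \<Longrightarrow> A' aDEG v = card {u. (u, v) \<in> set (take i es)}" using pr(4) by auto
    have J1: "\<forall>u<n. \<forall>v<n. ((A' aADJ)(a * n + b := 1)) (u * n + v) = (if (u, v) \<in> set (take (Suc i) es) then 1 else 0)"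
    proof (intro allI impI)
      fix u v assume "u < n" "v < n"
      then show "((A' aADJ)(a * n + b := 1)) (u * n + v) = (if (u, v) \<in> set (take (Suc i) es) then 1 else 0)"
        using I1 nn_eq[of v b u a] lt unfolding tk by auto
    qed
    have J2: "\<forall>v<n. ((A' aDEG)(b := Suc (A' aDEG b))) v = card {u. (u, v) \<in> set (take (Suc i) es)}"
      using I2 cd by simp
    show ?thesis
      apply (intro vs)
      using H_large J1 J2 by (simp_all add: v d[THEN order_trans] p idx lt ltb dH)
  qed
  using z by (auto simp: V zeroed_def nn_ltN ltb)

definition topo :: cmd where
  "topo = For vi vn (
     For vx vn (When Eq (Arr aDEG (Var vx)) (Num 0) (When Eq (Arr aLAB (Var vx)) (Num 0) (Asg vz (Var vx)))) ;;
     Upd aLAB (Var vz) (Var vi |+| Num 1) ;; Upd aINV (Var vi) (Var vz) ;;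
     For vy vn (When Eq (Arr aADJ (Var vz |*| Var vn |+| Var vy)) (Num 1)
       (Upd aDEG (Var vy) (Arr aDEG (Var vy) |-| Num 1))))"

lemma mods_topo [simp]: "mv topo = {vi, vx, vz, vy}" "ma topo = {aLAB, aINV, aDEG}"
  by (auto simp: topo_def)

text \<open>\<open>aDEG\<close> counts the predecessors without a label, so at degree 0 all
  predecessors carry smaller labels already.\<close>

definition tinv :: "(nat \<times> nat) set \<Rightarrow> nat \<Rightarrow> arrs \<Rightarrow> bool" where
  "tinv E i A \<longleftrightarrow> (\<forall>j<i. A aINV j < n \<and> A aLAB (A aINV j) = Suc j) \<and>
    (\<forall>x<n. A aLAB x \<noteq> 0 \<longrightarrow> A aLAB x \<le> i \<and> A aINV (A aLAB x - 1) = x) \<and>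
    (\<forall>v<n. A aDEG v = card {u. (u, v) \<in> E \<and> A aLAB u = 0}) \<and>
    (\<forall>(u, v)\<in>E. A aLAB v \<noteq> 0 \<longrightarrow> A aLAB u \<noteq> 0 \<and> A aLAB u < A aLAB v)"

text \<open>Acyclicity enters as a source in every nonempty set. Applied to the elements without a
  label, it guarantees that each round finds a candidate; a linear scan per round is affordable
  within O(n^2).\<close>

lemma runs_topo:
  assumes V: "V vn = n" and E: "E \<subseteq> {..<n} \<times> {..<n}"
    "\<And>S. S \<subseteq> {..<n} \<Longrightarrow> S \<noteq> {} \<Longrightarrow> \<exists>x\<in>S. \<forall>u\<in>S. (u, x) \<notin> E"
    and adj: "\<forall>u<n. \<forall>v<n. A aADJ (u * n + v) = (if (u, v) \<in> E then 1 else 0)"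
    and deg: "\<forall>v<n. A aDEG v = card {u. (u, v) \<in> E}" and z: "\<forall>x<n. A aLAB x = 0"
  shows "runs topo V A (2 + n * (n * 60 + 40)) (\<lambda>V' A'. tinv E n A')"
  unfolding topo_def
  apply (rule vFor[where m = n and B = "n * 60 + 38" and I = "\<lambda>i V' A'. tinv E i A'"])
  subgoal premises pr for i V' A'
  proof -
    have v: "V' vn = n" "V' vi = i" "A' aADJ = A aADJ" using pr(2)[simplified] pr(3) V by (simp_all add: frame_def)
    have T1: "\<forall>j<i. A' aINV j < n \<and> A' aLAB (A' aINV j) = Suc j"
      and T2: "\<forall>x<n. A' aLAB x \<noteq> 0 \<longrightarrow> A' aLAB x \<le> i \<and> A' aINV (A' aLAB x - 1) = x"
      and T3: "\<forall>v<n. A' aDEG v = card {u. (u, v) \<in> E \<and> A' aLAB u = 0}"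
      and T4: "\<forall>(u, v)\<in>E. A' aLAB v \<noteq> 0 \<longrightarrow> A' aLAB u \<noteq> 0 \<and> A' aLAB u < A' aLAB v"
      using pr(4) unfolding tinv_def by blast+
    have finE: "finite {u. (u, v) \<in> E \<and> P u}" for v P
      by (rule finite_subset[of _ "{..<n}"]) (use E(1) in auto)
    let ?S = "{x. x < n \<and> A' aLAB x = 0}"
    \<comment> \<open>Pigeonhole: only \<open>i\<close> labels, fewer than \<open>n\<close>, have
      been given out.\<close>
    have "?S \<noteq> {}"
    proof
      assume "?S = {}"
      then have "{..<n} \<subseteq> A' aINV ` {..<i}"
      proof (intro subsetI)
        fix x assume "?S = {}" "x \<in> {..<n}"
        then have "A' aLAB x \<noteq> 0" "A' aLAB x \<le> i" "A' aINV (A' aLAB x - 1) = x" using T2 by auto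
        then show "x \<in> A' aINV ` {..<i}" by (intro image_eqI[of _ _ "A' aLAB x - 1"]) auto
      qed
      then have "card {..<n} \<le> card (A' aINV ` {..<i})" by (rule card_mono[rotated]) simp
      also have "\<dots> \<le> i" using card_image_le[of "{..<i}" "A' aINV"] by simp
      finally show False using pr(1) by simp
    qed
    then obtain x0 where x0: "x0 \<in> ?S" "\<forall>u\<in>?S. (u, x0) \<notin> E" using E(2)[of ?S] by blast
    have "{u. (u, x0) \<in> E \<and> A' aLAB u = 0} = {}" using x0 E(1) by auto
    moreover have "x0 < n" "A' aLAB x0 = 0" using x0(1) by auto
    moreover have "A' aDEG x0 = card {u. (u, x0) \<in> E \<and> A' aLAB u = 0}" using T3 \<open>x0 < n\<close> by blast
    ultimately have x0c: "x0 < n" "A' aDEG x0 = 0" "A' aLAB x0 = 0" by (simp_all only: card.empty)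
    show ?thesis
      apply (rule vcut[where Tc = "2 + n * 20" and P = "\<lambda>V1 A1. V1 vz < n \<and> A' aDEG (V1 vz) = 0 \<and> A' aLAB (V1 vz) = 0"])
      subgoal premises p1 for V1 A1
      proof -
        define z where "z = V1 vz"
        have v1: "V1 vn = n" "V1 vi = i" "V1 vz = z" "A1 = A'"
          using p1(1)[simplified] v by (auto simp: frame_def z_def)
        have zc: "z < n" "A' aDEG z = 0" "A' aLAB z = 0" using p1(2) z_def by auto
        have noin: "A' aLAB u \<noteq> 0" if "(u, z) \<in> E" for u
          using zc T3 finE[of z "\<lambda>u. A' aLAB u = 0"] that by auto
        have cd: "card {u. (u, y) \<in> E \<and> u \<noteq> z \<and> A' aLAB u = 0} = (if (z, y) \<in> E then A' aDEG y - 1 else A' aDEG y)"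
          "(z, y) \<in> E \<Longrightarrow> 1 \<le> A' aDEG y" if "y < n" for y
        proof -
          have *: "{u. (u, y) \<in> E \<and> u \<noteq> z \<and> A' aLAB u = 0} = {u. (u, y) \<in> E \<and> A' aLAB u = 0} - (if (z, y) \<in> E then {z} else {})"
            using zc(3) by auto
          show "card {u. (u, y) \<in> E \<and> u \<noteq> z \<and> A' aLAB u = 0} = (if (z, y) \<in> E then A' aDEG y - 1 else A' aDEG y)"
            unfolding * using T3 that zc(3) finE by (simp add: card_Diff_subset)
          assume "(z, y) \<in> E"
          then have "{u. (u, y) \<in> E \<and> A' aLAB u = 0} \<noteq> {}" using zc(3) by blast
          then show "1 \<le> A' aDEG y" using T3 that finE[of y "\<lambda>u. A' aLAB u = 0"]
            by (simp add: Suc_le_eq card_gt_0_iff)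
        qed
        have dH: "A' aDEG y < H" if "y < n" for y
        proof -
          have "card {u. (u, y) \<in> E \<and> A' aLAB u = 0} \<le> card {..<n}" by (rule card_mono) (use E(1) in auto)
          then show ?thesis using T3 that small_ltH(1) by simp
        qed
        show ?thesis
          apply (intro vs)
          apply (rule vFor[where m = n and B = 36 and I = "\<lambda>y V2 A2. (\<forall>v<n. A2 aDEG v = (if v < y \<and> (z, v) \<in> E then A' aDEG v - 1 else A' aDEG v))"])
          subgoal premises p2 for y V2 A2
          proof -
            have v2: "V2 vn = n" "V2 vz = z" "V2 vy = y" "A2 aADJ = A aADJ"
              using p2(2)[simplified] p2(3) v1 v by (simp_all add: frame_def)
            have ad: "A aADJ (z * n + y) = (if (z, y) \<in> E then 1 else 0)" using adj p2(1) zc by simp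
            have dy: "A2 aDEG y = A' aDEG y" using p2(1,4) by simp
            have dz: "A' aDEG y - Suc 0 < H" using dH[OF p2(1)] by simp
            have idx: "z * n + y < N" "z < N" "y < N" using nn_ltN zc p2(1) ltb by blast+
            show ?thesis
            proof (cases "(z, y) \<in> E")
              case True
              have J: "\<forall>v<n. ((A2 aDEG)(y := A' aDEG y - Suc 0)) v =
                (if v < Suc y \<and> (z, v) \<in> E then A' aDEG v - Suc 0 else A' aDEG v)"
                using p2(4) True by (simp add: less_Suc_eq)
              have d1: "Suc 0 \<le> A' aDEG y" using cd(2)[OF p2(1) True] by simp
              show ?thesis
                apply (intro vs)
                using J True by (simp_all add: v2 ad dy idx dz d1)
            next
              case False
              have J: "\<forall>v<n. A2 aDEG v = (if v < Suc y \<and> (z, v) \<in> E then A' aDEG v - Suc 0 else A' aDEG v)"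
                using p2(4) False by (simp add: less_Suc_eq)
              show ?thesis
                apply (intro vs)
                using J False by (simp_all add: v2 ad dy idx)
            qed
          qed
          subgoal premises p2 for V2 A2
          proof -
            have a2: "A2 aLAB = (A' aLAB)(z := Suc i)" "A2 aINV = (A' aINV)(i := z)"
              using p2(1)[simplified] v1 by (simp_all add: frame_def)
            have dg: "A2 aDEG v = card {u. (u, v) \<in> E \<and> A2 aLAB u = 0}" if "v < n" for v
            proof -
              have "{u. (u, v) \<in> E \<and> A2 aLAB u = 0} = {u. (u, v) \<in> E \<and> u \<noteq> z \<and> A' aLAB u = 0}" by (auto simp: a2)
              then show ?thesis using p2(3) that cd(1)[OF that] by simp
            qed
            have "tinv E (Suc i) A2"
              unfolding tinv_def
            proof (intro conjI)
              show "\<forall>j<Suc i. A2 aINV j < n \<and> A2 aLAB (A2 aINV j) = Suc j"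
                using T1 zc by (auto simp: a2 less_Suc_eq)
              show "\<forall>x<n. A2 aLAB x \<noteq> 0 \<longrightarrow> A2 aLAB x \<le> Suc i \<and> A2 aINV (A2 aLAB x - 1) = x"
              proof (intro allI impI)
                fix x assume x: "x < n" "A2 aLAB x \<noteq> 0"
                show "A2 aLAB x \<le> Suc i \<and> A2 aINV (A2 aLAB x - 1) = x"
                proof (cases "x = z")
                  case False
                  then have "A' aLAB x \<noteq> 0" using x by (simp add: a2)
                  then have "A' aLAB x \<le> i" "A' aINV (A' aLAB x - 1) = x" "A' aLAB x - 1 \<noteq> i" using T2 x by auto
                  then show ?thesis using False by (simp add: a2)
                qed (simp add: a2)
              qed
              show "\<forall>v<n. A2 aDEG v = card {u. (u, v) \<in> E \<and> A2 aLAB u = 0}" using dg by blast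
              show "\<forall>(u, v)\<in>E. A2 aLAB v \<noteq> 0 \<longrightarrow> A2 aLAB u \<noteq> 0 \<and> A2 aLAB u < A2 aLAB v"
              proof (intro ballI, clarsimp)
                fix u v assume uv: "(u, v) \<in> E" "0 < A2 aLAB v"
                then have "u < n" using E(1) by auto
                show "0 < A2 aLAB u \<and> A2 aLAB u < A2 aLAB v"
                proof (cases "v = z")
                  case True
                  then have nz: "A' aLAB u \<noteq> 0" "A' aLAB u \<le> i" using noin uv T2 \<open>u < n\<close> by blast+
                  then have "u \<noteq> z" using zc by auto
                  then show ?thesis using nz True by (simp add: a2)
                next
                  case False
                  then have "A' aLAB v \<noteq> 0" using uv by (simp add: a2)
                  then have "A' aLAB u \<noteq> 0" "A' aLAB u < A' aLAB v" using T4 uv by auto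
                  then show ?thesis using False zc by (auto simp: a2)
                qed
              qed
            qed
            then show ?thesis by simp
          qed
          using pr(1) zc by (simp_all add: v1 ltb)
      qed
      subgoal by simp
      apply (rule vFor[where m = n and B = 18 and I = "\<lambda>x V1 A1. (\<exists>x'<x. A' aDEG x' = 0 \<and> A' aLAB x' = 0) \<longrightarrow>
         V1 vz < n \<and> A' aDEG (V1 vz) = 0 \<and> A' aLAB (V1 vz) = 0"])
      subgoal premises p1 for x V1 A1
      proof -
        have a1: "A1 aDEG = A' aDEG" "A1 aLAB = A' aLAB" using p1(2)[simplified] by (simp_all add: frame_def)
        show ?thesis
          apply (intro vs)
          using p1(1,4) by (simp_all add: p1(3) a1 ltb less_Suc_eq) (metis less_irrefl)+
      qed
      using x0c v by auto
  qed
  using deg z E(1) by (auto simp: V tinv_def subset_iff intro!: arg_cong[where f = card])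

text \<open>The edges are listed by increasing upper end, so that one sweep over the list can
  propagate information upwards. Reading them off the matrix in label order does the
  sorting.\<close>

definition elist :: cmd where
  "elist = Asg vne (Num 0) ;; For vz vn (For vu vn (
     When Eq (Arr aADJ (Arr aINV (Var vu) |*| Var vn |+| Arr aINV (Var vz))) (Num 1) (
       Upd aEU (Var vne) (Var vu) ;; Upd aEV (Var vne) (Var vz) ;; Asg vne (Var vne |+| Num 1))))"

lemma mods_elist [simp]: "mv elist = {vne, vz, vu}" "ma elist = {aEU, aEV}"
  by (auto simp: elist_def)

text \<open>The edges found so far are those preceding the pair (u, z) when pairs are ordered by
  their upper end first.\<close>

definition elinv :: "(nat \<Rightarrow> nat \<Rightarrow> bool) \<Rightarrow> nat \<Rightarrow> nat \<Rightarrow> vars \<Rightarrow> arrs \<Rightarrow> bool" where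
  "elinv cv z u V A \<longleftrightarrow> (\<exists>xs. V vne = length xs \<and> distinct xs \<and>
     set xs = {(a, b). a < n \<and> b < n \<and> cv a b \<and> (b < z \<or> b = z \<and> a < u)} \<and> sorted (map snd xs) \<and>
     (\<forall>i<length xs. A aEU i = fst (xs ! i) \<and> A aEV i = snd (xs ! i)))"

lemma runs_elist:
  assumes V: "V vn = n" and inv: "\<forall>j<n. A aINV j < n"
    and cv: "\<forall>a<n. \<forall>b<n. A aADJ (A aINV a * n + A aINV b) = (if cv a b then 1 else 0)"
    and card: "card {(a, b). a < n \<and> b < n \<and> cv a b} \<le> n * p"
  shows "runs elist V A (4 + n * (n * 60 + 10)) (\<lambda>V' A'. elinv cv n 0 V' A')"
proof -
  have finC: "finite {(a, b). a < n \<and> b < n \<and> cv a b}"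
    by (rule finite_subset[of _ "{..<n} \<times> {..<n}"]) auto
  have inner: "runs (For vu vn (
     When Eq (Arr aADJ (Arr aINV (Var vu) |*| Var vn |+| Arr aINV (Var vz))) (Num 1) (
       Upd aEU (Var vne) (Var vu) ;; Upd aEV (Var vne) (Var vz) ;; Asg vne (Var vne |+| Num 1)))) V' A' (2 + n * 60)
     (\<lambda>V'' A''. elinv cv (Suc z) 0 V'' A'')"
    if z: "z < n" "V' vn = n" "V' vz = z" "A' aINV = A aINV" "A' aADJ = A aADJ" and el: "elinv cv z 0 V' A'" for z V' A'
    apply (rule vFor[where m = n and B = 58 and I = "\<lambda>u V'' A''. elinv cv z u V'' A''"])
    subgoal premises pr for u V1 A1
    proof -
      have v: "V1 vn = n" "V1 vz = z" "V1 vu = u" "A1 aINV = A aINV" "A1 aADJ = A aADJ"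
        using pr(2)[simplified] pr(3) z by (simp_all add: frame_def)
      obtain xs where xs: "V1 vne = length xs" "distinct xs"
        "set xs = {(a, b). a < n \<and> b < n \<and> cv a b \<and> (b < z \<or> b = z \<and> a < u)}" "sorted (map snd xs)"
        "\<forall>i<length xs. A1 aEU i = fst (xs ! i) \<and> A1 aEV i = snd (xs ! i)"
        using pr(4) unfolding elinv_def by blast
      have ad: "A aADJ (A aINV u * n + A aINV z) = (if cv u z then 1 else 0)" using cv pr(1) z(1) by blast
      have ii: "A aINV u < n" "A aINV z < n" using inv pr(1) z(1) by blast+
      have "length xs = card (set xs)" using xs(2) distinct_card by metis
      also have "\<dots> \<le> card {(a, b). a < n \<and> b < n \<and> cv a b}" unfolding xs(3) by (rule card_mono[OF finC]) auto
      also have "\<dots> \<le> n * p" by (rule card)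
      finally have len: "length xs < N" "Suc (length xs) < H"
        using n_ltN(3) N_lt by (blast, meson Suc_leI n_ltN(3) le_less_trans)
      show ?thesis
      proof (cases "cv u z")
        case False
        have "{(a, b). a < n \<and> b < n \<and> cv a b \<and> (b < z \<or> b = z \<and> a < Suc u)} =
          {(a, b). a < n \<and> b < n \<and> cv a b \<and> (b < z \<or> b = z \<and> a < u)}" using False less_Suc_eq by auto
        then have "elinv cv z (Suc u) V1 A1" using pr(4) unfolding elinv_def by simp
        then have el': "elinv cv z (Suc u) (V1(vu := Suc u)) A1" unfolding elinv_def by simp
        show ?thesis
          apply (intro vs)
          using el' False by (simp_all add: v ad ii nn_ltN ltb pr(1) z(1))
      next
        case True
        let ?xs = "xs @ [(u, z)]"
        have nin: "(u, z) \<notin> set xs" unfolding xs(3) by simp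
        have st: "set ?xs = {(a, b). a < n \<and> b < n \<and> cv a b \<and> (b < z \<or> b = z \<and> a < Suc u)}"
          unfolding set_append xs(3) using True pr(1) z(1) by (auto simp: less_Suc_eq)
        have "\<forall>x\<in>set xs. snd x \<le> z" unfolding xs(3) by auto
        then have so: "sorted (map snd ?xs)" by (simp add: sorted_append xs(4))
        have el': "elinv cv z (Suc u) V2 A2" if "V2 vne = Suc (length xs)" "A2 aEU = (A1 aEU)(length xs := u)"
          "A2 aEV = (A1 aEV)(length xs := z)" for V2 A2
          unfolding elinv_def using that xs(2,5) nin st so
          by (intro exI[of _ ?xs]) (auto simp: nth_append less_Suc_eq)
        show ?thesis
          apply (intro vs)
                           apply (rule el')
          using True by (simp_all add: v ad ii nn_ltN ltb pr(1) z(1) xs(1) len)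
      qed
    qed
    subgoal premises pr for V1 A1
    proof -
      have "{(a, b). a < n \<and> b < n \<and> cv a b \<and> (b < z \<or> b = z \<and> a < n)} =
          {(a, b). a < n \<and> b < n \<and> cv a b \<and> (b < Suc z \<or> b = Suc z \<and> a < 0)}" using less_Suc_eq by auto
      then show ?thesis using pr(3) unfolding elinv_def by simp
    qed
    using z el by (simp_all add: elinv_def)
  show ?thesis
    unfolding elist_def
    apply (intro vs)
    apply (rule vFor[where m = n and B = "2 + n * 60" and I = "\<lambda>z V' A'. elinv cv z 0 V' A'"])
    subgoal premises pr for z V' A'
    proof -
      have v: "V' vn = n" "A' aINV = A aINV" "A' aADJ = A aADJ" using pr(2)[simplified] V by (simp_all add: frame_def)
      have el': "elinv cv (Suc z) 0 (V''(vz := Suc z)) A''" if "elinv cv (Suc z) 0 V'' A''" for V'' A''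
        using that unfolding elinv_def by simp
      show ?thesis
        by (rule runs_conseq[OF inner[where z = z]]) (use pr el' v in simp_all)
    qed
    using V H_large by (auto simp: elinv_def algebra_simps)
qed

end

locale bplat = bmachine w H N pre n q p s N1 + plat n le
  for w H N pre n q p s N1 le
begin

section \<open>Blocks\<close>

definition addrow :: cmd where
  "addrow = Asg vw (Arr aLL (ix (Var vu) (Var vj))) ;;
     When Eq (Arr aBLK (Var vw)) (Num 0) (When Eq (Arr aLE (Var vz |*| Var vn |+| Var vw)) (Num 0) (
       Upd aLE (Var vz |*| Var vn |+| Var vw) (Num 1) ;;
       Upd aLL (ix (Var vz) (Var vc)) (Var vw) ;; Asg vc (Var vc |+| Num 1)))"

definition mkrow :: cmd where
  "mkrow = For vu vn (When Eq (Arr aADJ (Arr aINV (Var vu) |*| Var vn |+| Arr aINV (Var vz))) (Num 1) (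
     When Eq (Arr aBLK (Var vu)) (Num 0) (Asg vt (Arr aCD (Var vu)) ;; For vj vt addrow)))"

definition inirow :: cmd where
  "inirow = Upd aLE (Var vz |*| Var vn |+| Var vz) (Num 1) ;; Upd aLL (ix (Var vz) (Num 0)) (Var vz) ;; Asg vc (Num 1)"

lemma mods_row [simp]: "mv addrow = {vw, vc}" "ma addrow = {aLE, aLL}"
  "mv mkrow = {vu, vt, vj, vw, vc}" "ma mkrow = {aLE, aLL}" "mv inirow = {vc}" "ma inirow = {aLE, aLL}"
  by (auto simp: addrow_def mkrow_def inirow_def)

text \<open>The state while the list \<open>W\<close> of row \<open>z\<close> is collected, compared
  with the arrays \<open>Ao\<close> before. Of \<open>aLL\<close> only the earlier rows are known to
  be unchanged: a list may have up to \<open>n\<close> entries and run into the rows behind, which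
  are rewritten when their turn comes.\<close>

definition rw :: "arrs \<Rightarrow> nat \<Rightarrow> nat set \<Rightarrow> vars \<Rightarrow> arrs \<Rightarrow> bool" where
  "rw Ao z W V A \<longleftrightarrow> (\<exists>ws. distinct ws \<and> set ws = W \<and> V vc = length ws \<and>
     (\<forall>j<length ws. A aLL (z * p + j) = ws ! j)) \<and>
     (\<forall>x<n. A aLE (z * n + x) = (if x \<in> W then 1 else 0)) \<and>
     (\<forall>v x. v \<noteq> z \<longrightarrow> x < n \<longrightarrow> A aLE (v * n + x) = Ao aLE (v * n + x)) \<and> (\<forall>i<z * p. A aLL i = Ao aLL i)"

text \<open>A list that overruns its row still ends inside the array.\<close>

lemma ovf_lt: "z < n \<Longrightarrow> l \<le> n \<Longrightarrow> z * p + l < N"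
proof -
  assume "z < n" "l \<le> n"
  then have "Suc z * p \<le> n * p" by (intro mult_le_mono1) simp
  then have "z * p + l < N1" using \<open>l \<le> n\<close> N1_def by simp
  then show ?thesis using N1_le by simp
qed

lemma rw_add:
  assumes "rw Ao z W V A" "x < n" "x \<notin> W" "V' vc = Suc (V vc)" "A' aLE = (A aLE)(z * n + x := 1)"
    "A' aLL = (A aLL)(z * p + V vc := x)"
  shows "rw Ao z (insert x W) V' A'"
proof -
  obtain ws where ws: "distinct ws" "set ws = W" "V vc = length ws" "\<forall>j<length ws. A aLL (z * p + j) = ws ! j"
    using assms(1) unfolding rw_def by blast
  have r: "\<forall>y<n. A aLE (z * n + y) = (if y \<in> W then 1 else 0)"
    "\<forall>v y. v \<noteq> z \<longrightarrow> y < n \<longrightarrow> A aLE (v * n + y) = Ao aLE (v * n + y)" "\<forall>i<z * p. A aLL i = Ao aLL i"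
    using assms(1) unfolding rw_def by blast+
  show ?thesis
    unfolding rw_def
  proof (intro conjI)
    show "\<exists>ws. distinct ws \<and> set ws = insert x W \<and> V' vc = length ws \<and> (\<forall>j<length ws. A' aLL (z * p + j) = ws ! j)"
      using ws assms(3,4,6) by (intro exI[of _ "ws @ [x]"]) (auto simp: nth_append less_Suc_eq)
    show "\<forall>y<n. A' aLE (z * n + y) = (if y \<in> insert x W then 1 else 0)" using r(1) assms(2,5) by auto
    show "\<forall>v y. v \<noteq> z \<longrightarrow> y < n \<longrightarrow> A' aLE (v * n + y) = Ao aLE (v * n + y)" using r(2) assms(2,5) by (simp add: nn_eq)
    show "\<forall>i<z * p. A' aLL i = Ao aLL i" using r(3) assms(6) by simp
  qed
qed

lemma rw_cong: "rw Ao z W V A \<Longrightarrow> V' vc = V vc \<Longrightarrow> A' aLE = A aLE \<Longrightarrow> A' aLL = A aLL \<Longrightarrow> rw Ao z W V' A'"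
  unfolding rw_def by simp

lemma rw_len: "rw Ao z W V A \<Longrightarrow> V vc = card W"
  unfolding rw_def using distinct_card by metis

lemma runs_addrow:
  assumes V: "V vn = n" "V vp = p" "V vz = z" "z < n" "V vu = u" "u < n" "V vj = j" "j < p" "A aLL (u * p + j) = x" "x < n"
    and r: "rw Ao z W V A" "W \<subseteq> {..<n}"
  shows "runs addrow V A 60 (\<lambda>V' A'. rw Ao z (if A aBLK x = 0 then insert x W else W) V' A')"
proof -
  have fW: "finite W" using r(2) finite_subset by blast
  have idx: "u * p + j < N" "x < N" "x < H" "z * n + x < N" "V vc \<le> n"
    using ix_ltN V ltb nn_ltN rw_len[OF r(1)] card_mono[OF _ r(2)] by auto
  have idx2: "z * p + V vc < N" "Suc (V vc) < H" using ovf_lt V(4) idx(5) small_ltH(4) by auto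
  have le: "A aLE (z * n + x) = (if x \<in> W then 1 else 0)" using r(1) V(10) unfolding rw_def by blast
  show ?thesis
  proof (cases "A aBLK x = 0 \<and> x \<notin> W")
    case True
    have R: "rw Ao z (insert x W) V' A'" if "V' vc = Suc (V vc)" "A' aLE = (A aLE)(z * n + x := 1)"
      "A' aLL = (A aLL)(z * p + V vc := x)" for V' A'
      using rw_add[OF r(1) V(10)] True that by blast
    show ?thesis
      unfolding addrow_def
      apply (intro vs)
      using True H_large by (simp_all add: V idx idx2 le R)
  next
    case False
    have eq: "(if A aBLK x = 0 then insert x W else W) = W" using False by auto
    have R: "rw Ao z W V' A" if "V' vc = V vc" for V' using rw_cong[OF r(1)] that by blast
    show ?thesis
      unfolding addrow_def eq
      apply (intro vs)
      using False by (simp_all add: V idx idx2 le R)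
  qed
qed

text \<open>The invariant of a scan by increasing label that has treated the elements below
  \<open>z\<close>. Row \<open>v\<close> of \<open>aLE\<close> marks what was unassigned and below
  \<open>v\<close> when \<open>v\<close> was visited. Such elements may end up in several blocks, so
  the row is exact only on the block of \<open>v\<close>. Each block consumes at least
  \<open>q\<close> fresh elements, which bounds the number \<open>vr\<close> of blocks. The list of
  \<open>v\<close> in \<open>aLL\<close> is guaranteed only while \<open>v\<close> is unassigned; it
  is then short enough not to overrun its row.\<close>

definition binv :: "nat \<Rightarrow> vars \<Rightarrow> arrs \<Rightarrow> bool" where
  "binv z V A \<longleftrightarrow>
    (\<forall>x<n. A aBLK x \<noteq> 0 \<longrightarrow> A aBLK x \<le> V vr \<and> (\<exists>h<z. A aISH h = 1 \<and> A aBLK h = A aBLK x \<and> le x h)) \<and>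
    (\<forall>h<n. A aISH h = 1 \<longrightarrow> A aBLK h \<noteq> 0 \<and> (\<forall>h'<n. A aISH h' = 1 \<longrightarrow> A aBLK h = A aBLK h' \<longrightarrow> h = h')) \<and>
    (\<forall>x y. le x y \<longrightarrow> A aBLK y \<noteq> 0 \<longrightarrow> A aBLK x \<noteq> 0 \<and> A aBLK x \<le> A aBLK y) \<and>
    V vr * q \<le> card {x. x < n \<and> A aBLK x \<noteq> 0} \<and>
    (\<forall>v<z. \<forall>x<n. (A aLE (v * n + x) = 1 \<longrightarrow> le x v) \<and> (le x v \<and> A aBLK x = A aBLK v \<longrightarrow> A aLE (v * n + x) = 1)) \<and>
    (\<forall>v<z. A aISH v \<noteq> 1 \<longrightarrow> card {x. x < n \<and> A aLE (v * n + x) = 1} < q) \<and>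
    (\<forall>v<z. A aBLK v = 0 \<longrightarrow> (\<exists>us. length us = A aCD v \<and> length us < q \<and>
       set us = {x. x < n \<and> A aLE (v * n + x) = 1} \<and> (\<forall>j<length us. A aLL (v * p + j) = us ! j))) \<and>
    (\<forall>v<n. z \<le> v \<longrightarrow> (\<forall>x<n. A aLE (v * n + x) = 0) \<and> A aISH v = 0)"

text \<open>Assigned elements form a down-set, so the unassigned elements below \<open>z\<close> are
  \<open>z\<close> and those below its unassigned lower covers. The lists of these covers have fewer
  than \<open>q\<close> entries each; the cost is O(n) plus O(q) for each edge into
  \<open>z\<close>.\<close>

lemma runs_mkrow:
  assumes V: "V vn = n" "V vp = p" "V vz = z" "z < n"
    and inv: "\<forall>j<n. A aINV j < n" "\<forall>a<n. \<forall>b<n. A aADJ (A aINV a * n + A aINV b) = (if cov a b then 1 else 0)"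
    and b: "binv z Vo Ao" "Ao aBLK = A aBLK" "Ao aCD = A aCD" and bz: "A aBLK z = 0"
    and r: "rw Ao z {z} V A"
  shows "runs mkrow V A (2 + n * 40 + card {u. u < n \<and> cov u z} * (q * 70))
    (\<lambda>V' A'. rw Ao z {x. le x z \<and> A aBLK x = 0} V' A')"
proof -
  note b5 = b(1)[unfolded binv_def b(2,3), THEN conjunct2, THEN conjunct2, THEN conjunct2, THEN conjunct2]
  note P5 = b5[THEN conjunct1, rule_format]
  note P7 = b5[THEN conjunct2, THEN conjunct2, THEN conjunct1, rule_format]
  let ?R = "\<lambda>u. {x. A aBLK x = 0 \<and> (x = z \<or> (\<exists>u'<u. cov u' z \<and> le x u'))}"
  have mono: "A aBLK y = 0" if "le x y" "A aBLK x = 0" for x y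
    using b(1) that unfolding binv_def b(2) by blast
  have Rn: "?R n = {x. le x z \<and> A aBLK x = 0}"
  proof (rule set_eqI)
    fix x
    have "(x = z \<or> (\<exists>u'<n. cov u' z \<and> le x u')) \<longleftrightarrow> le x z"
    proof
      assume "x = z \<or> (\<exists>u'<n. cov u' z \<and> le x u')"
      then show "le x z" using le_refl V(4) cov_lt(4) le_trans by blast
    next
      assume xz: "le x z"
      show "x = z \<or> (\<exists>u'<n. cov u' z \<and> le x u')"
      proof (cases "x = z")
        case False
        then obtain u where "le x u" "cov u z" using cov_ex[OF xz] by blast
        then show ?thesis using cov_lt(3) by blast
      qed simp
    qed
    then show "x \<in> ?R n \<longleftrightarrow> x \<in> {x. le x z \<and> A aBLK x = 0}" by auto
  qed
  have Rlt: "?R u \<subseteq> {..<n}" for u using V(4) le_lt by auto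
  define f where "f u = (if cov u z then q * 70 else 0) + 38" for u
  have time: "2 + (\<Sum>u<n. f u + 2) \<le> 2 + n * 40 + card {u. u < n \<and> cov u z} * (q * 70)"
  proof -
    have "(\<Sum>u<n. f u + 2) = (\<Sum>u<n. (if cov u z then q * 70 else 0)) + n * 40"
      unfolding f_def by (simp add: sum.distrib)
    also have "(\<Sum>u<n. (if cov u z then q * 70 else 0)) = card ({..<n} \<inter> {u. cov u z}) * (q * 70)"
      by (simp add: sum.If_cases)
    also have "{..<n} \<inter> {u. cov u z} = {u. u < n \<and> cov u z}" by auto
    finally show ?thesis by simp
  qed
  show ?thesis
    unfolding mkrow_def
    apply (rule vFor_sum[where m = n and f = f and I = "\<lambda>u V' A'. rw Ao z (?R u) V' A'"])
    subgoal premises pr for u V' A'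
    proof -
      have v: "V' vn = n" "V' vp = p" "V' vz = z" "V' vu = u" "A' aINV = A aINV" "A' aADJ = A aADJ" "A' aBLK = A aBLK" "A' aCD = A aCD"
        using pr(2)[simplified] pr(3) V by (simp_all add: frame_def)
      have ad: "A aADJ (A aINV u * n + A aINV z) = (if cov u z then 1 else 0)" using inv pr(1) V(4) by blast
      have ii: "A aINV u < n" "A aINV z < n" using inv pr(1) V(4) by blast+
      have idx: "A aINV u * n + A aINV z < N" "u < N" "z < N" using nn_ltN ii ltb pr(1) V(4) by auto
      show ?thesis
      proof (cases "cov u z \<and> A aBLK u = 0")
        case False
        \<comment> \<open>An assigned cover contributes nothing, because everything below it is
          assigned too.\<close>
        have RR: "?R (Suc u) = ?R u"
        proof (intro subset_antisym subsetI)
          fix x assume x: "x \<in> ?R (Suc u)"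
          have "A aBLK x = 0" using x by simp
          then have "\<not> (cov u z \<and> le x u)" using False mono[of x u] by blast
          then show "x \<in> ?R u" using x less_Suc_eq by auto
        next
          fix x assume "x \<in> ?R u" then show "x \<in> ?R (Suc u)" using less_SucI by blast
        qed
        have R: "rw Ao z (?R (Suc u)) V'' A'" if "V'' vc = V' vc" for V''
          unfolding RR by (rule rw_cong[OF pr(4)]) (simp_all add: that)
        show ?thesis
          apply (intro vs)
          using False by (simp_all add: v ad idx R f_def)
      next
        case True
        have uz: "u < z" using True cov_lt by blast
        obtain us where us: "length us = A aCD u" "length us < q" "set us = {x. x < n \<and> Ao aLE (u * n + x) = 1}"
          "\<forall>j<length us. Ao aLL (u * p + j) = us ! j"
          using P7[OF uz conjunct2[OF True]] by (elim exE conjE) (rule that, assumption+)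
        have mem: "{x \<in> set us. A aBLK x = 0} = {x. le x u \<and> A aBLK x = 0}"
        proof -
          have "(Ao aLE (u * n + x) = 1 \<longrightarrow> le x u) \<and> (le x u \<and> A aBLK x = 0 \<longrightarrow> Ao aLE (u * n + x) = 1)" if "x < n" for x
            using P5[OF uz that] True by simp
          then show ?thesis unfolding us(3) using le_lt by blast
        qed
        have ul: "length us < H" "A aCD u < H" using us small_ltH(5) by auto
        have us_lt: "us ! j < n" if "j < length us" for j using us(3) nth_mem[OF that] by blast
        \<comment> \<open>The list of \<open>u\<close> ends before row \<open>z\<close> begins, in
          the part of \<open>aLL\<close> that is known to be unchanged.\<close>
        have llj: "A1 aLL (u * p + j) = us ! j" if "rw Ao z W V1 A1" "j < length us" for W V1 A1 j
        proof -
          have "u * p + j < Suc u * p" using that(2) us(2) pos by simp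
          also have "\<dots> \<le> z * p" using uz by (intro mult_le_mono1) simp
          finally have "A1 aLL (u * p + j) = Ao aLL (u * p + j)" using that(1) unfolding rw_def by blast
          then show ?thesis using us(4) that(2) by simp
        qed
        have eq: "?R u \<union> {x \<in> set us. A aBLK x = 0} = ?R (Suc u)"
          unfolding mem using True by (auto simp: less_Suc_eq)
        show ?thesis
          apply (intro vs)
          apply (rule vFor[where m = "length us" and B = 60 and I = "\<lambda>j V'' A''. rw Ao z (?R u \<union> {x \<in> set (take j us). A aBLK x = 0}) V'' A''"])
          subgoal premises p1 for j V1 A1
          proof -
            have v1: "V1 vn = n" "V1 vp = p" "V1 vz = z" "V1 vu = u" "A1 aBLK = A aBLK"
              using p1(4)[simplified] v by (simp_all add: frame_def)
            have jp: "j < p" using p1(3) us(2) pos by simp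
            have st: "?R u \<union> {x \<in> set (take (Suc j) us). A aBLK x = 0} = (if A1 aBLK (us ! j) = 0
              then insert (us ! j) (?R u \<union> {x \<in> set (take j us). A aBLK x = 0}) else ?R u \<union> {x \<in> set (take j us). A aBLK x = 0})"
              using p1(3) by (auto simp: take_Suc_conv_app_nth v1)
            have sub: "?R u \<union> {x \<in> set (take j us). A aBLK x = 0} \<subseteq> {..<n}"
              using Rlt[of u] us(3) set_take_subset[of j us] by auto
            show ?thesis
              apply (rule runs_conseq[OF runs_addrow[where z = z and u = u and j = j and x = "us ! j" and Ao = Ao and
                 W = "?R u \<union> {x \<in> set (take j us). A aBLK x = 0}"]])
              subgoal by (rule v1) subgoal by (rule v1) subgoal by (rule v1) subgoal by (rule V) subgoal by (rule v1)
              subgoal by (rule pr(1)) subgoal by (rule p1(5)) subgoal by (rule jp) subgoal by (rule llj[OF p1(6) p1(3)])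
              subgoal by (rule us_lt[OF p1(3)]) subgoal by (rule p1(6)) subgoal by (rule sub) subgoal by simp
              subgoal premises p2 for V2 A2 unfolding st by (rule rw_cong[OF p2(2)]) simp_all
              done
          qed
          subgoal premises p1 for V1 A1
            using p1(5) unfolding take_all[OF order_refl] eq by (rule rw_cong) simp_all
          subgoal premises p1
          proof -
            have "?R u \<union> {x \<in> set (take 0 us). A aBLK x = 0} = ?R u" by simp
            then show ?thesis by (simp only:) (rule rw_cong[OF pr(4)]; simp)
          qed
          using True us ul by (simp_all add: v ad idx f_def)
      qed
    qed
    subgoal premises pr for V' A' using pr(3) unfolding Rn .
    subgoal
    proof -
      have "?R 0 = {z}" using bz by auto
      then show ?thesis using rw_cong[OF r] by simp
    qed
    using V time[simplified] by simp_all
qed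

definition asgblk :: cmd where
  "asgblk = For vw vn (When Eq (Arr aLE (Var vz |*| Var vn |+| Var vw)) (Num 1) (Upd aBLK (Var vw) (Var vr)))"

lemma mods_asgblk [simp]: "mv asgblk = {vw}" "ma asgblk = {aBLK}" by (auto simp: asgblk_def)

lemma runs_asgblk:
  assumes V: "V vn = n" "V vz = z" "z < n" "V vr \<le> n"
  shows "runs asgblk V A (2 + n * 25) (\<lambda>V' A'. \<forall>x<n. A' aBLK x = (if A aLE (z * n + x) = 1 then V vr else A aBLK x))"
  unfolding asgblk_def
  apply (rule vFor[where m = n and B = 23 and I = "\<lambda>i V' A'. \<forall>x<n. A' aBLK x = (if x < i \<and> A aLE (z * n + x) = 1 then V vr else A aBLK x)"])
  subgoal premises pr for i V' A'
  proof -
    have v: "V' vn = n" "V' vz = z" "V' vr = V vr" "V' vw = i" "A' aLE = A aLE"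
      using pr(2)[simplified] pr(3) V by (simp_all add: frame_def)
    show ?thesis
      apply (intro vs)
      using pr(4) small_ltH(1)[OF V(4)] by (simp_all add: v nn_ltN pr(1) V(3) ltb less_Suc_eq)
  qed
  using V by simp_all

definition bpass :: cmd where
  "bpass = Asg vr (Num 0) ;; For vz vn (inirow ;; mkrow ;; Upd aCD (Var vz) (Var vc) ;;
     When Leq (Var vq) (Var vc) (Asg vr (Var vr |+| Num 1) ;; Upd aISH (Var vz) (Num 1) ;; asgblk))"

lemma mods_bpass [simp]: "mv bpass = {vr, vz, vc, vu, vt, vj, vw}" "ma bpass = {aLE, aLL, aCD, aISH, aBLK}"
  by (auto simp: bpass_def)

lemma binv_thin:
  assumes b: "binv z V A" and zn: "z < n" and r: "rw A z {x. le x z \<and> A aBLK x = 0} V1 A1" "V1 vc < q"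
    and A1: "A1 aBLK = A aBLK" "A1 aISH = A aISH" "A1 aCD = (A aCD)(z := V1 vc)" and bz: "A aBLK z = 0" and vr: "V2 vr = V vr"
  shows "binv (Suc z) V2 A1"
proof -
  let ?S = "{x. le x z \<and> A aBLK x = 0}"
  note b' = b[unfolded binv_def]
  note P1 = b'[THEN conjunct1] and b2 = b'[THEN conjunct2]
  note P2 = b2[THEN conjunct1] and b3 = b2[THEN conjunct2]
  note P3 = b3[THEN conjunct1] and b4 = b3[THEN conjunct2]
  note P4 = b4[THEN conjunct1] and b5 = b4[THEN conjunct2]
  note P5 = b5[THEN conjunct1, rule_format] and b6 = b5[THEN conjunct2]
  note P6 = b6[THEN conjunct1, rule_format] and b7 = b6[THEN conjunct2]
  note P7 = b7[THEN conjunct1, rule_format] and P8 = b7[THEN conjunct2, rule_format]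
  obtain ws where ws: "distinct ws" "set ws = ?S" "V1 vc = length ws" "\<forall>j<length ws. A1 aLL (z * p + j) = ws ! j"
    using r(1) unfolding rw_def by blast
  have R: "\<forall>x<n. A1 aLE (z * n + x) = (if x \<in> ?S then 1 else 0)"
    "\<forall>v x. v \<noteq> z \<longrightarrow> x < n \<longrightarrow> A1 aLE (v * n + x) = A aLE (v * n + x)" "\<forall>i<z * p. A1 aLL i = A aLL i"
    using r(1) unfolding rw_def by blast+
  have S: "{x. x < n \<and> A1 aLE (z * n + x) = 1} = ?S"
  proof (rule set_eqI)
    fix x show "x \<in> {x. x < n \<and> A1 aLE (z * n + x) = 1} \<longleftrightarrow> x \<in> ?S"
      using R(1)[rule_format, of x] le_lt[of x z] by (cases "x < n"; cases "x \<in> ?S") auto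
  qed
  have row: "{x. x < n \<and> A1 aLE (v * n + x) = 1} = {x. x < n \<and> A aLE (v * n + x) = 1}" if "v \<noteq> z" for v
    by (intro Collect_cong conj_cong refl) (simp add: R(2)[rule_format, OF that])
  have ll: "A1 aLL (v * p + j) = A aLL (v * p + j)" if "v < z" "j < p" for v j
  proof -
    have "v * p + j < Suc v * p" using that(2) by simp
    also have "\<dots> \<le> z * p" using that(1) by (intro mult_le_mono1) simp
    finally show ?thesis using R(3) by simp
  qed
  show ?thesis
    unfolding binv_def A1 vr
  proof (intro conjI)
    show "\<forall>x<n. A aBLK x \<noteq> 0 \<longrightarrow> A aBLK x \<le> V vr \<and> (\<exists>h<Suc z. A aISH h = 1 \<and> A aBLK h = A aBLK x \<and> le x h)"
      using P1 by (meson less_SucI)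
    show "\<forall>v<Suc z. \<forall>x<n. (A1 aLE (v * n + x) = 1 \<longrightarrow> le x v) \<and> (le x v \<and> A aBLK x = A aBLK v \<longrightarrow> A1 aLE (v * n + x) = 1)"
    proof (intro allI impI)
      fix v x assume "v < Suc z" "x < n"
      then consider "v = z" | "v < z" by linarith
      then show "(A1 aLE (v * n + x) = 1 \<longrightarrow> le x v) \<and> (le x v \<and> A aBLK x = A aBLK v \<longrightarrow> A1 aLE (v * n + x) = 1)"
      proof cases
        case 1 then show ?thesis using R(1) \<open>x < n\<close> bz by auto
      next
        case 2
        then have "A1 aLE (v * n + x) = A aLE (v * n + x)" using R(2) \<open>x < n\<close> by auto
        then show ?thesis using P5[OF 2 \<open>x < n\<close>] by simp
      qed
    qed
    show "\<forall>v<Suc z. A aISH v \<noteq> 1 \<longrightarrow> card {x. x < n \<and> A1 aLE (v * n + x) = 1} < q"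
    proof (intro allI impI)
      fix v assume v: "v < Suc z" "A aISH v \<noteq> 1"
      then consider "v = z" | "v < z" by linarith
      then show "card {x. x < n \<and> A1 aLE (v * n + x) = 1} < q"
      proof cases
        case 1
        have "card ?S < q" using ws(1,3) r(2) distinct_card[OF ws(1)] ws(2) by simp
        then show ?thesis using 1 S by simp
      next
        case 2 then show ?thesis using P6[OF 2 v(2)] row[of v] by simp
      qed
    qed
    show "\<forall>v<Suc z. A aBLK v = 0 \<longrightarrow> (\<exists>us. length us = ((A aCD)(z := V1 vc)) v \<and> length us < q \<and>
       set us = {x. x < n \<and> A1 aLE (v * n + x) = 1} \<and> (\<forall>j<length us. A1 aLL (v * p + j) = us ! j))"
    proof (intro allI impI)
      fix v assume v: "v < Suc z" "A aBLK v = 0"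
      then consider "v = z" | "v < z" by linarith
      then show "\<exists>us. length us = ((A aCD)(z := V1 vc)) v \<and> length us < q \<and>
       set us = {x. x < n \<and> A1 aLE (v * n + x) = 1} \<and> (\<forall>j<length us. A1 aLL (v * p + j) = us ! j)"
      proof cases
        case 1 then show ?thesis using ws r(2) S by (intro exI[of _ ws]) simp
      next
        case 2
        then obtain us where us: "length us = A aCD v" "length us < q"
          "set us = {x. x < n \<and> A aLE (v * n + x) = 1}" "\<forall>j<length us. A aLL (v * p + j) = us ! j"
          using P7[OF 2 v(2)] by blast
        have "\<forall>j<length us. A1 aLL (v * p + j) = us ! j" using us(2,4) ll[OF 2] pos by simp
        then show ?thesis using us 2 row[of v] by (intro exI[of _ us]) simp
      qed
    qed
    show "\<forall>v<n. Suc z \<le> v \<longrightarrow> (\<forall>x<n. A1 aLE (v * n + x) = 0) \<and> A aISH v = 0"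
      using P8 R(2) by auto
  qed (rule P2 P3 P4)+
qed

text \<open>The new number exceeds all earlier ones, and what lies below the new block was assigned
  before or belongs to it, so the numbering stays monotone. The elements taken were all unassigned:
  at least \<open>q\<close> new ones are counted, and elements with equal numbers now had equal
  numbers before.\<close>

lemma binv_fat:
  assumes b: "binv z V A" and zn: "z < n" and r: "rw A z {x. le x z \<and> A aBLK x = 0} V1 A1" "q \<le> V1 vc"
    and A1: "\<forall>x<n. A1 aBLK x = (if A1 aLE (z * n + x) = 1 then Suc (V vr) else A aBLK x)"
      "A1 aISH = (A aISH)(z := 1)" "A1 aCD = (A aCD)(z := V1 vc)" and bz: "A aBLK z = 0" and vr: "V2 vr = Suc (V vr)"
  shows "binv (Suc z) V2 A1"
proof -
  let ?S = "{x. le x z \<and> A aBLK x = 0}"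
  have R: "\<forall>x<n. A1 aLE (z * n + x) = (if x \<in> ?S then 1 else 0)"
    "\<forall>v x. v \<noteq> z \<longrightarrow> x < n \<longrightarrow> A1 aLE (v * n + x) = A aLE (v * n + x)" "\<forall>i<z * p. A1 aLL i = A aLL i"
    using r(1) unfolding rw_def by blast+
  have B: "A1 aBLK x = (if x \<in> ?S then Suc (V vr) else A aBLK x)" if "x < n" for x using A1(1) R(1) that by simp
  have zS: "z \<in> ?S" using le_refl zn bz by blast
  note b' = b[unfolded binv_def]
  note a = b'[THEN conjunct1, rule_format] and b'' = b'[THEN conjunct2]
  note bb = b''[THEN conjunct1, rule_format] and b3 = b''[THEN conjunct2]
  note c = b3[THEN conjunct1, rule_format] and b4 = b3[THEN conjunct2]
  note d = b4[THEN conjunct1] and b5 = b4[THEN conjunct2]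
  note e = b5[THEN conjunct1, rule_format] and b6 = b5[THEN conjunct2]
  note f = b6[THEN conjunct1, rule_format] and b7 = b6[THEN conjunct2]
  note g = b7[THEN conjunct1, rule_format] and h = b7[THEN conjunct2]
  have le_r: "A aBLK x \<le> V vr" if "x < n" for x using a[OF that] by (cases "A aBLK x = 0") auto
  have row: "{x. x < n \<and> A1 aLE (v * n + x) = 1} = {x. x < n \<and> A aLE (v * n + x) = 1}" if "v \<noteq> z" for v
    by (intro Collect_cong conj_cong refl) (simp add: R(2)[rule_format, OF that])
  have ll: "A1 aLL (v * p + j) = A aLL (v * p + j)" if "v < z" "j < p" for v j
  proof -
    have "v * p + j < Suc v * p" using that(2) by simp
    also have "\<dots> \<le> z * p" using that(1) by (intro mult_le_mono1) simp
    finally show ?thesis using R(3) by simp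
  qed
  show ?thesis
    unfolding binv_def vr
  proof (intro conjI)
    show "\<forall>x<n. A1 aBLK x \<noteq> 0 \<longrightarrow> A1 aBLK x \<le> Suc (V vr) \<and> (\<exists>h<Suc z. A1 aISH h = 1 \<and> A1 aBLK h = A1 aBLK x \<and> le x h)"
    proof (intro allI impI)
      fix x assume x: "x < n" "A1 aBLK x \<noteq> 0"
      show "A1 aBLK x \<le> Suc (V vr) \<and> (\<exists>h<Suc z. A1 aISH h = 1 \<and> A1 aBLK h = A1 aBLK x \<and> le x h)"
      proof (cases "x \<in> ?S")
        case True
        then show ?thesis using B[OF x(1)] B[OF zn] zS A1(2) by auto
      next
        case False
        then have nz: "A aBLK x \<noteq> 0" using B[OF x(1)] x(2) by (auto split: if_splits)
        obtain h where h: "h < z" "A aISH h = 1" "A aBLK h = A aBLK x" "le x h" using a[OF x(1) nz] by blast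
        have "A1 aBLK h = A aBLK h" using B[of h] h zn nz by simp
        then show ?thesis using B[OF x(1)] False h A1(2) le_r[OF x(1)] by (auto intro!: exI[of _ h])
      qed
    qed
    show "\<forall>h<n. A1 aISH h = 1 \<longrightarrow> A1 aBLK h \<noteq> 0 \<and> (\<forall>h'<n. A1 aISH h' = 1 \<longrightarrow> A1 aBLK h = A1 aBLK h' \<longrightarrow> h = h')"
    proof -
      have o: "A1 aBLK h = A aBLK h \<and> A aBLK h \<noteq> 0 \<and> A aBLK h \<le> V vr \<and> A aISH h = 1" if "h < n" "A1 aISH h = 1" "h \<noteq> z" for h
        using that A1(2) bb[of h] B[of h] le_r by auto
      have zz: "A1 aBLK z = Suc (V vr)" using B[OF zn] zS by simp
      show ?thesis
      proof (intro allI impI conjI)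
        fix h assume h1: "h < n" "A1 aISH h = 1"
        then show "A1 aBLK h \<noteq> 0" using o[OF h1] zz by (cases "h = z") simp_all
        fix h' assume h2: "h' < n" "A1 aISH h' = 1" "A1 aBLK h = A1 aBLK h'"
        show "h = h'"
        proof (cases "h = z \<or> h' = z")
          case True
          then show ?thesis using o[OF h1] o[OF h2(1,2)] zz h2(3) by (cases "h = z"; cases "h' = z") simp_all
        next
          case False
          then have "A aISH h = 1" "A aISH h' = 1" "A aBLK h = A aBLK h'" using o[OF h1] o[OF h2(1,2)] h2(3) by simp_all
          then show ?thesis using bb[OF h1(1)] h2(1) by blast
        qed
      qed
    qed
    show "\<forall>x y. le x y \<longrightarrow> A1 aBLK y \<noteq> 0 \<longrightarrow> A1 aBLK x \<noteq> 0 \<and> A1 aBLK x \<le> A1 aBLK y"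
    proof (intro allI impI)
      fix x y assume xy: "le x y" "A1 aBLK y \<noteq> 0"
      have lt: "x < n" "y < n" using xy le_lt by blast+
      show "A1 aBLK x \<noteq> 0 \<and> A1 aBLK x \<le> A1 aBLK y"
      proof (cases "y \<in> ?S")
        case True
        then have "le x z" using xy le_trans by blast
        then show ?thesis using B[OF lt(1)] B[OF lt(2)] True le_r[OF lt(1)] by auto
      next
        case False
        then show ?thesis using c[OF xy(1)] xy(2) B[OF lt(1)] B[OF lt(2)] by auto
      qed
    qed
    show "Suc (V vr) * q \<le> card {x. x < n \<and> A1 aBLK x \<noteq> 0}"
    proof -
      have "{x. x < n \<and> A1 aBLK x \<noteq> 0} = {x. x < n \<and> A aBLK x \<noteq> 0} \<union> ?S" using B le_lt by auto
      moreover have "card ({x. x < n \<and> A aBLK x \<noteq> 0} \<union> ?S) = card {x. x < n \<and> A aBLK x \<noteq> 0} + card ?S"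
        by (rule card_Un_disjoint) (use le_fin in auto)
      moreover have "q \<le> card ?S" using rw_len[OF r(1)] r(2) by simp
      ultimately show ?thesis using d by simp
    qed
    show "\<forall>v<Suc z. \<forall>x<n. (A1 aLE (v * n + x) = 1 \<longrightarrow> le x v) \<and> (le x v \<and> A1 aBLK x = A1 aBLK v \<longrightarrow> A1 aLE (v * n + x) = 1)"
    proof (intro allI impI)
      fix v x assume vx: "v < Suc z" "x < n"
      then consider "v = z" | "v < z" by linarith
      then show "(A1 aLE (v * n + x) = 1 \<longrightarrow> le x v) \<and> (le x v \<and> A1 aBLK x = A1 aBLK v \<longrightarrow> A1 aLE (v * n + x) = 1)"
      proof cases
        case 1
        then show ?thesis using R(1) vx(2) B[OF vx(2)] B[OF zn] zS le_r[OF vx(2)] by auto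
      next
        case 2
        then have "A1 aLE (v * n + x) = A aLE (v * n + x)" using R(2) vx(2) by auto
        moreover have "A aBLK x = A aBLK v" if "A1 aBLK x = A1 aBLK v"
          using that B[OF vx(2)] B[of v] 2 zn le_r[OF vx(2)] le_r[of v] by (auto split: if_splits)
        ultimately show ?thesis using e[OF 2 vx(2)] by auto
      qed
    qed
    show "\<forall>v<Suc z. A1 aISH v \<noteq> 1 \<longrightarrow> card {x. x < n \<and> A1 aLE (v * n + x) = 1} < q"
    proof (intro allI impI)
      fix v assume v: "v < Suc z" "A1 aISH v \<noteq> 1"
      then have "v \<noteq> z" "v < z" "A aISH v \<noteq> 1" using A1(2) by (auto simp: less_Suc_eq split: if_splits)
      then show "card {x. x < n \<and> A1 aLE (v * n + x) = 1} < q" using f row by simp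
    qed
    show "\<forall>v<Suc z. A1 aBLK v = 0 \<longrightarrow> (\<exists>us. length us = A1 aCD v \<and> length us < q \<and>
       set us = {x. x < n \<and> A1 aLE (v * n + x) = 1} \<and> (\<forall>j<length us. A1 aLL (v * p + j) = us ! j))"
    proof (intro allI impI)
      fix v assume v: "v < Suc z" "A1 aBLK v = 0"
      then have v': "v < z" "A aBLK v = 0" using B[of v] zn zS by (auto simp: less_Suc_eq split: if_splits)
      then obtain us where us: "length us = A aCD v" "length us < q"
          "set us = {x. x < n \<and> A aLE (v * n + x) = 1}" "\<forall>j<length us. A aLL (v * p + j) = us ! j"
        using g by blast
      have "\<forall>j<length us. A1 aLL (v * p + j) = us ! j" using us(2,4) ll[OF v'(1)] pos by simp
      then show "\<exists>us. length us = A1 aCD v \<and> length us < q \<and>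
       set us = {x. x < n \<and> A1 aLE (v * n + x) = 1} \<and> (\<forall>j<length us. A1 aLL (v * p + j) = us ! j)"
        using us v' row[of v] A1(3) by (intro exI[of _ us]) simp
    qed
    show "\<forall>v<n. Suc z \<le> v \<longrightarrow> (\<forall>x<n. A1 aLE (v * n + x) = 0) \<and> A1 aISH v = 0"
      using h R(2) A1(2) by auto
  qed
qed

text \<open>The cost of an element depends on its number of lower covers. These sum to at most 2nq
  by \<open>cov_count\<close>, so the merging of lists costs O(n * q^2) in total.\<close>

lemma runs_bpass:
  assumes V: "V vn = n" "V vp = p" "V vq = q"
    and inv: "\<forall>j<n. A aINV j < n" "\<forall>a<n. \<forall>b<n. A aADJ (A aINV a * n + A aINV b) = (if cov a b then 1 else 0)"
    and z: "\<forall>x<n. A aBLK x = 0 \<and> A aISH x = 0 \<and> (\<forall>y<n. A aLE (x * n + y) = 0)"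
  shows "runs bpass V A (4 + n * (n * 65 + 60) + (2 * n * q) * (q * 70)) (\<lambda>V' A'. binv n V' A')"
proof -
  define d where "d z = card {u. u < n \<and> cov u z}" for z
  define f where "f z = n * 65 + 58 + d z * (q * 70)" for z
  have sd: "(\<Sum>z<n. d z) \<le> 2 * n * q"
  proof -
    have "(\<Sum>z<n. d z) = card (SIGMA z:{..<n}. {u. u < n \<and> cov u z})" by (simp add: d_def)
    also have "\<dots> = card ((\<lambda>(z, u). (u, z)) ` (SIGMA z:{..<n}. {u. u < n \<and> cov u z}))"
      by (rule card_image[symmetric]) (auto simp: inj_on_def)
    also have "(\<lambda>(z, u). (u, z)) ` (SIGMA z:{..<n}. {u. u < n \<and> cov u z}) = {(u, v). cov u v}"
      using cov_lt by force
    finally show ?thesis using cov_count[OF n_le q_pos] by simp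
  qed
  have time: "2 + (\<Sum>z<n. f z + 2) \<le> 2 + n * (n * 65 + 60) + (2 * n * q) * (q * 70)"
  proof -
    have "f z + 2 = (n * 65 + 60) + d z * (q * 70)" for z by (simp add: f_def)
    then have "(\<Sum>z<n. f z + 2) = n * (n * 65 + 60) + (\<Sum>z<n. d z) * (q * 70)"
      by (simp only: sum.distrib sum_constant card_lessThan sum_distrib_right of_nat_id add_mult_distrib2)
    also have "\<dots> \<le> n * (n * 65 + 60) + (2 * n * q) * (q * 70)" using sd by (intro add_left_mono mult_le_mono1)
    finally show ?thesis by simp
  qed
  show ?thesis
    unfolding bpass_def
    apply (intro vs)
    apply (rule vFor_sum[where m = n and f = f and I = binv])
    subgoal premises pr for z V' A'
    proof -
      have v: "V' vn = n" "V' vp = p" "V' vq = q" "V' vz = z" "A' aINV = A aINV" "A' aADJ = A aADJ"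
        using pr(2)[simplified] pr(3) V by (simp_all add: frame_def)
      note b' = pr(4)[unfolded binv_def]
      note P1 = b'[THEN conjunct1, rule_format]
      note P4 = b'[THEN conjunct2, THEN conjunct2, THEN conjunct2, THEN conjunct1]
      note P8 = b'[THEN conjunct2, THEN conjunct2, THEN conjunct2, THEN conjunct2, THEN conjunct2, THEN conjunct2,
        THEN conjunct2, rule_format]
      \<comment> \<open>An assigned element lies below a header visited earlier, whose label is
        smaller than \<open>z\<close>; labels would decrease along the order.\<close>
      have bz: "A' aBLK z = 0"
      proof (rule ccontr)
        assume "A' aBLK z \<noteq> 0"
        then obtain h where "h < z" "le z h" using P1[OF pr(1)] by blast
        then show False using le_mono[of z h] by simp
      qed
      have hz: "\<forall>x<n. A' aLE (z * n + x) = 0" using P8[OF pr(1) order_refl] by blast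
      have vrn: "V' vr \<le> n"
      proof -
        have "V' vr * q \<le> card {x. x < n \<and> A' aBLK x \<noteq> 0}" by (rule P4)
        also have "\<dots> \<le> card {..<n}" by (rule card_mono) auto
        finally have "V' vr * q \<le> n" by simp
        moreover have "V' vr \<le> V' vr * q" using q_pos by simp
        ultimately show ?thesis by linarith
      qed
      show ?thesis
        apply (rule vcut[where Tc = 30 and P = "\<lambda>V1 A1. rw A' z {z} V1 A1"])
        subgoal premises p1 for V1 A1
        proof -
          have v1: "V1 vn = n" "V1 vp = p" "V1 vq = q" "V1 vz = z" "V1 vr = V' vr" "A1 aINV = A aINV" "A1 aADJ = A aADJ" "A1 aBLK = A' aBLK"
            "A1 aCD = A' aCD" "A1 aISH = A' aISH"
            using p1(1)[simplified] v by (simp_all add: frame_def)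
          show ?thesis
            apply (rule vcut[OF _ _ runs_mkrow[where z = z and Ao = A' and Vo = V']])
            subgoal premises p2 for V2 A2
            proof -
              let ?S = "{x. le x z \<and> A' aBLK x = 0}"
              have v2: "V2 vn = n" "V2 vq = q" "V2 vz = z" "V2 vr = V' vr" "A2 aBLK = A' aBLK"
                "A2 aCD = A' aCD" "A2 aISH = A' aISH"
                using p2(1)[simplified] v1 by (simp_all add: frame_def)
              have r2: "rw A' z ?S V2 A2" using p2(2) v1 by simp
              have vc: "V2 vc \<le> n"
              proof -
                have "card ?S \<le> card {..<n}" by (rule card_mono) (use le_lt in auto)
                then show ?thesis using rw_len[OF r2] by simp
              qed
              show ?thesis
              proof (cases "q \<le> V2 vc")
                case False
                have b: "binv (Suc z) V3 A3" if "A3 = A2(aCD := (A' aCD)(z := V2 vc))" "V3 vr = V' vr" for V3 A3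
                  by (rule binv_thin[OF pr(4,1), where ?V1.0 = V2]) (use rw_cong[OF r2] that v2 False bz in auto)
                show ?thesis
                  apply (intro vs)
                  using False by (simp_all add: v2 b small_ltH vc ltb pr(1) f_def d_def)
              next
                case True
                have b: "binv (Suc z) V3 A3" if "A3 aLE = A2 aLE" "A3 aLL = A2 aLL" "A3 aCD = (A' aCD)(z := V2 vc)"
                  "A3 aISH = (A' aISH)(z := 1)"
                  "\<forall>x<n. A3 aBLK x = (if A2 aLE (z * n + x) = 1 then Suc (V' vr) else A' aBLK x)" "V3 vr = Suc (V' vr)" for V3 A3
                  by (rule binv_fat[OF pr(4,1), where ?V1.0 = V2]) (use rw_cong[OF r2] that True bz in auto)
                have vr1: "Suc (V' vr) \<le> n"
                proof -
                  have "V' vr * q \<le> card {x. x < n \<and> A' aBLK x \<noteq> 0}" by (rule P4)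
                  also have "\<dots> \<le> card ({..<n} - {z})" by (rule card_mono) (use bz in auto)
                  also have "\<dots> = n - 1" using pr(1) by simp
                  finally have "V' vr * q \<le> n - 1" .
                  moreover have "V' vr \<le> V' vr * q" using q_pos by simp
                  ultimately show ?thesis using pr(1) by linarith
                qed
                show ?thesis
                  apply (intro vs)
                  apply (rule vuse[OF _ _ runs_asgblk[where z = z]])
                  subgoal premises p3 for V3 A3
                    by (rule b) (use p3(2)[simplified] p3(3) v2 in \<open>simp_all add: frame_def\<close>)
                  using True vr1 H_large by (simp_all add: v2 small_ltH vc ltb pr(1) f_def d_def)
              qed
            qed
            subgoal by (simp add: f_def d_def)
            using p1(2) pr(1,4) inv bz by (simp_all add: v1)
        qed
        subgoal by (simp add: f_def)
        subgoal
        proof -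
          have R: "rw A' z {z} V1 A1" if "V1 vc = Suc 0" "A1 aLE = (A' aLE)(z * n + z := Suc 0)" "A1 aLL = (A' aLL)(z * p := z)" for V1 A1
            unfolding rw_def
          proof (intro conjI)
            show "\<exists>ws. distinct ws \<and> set ws = {z} \<and> V1 vc = length ws \<and> (\<forall>j<length ws. A1 aLL (z * p + j) = ws ! j)"
              by (intro exI[of _ "[z]"]) (simp add: that)
            show "\<forall>x<n. A1 aLE (z * n + x) = (if x \<in> {z} then 1 else 0)" using hz by (simp add: that)
            show "\<forall>v x. v \<noteq> z \<longrightarrow> x < n \<longrightarrow> A1 aLE (v * n + x) = A' aLE (v * n + x)" using pr(1) by (simp add: that nn_eq)
          qed (simp add: that)
          show ?thesis
            unfolding inirow_def
            apply (intro vs)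
            using ovf_lt[OF pr(1), of 0] H_large by (simp_all add: v R nn_ltN pr(1) ltb)
        qed
        done
    qed
    subgoal premises pr for V' A' by (rule pr(3))
    subgoal
    proof -
      have "A aBLK y = 0" if "le x y" for x y using z le_lt that by blast
      then show ?thesis by (simp add: binv_def z)
    qed
    using V time[simplified] H_large by simp_all
qed

end

context bplat
begin

section \<open>Representatives\<close>

definition reppass :: cmd where
  "reppass = Asg vk (Var vr |+| Num 1) ;; For vi vk (
     For vx vn (IfC Eq (Arr aBLK (Var vx)) (Var vi) (Upd aREP (ix (Var vx) (Var vi)) (Var vx |+| Num 1))
       (Upd aREP (ix (Var vx) (Var vi)) (Num 0))) ;;
     For vj vne (Asg vx (Arr aEU (Var vj)) ;; Asg vy (Arr aEV (Var vj)) ;;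
       When Less (Arr aREP (ix (Var vy) (Var vi))) (Arr aREP (ix (Var vx) (Var vi)))
         (Upd aREP (ix (Var vy) (Var vi)) (Arr aREP (ix (Var vx) (Var vi))))))"

lemma mods_reppass [simp]: "mv reppass = {vk, vi, vx, vj, vy}" "ma reppass = {aREP}"
  by (auto simp: reppass_def)

definition rpset :: "arrs \<Rightarrow> nat \<Rightarrow> nat \<Rightarrow> nat set" where
  "rpset A i x = {w. le w x \<and> A aBLK w = i}"

lemma fin_rpset [simp]: "finite (rpset A i x)" unfolding rpset_def by (rule le_fin)

text \<open>For each block number one sweep over the edges, sorted by upper end, carries the largest
  label of the block upwards. There are at most q + 1 sweeps over at most 2nq edges, which is O(n *
  q^2).\<close>

lemma runs_reppass:
  assumes V: "V vn = n" "V vp = p" "V vr \<le> q" and el: "elinv cov n 0 V A"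
  shows "runs reppass V A (10 + (q + 1) * (10 + n * 40 + (2 * n * q) * 70))
    (\<lambda>V' A'. \<forall>i\<le>V vr. \<forall>x<n. A' aREP (x * p + i) = mxs (rpset A i x))"
proof -
  obtain xs where xs: "V vne = length xs" "distinct xs" "set xs = {(a, b). a < n \<and> b < n \<and> cov a b \<and> (b < n \<or> b = n \<and> a < 0)}"
    "sorted (map snd xs)" "\<forall>i<length xs. A aEU i = fst (xs ! i) \<and> A aEV i = snd (xs ! i)"
    using el unfolding elinv_def by blast
  have sx: "set xs = {(a, b). cov a b}" unfolding xs(3) using cov_lt by auto
  have len: "length xs \<le> 2 * n * q" using cov_count[OF n_le q_pos] distinct_card[OF xs(2)] sx by simp
  have lN: "length xs < N" "2 * n * q \<le> n * p" using len n_ltN(3)[of "length xs"] by (simp_all add: p_def)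
  have ed: "fst (xs ! j) < n" "snd (xs ! j) < n" "fst (xs ! j) < snd (xs ! j)" "cov (fst (xs ! j)) (snd (xs ! j))" if "j < length xs" for j
    using nth_mem[OF that] cov_lt unfolding sx by (auto simp: split_beta)
  have so: "snd (xs ! i) \<le> snd (xs ! j)" if "i < j" "j < length xs" for i j
    using sorted_nth_mono[OF xs(4), of i j] that by simp
  have ip: "i < p" if "i \<le> V vr" for i using that V(3) pos by simp
  have body: "runs (For vx vn (IfC Eq (Arr aBLK (Var vx)) (Var vi) (Upd aREP (ix (Var vx) (Var vi)) (Var vx |+| Num 1))
       (Upd aREP (ix (Var vx) (Var vi)) (Num 0))) ;;
     For vj vne (Asg vx (Arr aEU (Var vj)) ;; Asg vy (Arr aEV (Var vj)) ;;
       When Less (Arr aREP (ix (Var vy) (Var vi))) (Arr aREP (ix (Var vx) (Var vi)))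
         (Upd aREP (ix (Var vy) (Var vi)) (Arr aREP (ix (Var vx) (Var vi)))))) V1 A1 (8 + n * 40 + (2 * n * q) * 70)
     (\<lambda>V2 A2. (\<forall>x<n. A2 aREP (x * p + i) = mxs (rpset A i x)) \<and>
       (\<forall>x<n. \<forall>i'<p. i' \<noteq> i \<longrightarrow> A2 aREP (x * p + i') = A1 aREP (x * p + i')))"
    if i: "i < p" and V1: "V1 vn = n" "V1 vp = p" "V1 vi = i" "V1 vne = length xs" and A1: "A1 aBLK = A aBLK" "A1 aEU = A aEU" "A1 aEV = A aEV" for i V1 A1
    apply (rule vcut[where Tc = "2 + n * 40" and P = "\<lambda>V2 A2. \<forall>x<n. A2 aREP (x * p + i) = (if A aBLK x = i then Suc x else 0) \<and>
       (\<forall>i'<p. i' \<noteq> i \<longrightarrow> A2 aREP (x * p + i') = A1 aREP (x * p + i'))"])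
    subgoal premises p1 for V2 A2
    proof -
      have v2: "V2 vn = n" "V2 vp = p" "V2 vi = i" "V2 vne = length xs" "A2 aBLK = A aBLK" "A2 aEU = A aEU" "A2 aEV = A aEV"
        using p1(1)[simplified] V1 A1 by (simp_all add: frame_def)
      show ?thesis
        apply (rule vFor[where m = "length xs" and B = 65 and I = "\<lambda>j V3 A3.
          (\<forall>x<n. A3 aREP (x * p + i) = 0 \<or> A3 aREP (x * p + i) - 1 \<in> rpset A i x) \<and>
          (\<forall>x<n. A aBLK x = i \<longrightarrow> Suc x \<le> A3 aREP (x * p + i)) \<and>
          (\<forall>j'<j. A3 aREP (fst (xs ! j') * p + i) \<le> A3 aREP (snd (xs ! j') * p + i)) \<and>
          (\<forall>x<n. \<forall>i'<p. i' \<noteq> i \<longrightarrow> A3 aREP (x * p + i') = A1 aREP (x * p + i'))"])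
        subgoal premises p2 for j V3 A3
        proof -
          let ?u = "fst (xs ! j)" and ?v = "snd (xs ! j)" and ?r = "\<lambda>x. A3 aREP (x * p + i)"
          have v3: "V3 vn = n" "V3 vp = p" "V3 vi = i" "V3 vj = j" "A3 aEU j = ?u" "A3 aEV j = ?v"
            using p2(1,3) p2(2)[simplified] v2 xs(5) by (simp_all add: frame_def)
          note e = ed[OF p2(1)]
          have I1: "\<And>x. x < n \<Longrightarrow> ?r x = 0 \<or> ?r x - 1 \<in> rpset A i x"
            and I2: "\<And>x. x < n \<Longrightarrow> A aBLK x = i \<Longrightarrow> Suc x \<le> ?r x"
            and I3: "\<And>j'. j' < j \<Longrightarrow> ?r (fst (xs ! j')) \<le> ?r (snd (xs ! j'))"
            and I4: "\<And>x i'. x < n \<Longrightarrow> i' < p \<Longrightarrow> i' \<noteq> i \<Longrightarrow> A3 aREP (x * p + i') = A1 aREP (x * p + i')"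
            using p2(4) by blast+
          have idx: "j < N" "?u * p + i < N" "?v * p + i < N" using p2(1) lN ix_ltN e i by simp_all
          have rH: "?r ?u < H"
          proof -
            have "?r ?u \<le> n" using I1[OF e(1)] le_lt unfolding rpset_def by (cases "?r ?u") fastforce+
            then show ?thesis by (rule small_ltH)
          qed
          show ?thesis
          proof (cases "?r ?v < ?r ?u")
            case True
            let ?R = "(A3 aREP)(?v * p + i := ?r ?u)"
            have c1: "\<forall>x<n. ?R (x * p + i) = 0 \<or> ?R (x * p + i) - 1 \<in> rpset A i x"
            proof (intro allI impI)
              fix x assume x: "x < n"
              have "?r ?u - 1 \<in> rpset A i ?v" using True I1[OF e(1)] le_trans cov_lt(4)[OF e(4)]
                unfolding rpset_def by auto
              then show "?R (x * p + i) = 0 \<or> ?R (x * p + i) - 1 \<in> rpset A i x" using I1[OF x] i by simp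
            qed
            have c2: "\<forall>x<n. A aBLK x = i \<longrightarrow> Suc x \<le> ?R (x * p + i)"
            proof (intro allI impI)
              fix x assume x: "x < n" "A aBLK x = i"
              have "Suc x \<le> ?r x" by (rule I2[OF x])
              then show "Suc x \<le> ?R (x * p + i)" using i True by (cases "x = ?v") auto
            qed
            have c3: "\<forall>j'<Suc j. ?R (fst (xs ! j') * p + i) \<le> ?R (snd (xs ! j') * p + i)"
            proof (intro allI impI)
              fix j' assume j': "j' < Suc j"
              show "?R (fst (xs ! j') * p + i) \<le> ?R (snd (xs ! j') * p + i)"
              proof (cases "j' = j")
                case eq: True then show ?thesis using e(3) i by simp
              next
                case False
                then have jj: "j' < j" using j' by simp
                \<comment> \<open>Here the order of the list is used: the lower end of an earlier
                  edge is smaller than the current upper end, so its entry is final.\<close>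
                have "fst (xs ! j') < snd (xs ! j')" using ed(3)[of j'] jj p2(1) by simp
                also have "\<dots> \<le> ?v" by (rule so[OF jj p2(1)])
                finally have ne: "fst (xs ! j') \<noteq> ?v" by simp
                have "?r (fst (xs ! j')) \<le> ?r (snd (xs ! j'))" by (rule I3[OF jj])
                then show ?thesis using ne i True by (cases "snd (xs ! j') = ?v") auto
              qed
            qed
            have c4: "\<forall>x<n. \<forall>i'<p. i' \<noteq> i \<longrightarrow> ?R (x * p + i') = A1 aREP (x * p + i')" using I4 i by simp
            show ?thesis
              apply (intro vs)
              using c1 c2 c3 c4 True by (simp_all only: ev.simps nat_op.simps compare.simps v3 fun_upd_same fun_upd_other) (simp_all add: v3 idx ltb e rH)
          next
            case False
            have c3: "\<forall>j'<Suc j. ?r (fst (xs ! j')) \<le> ?r (snd (xs ! j'))" using I3 False by (auto simp: less_Suc_eq)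
            show ?thesis
              apply (intro vs)
              using c3 p2(4) False by (simp_all add: v3 idx ltb e)
          qed
        qed
        subgoal premises p2 for V3 A3
        proof -
          let ?r = "\<lambda>x. A3 aREP (x * p + i)"
          have I1: "\<And>x. x < n \<Longrightarrow> ?r x = 0 \<or> ?r x - 1 \<in> rpset A i x"
            and I2: "\<And>x. x < n \<Longrightarrow> A aBLK x = i \<Longrightarrow> Suc x \<le> ?r x"
            and I3: "\<And>j'. j' < length xs \<Longrightarrow> ?r (fst (xs ! j')) \<le> ?r (snd (xs ! j'))"
            using p2(3) by blast+
          have cv: "?r u \<le> ?r x" if "cov u x" for u x
          proof -
            have "(u, x) \<in> set xs" using sx that by simp
            then obtain j where "j < length xs" "xs ! j = (u, x)" by (auto simp: in_set_conv_nth)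
            then show ?thesis using I3[of j] by simp
          qed
          \<comment> \<open>What holds along covers is carried to the whole order by descending
            through a lower cover.\<close>
          have up: "Suc w \<le> ?r x" if "le w x" "A aBLK w = i" for w x
            using that
          proof (induction x rule: less_induct)
            case (less x)
            show ?case
            proof (cases "w = x")
              case True then show ?thesis using I2 less.prems le_lt by blast
            next
              case False
              then obtain u where u: "le w u" "cov u x" using cov_ex less.prems by blast
              then have "Suc w \<le> ?r u" using less.IH[OF cov_lt(1)[OF u(2)]] less.prems(2) by blast
              then show ?thesis using cv[OF u(2)] by linarith
            qed
          qed
          have "?r x = mxs (rpset A i x)" if "x < n" for x
            by (rule mxs_eqI[symmetric]) (use I1[OF that] up in \<open>auto simp: rpset_def intro: le_fin\<close>)
          then show ?thesis using p2(3) by blast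
        qed
        subgoal using p1(2) le_refl by (auto simp: rpset_def)
        subgoal using v2 by simp
        using len by simp_all
    qed
    subgoal by simp
    apply (rule vFor[where m = n and B = 38 and I = "\<lambda>x' V2 A2. (\<forall>x<x'. A2 aREP (x * p + i) = (if A aBLK x = i then Suc x else 0)) \<and>
       (\<forall>x<n. \<forall>i'<p. i' \<noteq> i \<longrightarrow> A2 aREP (x * p + i') = A1 aREP (x * p + i'))"])
    subgoal premises p1 for x V2 A2
    proof -
      have v2: "V2 vn = n" "V2 vp = p" "V2 vi = i" "V2 vx = x" "A2 aBLK = A aBLK"
        using p1(2)[simplified] p1(3) V1 A1 by (simp_all add: frame_def)
      show ?thesis
        apply (intro vs)
        using p1(4) H_large pos by (simp_all add: v2 ix_ltN p1(1) i ltb less_Suc_eq)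
    qed
    using V1 by simp_all
  show ?thesis
    unfolding reppass_def
    apply (intro vs)
    apply (rule vFor[where m = "Suc (V vr)" and B = "8 + n * 40 + (2 * n * q) * 70" and
      I = "\<lambda>i V1 A1. \<forall>i'<i. \<forall>x<n. A1 aREP (x * p + i') = mxs (rpset A i' x)"])
    subgoal premises p1 for i V1 A1
    proof -
      have v1: "V1 vn = n" "V1 vp = p" "V1 vi = i" "V1 vne = length xs" "A1 aBLK = A aBLK" "A1 aEU = A aEU" "A1 aEV = A aEV"
        using p1(2)[simplified] p1(3) V xs(1) by (simp_all add: frame_def)
      have i: "i < p" using ip p1(1) by simp
      show ?thesis
        by (rule runs_conseq[OF body[OF i v1]]) (use p1(1,4) ip in \<open>auto simp: less_Suc_eq\<close>)
    qed
    subgoal premises p1 for V1 A1 using p1(3) by (simp add: less_Suc_eq_le)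
    subgoal by simp
    subgoal by simp
    subgoal by simp subgoal by simp subgoal by simp subgoal by simp subgoal by simp
    subgoal
    proof -
      have "Suc (V vr) * (8 + n * 40 + 2 * n * q * 70 + 2) \<le> (q + 1) * (10 + n * 40 + 2 * n * q * 70)"
        using V(3) by (intro mult_le_mono) auto
      then show ?thesis by simp
    qed
    using small_ltH(2)[of "Suc (V vr)"] V(3) pos by simp_all
qed

section \<open>Selecting elements of a row\<close>

definition sel :: "nat \<Rightarrow> nat \<Rightarrow> nat \<Rightarrow> cmd" where
  "sel a k b = Asg vc (Num 0) ;; For vw vn (
     When Eq (Arr aLE (Var vz |*| Var vn |+| Var vw)) (Num 1) (
     When Eq (Arr aBLK (Var vw)) (Arr aBLK (Var vz)) (
     When Eq (Arr a (Var vw)) (Num k) (Upd b (ix (Var vz) (Var vc)) (Var vw) ;; Asg vc (Var vc |+| Num 1)))))"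

lemma mods_sel [simp]: "mv (sel a k b) = {vc, vw}" "ma (sel a k b) = {b}" by (auto simp: sel_def)

lemma runs_sel:
  assumes V: "V vn = n" "V vp = p" "V vz = z" "z < n" and ab: "a < 40" "b < 40" "k \<le> 1" "b \<notin> {aLE, aBLK, a}"
    and P: "\<forall>w<n. P w \<longleftrightarrow> A aLE (z * n + w) = 1 \<and> A aBLK w = A aBLK z \<and> A a w = k"
    and len: "length (filter P [0..<n]) < q"
  shows "runs (sel a k b) V A (4 + n * 60) (\<lambda>V' A'. V' vc = length (filter P [0..<n]) \<and>
    (\<forall>j<V' vc. A' b (z * p + j) = filter P [0..<n] ! j) \<and> row_eq z (A b) (A' b))"
  unfolding sel_def
  apply (intro vs)
  apply (rule vFor[where m = n and B = 58 and I = "\<lambda>i V' A'. V' vc = length (filter P [0..<i]) \<and>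
    (\<forall>j<V' vc. A' b (z * p + j) = filter P [0..<i] ! j) \<and> row_eq z (A b) (A' b)"])
  subgoal premises pr for i V' A'
  proof -
    have v: "V' vn = n" "V' vp = p" "V' vz = z" "V' vw = i" "A' aLE = A aLE" "A' aBLK = A aBLK" "A' a = A a"
      using pr(2)[simplified] pr(3) V ab(4) by (simp_all add: frame_def)
    have "[0..<n] = [0..<i] @ [i..<n]" using upt_add_eq_append[of 0 i "n - i"] pr(1) by simp
    then have "length (filter P [0..<i]) \<le> length (filter P [0..<n])" by simp
    then have l: "length (filter P [0..<i]) < q" using len by linarith
    then have l': "length (filter P [0..<i]) < p" "Suc (length (filter P [0..<i])) < H"
      using pos small_ltH(2)[of "Suc (length (filter P [0..<i]))"] by linarith+
    have idx: "z * n + i < N" "i < N" "z < N" "i < H" "z * p + length (filter P [0..<i]) < N"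
      using nn_ltN[OF V(4) pr(1)] ltb V(4) pr(1) ix_ltN[OF V(4) l'(1)] by blast+
    show ?thesis
    proof (cases "P i")
      case True
      then have Pi: "A aLE (z * n + i) = Suc 0" "A aBLK i = A aBLK z" "A a i = k" using P pr(1) by auto
      show ?thesis
        apply (intro vs)
        using pr(4) True ab H_large by (simp_all add: v idx l' Pi nth_append less_Suc_eq)
    next
      case False
      then have Pi: "A aLE (z * n + i) = Suc 0 \<Longrightarrow> A aBLK i = A aBLK z \<Longrightarrow> A a i \<noteq> k" using P pr(1) by auto
      show ?thesis
        apply (intro vs)
        using pr(4) False ab Pi by (simp_all add: v idx)
    qed
  qed
  using V H_large ab by simp_all

section \<open>Subblocks\<close>

definition asgsub :: cmd where
  "asgsub = For vj vc (Asg vw (Arr aMEM (ix (Var vz) (Var vj))) ;; Upd aSUB (Var vw) (Var vz |+| Num 1) ;;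
     Upd aIDX (Var vw) (Var vj))"

lemma mods_asgsub [simp]: "mv asgsub = {vj, vw}" "ma asgsub = {aSUB, aIDX}" by (auto simp: asgsub_def)

lemma runs_asgsub:
  assumes V: "V vp = p" "V vz = z" "z < n" "V vc = length ls" "length ls < q"
    and ls: "distinct ls" "set ls \<subseteq> {..<n}" "\<forall>j<length ls. A aMEM (z * p + j) = ls ! j"
  shows "runs asgsub V A (2 + n * 40) (\<lambda>V' A'. (\<forall>x<n. A' aSUB x = (if x \<in> set ls then Suc z else A aSUB x)) \<and>
    (\<forall>j<length ls. A' aIDX (ls ! j) = j) \<and> (\<forall>x<n. x \<notin> set ls \<longrightarrow> A' aIDX x = A aIDX x))"
proof -
  have ln: "length ls \<le> n" using card_mono[OF _ ls(2)] distinct_card[OF ls(1)] by simp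
  have lt: "ls ! j < n" if "j < length ls" for j using ls(2) that nth_mem by blast
  show ?thesis
    unfolding asgsub_def
    apply (rule vFor[where m = "length ls" and B = 38 and I = "\<lambda>i V' A'. (\<forall>x<n. A' aSUB x = (if x \<in> set (take i ls) then Suc z else A aSUB x)) \<and>
      (\<forall>j<i. A' aIDX (ls ! j) = j) \<and> (\<forall>x<n. x \<notin> set (take i ls) \<longrightarrow> A' aIDX x = A aIDX x)"])
    subgoal premises pr for i V' A'
    proof -
      have v: "V' vp = p" "V' vz = z" "V' vj = i" "A' aMEM = A aMEM"
        using pr(2)[simplified] pr(3) V by (simp_all add: frame_def)
      have m: "A aMEM (z * p + i) = ls ! i" "ls ! i < n" "ls ! i < N" "ls ! i < H" "i < p" "i < N" "z * p + i < N" "i < H" "Suc z < H"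
        using ls(3) pr(1) lt[OF pr(1)] ltb V(3,5) pos ix_ltN[OF V(3), of i] ltb(2)[of i] by auto
      have tk: "set (take (Suc i) ls) = insert (ls ! i) (set (take i ls))" using pr(1) by (simp add: take_Suc_conv_app_nth)
      have ne: "ls ! j \<noteq> ls ! i" if "j < i" for j using ls(1) that pr(1) by (simp add: nth_eq_iff_index_eq)
      have I: "\<And>x. x < n \<Longrightarrow> A' aSUB x = (if x \<in> set (take i ls) then Suc z else A aSUB x)"
        "\<And>j. j < i \<Longrightarrow> A' aIDX (ls ! j) = j" "\<And>x. x < n \<Longrightarrow> x \<notin> set (take i ls) \<Longrightarrow> A' aIDX x = A aIDX x" using pr(4) by blast+
      have J1: "\<forall>x<n. ((A' aSUB)(ls ! i := Suc z)) x = (if x \<in> set (take (Suc i) ls) then Suc z else A aSUB x)"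
        unfolding tk using I(1) by auto
      have J2: "\<forall>j<Suc i. ((A' aIDX)(ls ! i := i)) (ls ! j) = j" using I(2) ne by (auto simp: less_Suc_eq)
      have J3: "\<forall>x<n. x \<notin> set (take (Suc i) ls) \<longrightarrow> ((A' aIDX)(ls ! i := i)) x = A aIDX x" unfolding tk using I(3) by auto
      show ?thesis
        apply (intro vs)
        using J1 J2 J3 H_large by (simp_all only: ev.simps nat_op.simps v fun_upd_same m) (simp_all add: v m)
    qed
    using V ln by simp_all
qed

text \<open>The greedy decomposition repeated inside every block, with threshold \<open>s\<close>.
  Headers are passed over, so that a subblock has fewer than \<open>q\<close> elements and its meets
  fit into table rows.\<close>

definition subpass :: cmd where
  "subpass = Asg vnb (Num 0) ;; For vz vn (When Neq (Arr aISH (Var vz)) (Num 1) (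
     sel aSUB 0 aMEM ;; When Leq (Var vs) (Var vc) (
       asgsub ;; Upd aGS (Var vz) (Var vc) ;; Upd aBL (Var vnb) (Var vz) ;; Asg vnb (Var vnb |+| Num 1))))"

lemma mods_subpass [simp]: "mv subpass = {vnb, vz, vc, vw, vj}" "ma subpass = {aMEM, aSUB, aIDX, aGS, aBL}"
  by (auto simp: subpass_def)

definition mems :: "arrs \<Rightarrow> nat \<Rightarrow> bool" where
  "mems A c \<longleftrightarrow> (\<exists>ms. sorted ms \<and> distinct ms \<and> set ms = {x. x < n \<and> A aSUB x = Suc c} \<and> length ms \<le> q \<and> A aGS c = length ms \<and>
     (\<forall>j<length ms. A aMEM (c * p + j) = ms ! j \<and> A aIDX (ms ! j) = j))"

text \<open>The counterpart of \<open>binv\<close>, with 0 in \<open>aSUB\<close> for elements not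
  yet in a subblock. The last conjunct is the source of the bound on singletons: with
  \<open>s\<close> or more unassigned elements below it in its block, \<open>v\<close> would have
  become the top of a subblock.\<close>

definition sinv :: "nat \<Rightarrow> vars \<Rightarrow> arrs \<Rightarrow> bool" where
  "sinv z V A \<longleftrightarrow>
    (\<forall>x<n. \<forall>c. A aSUB x = Suc c \<longrightarrow> c < z \<and> le x c \<and> A aBLK c = A aBLK x \<and> A aSUB c = Suc c) \<and>
    (\<forall>x y. le x y \<longrightarrow> A aBLK x = A aBLK y \<longrightarrow> A aSUB y \<noteq> 0 \<longrightarrow> A aSUB x \<noteq> 0 \<and> A aSUB x \<le> A aSUB y) \<and>
    (\<forall>c<n. A aSUB c = Suc c \<longrightarrow> mems A c) \<and>
    (\<exists>bl. V vnb = length bl \<and> set bl = {c. c < n \<and> A aSUB c = Suc c} \<and> (\<forall>j<length bl. A aBL j = bl ! j) \<and>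
       length bl * s \<le> card {x. x < n \<and> A aSUB x \<noteq> 0}) \<and>
    (\<forall>v<z. A aISH v \<noteq> 1 \<longrightarrow> card {x. le x v \<and> A aBLK x = A aBLK v \<and> A aSUB x = 0} < s)"

lemma runs_subpass:
  assumes V: "V vn = n" "V vp = p" "V vs = s" and b: "binv n Vo A" and z: "\<forall>x<n. A aSUB x = 0"
  shows "runs subpass V A (4 + n * (n * 120 + 60)) (\<lambda>V' A'. sinv n V' A')"
proof -
  note b5 = b[unfolded binv_def, THEN conjunct2, THEN conjunct2, THEN conjunct2, THEN conjunct2]
  note P5 = b5[THEN conjunct1, rule_format]
  note P6 = b5[THEN conjunct2, THEN conjunct1, rule_format]
  show ?thesis
    unfolding subpass_def
    apply (intro vs)
    apply (rule vFor[where m = n and B = "n * 120 + 58" and I = sinv])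
    subgoal premises pr for z V' A'
    proof -
      have v: "V' vn = n" "V' vp = p" "V' vs = s" "V' vz = z" "A' aLE = A aLE" "A' aBLK = A aBLK" "A' aISH = A aISH"
        using pr(2)[simplified] pr(3) V by (simp_all add: frame_def)
      note q' = pr(4)[unfolded sinv_def v]
      note Q1 = q'[THEN conjunct1, rule_format] and q2 = q'[THEN conjunct2]
      note Q2 = q2[THEN conjunct1, rule_format] and q3 = q2[THEN conjunct2]
      note Q3 = q3[THEN conjunct1, rule_format] and q4 = q3[THEN conjunct2]
      note Q4 = q4[THEN conjunct1] and Q5 = q4[THEN conjunct2, rule_format]
      show ?thesis
      proof (cases "A aISH z = 1")
        case True
        have "sinv (Suc z) V1 A'" if "V1 vnb = V' vnb" for V1
          unfolding sinv_def v that
        proof (intro conjI)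
          show "\<forall>x<n. \<forall>c. A' aSUB x = Suc c \<longrightarrow> c < Suc z \<and> le x c \<and> A aBLK c = A aBLK x \<and> A' aSUB c = Suc c"
            using Q1 less_SucI by blast
          show "\<forall>v<Suc z. A aISH v \<noteq> 1 \<longrightarrow> card {x. le x v \<and> A aBLK x = A aBLK v \<and> A' aSUB x = 0} < s"
            using Q5 True by (auto simp: less_Suc_eq)
        qed (use Q2 Q3 Q4 in blast)+
        then show ?thesis
          apply (intro vs)
          using True by (simp_all add: v pr(1) ltb)
      next
        case False
        define P where "P x \<longleftrightarrow> le x z \<and> A aBLK x = A aBLK z \<and> A' aSUB x = 0" for x
        let ?ls = "filter P [0..<n]"
        have P: "\<forall>w<n. P w \<longleftrightarrow> A' aLE (z * n + w) = 1 \<and> A' aBLK w = A' aBLK z \<and> A' aSUB w = 0"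
          using P5[OF pr(1)] unfolding P_def v by blast
        have sl: "set ?ls = {x. le x z \<and> A aBLK x = A aBLK z \<and> A' aSUB x = 0}" using le_lt by (auto simp: P_def)
        have dl: "distinct ?ls" "sorted ?ls" by (simp_all add: sorted_wrt_filter)
        have cl: "card {x. le x z \<and> A aBLK x = A aBLK z \<and> A' aSUB x = 0} = length ?ls"
          using distinct_card[OF dl(1)] sl by simp
        have lq: "length ?ls < q"
        proof -
          have "card {x. le x z \<and> A aBLK x = A aBLK z \<and> A' aSUB x = 0} \<le> card {x. x < n \<and> A aLE (z * n + x) = 1}"
            by (rule card_mono) (use P5[OF pr(1)] le_lt in auto)
          then show ?thesis using P6[OF pr(1)] False cl by simp
        qed
        have ln: "length ?ls \<le> n" using length_filter_le[of P "[0..<n]"] by simp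
        have z0: "A' aSUB z = 0"
        proof (rule ccontr)
          assume "A' aSUB z \<noteq> 0"
          then obtain c where "A' aSUB z = Suc c" using not0_implies_Suc by blast
          then have "c < z" "le z c" using Q1[OF pr(1)] by blast+
          then show False using le_mono[of z c] by simp
        qed
        have zin: "z \<in> set ?ls" unfolding sl using z0 le_refl[OF pr(1)] by simp
        show ?thesis
          apply (intro vs)
          apply (rule vcut[OF _ _ runs_sel[where z = z and P = P]])
          subgoal premises p1 for V1 A1
          proof -
            have v1: "V1 vn = n" "V1 vp = p" "V1 vs = s" "V1 vz = z" "V1 vnb = V' vnb" "V1 vc = length ?ls"
              "A1 aSUB = A' aSUB" "A1 aIDX = A' aIDX" "A1 aGS = A' aGS" "A1 aBL = A' aBL" "A1 aBLK = A aBLK" "A1 aISH = A aISH"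
              using p1(2)[simplified] p1(3) v by (simp_all add: frame_def)
            have mm: "\<forall>j<length ?ls. A1 aMEM (z * p + j) = ?ls ! j" "row_eq z (A' aMEM) (A1 aMEM)" using p1(3) v1(6) by auto
            \<comment> \<open>Older subblocks keep their data: a new one takes unassigned elements
              only and writes to a row of its own.\<close>
            have memo: "mems A2 c" if c: "mems A' c" "c \<noteq> z" "{x. x < n \<and> A2 aSUB x = Suc c} = {x. x < n \<and> A' aSUB x = Suc c}"
              "\<And>x. x < n \<Longrightarrow> A' aSUB x = Suc c \<Longrightarrow> A2 aIDX x = A' aIDX x" "A2 aGS c = A' aGS c" "A2 aMEM = A1 aMEM" for A2 c
            proof -
              obtain ms where ms: "sorted ms" "distinct ms" "set ms = {x. x < n \<and> A' aSUB x = Suc c}" "length ms \<le> q"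
                "A' aGS c = length ms" "\<forall>j<length ms. A' aMEM (c * p + j) = ms ! j \<and> A' aIDX (ms ! j) = j"
                using c(1) unfolding mems_def by blast
              have "\<forall>j<length ms. A2 aMEM (c * p + j) = ms ! j \<and> A2 aIDX (ms ! j) = j"
              proof (intro allI impI)
                fix j assume j: "j < length ms"
                then have "j < p" using ms(4) pos by simp
                then have "A2 aMEM (c * p + j) = A' aMEM (c * p + j)" using mm(2) c(2,6) by (simp add: row_eq_def)
                moreover have "A2 aIDX (ms ! j) = A' aIDX (ms ! j)" using c(4) ms(3) nth_mem[OF j] by blast
                ultimately show "A2 aMEM (c * p + j) = ms ! j \<and> A2 aIDX (ms ! j) = j" using ms(6) j by simp
              qed
              then show ?thesis unfolding mems_def c(3,5) using ms by blast
            qed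
            show ?thesis
            proof (cases "s \<le> length ?ls")
              case small: False
              have "sinv (Suc z) V2 A1" if "V2 vnb = V' vnb" for V2
                unfolding sinv_def v1 that
              proof (intro conjI)
                show "\<forall>x<n. \<forall>c. A' aSUB x = Suc c \<longrightarrow> c < Suc z \<and> le x c \<and> A aBLK c = A aBLK x \<and> A' aSUB c = Suc c"
                  using Q1 less_SucI by blast
                show "\<forall>c<n. A' aSUB c = Suc c \<longrightarrow> mems A1 c"
                proof (intro allI impI)
                  fix c assume c: "c < n" "A' aSUB c = Suc c"
                  show "mems A1 c" by (rule memo[OF Q3[OF c]]) (use c z0 v1 in auto)
                qed
                show "\<forall>v<Suc z. A aISH v \<noteq> 1 \<longrightarrow> card {x. le x v \<and> A aBLK x = A aBLK v \<and> A' aSUB x = 0} < s"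
                  using Q5 small cl by (auto simp: less_Suc_eq)
              qed (use Q2 Q4 in blast)+
              then show ?thesis
                apply (intro vs)
                using small by (simp_all add: v1)
            next
              case big: True
              show ?thesis
                apply (intro vs)
                apply (rule vcut[OF _ _ runs_asgsub[where z = z and ls = ?ls]])
                subgoal premises p2 for V2 A2
                proof -
                  have v2: "V2 vz = z" "V2 vnb = V' vnb" "V2 vc = length ?ls" "A2 aGS = A' aGS" "A2 aBL = A' aBL" "A2 aBLK = A aBLK" "A2 aISH = A aISH"
                    "A2 aMEM = A1 aMEM"
                    using p2(2)[simplified] v1 by (simp_all add: frame_def)
                  define L where "L = set ?ls"
                  have sb: "\<And>x. x < n \<Longrightarrow> A2 aSUB x = (if x \<in> L then Suc z else A' aSUB x)"
                    and ix1: "\<And>j. j < length ?ls \<Longrightarrow> A2 aIDX (?ls ! j) = j" and ix2: "\<And>x. x < n \<Longrightarrow> x \<notin> L \<Longrightarrow> A2 aIDX x = A' aIDX x"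
                    using p2(3) v1 unfolding L_def by auto
                  have inl: "x \<in> L \<longleftrightarrow> le x z \<and> A aBLK x = A aBLK z \<and> A' aSUB x = 0" for x unfolding L_def sl by blast
                  have zL: "z \<in> L" using zin by (simp only: L_def)
                  have fL: "finite L" "card L = length ?ls" using distinct_card[OF dl(1)] by (simp_all only: L_def finite_set)
                  have szz: "A' aSUB x \<le> z" if "x < n" for x using Q1[OF that] by (cases "A' aSUB x") auto
                  obtain bl where bl: "V' vnb = length bl" "set bl = {c. c < n \<and> A' aSUB c = Suc c}" "\<forall>j<length bl. A' aBL j = bl ! j"
                    "length bl * s \<le> card {x. x < n \<and> A' aSUB x \<noteq> 0}" using Q4 by blast
                  have dis: "card {x. x < n \<and> A2 aSUB x \<noteq> 0} = card {x. x < n \<and> A' aSUB x \<noteq> 0} + length ?ls"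
                  proof -
                    have "{x. x < n \<and> A2 aSUB x \<noteq> 0} = {x. x < n \<and> A' aSUB x \<noteq> 0} \<union> L" using sb inl le_lt by (auto split: if_splits)
                    moreover have "card ({x. x < n \<and> A' aSUB x \<noteq> 0} \<union> L) = card {x. x < n \<and> A' aSUB x \<noteq> 0} + card (L)"
                      by (rule card_Un_disjoint) (use inl fL in auto)
                    ultimately show ?thesis using fL by simp
                  qed
                  have bls: "length (bl @ [z]) * s \<le> card {x. x < n \<and> A2 aSUB x \<noteq> 0}" using dis bl(4) big by simp
                  have bln: "length bl < n"
                  proof -
                    have "length (bl @ [z]) * s \<le> card {..<n}" by (rule order_trans[OF bls card_mono]) auto
                    moreover have "length (bl @ [z]) * 1 \<le> length (bl @ [z]) * s" using s_pos by (intro mult_le_mono) auto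
                    ultimately show ?thesis by simp
                  qed
                  have "sinv (Suc z) V3 A3" if t: "V3 vnb = Suc (length bl)" "A3 aSUB = A2 aSUB" "A3 aIDX = A2 aIDX" "A3 aMEM = A1 aMEM"
                    "A3 aGS = (A' aGS)(z := length ?ls)" "A3 aBL = (A' aBL)(length bl := z)" "A3 aBLK = A aBLK" "A3 aISH = A aISH" for V3 A3
                    unfolding sinv_def t(1,2,6,7,8)
                  proof (intro conjI)
                    show "\<forall>x<n. \<forall>c. A2 aSUB x = Suc c \<longrightarrow> c < Suc z \<and> le x c \<and> A aBLK c = A aBLK x \<and> A2 aSUB c = Suc c"
                    proof (intro allI impI)
                      fix x c assume x: "x < n" "A2 aSUB x = Suc c"
                      show "c < Suc z \<and> le x c \<and> A aBLK c = A aBLK x \<and> A2 aSUB c = Suc c"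
                      proof (cases "x \<in> L")
                        case True
                        then have "c = z" using x sb by simp
                        then show ?thesis using True inl zL sb[OF pr(1)] by simp
                      next
                        case False
                        then have s': "A' aSUB x = Suc c" using x sb by simp
                        have "c \<notin> L" "c < n" using Q1[OF x(1) s'] inl le_lt by auto
                        then show ?thesis using Q1[OF x(1) s'] sb by simp
                      qed
                    qed
                    show "\<forall>x y. le x y \<longrightarrow> A aBLK x = A aBLK y \<longrightarrow> A2 aSUB y \<noteq> 0 \<longrightarrow> A2 aSUB x \<noteq> 0 \<and> A2 aSUB x \<le> A2 aSUB y"
                    proof (intro allI impI)
                      fix x y assume xy: "le x y" "A aBLK x = A aBLK y" "A2 aSUB y \<noteq> 0"
                      have lt: "x < n" "y < n" using le_lt xy(1) by blast+
                      show "A2 aSUB x \<noteq> 0 \<and> A2 aSUB x \<le> A2 aSUB y"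
                      proof (cases "y \<in> L")
                        case True
                        then have "le x z" "A aBLK x = A aBLK z" using inl xy le_trans by auto
                        then show ?thesis using sb lt True szz[OF lt(1)] inl by auto
                      next
                        case False
                        then have "A' aSUB x \<noteq> 0 \<and> A' aSUB x \<le> A' aSUB y" using Q2[OF xy(1,2)] xy(3) sb[OF lt(2)] by simp
                        then show ?thesis using False sb lt inl by auto
                      qed
                    qed
                    show "\<forall>c<n. A2 aSUB c = Suc c \<longrightarrow> mems A3 c"
                    proof (intro allI impI)
                      fix c assume c: "c < n" "A2 aSUB c = Suc c"
                      show "mems A3 c"
                      proof (cases "c = z")
                        case True
                        have "x \<in> L \<longleftrightarrow> x < n \<and> A3 aSUB x = Suc z" for x
                        proof (cases "x < n")
                          case x: True
                          show ?thesis using sb[OF x] szz[OF x] x unfolding t(2) by (cases "x \<in> L") simp_all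
                        next
                          case False
                          then show ?thesis using inl[of x] le_lt[of x z] by blast
                        qed
                        then have "set ?ls = {x. x < n \<and> A3 aSUB x = Suc z}" unfolding L_def by blast
                        then show ?thesis unfolding mems_def True using dl lq mm(1) ix1 t
                          by (intro exI[of _ ?ls]) simp
                      next
                        case False
                        then have cl': "c \<notin> L" using c sb[OF c(1)] by auto
                        then have c': "A' aSUB c = Suc c" using c sb by simp
                        show ?thesis
                        proof (rule memo[OF Q3[OF c(1) c'] False])
                          show "{x. x < n \<and> A3 aSUB x = Suc c} = {x. x < n \<and> A' aSUB x = Suc c}"
                          proof (intro Collect_cong conj_cong refl)
                            fix x assume x: "x < n"
                            show "(A3 aSUB x = Suc c) = (A' aSUB x = Suc c)"
                              using sb[OF x] inl[of x] False unfolding t(2) by (cases "x \<in> L") simp_all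
                          qed
                          fix x assume "x < n" "A' aSUB x = Suc c"
                          then show "A3 aIDX x = A' aIDX x" using ix2 inl t(3) by simp
                        qed (use t False in simp_all)
                      qed
                    qed
                    show "\<exists>bl'. Suc (length bl) = length bl' \<and> set bl' = {c. c < n \<and> A2 aSUB c = Suc c} \<and>
                      (\<forall>j<length bl'. ((A' aBL)(length bl := z)) j = bl' ! j) \<and> length bl' * s \<le> card {x. x < n \<and> A2 aSUB x \<noteq> 0}"
                    proof (intro exI[of _ "bl @ [z]"] conjI)
                      show "set (bl @ [z]) = {c. c < n \<and> A2 aSUB c = Suc c}"
                      proof (rule set_eqI)
                        fix x show "x \<in> set (bl @ [z]) \<longleftrightarrow> x \<in> {c. c < n \<and> A2 aSUB c = Suc c}"
                          using bl(2) sb[of x] inl[of x] zL pr(1) by (cases "x < n"; cases "x \<in> L"; cases "x = z") auto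
                      qed
                    qed (use bl(3) bls in \<open>auto simp: nth_append less_Suc_eq\<close>)
                    show "\<forall>v<Suc z. A aISH v \<noteq> 1 \<longrightarrow> card {x. le x v \<and> A aBLK x = A aBLK v \<and> A2 aSUB x = 0} < s"
                    proof (intro allI impI)
                      fix v assume vz: "v < Suc z" "A aISH v \<noteq> 1"
                      show "card {x. le x v \<and> A aBLK x = A aBLK v \<and> A2 aSUB x = 0} < s"
                      proof (cases "v = z")
                        case True
                        have "\<not> (le x z \<and> A aBLK x = A aBLK z \<and> A2 aSUB x = 0)" for x
                          using sb[of x] inl[of x] le_lt[of x z] by (cases "x \<in> L") simp_all
                        then have e: "{x. le x v \<and> A aBLK x = A aBLK v \<and> A2 aSUB x = 0} = {}" unfolding True by blast
                        show ?thesis unfolding e using s_pos by simp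
                      next
                        case False
                        have "card {x. le x v \<and> A aBLK x = A aBLK v \<and> A2 aSUB x = 0} \<le> card {x. le x v \<and> A aBLK x = A aBLK v \<and> A' aSUB x = 0}"
                          by (rule card_mono) (use sb le_lt le_fin in \<open>auto split: if_splits\<close>)
                        then show ?thesis using Q5[of v] False vz by simp
                      qed
                    qed
                  qed
                  then show ?thesis
                    apply (intro vs)
                    using H_large by (simp_all add: v2 bl(1) ltb pr(1) bln small_ltH ln)
                qed
                using big by (simp_all add: v1 lq pr(1) dl mm(1)) (use le_lt in \<open>auto simp: P_def\<close>)
            qed
          qed
          using False pr(1) P lq by (simp_all add: v ltb)
      qed
    qed
    subgoal premises pr for V' A' by (rule pr(3))
    subgoal
    proof -
      have z': "A aSUB x = 0" if "le x y" for x y using z le_lt that by blast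
      show ?thesis unfolding sinv_def
      proof (intro conjI)
        show "\<forall>x y. le x y \<longrightarrow> A aBLK x = A aBLK y \<longrightarrow> A aSUB y \<noteq> 0 \<longrightarrow> A aSUB x \<noteq> 0 \<and> A aSUB x \<le> A aSUB y"
          using z le_lt by simp
      qed (use z in \<open>auto intro: exI[of _ "[]"]\<close>)
    qed
    using V H_large by simp_all
qed

end

context bplat
begin

text \<open>The elements left over become subblocks of one element with themselves as top, entered
  into the same tables, so that a look-up need not distinguish the two kinds.\<close>

definition single :: cmd where
  "single = For vw vn (When Eq (Arr aSUB (Var vw)) (Num 0) (
       Upd aSG (Var vw) (Num 1) ;; Upd aSUB (Var vw) (Var vw |+| Num 1))) ;;
     For vw vn (When Eq (Arr aSG (Var vw)) (Num 1) (
       Upd aIDX (Var vw) (Num 0) ;; Upd aMEM (ix (Var vw) (Num 0)) (Var vw) ;; Upd aGS (Var vw) (Num 1)))"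

lemma mods_single [simp]: "mv single = {vw}" "ma single = {aSG, aSUB, aIDX, aMEM, aGS}" by (auto simp: single_def)

definition subok :: "vars \<Rightarrow> arrs \<Rightarrow> bool" where
  "subok V A \<longleftrightarrow>
    (\<forall>x<n. \<exists>c. A aSUB x = Suc c \<and> le x c \<and> A aBLK c = A aBLK x \<and> A aSUB c = Suc c) \<and>
    (\<forall>x<n. \<forall>c. A aSUB x = Suc c \<longrightarrow> A aSG c = 1 \<longrightarrow> x = c) \<and>
    (\<forall>x y. le x y \<longrightarrow> A aBLK x = A aBLK y \<longrightarrow> A aSG y \<noteq> 1 \<longrightarrow> A aSG x \<noteq> 1 \<and> A aSUB x \<le> A aSUB y) \<and>
    (\<forall>c<n. A aSUB c = Suc c \<longrightarrow> mems A c) \<and>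
    (\<exists>bl. V vnb = length bl \<and> set bl = {c. c < n \<and> A aSUB c = Suc c \<and> A aSG c \<noteq> 1} \<and> (\<forall>j<length bl. A aBL j = bl ! j) \<and>
       length bl * s \<le> n) \<and>
    (\<forall>v<n. A aISH v \<noteq> 1 \<longrightarrow> card {x. le x v \<and> A aBLK x = A aBLK v \<and> A aSG x = 1} < s)"

lemma runs_single:
  assumes V: "V vn = n" "V vp = p" and i: "sinv n V A" and z: "\<forall>x<n. A aSG x = 0"
  shows "runs single V A (4 + n * 90) (\<lambda>V' A'. subok V' A')"
proof -
  note q' = i[unfolded sinv_def]
  note Q1 = q'[THEN conjunct1, rule_format] and q2 = q'[THEN conjunct2]
  note Q2 = q2[THEN conjunct1, rule_format] and q3 = q2[THEN conjunct2]
  note Q3 = q3[THEN conjunct1, rule_format] and q4 = q3[THEN conjunct2]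
  note Q4 = q4[THEN conjunct1] and Q5 = q4[THEN conjunct2, rule_format]
  show ?thesis
    unfolding single_def
    apply (rule vcut[where Tc = "2 + n * 30" and P = "\<lambda>V1 A1. \<forall>x<n. A1 aSUB x = (if A aSUB x = 0 then Suc x else A aSUB x) \<and>
      A1 aSG x = (if A aSUB x = 0 then 1 else 0)"])
    subgoal premises p1 for V1 A1
    proof -
      have v1: "V1 vn = n" "V1 vp = p" "V1 vnb = V vnb" "A1 aIDX = A aIDX" "A1 aMEM = A aMEM" "A1 aGS = A aGS" "A1 aBLK = A aBLK" "A1 aISH = A aISH" "A1 aBL = A aBL"
        using p1(1)[simplified] V by (simp_all add: frame_def)
      have sb: "\<And>x. x < n \<Longrightarrow> A1 aSUB x = (if A aSUB x = 0 then Suc x else A aSUB x)"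
        and sg: "\<And>x. x < n \<Longrightarrow> A1 aSG x = (if A aSUB x = 0 then 1 else 0)" using p1(2) by blast+
      show ?thesis
        apply (rule vFor[where m = n and B = 55 and I = "\<lambda>i V2 A2. (\<forall>x<i. A aSUB x = 0 \<longrightarrow> A2 aIDX x = 0 \<and> A2 aMEM (x * p) = x \<and> A2 aGS x = 1) \<and>
          (\<forall>x<n. A aSUB x \<noteq> 0 \<longrightarrow> A2 aIDX x = A aIDX x \<and> A2 aGS x = A aGS x \<and> (\<forall>j<p. A2 aMEM (x * p + j) = A aMEM (x * p + j)))"])
        subgoal premises p2 for x V2 A2
        proof -
          have v2: "V2 vn = n" "V2 vp = p" "V2 vw = x" "A2 aSG = A1 aSG"
            using p2(2)[simplified] p2(3) v1 by (simp_all add: frame_def)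
          have idx: "x < N" "x * p < N" "x < H" using ltb p2(1) ix_ltN[OF p2(1), of 0] pos by auto
          have e0: "y * p = x * p \<longleftrightarrow> y = x" "y * p + j = x * p \<longleftrightarrow> y = x \<and> j = 0" if "j < p" for y j
            using ix_eq[of 0 0 y x] ix_eq[of j 0 y x] that pos by simp_all
          show ?thesis
          proof (cases "A aSUB x = 0")
            case True
            have J: "(\<forall>y<Suc x. A aSUB y = 0 \<longrightarrow> ((A2 aIDX)(x := 0)) y = 0 \<and> ((A2 aMEM)(x * p := x)) (y * p) = y \<and> ((A2 aGS)(x := Suc 0)) y = 1) \<and>
              (\<forall>y<n. A aSUB y \<noteq> 0 \<longrightarrow> ((A2 aIDX)(x := 0)) y = A aIDX y \<and> ((A2 aGS)(x := Suc 0)) y = A aGS y \<and>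
                (\<forall>j<p. ((A2 aMEM)(x * p := x)) (y * p + j) = A aMEM (y * p + j)))"
              using p2(4) True e0 pos by (auto simp: less_Suc_eq)
            show ?thesis
              apply (intro vs)
              using J True H_large by (simp_all add: v2 sg p2(1) idx)
          next
            case False
            have J: "\<forall>y<Suc x. A aSUB y = 0 \<longrightarrow> A2 aIDX y = 0 \<and> A2 aMEM (y * p) = y \<and> A2 aGS y = 1"
              using p2(4) False by (auto simp: less_Suc_eq)
            show ?thesis
              apply (intro vs)
              using J p2(4) False by (simp_all add: v2 sg p2(1) idx)
          qed
        qed
        subgoal premises p2 for V2 A2
        proof -
          have v2: "V2 vnb = V vnb" "A2 aSUB = A1 aSUB" "A2 aSG = A1 aSG" "A2 aBLK = A aBLK" "A2 aISH = A aISH" "A2 aBL = A aBL"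
            using p2(1)[simplified] v1 by (simp_all add: frame_def)
          have M1: "\<And>x. x < n \<Longrightarrow> A aSUB x = 0 \<Longrightarrow> A2 aIDX x = 0 \<and> A2 aMEM (x * p) = x \<and> A2 aGS x = 1"
            and M2: "\<And>x. x < n \<Longrightarrow> A aSUB x \<noteq> 0 \<Longrightarrow> A2 aIDX x = A aIDX x \<and> A2 aGS x = A aGS x \<and> (\<forall>j<p. A2 aMEM (x * p + j) = A aMEM (x * p + j))"
            using p2(3) by blast+
          have sgb: "A1 aSG x \<noteq> 1 \<longleftrightarrow> A aSUB x \<noteq> 0" if "x < n" for x using sg[OF that] by simp
          show ?thesis
            unfolding subok_def v2
          proof (intro conjI)
            show "\<forall>x<n. \<exists>c. A1 aSUB x = Suc c \<and> le x c \<and> A aBLK c = A aBLK x \<and> A1 aSUB c = Suc c"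
            proof (intro allI impI)
              fix x assume x: "x < n"
              show "\<exists>c. A1 aSUB x = Suc c \<and> le x c \<and> A aBLK c = A aBLK x \<and> A1 aSUB c = Suc c"
              proof (cases "A aSUB x")
                case 0 then show ?thesis using sb x le_refl by simp
              next
                case (Suc c)
                then show ?thesis using sb[OF x] sb[of c] Q1[OF x Suc] by (intro exI[of _ c]) simp
              qed
            qed
            show "\<forall>x<n. \<forall>c. A1 aSUB x = Suc c \<longrightarrow> A1 aSG c = 1 \<longrightarrow> x = c"
            proof (intro allI impI)
              fix x c assume x: "x < n" "A1 aSUB x = Suc c" "A1 aSG c = 1"
              show "x = c"
              proof (cases "A aSUB x")
                case 0 then show ?thesis using sb[OF x(1)] x(2) by simp
              next
                case (Suc d)
                then have "A aSUB c = Suc c" "c < n" using sb[OF x(1)] x(2) Q1[OF x(1) Suc] by simp_all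
                then show ?thesis using sg x(3) by simp
              qed
            qed
            show "\<forall>x y. le x y \<longrightarrow> A aBLK x = A aBLK y \<longrightarrow> A1 aSG y \<noteq> 1 \<longrightarrow> A1 aSG x \<noteq> 1 \<and> A1 aSUB x \<le> A1 aSUB y"
            proof (intro allI impI)
              fix x y assume xy: "le x y" "A aBLK x = A aBLK y" "A1 aSG y \<noteq> 1"
              have lt: "x < n" "y < n" using le_lt xy(1) by blast+
              then show "A1 aSG x \<noteq> 1 \<and> A1 aSUB x \<le> A1 aSUB y" using Q2[OF xy(1,2)] xy(3) sgb sb by simp
            qed
            show "\<forall>c<n. A1 aSUB c = Suc c \<longrightarrow> mems A2 c"
            proof (intro allI impI)
              fix c assume c: "c < n" "A1 aSUB c = Suc c"
              show "mems A2 c"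
              proof (cases "A aSUB c = 0")
                case True
                have "x = c" if "x < n" "A1 aSUB x = Suc c" for x
                proof (cases "A aSUB x")
                  case 0 then show ?thesis using sb that by simp
                next
                  case (Suc d)
                  then show ?thesis using sb[OF that(1)] that(2) Q1[OF that(1) Suc] True by simp
                qed
                then have "{x. x < n \<and> A2 aSUB x = Suc c} = {c}" using c v2 by auto
                then show ?thesis unfolding mems_def using M1[OF c(1) True] q_pos by (intro exI[of _ "[c]"]) simp
              next
                case False
                then have "A aSUB c = Suc c" using c sb by simp
                then obtain ms where ms: "sorted ms" "distinct ms" "set ms = {x. x < n \<and> A aSUB x = Suc c}" "length ms \<le> q"
                "A aGS c = length ms" "\<forall>j<length ms. A aMEM (c * p + j) = ms ! j \<and> A aIDX (ms ! j) = j"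
                  using Q3[OF c(1)] unfolding mems_def by blast
                have "{x. x < n \<and> A2 aSUB x = Suc c} = {x. x < n \<and> A aSUB x = Suc c}"
                proof (intro Collect_cong conj_cong refl)
                  fix x assume x: "x < n"
                  show "(A2 aSUB x = Suc c) = (A aSUB x = Suc c)" using sb[OF x] False unfolding v2 by (cases "x = c") auto
                qed
                moreover have "\<forall>j<length ms. A2 aMEM (c * p + j) = ms ! j \<and> A2 aIDX (ms ! j) = j"
                proof (intro allI impI)
                  fix j assume j: "j < length ms"
                  then have "ms ! j < n" "A aSUB (ms ! j) \<noteq> 0" using ms(3) nth_mem[OF j] by auto
                  moreover have "j < p" using j ms(4) pos by simp
                  ultimately show "A2 aMEM (c * p + j) = ms ! j \<and> A2 aIDX (ms ! j) = j"
                    using M2 ms(6) j c(1) False by simp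
                qed
                ultimately show ?thesis unfolding mems_def using ms M2[OF c(1) False] by (intro exI[of _ ms]) simp
              qed
            qed
            obtain bl where bl: "V vnb = length bl" "set bl = {c. c < n \<and> A aSUB c = Suc c}" "\<forall>j<length bl. A aBL j = bl ! j"
              "length bl * s \<le> card {x. x < n \<and> A aSUB x \<noteq> 0}" using Q4 by blast
            have "card {x. x < n \<and> A aSUB x \<noteq> 0} \<le> card {..<n}" by (rule card_mono) auto
            then have "length bl * s \<le> n" using bl(4) by simp
            moreover have "set bl = {c. c < n \<and> A1 aSUB c = Suc c \<and> A1 aSG c \<noteq> 1}"
              unfolding bl(2)
            proof (intro Collect_cong conj_cong refl)
              fix c assume c: "c < n"
              show "(A aSUB c = Suc c) = (A1 aSUB c = Suc c \<and> A1 aSG c \<noteq> 1)" using sb[OF c] sg[OF c] by auto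
            qed
            ultimately show "\<exists>bl. V vnb = length bl \<and> set bl = {c. c < n \<and> A1 aSUB c = Suc c \<and> A1 aSG c \<noteq> 1} \<and>
              (\<forall>j<length bl. A aBL j = bl ! j) \<and> length bl * s \<le> n" using bl by blast
            show "\<forall>v<n. A aISH v \<noteq> 1 \<longrightarrow> card {x. le x v \<and> A aBLK x = A aBLK v \<and> A1 aSG x = 1} < s"
            proof (intro allI impI)
              fix v assume v: "v < n" "A aISH v \<noteq> 1"
              have "{x. le x v \<and> A aBLK x = A aBLK v \<and> A1 aSG x = 1} = {x. le x v \<and> A aBLK x = A aBLK v \<and> A aSUB x = 0}"
                using sgb le_lt by blast
              then show "card {x. le x v \<and> A aBLK x = A aBLK v \<and> A1 aSG x = 1} < s" using Q5[OF v] by simp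
            qed
          qed
        qed
        using v1 by simp_all
    qed
    subgoal by simp
    apply (rule vFor[where m = n and B = 28 and I = "\<lambda>i V1 A1. \<forall>x<n. A1 aSUB x = (if x < i \<and> A aSUB x = 0 then Suc x else A aSUB x) \<and>
      A1 aSG x = (if x < i \<and> A aSUB x = 0 then 1 else 0)"])
    subgoal premises p1 for x V1 A1
    proof -
      have sx: "A1 aSUB x = A aSUB x" using p1(1,4) by simp
      show ?thesis
        apply (intro vs)
        using p1(4) H_large by (simp_all add: p1(1,3) sx ltb less_Suc_eq)
    qed
    using V z by simp_all
qed

section \<open>Meets inside subblocks\<close>

definition pmset :: "arrs \<Rightarrow> nat set \<Rightarrow> nat \<Rightarrow> nat \<Rightarrow> nat set" where
  "pmset A U a b = {u \<in> U. le u a \<and> le u b}"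

definition pm3 :: cmd where
  "pm3 = For vl vk (Asg vx (Arr aMEM (ix (Var vz) (Var vl))) ;;
     When Eq (Arr aLE (Var vx |*| Var vn |+| Var vu)) (Num 1) (Upd aPM (ix (Var vw) (Var vl)) (Var vu |+| Num 1)))"

definition pm2 :: cmd where
  "pm2 = For vj vk (Asg vw (Arr aMEM (ix (Var vz) (Var vj))) ;;
     When Eq (Arr aLE (Var vw |*| Var vn |+| Var vu)) (Num 1) pm3)"

definition pm1 :: cmd where
  "pm1 = For vi vk (Asg vu (Arr aMEM (ix (Var vz) (Var vi))) ;; pm2)"

definition pmpass :: cmd where
  "pmpass = For vz vn (When Eq (Arr aSUB (Var vz)) (Var vz |+| Num 1) (Asg vk (Arr aGS (Var vz)) ;; pm1))"

lemma mods_pm [simp]: "mv pm3 = {vl, vx}" "ma pm3 = {aPM}" "mv pm2 = {vj, vw, vl, vx}" "ma pm2 = {aPM}"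
  "mv pm1 = {vi, vu, vj, vw, vl, vx}" "ma pm1 = {aPM}" "mv pmpass = {vz, vk, vi, vu, vj, vw, vl, vx}" "ma pmpass = {aPM}"
  by (auto simp: pm1_def pm2_def pm3_def pmpass_def)

text \<open>One round of the three nested loops: \<open>u\<close> becomes the current best lower bound of all pairs above it.\<close>

lemma runs_pm2:
  assumes V: "V vn = n" "V vp = p" "V vz = z" "z < n" "V vk = length ms" "V vu = u" "u < n"
    and ms: "length ms \<le> q" "distinct ms" "\<forall>j<length ms. ms ! j < n \<and> A aMEM (z * p + j) = ms ! j"
    and L: "\<forall>a\<in>set ms. A aLE (a * n + u) = 1 \<longleftrightarrow> le u a"
  shows "runs pm2 V A (2 + length ms * (30 + length ms * 50)) (\<lambda>V' A'.
    (\<forall>a b. a < length ms \<longrightarrow> b < length ms \<longrightarrow> A' aPM (ms ! a * p + b) =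
       (if le u (ms ! a) \<and> le u (ms ! b) then Suc u else A aPM (ms ! a * p + b))) \<and>
    (\<forall>x b. x < n \<longrightarrow> b < p \<longrightarrow> x \<notin> set ms \<longrightarrow> A' aPM (x * p + b) = A aPM (x * p + b)))"
proof -
  have bp: "b < p" "b < N" "b < H" if "b < length ms" for b
  proof -
    show "b < p" using that ms(1) pos by simp
    then show "b < N" "b < H" using ltb by blast+
  qed
  have mlt: "ms ! j < n" "ms ! j < N" "ms ! j < H" "A aMEM (z * p + j) = ms ! j" "z * p + j < N" "ms ! j * n + u < N"
    "ms ! j * p + b < N" if "j < length ms" "b < p" for j b
    using ms(3) that(1) ltb ix_ltN[OF V(4) bp(1)[OF that(1)]] nn_ltN[OF _ V(7)] ix_ltN[OF _ that(2)] by auto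
  have inj: "ms ! a = ms ! b \<longleftrightarrow> a = b" if "a < length ms" "b < length ms" for a b
    using that ms(2) by (simp add: nth_eq_iff_index_eq)
  have Lj: "A aLE (ms ! j * n + u) = Suc 0 \<longleftrightarrow> le u (ms ! j)" if "j < length ms" for j using L that by simp
  have in3: "runs pm3 V1 A1 (2 + length ms * 50) (\<lambda>V2 A2. (\<forall>b<length ms. A2 aPM (ms ! i * p + b) =
       (if le u (ms ! b) then Suc u else A1 aPM (ms ! i * p + b))) \<and>
     (\<forall>x b. x < n \<longrightarrow> b < p \<longrightarrow> x \<noteq> ms ! i \<longrightarrow> A2 aPM (x * p + b) = A1 aPM (x * p + b)))"
    if i: "i < length ms" and v: "V1 vn = n" "V1 vp = p" "V1 vz = z" "V1 vk = length ms" "V1 vu = u" "V1 vw = ms ! i"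
      "A1 aMEM = A aMEM" "A1 aLE = A aLE" for i V1 A1
    unfolding pm3_def
    apply (rule vFor[where m = "length ms" and B = 48 and I = "\<lambda>l V2 A2. (\<forall>b<length ms. A2 aPM (ms ! i * p + b) =
       (if b < l \<and> le u (ms ! b) then Suc u else A1 aPM (ms ! i * p + b))) \<and>
     (\<forall>x b. x < n \<longrightarrow> b < p \<longrightarrow> x \<noteq> ms ! i \<longrightarrow> A2 aPM (x * p + b) = A1 aPM (x * p + b))"])
    subgoal premises pr for l V2 A2
    proof -
      have v2: "V2 vn = n" "V2 vp = p" "V2 vz = z" "V2 vu = u" "V2 vw = ms ! i" "V2 vl = l" "A2 aMEM = A aMEM" "A2 aLE = A aLE"
        using pr(2)[simplified] pr(3) v by (simp_all add: frame_def)
      have lp: "l < p" "l < N" "l < H" using bp[OF pr(1)] by blast+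
      note ml = mlt[OF pr(1) lp(1)] and mi = mlt[OF i lp(1)]
      show ?thesis
        apply (intro vs)
        using pr(4) Lj[OF pr(1)] ltb(3)[OF V(7)] bp(1) by (simp_all add: v2 ml mi lp less_Suc_eq)
    qed
    using v by simp_all
  show ?thesis
    unfolding pm2_def
    apply (rule vFor[where m = "length ms" and B = "28 + length ms * 50" and I = "\<lambda>j V1 A1.
      (\<forall>a b. a < length ms \<longrightarrow> b < length ms \<longrightarrow> A1 aPM (ms ! a * p + b) =
       (if a < j \<and> le u (ms ! a) \<and> le u (ms ! b) then Suc u else A aPM (ms ! a * p + b))) \<and>
      (\<forall>x b. x < n \<longrightarrow> b < p \<longrightarrow> x \<notin> set ms \<longrightarrow> A1 aPM (x * p + b) = A aPM (x * p + b))"])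
    subgoal premises pr for j V1 A1
    proof -
      have v1: "V1 vn = n" "V1 vp = p" "V1 vz = z" "V1 vk = length ms" "V1 vu = u" "V1 vj = j" "A1 aMEM = A aMEM" "A1 aLE = A aLE"
        using pr(2)[simplified] pr(3) V by (simp_all add: frame_def)
      note mj = mlt[OF pr(1) pos(1)]
      have I1: "\<And>a b. a < length ms \<Longrightarrow> b < length ms \<Longrightarrow> A1 aPM (ms ! a * p + b) =
        (if a < j \<and> le u (ms ! a) \<and> le u (ms ! b) then Suc u else A aPM (ms ! a * p + b))"
        and I2: "\<And>x b. x < n \<Longrightarrow> b < p \<Longrightarrow> x \<notin> set ms \<Longrightarrow> A1 aPM (x * p + b) = A aPM (x * p + b)" using pr(4) by blast+
      show ?thesis
      proof (cases "le u (ms ! j)")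
        case True
        show ?thesis
          apply (intro vs)
          apply (rule vuse[OF _ _ in3[OF pr(1)]])
          subgoal premises p2 for V2 A2
          proof -
            have J1: "\<And>b. b < length ms \<Longrightarrow> A2 aPM (ms ! j * p + b) = (if le u (ms ! b) then Suc u else A1 aPM (ms ! j * p + b))"
              and J2: "\<And>x b. x < n \<Longrightarrow> b < p \<Longrightarrow> x \<noteq> ms ! j \<Longrightarrow> A2 aPM (x * p + b) = A1 aPM (x * p + b)" using p2(3) by blast+
            have K1: "A2 aPM (ms ! a * p + b) = (if a < Suc j \<and> le u (ms ! a) \<and> le u (ms ! b) then Suc u else A aPM (ms ! a * p + b))"
              if ab: "a < length ms" "b < length ms" for a b
            proof (cases "a = j")
              case t: True then show ?thesis using J1[OF ab(2)] I1[OF ab] True by simp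
            next
              case False
              then have "ms ! a \<noteq> ms ! j" using inj[OF ab(1) pr(1)] by simp
              then show ?thesis using J2[OF mlt(1)[OF ab(1) pos(1)] bp(1)[OF ab(2)]] I1[OF ab] False by (simp add: less_Suc_eq)
            qed
            have K2: "A2 aPM (x * p + b) = A aPM (x * p + b)" if "x < n" "b < p" "x \<notin> set ms" for x b
              using J2[OF that(1,2)] I2[OF that] that(3) pr(1) nth_mem by metis
            show ?thesis using K1 K2 by simp
          qed
          using True Lj[OF pr(1)] by (simp_all add: v1 mj)
      next
        case False
        have K: "\<And>a b. a < length ms \<Longrightarrow> b < length ms \<Longrightarrow> A1 aPM (ms ! a * p + b) =
          (if a < Suc j \<and> le u (ms ! a) \<and> le u (ms ! b) then Suc u else A aPM (ms ! a * p + b))"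
          using I1 False by (auto simp: less_Suc_eq)
        show ?thesis
          apply (intro vs)
          using False Lj[OF pr(1)] K I2 by (simp_all add: v1 mj)
      qed
    qed
    using V by simp_all
qed

text \<open>The lower bounds \<open>u\<close> are tried by increasing label, so the last one written
  for a pair is the largest.\<close>

lemma runs_pm1:
  assumes V: "V vn = n" "V vp = p" "V vz = z" "z < n" "V vk = length ms"
    and ms: "length ms \<le> q" "distinct ms" "sorted ms" "\<forall>j<length ms. ms ! j < n \<and> A aMEM (z * p + j) = ms ! j"
    and L: "\<forall>a\<in>set ms. \<forall>u\<in>set ms. A aLE (a * n + u) = 1 \<longleftrightarrow> le u a"
    and z: "\<forall>a b. a < length ms \<longrightarrow> b < length ms \<longrightarrow> A aPM (ms ! a * p + b) = 0"
  shows "runs pm1 V A (2 + length ms * (30 + q * (30 + q * 50))) (\<lambda>V' A'.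
    (\<forall>a b. a < length ms \<longrightarrow> b < length ms \<longrightarrow> A' aPM (ms ! a * p + b) = mxs (pmset A (set ms) (ms ! a) (ms ! b))) \<and>
    (\<forall>x b. x < n \<longrightarrow> b < p \<longrightarrow> x \<notin> set ms \<longrightarrow> A' aPM (x * p + b) = A aPM (x * p + b)))"
  unfolding pm1_def
  apply (rule vFor[where m = "length ms" and B = "28 + q * (30 + q * 50)" and I = "\<lambda>i V' A'.
    (\<forall>a b. a < length ms \<longrightarrow> b < length ms \<longrightarrow> A' aPM (ms ! a * p + b) = mxs (pmset A (set (take i ms)) (ms ! a) (ms ! b))) \<and>
    (\<forall>x b. x < n \<longrightarrow> b < p \<longrightarrow> x \<notin> set ms \<longrightarrow> A' aPM (x * p + b) = A aPM (x * p + b))"])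
  subgoal premises pr for i V1 A1
  proof -
    have v1: "V1 vn = n" "V1 vp = p" "V1 vz = z" "V1 vk = length ms" "V1 vi = i" "A1 aMEM = A aMEM" "A1 aLE = A aLE"
      using pr(2)[simplified] pr(3) V by (simp_all add: frame_def)
    have ip: "i < p" using pr(1) ms(1) pos by simp
    have m: "A aMEM (z * p + i) = ms ! i" "ms ! i < n" "ms ! i < H" "z * p + i < N"
      using ms(4) pr(1) ltb ix_ltN[OF V(4) ip] by auto
    have tk: "set (take (Suc i) ms) = insert (ms ! i) (set (take i ms))" using pr(1) by (simp add: take_Suc_conv_app_nth)
    have le': "x \<le> ms ! i" if "x \<in> set (take i ms)" for x
    proof -
      obtain j where "j < i" "x = ms ! j" using \<open>x \<in> set (take i ms)\<close> pr(1) by (auto simp: in_set_conv_nth)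
      then show ?thesis using sorted_nth_mono[OF ms(3), of j i] pr(1) by simp
    qed
    have mx: "mxs (pmset A (set (take (Suc i) ms)) a b) = (if le (ms ! i) a \<and> le (ms ! i) b then Suc (ms ! i)
      else mxs (pmset A (set (take i ms)) a b))" for a b
    proof (cases "le (ms ! i) a \<and> le (ms ! i) b")
      case True
      have "mxs (pmset A (set (take (Suc i) ms)) a b) = Suc (ms ! i)"
        by (rule mxs_eqI) (use le' True in \<open>auto simp: pmset_def tk\<close>)
      then show ?thesis using True by simp
    next
      case False
      then have "pmset A (set (take (Suc i) ms)) a b = pmset A (set (take i ms)) a b" by (auto simp: pmset_def tk)
      then show ?thesis using False by auto
    qed
    have tb: "2 + length ms * (30 + length ms * 50) \<le> 2 + q * (30 + q * 50)" using ms(1) by (intro add_left_mono mult_le_mono) auto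
    show ?thesis
      apply (intro vs)
      apply (rule vuse[OF _ _ runs_pm2[where z = z and u = "ms ! i" and ms = ms]])
      subgoal premises p2 for V2 A2 using p2(2) pr(4) mx by simp
      using tb L ms pr(1) by (simp_all add: v1 m V(4))
  qed
  subgoal premises pr for V' A' using pr(3) by simp
  using V z by (simp_all add: pmset_def mxs_def)

text \<open>The second argument is addressed by its position in the subblock instead of its label.
  Rows of length \<open>p\<close> then suffice for a table indexed by pairs.\<close>

definition pmok :: "arrs \<Rightarrow> bool" where
  "pmok A \<longleftrightarrow> (\<forall>a<n. \<forall>b<n. A aSUB a = A aSUB b \<longrightarrow> A aIDX b < p \<and>
     A aPM (a * p + A aIDX b) = mxs {u. le u a \<and> (le u b \<and> A aSUB u = A aSUB a)})"

text \<open>A subblock with g elements costs O(g * q^2), and the sizes of all subblocks sum to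
  \<open>n\<close>.\<close>

lemma runs_pmpass:
  assumes V: "V vn = n" "V vp = p" and b: "binv n Vo A" and so: "subok Va A" and z: "\<forall>i<N. A aPM i = 0"
  shows "runs pmpass V A (2 + n * 50 + n * (32 + q * (30 + q * 50))) (\<lambda>V' A'. pmok A')"
proof -
  note P5 = b[unfolded binv_def, THEN conjunct2, THEN conjunct2, THEN conjunct2, THEN conjunct2, THEN conjunct1, rule_format]
  note S1 = so[unfolded subok_def, THEN conjunct1, rule_format]
  note S4 = so[unfolded subok_def, THEN conjunct2, THEN conjunct2, THEN conjunct2, THEN conjunct1, rule_format]
  define X where "X = 32 + q * (30 + q * 50)"
  define g where "g c = card {x. x < n \<and> A aSUB x = Suc c}" for c
  define f where "f c = g c * X + 48" for c
  have sg: "(\<Sum>c<n. g c) = n"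
  proof -
    have "(\<Sum>c<n. card {x \<in> {..<n}. A aSUB x - 1 = c}) = card {..<n}"
    proof (rule card_fibres)
      fix x assume "x \<in> {..<n}"
      then obtain c where "A aSUB x = Suc c" "le x c" using S1[of x] by auto
      then show "A aSUB x - 1 < n" using le_lt by simp
    qed simp
    moreover have "{x \<in> {..<n}. A aSUB x - 1 = c} = {x. x < n \<and> A aSUB x = Suc c}" for c
      using S1 by fastforce
    ultimately show ?thesis by (simp add: g_def)
  qed
  have time: "2 + (\<Sum>c<n. f c + 2) \<le> 2 + n * 50 + n * X"
  proof -
    have "f c + 2 = g c * X + 50" for c by (simp add: f_def)
    then have "(\<Sum>c<n. f c + 2) = (\<Sum>c<n. g c) * X + n * 50"
      by (simp only: sum.distrib sum_constant card_lessThan sum_distrib_right of_nat_id)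
    then show ?thesis using sg by simp
  qed
  show ?thesis
    unfolding pmpass_def X_def[symmetric]
    apply (rule vFor_sum[where m = n and f = f and I = "\<lambda>c V' A'.
      (\<forall>a<n. \<forall>b<n. \<forall>d. A aSUB a = Suc d \<longrightarrow> A aSUB b = Suc d \<longrightarrow> d < c \<longrightarrow> A aIDX b < p \<and>
        A' aPM (a * p + A aIDX b) = mxs {u. le u a \<and> (le u b \<and> A aSUB u = Suc d)}) \<and>
      (\<forall>x<n. \<forall>j<p. \<forall>d. A aSUB x = Suc d \<longrightarrow> c \<le> d \<longrightarrow> A' aPM (x * p + j) = 0)"])
    subgoal premises pr for c V1 A1
    proof -
      have v1: "V1 vn = n" "V1 vp = p" "V1 vz = c" "A1 aMEM = A aMEM" "A1 aLE = A aLE" "A1 aSUB = A aSUB" "A1 aGS = A aGS"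
        using pr(2)[simplified] pr(3) V by (simp_all add: frame_def)
      have I1: "\<And>a b d. a < n \<Longrightarrow> b < n \<Longrightarrow> A aSUB a = Suc d \<Longrightarrow> A aSUB b = Suc d \<Longrightarrow> d < c \<Longrightarrow> A aIDX b < p \<and>
        A1 aPM (a * p + A aIDX b) = mxs {u. le u a \<and> (le u b \<and> A aSUB u = Suc d)}"
        and I2: "\<And>x j d. x < n \<Longrightarrow> j < p \<Longrightarrow> A aSUB x = Suc d \<Longrightarrow> c \<le> d \<Longrightarrow> A1 aPM (x * p + j) = 0" using pr(4) by blast+
      show ?thesis
      proof (cases "A aSUB c = Suc c")
        case False
        \<comment> \<open>Subblock numbers of elements are always tops; if \<open>c\<close> is no
          top, no element carries its number.\<close>
        have no: "d \<noteq> c" if "x < n" "A aSUB x = Suc d" for x d using S1[OF that(1)] that(2) False by auto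
        have K1: "\<forall>a<n. \<forall>b<n. \<forall>d. A aSUB a = Suc d \<longrightarrow> A aSUB b = Suc d \<longrightarrow> d < Suc c \<longrightarrow> A aIDX b < p \<and>
          A1 aPM (a * p + A aIDX b) = mxs {u. le u a \<and> (le u b \<and> A aSUB u = Suc d)}"
        proof (intro allI impI)
          fix a b d assume h: "a < n" "b < n" "A aSUB a = Suc d" "A aSUB b = Suc d" "d < Suc c"
          then have "d < c" using no[OF h(1,3)] by simp
          then show "A aIDX b < p \<and> A1 aPM (a * p + A aIDX b) = mxs {u. le u a \<and> (le u b \<and> A aSUB u = Suc d)}"
            using I1[OF h(1-4)] by simp
        qed
        have K2: "\<forall>x<n. \<forall>j<p. \<forall>d. A aSUB x = Suc d \<longrightarrow> Suc c \<le> d \<longrightarrow> A1 aPM (x * p + j) = 0" using I2 Suc_leD by blast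
        show ?thesis
          apply (intro vs)
          using K1 K2 False by (simp_all add: v1 pr(1) ltb f_def)
      next
        case True
        obtain ms where ms: "sorted ms" "distinct ms" "set ms = {x. x < n \<and> A aSUB x = Suc c}" "length ms \<le> q"
          "A aGS c = length ms" "\<forall>j<length ms. A aMEM (c * p + j) = ms ! j \<and> A aIDX (ms ! j) = j"
          using S4[OF pr(1) True] unfolding mems_def by blast
        have gl: "g c = length ms" using distinct_card[OF ms(2)] ms(3) by (simp add: g_def)
        have mn: "\<forall>j<length ms. ms ! j < n \<and> A aMEM (c * p + j) = ms ! j" using ms(3,6) nth_mem by blast
        \<comment> \<open>Members of a subblock share a block, and there the row of
          \<open>aLE\<close> is exact.\<close>
        have L: "\<forall>a\<in>set ms. \<forall>u\<in>set ms. A aLE (a * n + u) = 1 \<longleftrightarrow> le u a"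
        proof (intro ballI)
          fix a u assume "a \<in> set ms" "u \<in> set ms"
          then have au: "a < n" "u < n" "A aSUB a = Suc c" "A aSUB u = Suc c" using ms(3) by auto
          have "A aBLK a = A aBLK c" "A aBLK u = A aBLK c" using S1[OF au(1)] S1[OF au(2)] au(3,4) by auto
          then show "A aLE (a * n + u) = 1 \<longleftrightarrow> le u a" using P5[OF au(1,2)] by auto
        qed
        have z0: "\<forall>a b. a < length ms \<longrightarrow> b < length ms \<longrightarrow> A1 aPM (ms ! a * p + b) = 0"
        proof (intro allI impI)
          fix a b assume ab: "a < length ms" "b < length ms"
          have "ms ! a < n" "A aSUB (ms ! a) = Suc c" using ms(3) nth_mem[OF ab(1)] by auto
          moreover have "b < p" using ab(2) ms(4) pos by simp
          ultimately show "A1 aPM (ms ! a * p + b) = 0" using I2 by blast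
        qed
        have lH: "length ms < H" using ms(4) small_ltH by blast
        have tb: "2 + length ms * (30 + q * (30 + q * 50)) \<le> g c * X + 2"
          unfolding gl X_def by (simp add: algebra_simps)
        show ?thesis
          apply (intro vs)
          apply (rule vuse[OF _ _ runs_pm1[where z = c and ms = ms]])
          subgoal premises p2 for V2 A2
          proof -
            have J1: "\<And>a b. a < length ms \<Longrightarrow> b < length ms \<Longrightarrow> A2 aPM (ms ! a * p + b) = mxs (pmset A1 (set ms) (ms ! a) (ms ! b))"
              and J2: "\<And>x b. x < n \<Longrightarrow> b < p \<Longrightarrow> x \<notin> set ms \<Longrightarrow> A2 aPM (x * p + b) = A1 aPM (x * p + b)" using p2(3) by blast+
            have K1: "A aIDX b < p \<and> A2 aPM (a * p + A aIDX b) = mxs {u. le u a \<and> (le u b \<and> A aSUB u = Suc d)}"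
              if a: "a < n" "b < n" "A aSUB a = Suc d" "A aSUB b = Suc d" "d < Suc c" for a b d
            proof (cases "d = c")
              case d: True
              then have "a \<in> set ms" "b \<in> set ms" using ms(3) a by auto
              then obtain i j where ij: "i < length ms" "ms ! i = a" "j < length ms" "ms ! j = b" by (auto simp: in_set_conv_nth)
              have "A aIDX b = j" using ms(6) ij by blast
              moreover have "pmset A1 (set ms) a b = {u. le u a \<and> (le u b \<and> A aSUB u = Suc d)}"
                unfolding pmset_def ms(3) d using le_lt by blast
              ultimately show ?thesis using J1[OF ij(1,3)] ij ms(4) pos by simp
            next
              case d: False
              then have "d < c" "a \<notin> set ms" using a ms(3) by auto
              then show ?thesis using I1[OF a(1-4)] J2[OF a(1)] by simp
            qed
            have K2: "A2 aPM (x * p + j) = 0" if "x < n" "j < p" "A aSUB x = Suc d" "Suc c \<le> d" for x j d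
            proof -
              have "x \<notin> set ms" using ms(3) that by auto
              then show ?thesis using J2[OF that(1,2)] I2[OF that(1-3)] that(4) by simp
            qed
            show ?thesis using K1 K2 by blast
          qed
          using True tb L ms(1,2,4,5) mn z0 lH by (simp_all add: v1 pr(1) ltb f_def)
      qed
    qed
    subgoal premises pr for V' A'
    proof -
      have v: "A' aSUB = A aSUB" "A' aIDX = A aIDX" using pr(1)[simplified] by (simp_all add: frame_def)
      show ?thesis
        unfolding pmok_def v
      proof (intro allI impI)
        fix a b assume ab: "a < n" "b < n" "A aSUB a = A aSUB b"
        obtain d where d: "A aSUB a = Suc d" "le a d" using S1[OF ab(1)] by blast
        then show "A aIDX b < p \<and> A' aPM (a * p + A aIDX b) = mxs {u. le u a \<and> (le u b \<and> A aSUB u = A aSUB a)}"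
          using pr(3) ab le_lt[OF d(2)] by simp
      qed
    qed
    using V z ix_ltN time by simp_all
qed

section \<open>Lists of singletons\<close>

definition slpass :: cmd where
  "slpass = For vz vn (When Neq (Arr aISH (Var vz)) (Num 1) (sel aSG 1 aSL ;; Upd aNSL (Var vz) (Var vc)))"

lemma mods_slpass [simp]: "mv slpass = {vz, vc, vw}" "ma slpass = {aSL, aNSL}" by (auto simp: slpass_def)

text \<open>A query cannot afford to try all singletons of the lattice, hence a list of its own,
  shorter than \<open>s\<close>, for every element other than a header.\<close>

definition slok :: "nat \<Rightarrow> arrs \<Rightarrow> bool" where
  "slok m A \<longleftrightarrow> (\<forall>z<m. A aISH z \<noteq> 1 \<longrightarrow> A aNSL z < s \<and>
     (\<lambda>j. A aSL (z * p + j)) ` {..<A aNSL z} = {x. le x z \<and> A aBLK x = A aBLK z \<and> A aSG x = 1})"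

lemma runs_slpass:
  assumes V: "V vn = n" "V vp = p" and b: "binv n Vo A" and so: "subok Va A"
  shows "runs slpass V A (2 + n * (n * 60 + 40)) (\<lambda>V' A'. slok n A')"
proof -
  note P5 = b[unfolded binv_def, THEN conjunct2, THEN conjunct2, THEN conjunct2, THEN conjunct2, THEN conjunct1, rule_format]
  note S6 = so[unfolded subok_def, THEN conjunct2, THEN conjunct2, THEN conjunct2, THEN conjunct2, THEN conjunct2, rule_format]
  show ?thesis
    unfolding slpass_def
    apply (rule vFor[where m = n and B = "n * 60 + 38" and I = "\<lambda>z V' A'. slok z A'"])
    subgoal premises pr for z V' A'
    proof -
      have v: "V' vn = n" "V' vp = p" "V' vz = z" "A' aLE = A aLE" "A' aBLK = A aBLK" "A' aISH = A aISH" "A' aSG = A aSG"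
        using pr(2)[simplified] pr(3) V by (simp_all add: frame_def)
      show ?thesis
      proof (cases "A aISH z = 1")
        case True
        have "slok (Suc z) A'" using pr(4) True unfolding slok_def by (auto simp: less_Suc_eq v)
        then show ?thesis
          apply (intro vs)
          using True by (simp_all add: v pr(1) ltb)
      next
        case False
        define P where "P x \<longleftrightarrow> le x z \<and> A aBLK x = A aBLK z \<and> A aSG x = 1" for x
        let ?ls = "filter P [0..<n]"
        have P: "\<forall>w<n. P w \<longleftrightarrow> A' aLE (z * n + w) = 1 \<and> A' aBLK w = A' aBLK z \<and> A' aSG w = 1"
          using P5[OF pr(1)] unfolding P_def v by blast
        have sl: "set ?ls = {x. le x z \<and> A aBLK x = A aBLK z \<and> A aSG x = 1}" using le_lt by (auto simp: P_def)
        have "length ?ls = card (set ?ls)" by (rule distinct_card[symmetric]) simp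
        then have ls: "length ?ls < s" unfolding sl using S6[OF pr(1) False] by simp
        then have lq: "length ?ls < q" "length ?ls < H" using s_le small_ltH(5)[of "length ?ls"] by linarith+
        show ?thesis
          apply (intro vs)
          apply (rule vcut[OF _ _ runs_sel[where z = z and P = P]])
          subgoal premises p1 for V1 A1
          proof -
            have v1: "V1 vz = z" "V1 vc = length ?ls" "A1 aNSL = A' aNSL" "A1 aISH = A aISH" "A1 aBLK = A aBLK" "A1 aSG = A aSG"
              using p1(2)[simplified] p1(3) v by (simp_all add: frame_def)
            have mm: "\<forall>j<length ?ls. A1 aSL (z * p + j) = ?ls ! j" "row_eq z (A' aSL) (A1 aSL)" using p1(3) v1(2) by auto
            have "slok (Suc z) A2" if t: "A2 aSL = A1 aSL" "A2 aNSL = (A' aNSL)(z := length ?ls)" "A2 aISH = A aISH" "A2 aBLK = A aBLK" "A2 aSG = A aSG" for A2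
              unfolding slok_def t(1,3,4,5)
            proof (intro allI impI)
              fix y assume y: "y < Suc z" "A aISH y \<noteq> 1"
              show "A2 aNSL y < s \<and> (\<lambda>j. A1 aSL (y * p + j)) ` {..<A2 aNSL y} = {x. le x y \<and> A aBLK x = A aBLK y \<and> A aSG x = 1}"
              proof (cases "y = z")
                case True
                have "(\<lambda>j. A1 aSL (z * p + j)) ` {..<length ?ls} = (!) ?ls ` {..<length ?ls}" using mm(1) by (intro image_cong) auto
                also have "\<dots> = set ?ls" by (auto simp: set_conv_nth)
                finally show ?thesis using True t(2) ls sl by simp
              next
                case f: False
                then have o: "A' aNSL y < s" "(\<lambda>j. A' aSL (y * p + j)) ` {..<A' aNSL y} = {x. le x y \<and> A aBLK x = A aBLK y \<and> A aSG x = 1}"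
                  using pr(4) y unfolding slok_def v by (auto simp: less_Suc_eq)
                have "A1 aSL (y * p + j) = A' aSL (y * p + j)" if "j < A' aNSL y" for j
                proof -
                  have "j < p" using that o(1) s_le pos by linarith
                  then show ?thesis using mm(2) f by (simp add: row_eq_def)
                qed
                then have "(\<lambda>j. A1 aSL (y * p + j)) ` {..<A' aNSL y} = (\<lambda>j. A' aSL (y * p + j)) ` {..<A' aNSL y}" by (intro image_cong) auto
                then show ?thesis using o t(2) f by simp
              qed
            qed
            then show ?thesis
              apply (intro vs)
              using lq by (simp_all add: v1 pr(1) ltb)
          qed
          using False pr(1) P lq by (simp_all add: v ltb)
      qed
    qed
    using V by (simp_all add: slok_def)
qed

end

section \<open>Queries\<close>

text \<open>The address given by \<open>slot\<close>, restated outside the preprocessing locales so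
  that queries can be specified without them.\<close>

definition slt :: "nat \<Rightarrow> arrs \<Rightarrow> nat \<Rightarrow> nat \<Rightarrow> nat" where
  "slt p D z c = z * p + (c div p + D aDD (z * p + (c mod p + D aEE (z * p + c div p)) mod p)) mod p"

text \<open>All that queries rely on, as properties of the finished arrays. \<open>r\<close> bounds
  the block numbers, and \<open>bl\<close> lists the tops of the large subblocks.\<close>

locale qstruct = pmachine w H N pre n q p s N1 +
  deco n le "D aBLK" hd "\<lambda>x. D aSUB x - Suc 0" "\<lambda>x. D aSG x = Suc 0"
  for w H N pre n q p s N1 le hd and D :: arrs +
  fixes bl :: "nat list" and r :: nat
  assumes hdr: "x < n \<Longrightarrow> D aISH x = 1 \<longleftrightarrow> isH x"
    and lab: "x < n \<Longrightarrow> D aLAB x \<noteq> 0 \<and> D aLAB x \<le> n \<and> D aINV (D aLAB x - 1) = x"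
    and inv: "i < n \<Longrightarrow> D aINV i < n \<and> D aLAB (D aINV i) = Suc i"
    and subs: "x < n \<Longrightarrow> D aSUB x \<noteq> 0 \<and> D aSUB x \<le> n"
    and blkr: "x < n \<Longrightarrow> D aBLK x \<le> r" and r_le: "r \<le> q"
    and reps: "i \<le> r \<Longrightarrow> x < n \<Longrightarrow> D aREP (x * p + i) = mxs (rp i x)"
    and dict: "z < n \<Longrightarrow> D aISH z \<noteq> 1 \<Longrightarrow> c < n \<Longrightarrow>
      (if D aTT (slt p D z c) = Suc c then D aVL (slt p D z c) else 0) = mxs (dk z c)"
    and pms: "a < n \<Longrightarrow> b < n \<Longrightarrow> D aSUB a = D aSUB b \<Longrightarrow> D aIDX b < p \<and> D aPM (a * p + D aIDX b) = mxs (pm a b)"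
    and sls: "z < n \<Longrightarrow> D aISH z \<noteq> 1 \<Longrightarrow> D aNSL z < s \<and>
      (\<lambda>j. D aSL (z * p + j)) ` {..<D aNSL z} = {x. le x z \<and> D aBLK x = D aBLK z \<and> D aSG x = 1}"
    and bls: "set bl = {c. c < n \<and> D aSUB c = Suc c \<and> D aSG c \<noteq> 1}" "\<forall>j<length bl. D aBL j = bl ! j" "length bl * s \<le> n"
    and par: "D aPAR 0 = p" "D aPAR 1 = length bl" "D aPAR 2 = Suc r"
begin

lemma frame_D: "frame X {} V D V' A' \<Longrightarrow> A' = D"
  by (auto simp: frame_def)

lemma bl_len: "length bl \<le> n"
proof -
  have "length bl * 1 \<le> length bl * s" using s_pos by (intro mult_le_mono2) simp
  then show ?thesis using bls(3) by linarith
qed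

definition dl :: "nat \<Rightarrow> cmd" where
  "dl zr = Asg vb (((Var vc |mod| Var vp) |+| Arr aEE (ix (Var zr) (Var vc |div| Var vp))) |mod| Var vp) ;;
     Asg vb (ix (Var zr) (((Var vc |div| Var vp) |+| Arr aDD (ix (Var zr) (Var vb))) |mod| Var vp)) ;;
     IfC Eq (Arr aTT (Var vb)) (Var vc |+| Num 1) (Asg vd (Arr aVL (Var vb))) (Asg vd (Num 0))"

lemma mods_dl [simp]: "mv (dl zr) = {vb, vd}" "ma (dl zr) = {}" by (auto simp: dl_def)

lemma bnd: "x < n \<Longrightarrow> x < H" "x < n \<Longrightarrow> x < N" "x < n \<Longrightarrow> Suc x < H" "x < p \<Longrightarrow> x < H" "z < n \<Longrightarrow> j < p \<Longrightarrow> z * p + j < H"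
  using small_ltH n_ltN ix_ltN[of z j] N_lt by (auto simp: less_imp_le)

lemma dkb: "mxs (dk z c) \<le> n" "mxs (pm a b) \<le> n" "mxs (rp i x) \<le> n"
  by (simp_all add: mxs_le) (auto simp: dk_def pm_def rp_def Suc_le_eq dest: le_lt)

lemma runs_dl:
  assumes V: "V vp = p" "V zr = z" "z < n" "V vc = c" "c < n" and h: "D aISH z \<noteq> 1" and zr: "zr < 64" "zr \<noteq> vb"
  shows "runs (dl zr) V D 70 (\<lambda>V' A'. V' vd = mxs (dk z c))"
proof -
  have m: "x mod p < p" for x using pos by simp
  note d = dict[OF V(3) h V(5), unfolded slt_def]
  have "mxs (dk z c) < H" using dkb(1)[of z c] small_ltH by auto
  then have vl: "D aTT (z * p + (c div p + D aDD (z * p + (c mod p + D aEE (z * p + c div p)) mod p)) mod p) = Suc c \<Longrightarrow>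
    D aVL (z * p + (c div p + D aDD (z * p + (c mod p + D aEE (z * p + c div p)) mod p)) mod p) < H" using d by simp
  show ?thesis
    unfolding dl_def
    apply (intro vs)
    using d vl by (simp_all add: V zr bnd m ix_ltN div_p H_large order.strict_trans[OF _ H_large])
qed

definition upd :: "nat \<Rightarrow> cmd" where
  "upd v = When Leq (Var vbest) (Var v) (Asg vbest (Var v |+| Num 1))"

text \<open>Candidates are combined by a plain maximum: 0 codes a missing one, and among common
  lower bounds the meet has the largest label.\<close>

definition lk :: cmd where
  "lk = dl vz ;; When Neq (Var vd) (Num 0) (Asg vu (Var vd |-| Num 1) ;; dl vk ;;
     When Neq (Var vd) (Num 0) (Asg vd (Arr aPM (ix (Var vu) (Arr aIDX (Var vd |-| Num 1)))) ;;
       When Less (Var vbest) (Var vd) (Asg vbest (Var vd))))"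

lemma mods_lk [simp]: "mv lk = {vb, vd, vu, vbest}" "ma lk = {}" "mv (upd v) = {vbest}" "ma (upd v) = {}"
  by (auto simp: lk_def upd_def)

lemma dk_mem: "mxs (dk z c) \<noteq> 0 \<Longrightarrow> mxs (dk z c) - 1 < n \<and> D aSUB (mxs (dk z c) - 1) = Suc c"
proof -
  assume "mxs (dk z c) \<noteq> 0"
  from dk_in[OF this] have *: "le (mxs (dk z c) - 1) z" "D aSUB (mxs (dk z c) - 1) - 1 = c" by (auto simp: dk_def)
  have l: "mxs (dk z c) - 1 < n" using le_lt[OF *(1)] by blast
  then have "D aSUB (mxs (dk z c) - 1) \<noteq> 0" using subs by blast
  then have "D aSUB (mxs (dk z c) - 1) = Suc c" using *(2) by linarith
  then show ?thesis using l by blast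
qed

lemma runs_lk:
  assumes V: "V vp = p" "V vz = z" "z < n" "V vk = k" "k < n" "V vc = c" "c < n"
    and h: "D aISH z \<noteq> 1" "D aISH k \<noteq> 1"
  shows "runs lk V D 250 (\<lambda>V' A'. V' vbest = max (V vbest) (lkp c z k))"
  unfolding lk_def
  apply (rule vcut[OF _ _ runs_dl[where z = z and c = c]])
  subgoal premises p1 for V1 A1
  proof -
    have v1: "V1 vp = p" "V1 vk = k" "V1 vc = c" "V1 vbest = V vbest" "A1 = D"
      using p1(1)[simplified] V by (auto simp: frame_def)
    let ?a = "mxs (dk z c)" and ?b = "mxs (dk k c)"
    have d: "V1 vd = ?a" by (rule p1(2))
    have aH: "?a < H" "?a - Suc 0 < H" using dkb(1)[of z c] small_ltH by auto
    show ?thesis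
    proof (cases "?a = 0")
      case True
      then show ?thesis
        apply (intro vs)
        by (simp_all add: v1 d lkp_def)
    next
      case False
      note am = dk_mem[OF False]
      show ?thesis
        unfolding v1(5)
        apply (intro vs)
        apply (rule vcut[OF _ _ runs_dl[where z = k and c = c]])
        subgoal premises p2 for V2 A2
        proof -
          have v2: "V2 vp = p" "V2 vbest = V vbest" "V2 vu = ?a - 1" "A2 = D"
            using p2(2)[simplified] v1 d by (auto simp: frame_def)
          have d2: "V2 vd = ?b" by (rule p2(3))
          show ?thesis
          proof (cases "?b = 0")
            case True
            then show ?thesis
              apply (intro vs)
              by (simp_all add: v2 d2 lkp_def)
          next
            case f: False
            note bm = dk_mem[OF f]
            have P: "D aIDX (?b - Suc 0) < p" "D aPM ((?a - Suc 0) * p + D aIDX (?b - Suc 0)) = mxs (pm (?a - Suc 0) (?b - Suc 0))"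
              using pms[of "?a - 1" "?b - 1"] am bm by auto
            have L: "lkp c z k = mxs (pm (?a - Suc 0) (?b - Suc 0))" using False f by (simp add: lkp_def)
            have lH: "lkp c z k < H" unfolding L using dkb(2) small_ltH by blast
            have I: "(?a - Suc 0) * p + D aIDX (?b - Suc 0) < N" "?b - Suc 0 < N" "?a - Suc 0 < N" using am bm P(1) ix_ltN bnd by auto
            show ?thesis
              apply (intro vs)
              using f lH by (simp_all add: v2 d2 P I L bnd Suc_le_eq)
          qed
        qed
        using V h False aH by (simp_all add: v1 d bnd Suc_le_eq)
    qed
  qed
  using V h by simp_all

text \<open>Passes to the representatives of both arguments in block \<open>vh\<close>. If one is
  missing, the block contains no common lower bound and is skipped.\<close>

definition getz :: "cmd \<Rightarrow> cmd" where
  "getz c = Asg vz (Arr aREP (ix (Var vx) (Var vh))) ;; Asg vk (Arr aREP (ix (Var vy) (Var vh))) ;;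
    When Neq (Var vz) (Num 0) (When Neq (Var vk) (Num 0)
      (Asg vz (Var vz |-| Num 1) ;; Asg vk (Var vk |-| Num 1) ;; c))"

lemma mods_getz [simp]: "mv (getz c) = {vz, vk} \<union> mv c" "ma (getz c) = ma c" by (auto simp: getz_def)

lemma runs_getz:
  assumes z: "mxs (rp i a) = 0 \<or> mxs (rp i b) = 0 \<Longrightarrow> \<forall>V'. V' vbest = V vbest \<longrightarrow> Q V' D"
    and c: "\<And>V' z k. mxs (rp i a) = Suc z \<Longrightarrow> mxs (rp i b) = Suc k \<Longrightarrow> z \<in> rp i a \<Longrightarrow> k \<in> rp i b \<Longrightarrow>
      V' = V(vz := z, vk := k) \<Longrightarrow> runs c V' D Tc Q"
    and V: "V vp = p" "V vx = a" "a < n" "V vy = b" "b < n" "V vh = i" "i \<le> r"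
  shows "runs (getz c) V D (60 + Tc) Q"
proof -
  have ip: "i < p" using V(7) r_le pos by simp
  note I = ix_ltN[OF V(3) ip] ix_ltN[OF V(5) ip]
  note R = reps[OF V(7,3)] reps[OF V(7,5)]
  have RH: "mxs (rp i x) < H" "mxs (rp i x) - Suc 0 < H" for x using dkb(3)[of i x] small_ltH(1)[of "mxs (rp i x)"] by auto
  show ?thesis
    unfolding getz_def
  proof (cases "mxs (rp i a) = 0 \<or> mxs (rp i b) = 0")
    case True
    note z' = z[OF True, rule_format]
    show "runs (Asg vz (Arr aREP (ix (Var vx) (Var vh))) ;; Asg vk (Arr aREP (ix (Var vy) (Var vh))) ;;
      When Neq (Var vz) (Num 0) (When Neq (Var vk) (Num 0)
      (Asg vz (Var vz |-| Num 1) ;; Asg vk (Var vk |-| Num 1) ;; c))) V D (60 + Tc) Q"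
      apply (intro vSq[where c = "Asg v e" and Tc = "tm (Asg v e)" for v e] vAsg vIf vNop)
      using True by (auto simp: V I R RH intro!: z')
  next
    case False
    then obtain z k where zk: "mxs (rp i a) = Suc z" "mxs (rp i b) = Suc k" by (metis not0_implies_Suc)
    have m: "z \<in> rp i a" "k \<in> rp i b" using zk mxs_in[of "rp i a"] mxs_in[of "rp i b"] by auto
    have "runs c (V(vz := z, vk := k)) D Tc Q" by (rule c[OF zk m refl])
    then have C: "runs c (V(vz := z, vk := k)) D t Q" if "Tc \<le> t" for t using runs_time that by blast
    have zkn: "z < n" "k < n" using m le_lt by (auto simp: rp_def)
    have U: "V(vz := Suc z, vk := Suc k, vz := z, vk := k) = V(vz := z, vk := k)" by auto
    show "runs (Asg vz (Arr aREP (ix (Var vx) (Var vh))) ;; Asg vk (Arr aREP (ix (Var vy) (Var vh))) ;;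
      When Neq (Var vz) (Num 0) (When Neq (Var vk) (Num 0)
      (Asg vz (Var vz |-| Num 1) ;; Asg vk (Var vk |-| Num 1) ;; c))) V D (60 + Tc) Q"
      apply (intro vSq[where c = "Asg v e" and Tc = "tm (Asg v e)" for v e] vAsg vIf vNop)
      using C by (simp_all add: V I R zk U bnd zkn)
  qed
qed

text \<open>\<open>okA\<close> and \<open>okB\<close> say that \<open>m\<close> is at least every
  candidate tried: those from the large subblock \<open>c\<close>, and those found in block
  \<open>i\<close>. In a block with a header among the two representatives the other one is the
  candidate; otherwise the singletons below \<open>z\<close> supply them.\<close>

definition okA :: "nat \<Rightarrow> nat \<Rightarrow> nat \<Rightarrow> nat \<Rightarrow> bool" where
  "okA a b c m \<longleftrightarrow> (\<forall>z k. mxs (rp (D aBLK c) a) = Suc z \<longrightarrow> mxs (rp (D aBLK c) b) = Suc k \<longrightarrow>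
     D aISH z \<noteq> 1 \<longrightarrow> D aISH k \<noteq> 1 \<longrightarrow> lkp c z k \<le> m)"

definition okB :: "nat \<Rightarrow> nat \<Rightarrow> nat \<Rightarrow> nat \<Rightarrow> bool" where
  "okB a b i m \<longleftrightarrow> (\<forall>z k. mxs (rp i a) = Suc z \<longrightarrow> mxs (rp i b) = Suc k \<longrightarrow>
     (D aISH z = 1 \<longrightarrow> Suc k \<le> m) \<and> (D aISH z \<noteq> 1 \<longrightarrow> D aISH k = 1 \<longrightarrow> Suc z \<le> m) \<and>
     (D aISH z \<noteq> 1 \<longrightarrow> D aISH k \<noteq> 1 \<longrightarrow> (\<forall>c. le c z \<and> D aBLK c = D aBLK z \<and> D aSG c = 1 \<longrightarrow> lkp c z k \<le> m)))"

text \<open>Soundness of the search: the running maximum codes nothing or a common lower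
  bound.\<close>

definition lbs :: "nat \<Rightarrow> nat \<Rightarrow> nat \<Rightarrow> bool" where
  "lbs a b m \<longleftrightarrow> m = 0 \<or> le (m - 1) a \<and> le (m - 1) b"

lemma lbs_max: "lbs a b m \<Longrightarrow> lbs a b m' \<Longrightarrow> lbs a b (max m m')" by (simp add: max_def)

lemma lbs_lkp: "z \<in> rp i a \<Longrightarrow> k \<in> rp i b \<Longrightarrow> lbs a b (lkp c z k)"
proof (cases "lkp c z k")
  case (Suc u)
  assume "z \<in> rp i a" "k \<in> rp i b"
  then show ?thesis using lkp_sound[OF Suc] Suc le_trans by (auto simp: lbs_def rp_def)
qed (simp add: lbs_def)

text \<open>The representative of the other argument lies in the same block, hence below the header
  and thereby below \<open>a\<close>.\<close>

lemma lbs_header: "D aISH h = 1 \<Longrightarrow> h \<in> rp i a \<Longrightarrow> x \<in> rp i b \<Longrightarrow> le x a"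
proof -
  assume h: "D aISH h = 1" "h \<in> rp i a" "x \<in> rp i b"
  then have "isH h" using hdr le_lt by (auto simp: rp_def)
  then have "D aBLK h \<noteq> 0" "hd (D aBLK h) = h" by (auto simp: isH_def)
  then have "le x h" using B2[of x] h(2,3) le_lt by (auto simp: rp_def)
  then show "le x a" using h(2) le_trans by (auto simp: rp_def)
qed

definition meetA :: cmd where
  "meetA = For vi vnb (Asg vc (Arr aBL (Var vi)) ;; Asg vh (Arr aBLK (Var vc)) ;;
     getz (When Neq (Arr aISH (Var vz)) (Num 1) (When Neq (Arr aISH (Var vk)) (Num 1) lk)))"

text \<open>It suffices to go through the singletons below the first representative, because a meet
  lies below both.\<close>

definition meetB :: cmd where
  "meetB = For vh vr (getz (IfC Eq (Arr aISH (Var vz)) (Num 1) (upd vk) (IfC Eq (Arr aISH (Var vk)) (Num 1) (upd vz)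
     (Asg vl (Arr aNSL (Var vz)) ;; For vj vl (Asg vc (Arr aSL (ix (Var vz) (Var vj))) ;; lk)))))"

lemma mods_meet [simp]: "mv meetA = {vi, vc, vh, vz, vk, vb, vd, vu, vbest}" "ma meetA = {}"
  "mv meetB = {vh, vz, vk, vl, vj, vc, vb, vd, vu, vbest}" "ma meetB = {}"
  by (auto simp: meetA_def meetB_def)

lemma runs_meetA:
  assumes V: "V vp = p" "V vx = a" "a < n" "V vy = b" "b < n" "V vnb = length bl" "lbs a b (V vbest)"
  shows "runs meetA V D (2 + length bl * 402) (\<lambda>V' A'. lbs a b (V' vbest) \<and> (\<forall>c\<in>set bl. okA a b c (V' vbest)))"
  unfolding meetA_def
  apply (rule vFor[where m = "length bl" and B = 400 and I = "\<lambda>i V' A'. lbs a b (V' vbest) \<and> (\<forall>j<i. okA a b (bl ! j) (V' vbest))"])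
  subgoal premises pr for i V1 A1
  proof -
    have A1: "A1 = D" by (rule frame_D[OF pr(2)[simplified]])
    have v1: "V1 vp = p" "V1 vx = a" "V1 vy = b" "V1 vi = i"
      using pr(2)[simplified] pr(3) V by (simp_all add: frame_def)
    have c: "D aBL i = bl ! i" "bl ! i < n" using bls(1,2) pr(1) nth_mem by (blast, force)
    have blk: "D aBLK (bl ! i) \<le> r" using blkr c(2) by blast
    then have bH: "D aBLK (bl ! i) < H" using r_le small_ltH(5) by fastforce
    have iN: "i < N" using pr(1) bl_len n_ltN(1)[of i] by linarith
    let ?Q = "\<lambda>V' (A' :: arrs). lbs a b (V' vbest) \<and> (\<forall>j<Suc i. okA a b (bl ! j) (V' vbest))"
    have ex: "\<forall>j<Suc i. okA a b (bl ! j) m" if "V1 vbest \<le> m" "okA a b (bl ! i) m" for m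
      using pr(4) that unfolding okA_def less_Suc_eq by (blast intro: order_trans)
    have "runs (getz (When Neq (Arr aISH (Var vz)) (Num 1) (When Neq (Arr aISH (Var vk)) (Num 1) lk))) V2 D (60 + 300) (\<lambda>V' A'. ?Q (V'(vi := Suc i)) A')"
      if V2: "V2 = V1(vc := bl ! i, vh := D aBLK (bl ! i))" for V2
      apply (rule runs_getz[where a = a and b = b and i = "D aBLK (bl ! i)"])
      subgoal premises z
      proof (intro allI impI)
        fix V' :: vars assume v: "V' vbest = V2 vbest"
        have "okA a b (bl ! i) (V1 vbest)" using z by (auto simp: okA_def)
        then show "?Q (V'(vi := Suc i)) D" using ex[OF order_refl] pr(4) v V2 by simp
      qed
      subgoal premises z for V3 z k
      proof -
        have zk: "z < n" "k < n" using z(3,4) le_lt by (auto simp: rp_def)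
        have K: "lbs a b (max (V1 vbest) (lkp (bl ! i) z k))" using lbs_max lbs_lkp[OF z(3,4)] pr(4) by blast
        have K1: "\<forall>j<Suc i. okA a b (bl ! j) (max (V1 vbest) (lkp (bl ! i) z k))"
          by (rule ex) (use z(1,2) in \<open>auto simp: okA_def\<close>)
        have K2: "\<forall>j<Suc i. okA a b (bl ! j) (V1 vbest)" if "D aISH z = 1 \<or> D aISH k = 1"
          by (rule ex) (use z(1,2) that in \<open>auto simp: okA_def\<close>)
        show ?thesis
          unfolding z(5) V2
          apply (intro vIf vNop)
          apply (rule vuse[OF _ _ runs_lk[where z = z and k = k and c = "bl ! i"]])
          subgoal premises p2 for V4 A4 using p2(4) K K1 by simp
          using pr(4) zk c K2 by (simp_all add: v1 bnd)
      qed
      using V by (simp_all add: V2 v1 blk)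
    note G = this
    show ?thesis
      unfolding A1
      apply (intro vs)
      apply (rule runs_time[OF G])
      using c bH iN by (simp_all add: v1 bnd)
  qed
  subgoal premises pr for V' A'
    using pr(3) by (metis in_set_conv_nth)
  using V by simp_all

lemma runs_meetB:
  assumes V: "V vp = p" "V vx = a" "a < n" "V vy = b" "b < n" "V vr = Suc r" "lbs a b (V vbest)"
  shows "runs meetB V D (2 + Suc r * (402 + s * 302)) (\<lambda>V' A'. lbs a b (V' vbest) \<and> V vbest \<le> V' vbest \<and> (\<forall>i\<le>r. okB a b i (V' vbest)))"
  unfolding meetB_def
  apply (rule vFor[where m = "Suc r" and B = "400 + s * 302" and I = "\<lambda>i V' A'. lbs a b (V' vbest) \<and> V vbest \<le> V' vbest \<and> (\<forall>j<i. okB a b j (V' vbest))"])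
  subgoal premises pr for i V1 A1
  proof -
    have A1: "A1 = D" by (rule frame_D[OF pr(2)[simplified]])
    have v1: "V1 vp = p" "V1 vx = a" "V1 vy = b" "V1 vh = i"
      using pr(2)[simplified] pr(3) V by (simp_all add: frame_def)
    have ir: "i \<le> r" using pr(1) by simp
    define Q where "Q V' A' \<longleftrightarrow> lbs a b (V' vbest) \<and> V vbest \<le> V' vbest \<and> (\<forall>j<Suc i. okB a b j (V' vbest))" for V' :: vars and A' :: arrs
    have ex: "Q V' D" if m: "V1 vbest \<le> V' vbest" "okB a b i (V' vbest)" "lbs a b (V' vbest)" for V'
    proof -
      have "okB a b j (V' vbest)" if "j < i" for j
        using pr(4) that m(1) unfolding okB_def by (meson order_trans)
      then show ?thesis using pr(4) m unfolding Q_def less_Suc_eq by (auto intro: order_trans)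
    qed
    have bH: "V1 vbest \<le> n" using pr(4) le_lt[of "V1 vbest - 1" a] by (auto simp: lbs_def)
    have Qu: "Q (V'(vh := Suc i)) A' \<longleftrightarrow> Q V' A'" for V' A' by (simp add: Q_def)
    have "runs (getz (IfC Eq (Arr aISH (Var vz)) (Num 1) (upd vk) (IfC Eq (Arr aISH (Var vk)) (Num 1) (upd vz)
     (Asg vl (Arr aNSL (Var vz)) ;; For vj vl (Asg vc (Arr aSL (ix (Var vz) (Var vj))) ;; lk))))) V1 D (60 + (340 + s * 302)) Q"
      apply (rule runs_getz[where a = a and b = b and i = i])
      subgoal premises z
      proof (intro allI impI)
        fix V' :: vars assume v: "V' vbest = V1 vbest"
        show "Q V' D" by (rule ex) (use pr(4) z v in \<open>auto simp: okB_def\<close>)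
      qed
      subgoal premises z for V2 z k
      proof -
        have zk: "z < n" "k < n" using z(3,4) le_lt by (auto simp: rp_def)
        have lb: "le z a" "le k b" using z(3,4) by (auto simp: rp_def)
        have fs: "okB a b i m \<longleftrightarrow> (D aISH z = 1 \<longrightarrow> Suc k \<le> m) \<and> (D aISH z \<noteq> 1 \<longrightarrow> D aISH k = 1 \<longrightarrow> Suc z \<le> m) \<and>
          (D aISH z \<noteq> 1 \<longrightarrow> D aISH k \<noteq> 1 \<longrightarrow> (\<forall>c. le c z \<and> D aBLK c = D aBLK z \<and> D aSG c = 1 \<longrightarrow> lkp c z k \<le> m))" for m
          unfolding okB_def z(1,2) by auto
        have v2: "V2 vz = z" "V2 vk = k" "V2 vbest = V1 vbest" "V2 vp = p" by (simp_all add: z(5) v1)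
        have up: "runs (upd v) V2 D (300 + s * 302) Q" if q: "okB a b i (max (V2 vbest) (Suc y))" "V2 v = y" "y < n" "le y a" "le y b" "v < 64" for v y
        proof -
          have l: "lbs a b (max (V2 vbest) (Suc y))" by (rule lbs_max) (use pr(4) q v2 in \<open>auto simp: lbs_def\<close>)
          have R: "Q V' D" if "V' vbest = max (V2 vbest) (Suc y)" for V' by (rule ex) (use that q(1) l v2 in auto)
          show ?thesis
            unfolding upd_def
            apply (intro vs)
            using q by (auto intro!: R simp: bnd max_def)
        qed
        show ?thesis
        proof (cases "D aISH z = 1")
          case True
          have "le k a" by (rule lbs_header[OF True z(3,4)])
          then have "runs (upd vk) V2 D (300 + s * 302) Q" using True v2 zk lb by (intro up[where y = k]) (auto simp: fs)
          note U = runs_time[OF this]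
          show ?thesis
            apply (intro vIf)
            apply (rule U)
            using True zk by (simp_all add: v2 bnd)
        next
          case F: False
          show ?thesis
          proof (cases "D aISH k = 1")
            case True
            have "le z b" by (rule lbs_header[OF True z(4,3)])
            then have "runs (upd vz) V2 D (300 + s * 302) Q" using F True v2 zk lb by (intro up[where y = z]) (auto simp: fs)
            note U = runs_time[OF this]
            show ?thesis
              apply (intro vIf)
              defer
              apply (rule U)
              using F True zk by (simp_all add: v2 bnd)
          next
            case F2: False
            note S = sls[OF zk(1) F]
            define sl where "sl j = D aSL (z * p + j)" for j
            have ls: "D aNSL z < H" using S s_le small_ltH(5)[of "D aNSL z"] by linarith
            have sn: "sl j < n" "j < p" if "j < D aNSL z" for j
            proof -
              have "sl j \<in> {x. le x z \<and> D aBLK x = D aBLK z \<and> D aSG x = 1}" using S that unfolding sl_def by blast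
              then show "sl j < n" using le_lt by blast
              show "j < p" using that S s_le pos by linarith
            qed
            have lp: "runs (For vj vl (Asg vc (Arr aSL (ix (Var vz) (Var vj))) ;; lk)) (V2(vl := D aNSL z)) D (2 + s * 302) Q"
              apply (rule vFor[where m = "D aNSL z" and B = 300 and I = "\<lambda>j V' A'. V1 vbest \<le> V' vbest \<and> lbs a b (V' vbest) \<and>
                (\<forall>j'<j. lkp (sl j') z k \<le> V' vbest)"])
              subgoal premises p3 for j V3 A3
              proof -
                have A3: "A3 = D" by (rule frame_D[OF p3(2)[simplified]])
                have v3: "V3 vp = p" "V3 vz = z" "V3 vk = k" "V3 vj = j" using p3(2)[simplified] p3(3) v2 by (simp_all add: frame_def)
                have lm: "lbs a b (max (V3 vbest) (lkp (sl j) z k))" using lbs_max lbs_lkp[OF z(3,4)] p3(4) by blast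
                have K: "V1 vbest \<le> max (V3 vbest) (lkp (sl j) z k)" "\<forall>j'<Suc j. lkp (sl j') z k \<le> max (V3 vbest) (lkp (sl j) z k)"
                  using p3(4) by (auto simp: less_Suc_eq le_max_iff_disj)
                note sj = sn[OF p3(1)]
                show ?thesis
                  unfolding A3
                  apply (intro vs)
                  apply (rule vuse[OF _ _ runs_lk[where z = z and k = k and c = "sl j"]])
                  subgoal premises p4 for V4 A4 using p4(2) lm K by simp
                  using F F2 zk sj ix_ltN[OF zk(1) sj(2)] by (simp_all add: v3 bnd sl_def)
              qed
              subgoal premises p3 for V3 A3
              proof -
                have A3: "A3 = D" by (rule frame_D[OF p3(1)[simplified]])
                show ?thesis
                  unfolding A3
                proof (rule ex)
                  have "lkp c z k \<le> V3 vbest" if "le c z \<and> D aBLK c = D aBLK z \<and> D aSG c = 1" for c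
                  proof -
                    have "c \<in> sl ` {..<D aNSL z}" using S that unfolding sl_def by blast
                    then show ?thesis using p3(3) by blast
                  qed
                  then show "okB a b i (V3 vbest)" using F F2 by (simp add: fs)
                qed (use p3(3) in auto)
              qed
              using pr(4) S by (simp_all add: v2)
            have lp': "runs (For vj vl (Asg vc (Arr aSL (ix (Var vz) (Var vj))) ;; lk)) V3 D t Q"
              if "V3 = V2(vl := D aNSL z)" "2 + s * 302 \<le> t" for V3 t using runs_time[OF lp] that by blast
            show ?thesis
              apply (intro vs lp')
              using F F2 zk ls by (simp_all add: v2 bnd)
          qed
        qed
      qed
      using V ir by (simp_all add: v1)
    then have "runs (getz (IfC Eq (Arr aISH (Var vz)) (Num 1) (upd vk) (IfC Eq (Arr aISH (Var vk)) (Num 1) (upd vz)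
     (Asg vl (Arr aNSL (Var vz)) ;; For vj vl (Asg vc (Arr aSL (ix (Var vz) (Var vj))) ;; lk))))) V1 D (400 + s * 302) (\<lambda>V' A'. Q (V'(vh := Suc i)) A')"
      unfolding Qu by simp
    then show ?thesis unfolding A1 Q_def by simp
  qed
  subgoal premises pr for V' A' using pr(3) by (simp add: less_Suc_eq_le)
  using V by simp_all

definition lb :: "nat \<Rightarrow> nat \<Rightarrow> nat set" where
  "lb a b = {w. le w a \<and> le w b}"

text \<open>Common lower bounds are directed by interpolation, so their largest label belongs to the
  meet.\<close>

lemma lb_meet: "x \<in> lb a b \<Longrightarrow> mxs (lb a b) \<noteq> 0 \<and> mxs (lb a b) - 1 \<in> lb a b \<and> (\<forall>v\<in>lb a b. le v (mxs (lb a b) - 1))"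
proof -
  assume w: "x \<in> lb a b"
  have f: "finite (lb a b)" unfolding lb_def by (rule le_fin)
  have "le v (mxs (lb a b) - 1)" if "v \<in> lb a b" for v
  proof (rule dir_max[OF f that])
    fix c d assume "c \<in> lb a b" "d \<in> lb a b"
    then show "\<exists>e\<in>lb a b. le c e \<and> le d e" using le_mid[of c a b d] by (auto simp: lb_def)
  qed
  then show ?thesis using f w mxs_0 mxs_in by blast
qed

text \<open>All candidates are common lower bounds, so their maximum is the meet as soon as the meet
  is one of them. It is one through a header of its block, as a singleton below the representatives,
  or through its large subblock.\<close>

lemma best:
  assumes ab: "a < n" "b < n" and m: "lbs a b m" "\<forall>c\<in>set bl. okA a b c m" "\<forall>i\<le>r. okB a b i m"
  shows "m = mxs (lb a b)"
proof (cases "lb a b = {}")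
  case True
  then show ?thesis using m(1) by (auto simp: lbs_def lb_def mxs_def)
next
  case False
  then obtain v where "v \<in> lb a b" by blast
  note M = lb_meet[OF this]
  define u where "u = mxs (lb a b) - 1"
  have mx: "mxs (lb a b) = Suc u" using M by (simp add: u_def)
  have u: "le u a" "le u b" "\<And>w. le w a \<Longrightarrow> le w b \<Longrightarrow> le w u" using M unfolding u_def[symmetric] by (auto simp: lb_def)
  note C = meet_complete[OF u]
  have un: "u < n" using le_lt[OF u(1)] by simp
  obtain z k where zk: "mxs (rp (D aBLK u) a) = Suc z" "mxs (rp (D aBLK u) b) = Suc k" using C(1,2) by (metis not0_implies_Suc)
  have zr: "z \<in> rp (D aBLK u) a" "k \<in> rp (D aBLK u) b" using zk mxs_in[of "rp (D aBLK u) a"] mxs_in[of "rp (D aBLK u) b"] by auto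
  then have zkn: "z < n" "k < n" using le_lt by (auto simp: rp_def)
  note C' = C[unfolded zk diff_Suc_1]
  have B: "okB a b (D aBLK u) m" using m(3) blkr[OF un] by blast
  have "Suc u \<le> m"
  proof (cases "D aISH z = 1 \<or> D aISH k = 1")
    case True
    then show ?thesis using B zk C'(5,6) hdr[OF zkn(1)] hdr[OF zkn(2)] unfolding okB_def by metis
  next
    case nh: False
    show ?thesis
    proof (cases "D aSG u = 1")
      case True
      \<comment> \<open>By \<open>S3\<close> the top of the subblock of a singleton is flagged as
        well, and by \<open>S2\<close> it is then the element itself.\<close>
      have s: "D aSG (D aSUB u - Suc 0) = Suc 0" using S3[of u "D aSUB u - Suc 0"] S1[OF un] True by auto
      have su: "D aSUB u - Suc 0 = u" using S2[OF un s] .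
      have "le u z" using rp_max[of u "D aBLK u" a] u(1) zk by (auto simp: rp_def)
      then have "lkp u z k \<le> m" using B nh zk True C'(3) unfolding okB_def by auto
      then show ?thesis using C'(7) su by simp
    next
      case False
      have "D aSUB (D aSUB u - Suc 0) - Suc 0 = D aSUB u - Suc 0" "le u (D aSUB u - Suc 0)" using S1[OF un] by blast+
      moreover from this have "D aSUB (D aSUB u - Suc 0) \<noteq> 0" using le_lt subs by blast
      ultimately have ss: "D aSUB (D aSUB u - Suc 0) = Suc (D aSUB u - Suc 0)" by linarith
      have c: "D aSUB u - 1 \<in> set bl"
        unfolding bls using big_sub[OF un False[unfolded One_nat_def]] S1[OF un] le_lt[of u "D aSUB u - 1"] ss by auto
      have "lkp (D aSUB u - 1) z k \<le> m" using m(2) c zk nh S1[OF un] unfolding okA_def by auto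
      then show ?thesis using C'(7) by simp
    qed
  qed
  moreover have "m \<le> Suc u" using m(1) u(3)[of "m - 1"] le_mono[of "m - 1" u] by (auto simp: lbs_def)
  ultimately show ?thesis using mx by simp
qed

definition meetq :: cmd where
  "meetq = Asg vp (Arr aPAR (Num 0)) ;; Asg vnb (Arr aPAR (Num 1)) ;; Asg vr (Arr aPAR (Num 2)) ;;
     Asg vx (Arr aLAB (Var 0) |-| Num 1) ;; Asg vy (Arr aLAB (Var 1) |-| Num 1) ;; Asg vbest (Num 0) ;;
     meetA ;; meetB ;;
     IfC Eq (Var vbest) (Num 0) (Asg 0 (Num 0)) (Asg 1 (Arr aINV (Var vbest |-| Num 1)) ;; Asg 0 (Num 1))"

lemma runs_meetq:
  assumes V: "V 0 = x" "x < n" "V 1 = y" "y < n"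
  defines "L \<equiv> lb (D aLAB x - 1) (D aLAB y - 1)"
  shows "runs meetq V D (100 + length bl * 402 + Suc r * (402 + s * 302)) (\<lambda>V' A'.
    V' 0 = (if L = {} then 0 else 1) \<and> (L \<noteq> {} \<longrightarrow> V' 1 = D aINV (mxs L - 1)))"
proof -
  let ?a = "D aLAB x - Suc 0" and ?b = "D aLAB y - Suc 0"
  have ab: "?a < n" "?b < n" using lab[OF V(2)] lab[OF V(4)] by auto
  have ge: "Suc 0 \<le> D aLAB x" "Suc 0 \<le> D aLAB y" using lab[OF V(2)] lab[OF V(4)] by auto
  have lb: "length bl < H" by (rule small_ltH(1)[OF bl_len])
  have rH: "Suc r < H" using r_le pos small_ltH(2)[of "Suc r"] by simp
  have N3: "0 < N" "Suc 0 < N" "2 < N" using N1_def N1_le by auto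
  have N2: "x < N" "y < N" using V bnd by auto
  have L: "L = lb ?a ?b" by (simp add: L_def)
  have fL: "finite L" unfolding L lb_def by (rule le_fin)
  have tail: "runs (IfC Eq (Var vbest) (Num 0) (Asg 0 (Num 0)) (Asg 1 (Arr aINV (Var vbest |-| Num 1)) ;; Asg 0 (Num 1))) V' D 30
    (\<lambda>V' A'. V' 0 = (if L = {} then 0 else 1) \<and> (L \<noteq> {} \<longrightarrow> V' 1 = D aINV (mxs L - 1)))" if "V' vbest = mxs L" for V'
  proof (cases "L = {}")
    case True
    then show ?thesis
      apply (intro vs)
      using H_large that by (simp_all add: mxs_def)
  next
    case False
    then have m: "mxs L \<noteq> 0" using mxs_0[OF fL] by blast
    then have "mxs L - 1 < n" using mxs_in[OF fL] le_lt unfolding L lb_def by blast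
    then have "mxs L - Suc 0 < n" by simp
    then show ?thesis
      apply (intro vs)
      using H_large that m False inv[of "mxs L - Suc 0"] by (simp_all add: bnd Suc_le_eq)
  qed
  show ?thesis
    unfolding meetq_def
    apply (intro vs)
    apply (rule vcut[OF _ _ runs_meetA[where a = ?a and b = ?b]])
    subgoal premises p1 for V1 A1
    proof -
      have A1: "A1 = D" by (rule frame_D[OF p1(1)[simplified]])
      have v1: "V1 vp = p" "V1 vx = ?a" "V1 vy = ?b" "V1 vr = Suc r"
        using p1(1)[simplified] V par by (simp_all add: frame_def)
      show ?thesis
        unfolding A1
        apply (rule vcut[OF _ _ runs_meetB[where a = ?a and b = ?b]])
        subgoal premises p2 for V2 A2
        proof -
          have A2: "A2 = D" by (rule frame_D[OF p2(1)[simplified]])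
          have "okA ?a ?b c (V2 vbest)" if "c \<in> set bl" for c
            using p1(2) p2(2) that unfolding okA_def by (meson order_trans)
          then have "V2 vbest = mxs L" unfolding L using best[OF ab] p2(2) by blast
          then show ?thesis unfolding A2 by (intro runs_time[OF tail]) simp_all
        qed
        using ab p1(2) by (simp_all add: v1)
    qed
    using V par ab ge by (simp_all add: lbs_def lb rH N3 N2 bnd small_ltH H_large)
qed

definition leqq :: cmd where
  "leqq = Asg vp (Arr aPAR (Num 0)) ;; Asg vx (Arr aLAB (Var 0) |-| Num 1) ;; Asg vy (Arr aLAB (Var 1) |-| Num 1) ;;
     Asg vh (Arr aBLK (Var vx)) ;; Asg vz (Arr aREP (ix (Var vy) (Var vh))) ;; Asg 0 (Num 0) ;;
     When Neq (Var vz) (Num 0) (Asg vz (Var vz |-| Num 1) ;;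
       IfC Eq (Arr aISH (Var vz)) (Num 1) (Asg 0 (Num 1))
        (Asg vc (Arr aSUB (Var vx) |-| Num 1) ;; dl vz ;; When Neq (Var vd) (Num 0)
          (When Eq (Arr aPM (ix (Var vx) (Arr aIDX (Var vd |-| Num 1)))) (Var vx |+| Num 1) (Asg 0 (Num 1)))))"

lemma runs_leqq:
  assumes V: "V 0 = x" "x < n" "V 1 = y" "y < n"
  shows "runs leqq V D 250 (\<lambda>V' A'. V' 0 = (if le (D aLAB x - 1) (D aLAB y - 1) then 1 else 0))"
proof -
  note V1 = V(3)[unfolded One_nat_def]
  define a b where "a = D aLAB x - Suc 0" and "b = D aLAB y - Suc 0"
  have ab: "a < n" "b < n" unfolding a_def b_def using lab[OF V(2)] lab[OF V(4)] by auto
  have ge: "Suc 0 \<le> D aLAB x" "Suc 0 \<le> D aLAB y" "D aLAB x - Suc 0 = a" "D aLAB y - Suc 0 = b"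
    using lab[OF V(2)] lab[OF V(4)] by (auto simp: a_def b_def)
  have N3: "0 < N" "x < N" "y < N" "a < N" "b < N" using V ab bnd N1_def N1_le by auto
  have bk: "D aBLK a \<le> r" "D aBLK a < p" "D aBLK a < H" using blkr[OF ab(1)] r_le pos small_ltH(2)[of "D aBLK a"] by auto
  define Z where "Z = mxs (rp (D aBLK a) b)"
  have R: "D aREP (b * p + D aBLK a) = Z" using reps[OF bk(1) ab(2)] by (simp add: Z_def)
  have ZH: "Z < H" "Z - Suc 0 < H" using dkb(3)[of "D aBLK a" b] small_ltH(1)[of Z] by (auto simp: Z_def)
  have zn: "Z - Suc 0 < n" "Z - Suc 0 < N" if "Z \<noteq> 0"
  proof -
    have "Z - 1 \<in> rp (D aBLK a) b" using that unfolding Z_def by (rule mxs_in[OF fin(1)])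
    then have "le (Z - 1) b" by (simp add: rp_def)
    from le_lt[OF this] show "Z - Suc 0 < n" by simp
    then show "Z - Suc 0 < N" by (rule bnd)
  qed
  have sa: "Suc 0 \<le> D aSUB a" "D aSUB a - Suc 0 < n" "D aSUB a - Suc 0 < H" using subs[OF ab(1)] bnd(1)[of "D aSUB a - Suc 0"] by auto
  note T = leq_test[OF ab, folded Z_def, simplified]
  note I = ix_ltN[OF ab(2) bk(2)]
  let ?d = "mxs (dk (Z - Suc 0) (D aSUB a - Suc 0))"
  show ?thesis
    unfolding leqq_def
    apply (rule vSq[where c = "Asg v e" and Tc = "tm (Asg v e)" for v e], rule vAsg)+
    apply (rule vIf)
    apply (rule vSq[where c = "Asg v e" and Tc = "tm (Asg v e)" for v e], rule vAsg)
    apply (rule vIf)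
    apply (rule vAsg)
    prefer 6
    apply (rule vSq[where c = "Asg v e" and Tc = "tm (Asg v e)" for v e], rule vAsg)
    apply (rule vcut[where Tc = 70 and P = "\<lambda>V' A'. V' vd = ?d"])
    subgoal premises p1 for V1 A1
    proof -
      have z: "Z \<noteq> 0" "\<not> isH (Z - Suc 0)" using p1(1,2) hdr[OF zn(1)] by (auto simp: V V1 ge par R)
      have A1: "A1 = D" by (rule frame_D[OF p1(3)[simplified]])
      have v1: "V1 vp = p" "V1 vx = a" "V1 0 = 0" "V1 vd = ?d"
        using p1(3)[simplified] p1(4) V par ge by (simp_all add: frame_def)
      show ?thesis
      proof (cases "?d = 0")
        case True
        then show ?thesis
          unfolding A1
          apply (intro vs)
          using z T by (simp_all add: v1 ge)
      next
        case False
        have m: "?d - Suc 0 < n" "D aSUB (?d - Suc 0) = D aSUB a" using dk_mem[OF False] sa by auto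
        have P: "D aIDX (?d - Suc 0) < p" "D aPM (a * p + D aIDX (?d - Suc 0)) = mxs (pm a (?d - Suc 0))"
          using pms[OF ab(1) m(1)] m(2) by auto
        have LE: "le a b \<longleftrightarrow> mxs (pm a (?d - Suc 0)) = Suc a" using T z False by blast
        define d where "d = ?d"
        have dd: "V1 vd = d" "d \<noteq> 0" "d - Suc 0 < n" "D aIDX (d - Suc 0) < p"
          "D aPM (a * p + D aIDX (d - Suc 0)) = mxs (pm a (d - Suc 0))" "le a b \<longleftrightarrow> mxs (pm a (d - Suc 0)) = Suc a"
          unfolding d_def by (rule v1(4) False m(1) P LE)+
        show ?thesis
          unfolding A1
          apply (intro vs)
          using ix_ltN[OF ab(1) dd(4)] H_large dd(2)[unfolded neq0_conv] by (simp_all add: v1(1-3) ge dd bnd ab Suc_le_eq)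
      qed
    qed
    subgoal by simp
    subgoal premises p1
      by (rule runs_dl) (use p1 zn sa in \<open>auto simp: V V1 ge par R\<close>)
    using T hdr[OF zn(1)] zn I sa ab pos apply (simp_all add: V V1 ge par R ZH N3 bk bnd small_ltH)
    by (rule vNop) simp_all
qed

text \<open>Each large subblock takes \<open>s\<close> elements of its own, and n <= q^2 <= q * s^2,
  so there are at most q * s of them.\<close>

lemma query_cost: "length bl * 402 + Suc r * (402 + s * 302) \<le> q * s * 402 + Suc q * (402 + s * 302)"
proof -
  have "length bl * s \<le> q * q" using bls(3) n_le by (rule order_trans)
  also have "\<dots> \<le> q * (s * s)" using q_le by (rule mult_le_mono2)
  finally have "length bl * s \<le> (q * s) * s" by (simp only: mult.assoc)
  then have "length bl \<le> q * s" using s_pos mult_le_cancel2[of "length bl" s "q * s"] by blast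
  then show ?thesis using r_le by (intro add_mono mult_le_mono) auto
qed

end

section \<open>Assembling the data structure\<close>

text \<open>Keeps time bounds as nested sums, one summand for each pass.\<close>

lemma (in bmachine) vcut_sum: "runs c V A Tc P \<Longrightarrow> (\<And>V' A'. frame (mv c) (ma c) V A V' A' \<Longrightarrow> P V' A' \<Longrightarrow> runs d V' A' Td Q) \<Longrightarrow>
    runs (Sq c d) V A (Tc + Td) Q"
  by (rule vcut[where Tc = Tc and P = P]) simp_all

context bplat
begin

lemma binv_cong: "A' aBLK = A aBLK \<Longrightarrow> A' aISH = A aISH \<Longrightarrow> A' aLE = A aLE \<Longrightarrow> A' aCD = A aCD \<Longrightarrow> A' aLL = A aLL \<Longrightarrow>
    binv z V A' = binv z V A"
  by (simp add: binv_def)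

lemma subok_cong: "V' vnb = V vnb \<Longrightarrow> A' aSUB = A aSUB \<Longrightarrow> A' aBLK = A aBLK \<Longrightarrow> A' aSG = A aSG \<Longrightarrow> A' aBL = A aBL \<Longrightarrow>
    A' aISH = A aISH \<Longrightarrow> A' aGS = A aGS \<Longrightarrow> A' aMEM = A aMEM \<Longrightarrow> A' aIDX = A aIDX \<Longrightarrow> subok V' A' = subok V A"
  by (simp add: subok_def mems_def)

lemma subok_len: assumes "subok V A" shows "V vnb \<le> n"
proof -
  from assms[unfolded subok_def, THEN conjunct2, THEN conjunct2, THEN conjunct2, THEN conjunct2, THEN conjunct1]
  obtain bl where bl: "V vnb = length bl" "set bl = {c. c < n \<and> A aSUB c = Suc c \<and> A aSG c \<noteq> 1}"
    "\<forall>j<length bl. A aBL j = bl ! j" "length bl * s \<le> n" by blast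
  have "length bl * 1 \<le> length bl * s" using s_pos by (intro mult_le_mono2) simp
  then show ?thesis using bl(1,4) by linarith
qed

lemma pmok_cong: "A' aSUB = A aSUB \<Longrightarrow> A' aIDX = A aIDX \<Longrightarrow> A' aPM = A aPM \<Longrightarrow> pmok A' = pmok A"
  by (simp add: pmok_def)

lemma slok_cong: "A' aISH = A aISH \<Longrightarrow> A' aNSL = A aNSL \<Longrightarrow> A' aSL = A aSL \<Longrightarrow> A' aBLK = A aBLK \<Longrightarrow> A' aSG = A aSG \<Longrightarrow>
    slok z A' = slok z A"
  by (simp add: slok_def)

lemma slt_slot: "z * p + slot A z c = slt p A z c"
  by (simp add: slot_def slt_def bkt_def)

text \<open>The invariants of the passes amount to the query interface. It is instantiated with
  array length \<open>N1\<close>: queries stay within the first \<open>N1\<close> cells, so the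
  scratch behind them can go.\<close>

lemma qstructI:
  assumes b: "binv n Vo A" "Vo vr = r" and so: "subok Vb A" and pm: "pmok A" and sl: "slok n A"
    and rep: "\<forall>i\<le>r. \<forall>x<n. A aREP (x * p + i) = mxs (rpset A i x)"
    and di: "\<forall>z<n. A aISH z \<noteq> 1 \<longrightarrow> (\<forall>c<n. dlook A z c = mxs {w. w < n \<and> (le w z \<and> A aBLK w = A aBLK z) \<and> A aSUB w - 1 = c})"
    and inv: "\<forall>j<n. A aINV j < n \<and> A aLAB (A aINV j) = Suc j"
    and par: "A aPAR 0 = p" "A aPAR (Suc 0) = Vb vnb" "A aPAR 2 = Suc r"
  shows "\<exists>hd bl. qstruct w H N1 n q p s N1 le hd A bl r"
proof -
  note P1 = b(1)[unfolded binv_def b(2), THEN conjunct1, rule_format]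
  note P2 = b(1)[unfolded binv_def, THEN conjunct2, THEN conjunct1, rule_format]
  note P3 = b(1)[unfolded binv_def, THEN conjunct2, THEN conjunct2, THEN conjunct1, rule_format]
  note P4 = b(1)[unfolded binv_def b(2), THEN conjunct2, THEN conjunct2, THEN conjunct2, THEN conjunct1]
  note s2 = so[unfolded subok_def, THEN conjunct2]
  note S1 = so[unfolded subok_def, THEN conjunct1, rule_format]
  note S2 = s2[THEN conjunct1, rule_format]
  note S3 = s2[THEN conjunct2, THEN conjunct1, rule_format]
  note S5 = s2[THEN conjunct2, THEN conjunct2, THEN conjunct2, THEN conjunct1]
  from S5 obtain bl where bl: "Vb vnb = length bl" "set bl = {c. c < n \<and> A aSUB c = Suc c \<and> A aSG c \<noteq> 1}"
    "\<forall>j<length bl. A aBL j = bl ! j" "length bl * s \<le> n" by blast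
  \<comment> \<open>By \<open>P2\<close> a block number has at most one header, so the choice
    returns the intended one.\<close>
  define hd where "hd i = (SOME h. h < n \<and> A aISH h = 1 \<and> A aBLK h = i)" for i
  have hd: "hd (A aBLK h) = h" if "h < n" "A aISH h = 1" for h
    unfolding hd_def by (rule some_equality) (use that P2 in auto)
  have sub: "\<exists>c. A aSUB x = Suc c \<and> le x c \<and> c < n \<and> A aBLK c = A aBLK x \<and> A aSUB c = Suc c" if "x < n" for x
    using S1[OF that] le_lt by blast
  have sub0: "A aSUB x \<noteq> 0" if "x < n" for x using sub[OF that] by auto
  interpret deco n le "A aBLK" hd "\<lambda>x. A aSUB x - Suc 0" "\<lambda>x. A aSG x = Suc 0"
  proof
    fix x assume x: "x < n" "A aBLK x \<noteq> 0"
    obtain h where h: "h < n" "A aISH h = 1" "A aBLK h = A aBLK x" "le x h" using P1[OF x] by blast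
    then show "le x (hd (A aBLK x)) \<and> A aBLK (hd (A aBLK x)) = A aBLK x" using hd[OF h(1,2)] by simp
  next
    fix x assume x: "x < n"
    obtain c where "A aSUB x = Suc c" "le x c" "A aBLK c = A aBLK x" "A aSUB c = Suc c" using sub[OF x] by blast
    then show "le x (A aSUB x - Suc 0) \<and> A aBLK (A aSUB x - Suc 0) = A aBLK x \<and>
      A aSUB (A aSUB x - Suc 0) - Suc 0 = A aSUB x - Suc 0" by simp
    show "A aSUB x - Suc 0 = x" if "A aSG (A aSUB x - Suc 0) = Suc 0"
      using S2[OF x \<open>A aSUB x = Suc c\<close>] that \<open>A aSUB x = Suc c\<close> by simp
  next
    fix x u assume "le x u" "A aBLK x = A aBLK u" "A aSG u \<noteq> Suc 0"
    then show "A aSG x \<noteq> Suc 0 \<and> A aSUB x - Suc 0 \<le> A aSUB u - Suc 0" using S3[of x u] by (auto intro: diff_le_mono)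
  qed (use P3 in auto)
  have lab: "A aLAB x \<noteq> 0 \<and> A aLAB x \<le> n \<and> A aINV (A aLAB x - 1) = x" if x: "x < n" for x
  proof -
    have "inj_on (A aINV) {..<n}" using inv by (metis inj_onI lessThan_iff nat.inject)
    moreover have "A aINV ` {..<n} \<subseteq> {..<n}" using inv by auto
    ultimately have "A aINV ` {..<n} = {..<n}" by (simp add: endo_inj_surj)
    then obtain j where "j < n" "x = A aINV j" using x by (metis imageE lessThan_iff)
    then show ?thesis using inv by simp
  qed
  have rq: "r \<le> q"
  proof -
    have "card {x. x < n \<and> A aBLK x \<noteq> 0} \<le> card {..<n}" by (intro card_mono) auto
    then have "r * q \<le> q * q" using P4 n_le unfolding card_lessThan by linarith
    then show ?thesis using q_pos mult_le_cancel2[of r q q] by blast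
  qed
  have NH: "N1 < H" using N1_le N_lt by simp
  have nb: "A aPAR 1 = length bl" using par(2) bl(1) by simp
  have rpe: "rpset A i x = rp i x" for i x by (simp add: rpset_def rp_def)
  have "qstruct w H N1 n q p s N1 le hd A bl r"
  proof unfold_locales
    fix x assume x: "x < n"
    show "A aISH x = 1 \<longleftrightarrow> isH x"
      unfolding isH_def using P1[OF x] P2[OF x] hd x by (metis less_numeral_extra(3))
    show "A aLAB x \<noteq> 0 \<and> A aLAB x \<le> n \<and> A aINV (A aLAB x - 1) = x" by (rule lab[OF x])
    show "A aSUB x \<noteq> 0 \<and> A aSUB x \<le> n" using sub[OF x] by auto
    show "A aBLK x \<le> r" using P1[OF x] by (cases "A aBLK x = 0") auto
  next
    fix z c assume z: "z < n" "A aISH z \<noteq> 1" "c < n"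
    have "{w. w < n \<and> (le w z \<and> A aBLK w = A aBLK z) \<and> A aSUB w - 1 = c} = dk z c"
      using le_lt by (auto simp: dk_def)
    then show "(if A aTT (slt p A z c) = Suc c then A aVL (slt p A z c) else 0) = mxs (dk z c)"
      using di z unfolding dlook_def slt_slot by simp
  next
    fix a b assume a: "a < n" "b < n" "A aSUB a = A aSUB b"
    have "A aSUB u - Suc 0 = A aSUB a - Suc 0 \<longleftrightarrow> A aSUB u = A aSUB a" if "le u a" for u
      using sub0[OF a(1)] sub0[of u] le_lt[OF that] by auto
    then have "pm a b = {u. le u a \<and> (le u b \<and> A aSUB u = A aSUB a)}" unfolding pm_def by blast
    then show "A aIDX b < p \<and> A aPM (a * p + A aIDX b) = mxs (pm a b)" using pm a unfolding pmok_def by simp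
  next
    fix i assume "i < n"
    then show "A aINV i < n \<and> A aLAB (A aINV i) = Suc i" using inv by blast
  next
    fix i x assume "i \<le> r" "x < n"
    then show "A aREP (x * p + i) = mxs (rp i x)" using rep rpe by simp
  next
    fix z assume "z < n" "A aISH z \<noteq> 1"
    then show "A aNSL z < s \<and> (\<lambda>j. A aSL (z * p + j)) ` {..<A aNSL z} = {x. le x z \<and> A aBLK x = A aBLK z \<and> A aSG x = 1}"
      using sl unfolding slok_def by blast
  qed (rule p_def q_pos n_le s_pos q_le s_le N1_def order_refl NH rq bl par nb H_word H_large)+
  then show ?thesis by blast
qed

text \<open>\<open>vt\<close> receives the number of words to keep, using N - n^2 = N1; the second
  structure is placed directly behind them.\<close>

definition wpar :: cmd where
  "wpar = Upd aPAR (Num 0) (Var vp) ;; Upd aPAR (Num 1) (Var vnb) ;; Upd aPAR (Num 2) (Var vr |+| Num 1) ;;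
     Asg vt (Num 40 |*| (Var vN |-| Var vn |*| Var vn))"

lemma mods_wpar [simp]: "mv wpar = {vt}" "ma wpar = {aPAR}" by (auto simp: wpar_def)

definition build2 :: cmd where
  "build2 = elist ;; bpass ;; reppass ;; subpass ;; single ;; pmpass ;; slpass ;; dpass ;; wpar"

lemma mods_build2: "vn \<notin> mv build2" "ve \<notin> mv build2" by (simp_all add: build2_def)

definition tbuild :: nat where
  "tbuild = (4 + n * (n * 60 + 10)) + ((4 + n * (n * 65 + 60) + (2 * n * q) * (q * 70)) +
     ((10 + (q + 1) * (10 + n * 40 + (2 * n * q) * 70)) + ((4 + n * (n * 120 + 60)) + ((4 + n * 90) +
     ((2 + n * 50 + n * (32 + q * (30 + q * 50))) + ((2 + n * (n * 60 + 40)) + ((2 + n * (5000 * (q * q) + 20)) + 50)))))))"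

lemma runs_build2:
  assumes V: "V vn = n" "V vp = p" "V vq = q" "V vs = s" "V vN = N" and N: "N = n * n + N1" "40 * N < H"
    and inv: "\<forall>j<n. A aINV j < n \<and> A aLAB (A aINV j) = Suc j"
    and adj: "\<forall>a<n. \<forall>b<n. A aADJ (A aINV a * n + A aINV b) = (if cov a b then 1 else 0)"
    and z: "\<forall>j<N. A aLE j = 0 \<and> A aBLK j = 0 \<and> A aISH j = 0 \<and> A aSUB j = 0 \<and> A aSG j = 0 \<and> A aPM j = 0"
  shows "runs build2 V A tbuild (\<lambda>V' A'. V' vt = 40 * N1 \<and> A' aINV = A aINV \<and> A' aLAB = A aLAB \<and>
    (\<exists>hd bl r. qstruct w H N1 n q p s N1 le hd A' bl r))"
proof -
  have invn: "\<forall>j<n. A aINV j < n" using inv by blast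
  have "card {(a, b). a < n \<and> b < n \<and> cov a b} = card {(a, b). cov a b}"
    by (rule arg_cong[where f = card]) (use cov_lt in blast)
  then have cc: "card {(a, b). a < n \<and> b < n \<and> cov a b} \<le> n * p" using cov_count[OF n_le q_pos] by (simp add: p_def)
  show ?thesis
    unfolding build2_def tbuild_def
    apply (rule vcut_sum[OF runs_elist[where V = V and A = A and cv = cov, OF V(1) invn adj cc]])
    subgoal premises p1 for V1 A1
    proof -
      note f1 = p1(1)[simplified, unfolded frame_def]
      have v1: "V1 vn = n" "V1 vp = p" "V1 vq = q" "V1 vs = s" "V1 vN = N" using f1 V by simp_all
      have a1: "A1 aINV = A aINV" "A1 aLAB = A aLAB" "A1 aADJ = A aADJ" "A1 aLE = A aLE" "A1 aBLK = A aBLK" "A1 aISH = A aISH"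
        "A1 aSUB = A aSUB" "A1 aSG = A aSG" "A1 aPM = A aPM" using f1 by simp_all
      have z1: "\<forall>x<n. A1 aBLK x = 0 \<and> A1 aISH x = 0 \<and> (\<forall>y<n. A1 aLE (x * n + y) = 0)"
        using z nn_ltN ltb(4) unfolding a1 by blast
      show ?thesis
        apply (rule vcut_sum[OF runs_bpass[where V = V1 and A = A1, OF v1(1,2,3) _ _ z1]])
        subgoal using invn unfolding a1 .
        subgoal using adj unfolding a1 .
        subgoal premises p2 for V2 A2
        proof -
          note f2 = p2(1)[simplified, unfolded frame_def] and b = p2(2)
          have v2: "V2 vn = n" "V2 vp = p" "V2 vq = q" "V2 vs = s" "V2 vN = N" "V2 vne = V1 vne" using f2 v1 by simp_all
          have a2: "A2 aINV = A aINV" "A2 aLAB = A aLAB" "A2 aSUB = A aSUB" "A2 aSG = A aSG" "A2 aPM = A aPM"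
            "A2 aEU = A1 aEU" "A2 aEV = A1 aEV" using f2 a1 by simp_all
          have el: "elinv cov n 0 V2 A2" using p1(2) unfolding elinv_def v2(6) a2(6,7) .
          note P4 = b[unfolded binv_def, THEN conjunct2, THEN conjunct2, THEN conjunct2, THEN conjunct1]
          have rq: "V2 vr \<le> q"
          proof -
            have "card {x. x < n \<and> A2 aBLK x \<noteq> 0} \<le> card {..<n}" by (intro card_mono) auto
            then have "V2 vr * q \<le> q * q" using P4 n_le unfolding card_lessThan by linarith
            then show ?thesis using q_pos mult_le_cancel2[of "V2 vr" q q] by blast
          qed
          show ?thesis
            apply (rule vcut_sum[OF runs_reppass[where V = V2 and A = A2, OF v2(1,2) rq el]])
            subgoal premises p3 for V3 A3
            proof -
              note f3 = p3(1)[simplified, unfolded frame_def] and rep = p3(2)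
              have v3: "V3 vn = n" "V3 vp = p" "V3 vq = q" "V3 vs = s" "V3 vN = N" "V3 vr = V2 vr" using f3 v2 by simp_all
              have a3: "A3 aINV = A aINV" "A3 aLAB = A aLAB" "A3 aSUB = A aSUB" "A3 aSG = A aSG" "A3 aPM = A aPM"
                "A3 aBLK = A2 aBLK" "A3 aISH = A2 aISH" "A3 aLE = A2 aLE" "A3 aCD = A2 aCD" "A3 aLL = A2 aLL" using f3 a2 by simp_all
              have b3: "binv n V2 A3" using b binv_cong[of A3 A2, OF a3(6-10)] by simp
              have z3: "\<forall>x<n. A3 aSUB x = 0" using z ltb(4) unfolding a3 by blast
              show ?thesis
                apply (rule vcut_sum[OF runs_subpass[where V = V3 and A = A3, OF v3(1,2,4) b3 z3]])
                subgoal premises p4 for V4 A4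
                proof -
                  note f4 = p4(1)[simplified, unfolded frame_def]
                  have v4: "V4 vn = n" "V4 vp = p" "V4 vq = q" "V4 vN = N" "V4 vr = V2 vr" using f4 v3 by simp_all
                  have a4: "A4 aINV = A aINV" "A4 aLAB = A aLAB" "A4 aSG = A aSG" "A4 aPM = A aPM" "A4 aREP = A3 aREP"
                    "A4 aBLK = A2 aBLK" "A4 aISH = A2 aISH" "A4 aLE = A2 aLE" "A4 aCD = A2 aCD" "A4 aLL = A2 aLL" using f4 a3 by simp_all
                  have z4: "\<forall>x<n. A4 aSG x = 0" using z ltb(4) unfolding a4 by blast
                  show ?thesis
                    apply (rule vcut_sum[OF runs_single[where V = V4 and A = A4, OF v4(1,2) p4(2) z4]])
                    subgoal premises p5 for V5 A5
                    proof -
                      note f5 = p5(1)[simplified, unfolded frame_def] and so = p5(2)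
                      have v5: "V5 vn = n" "V5 vp = p" "V5 vq = q" "V5 vN = N" "V5 vr = V2 vr" using f5 v4 by simp_all
                      have a5: "A5 aINV = A aINV" "A5 aLAB = A aLAB" "A5 aPM = A aPM" "A5 aREP = A3 aREP"
                        "A5 aBLK = A2 aBLK" "A5 aISH = A2 aISH" "A5 aLE = A2 aLE" "A5 aCD = A2 aCD" "A5 aLL = A2 aLL" using f5 a4 by simp_all
                      have b5: "binv n V2 A5" using b binv_cong[of A5 A2, OF a5(5-9)] by simp
                      have z5: "\<forall>i<N. A5 aPM i = 0" using z unfolding a5 by blast
                      show ?thesis
                        apply (rule vcut_sum[OF runs_pmpass[where V = V5 and A = A5, OF v5(1,2) b5 so z5]])
                        subgoal premises p6 for V6 A6
                        proof -
                          note f6 = p6(1)[simplified, unfolded frame_def]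
                          have v6: "V6 vn = n" "V6 vp = p" "V6 vq = q" "V6 vN = N" "V6 vr = V2 vr" "V6 vnb = V5 vnb" using f6 v5 by simp_all
                          have a6: "A6 aINV = A aINV" "A6 aLAB = A aLAB" "A6 aREP = A3 aREP"
                            "A6 aBLK = A2 aBLK" "A6 aISH = A2 aISH" "A6 aLE = A2 aLE" "A6 aCD = A2 aCD" "A6 aLL = A2 aLL" using f6 a5 by simp_all
                          have s6: "A6 aSUB = A5 aSUB" "A6 aBLK = A5 aBLK" "A6 aSG = A5 aSG" "A6 aBL = A5 aBL" "A6 aISH = A5 aISH"
                            "A6 aGS = A5 aGS" "A6 aMEM = A5 aMEM" "A6 aIDX = A5 aIDX" using f6 by simp_all
                          have b6: "binv n V2 A6" using b binv_cong[of A6 A2, OF a6(4-8)] by simp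
                          have so6: "subok V6 A6" using so subok_cong[of V6 V5 A6 A5, OF v6(6) s6] by simp
                          show ?thesis
                            apply (rule vcut_sum[OF runs_slpass[where V = V6 and A = A6, OF v6(1,2) b6 so6]])
                            subgoal premises p7 for V7 A7
                            proof -
                              note f7 = p7(1)[simplified, unfolded frame_def]
                              have v7: "V7 vn = n" "V7 vp = p" "V7 vq = q" "V7 vN = N" "V7 vr = V2 vr" "V7 vnb = V6 vnb" using f7 v6 by simp_all
                              have a7: "A7 aINV = A aINV" "A7 aLAB = A aLAB" "A7 aREP = A3 aREP"
                                "A7 aBLK = A2 aBLK" "A7 aISH = A2 aISH" "A7 aLE = A2 aLE" "A7 aCD = A2 aCD" "A7 aLL = A2 aLL" using f7 a6 by simp_all
                              have s7: "A7 aSUB = A6 aSUB" "A7 aBLK = A6 aBLK" "A7 aSG = A6 aSG" "A7 aBL = A6 aBL" "A7 aISH = A6 aISH"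
                                "A7 aGS = A6 aGS" "A7 aMEM = A6 aMEM" "A7 aIDX = A6 aIDX" "A7 aPM = A6 aPM" using f7 by simp_all
                              have b7: "binv n V2 A7" using b binv_cong[of A7 A2, OF a7(4-8)] by simp
                              have so7: "subok V7 A7" using so6 subok_cong[of V7 V6 A7 A6, OF v7(6) s7(1-8)] by simp
                              have pm7: "pmok A7" using p6(2) pmok_cong[of A7 A6, OF s7(1,8,9)] by simp
                              note P5 = b7[unfolded binv_def, THEN conjunct2, THEN conjunct2, THEN conjunct2, THEN conjunct2, THEN conjunct1, rule_format]
                              note P6 = b7[unfolded binv_def, THEN conjunct2, THEN conjunct2, THEN conjunct2, THEN conjunct2, THEN conjunct2, THEN conjunct1, rule_format]
                              note S1 = so7[unfolded subok_def, THEN conjunct1, rule_format]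
                              have d1: "\<forall>z<n. \<forall>w<n. (le w z \<and> A7 aBLK w = A7 aBLK z) \<longleftrightarrow> A7 aLE (z * n + w) = 1 \<and> A7 aBLK w = A7 aBLK z"
                                using P5 by blast
                              have d2: "\<forall>w<n. A7 aSUB w = Suc (A7 aSUB w - 1) \<and> A7 aSUB w - 1 < n"
                              proof (intro allI impI)
                                fix x assume "x < n"
                                then obtain c where "A7 aSUB x = Suc c" "le x c" using S1 by blast
                                then show "A7 aSUB x = Suc (A7 aSUB x - 1) \<and> A7 aSUB x - 1 < n" using le_lt by auto
                              qed
                              have d3: "\<forall>z<n. A7 aISH z \<noteq> 1 \<longrightarrow> card {w. w < n \<and> (le w z \<and> A7 aBLK w = A7 aBLK z)} < q"
                              proof (intro allI impI)
                                fix y assume y: "y < n" "A7 aISH y \<noteq> 1"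
                                have "card {w. w < n \<and> (le w y \<and> A7 aBLK w = A7 aBLK y)} \<le> card {x. x < n \<and> A7 aLE (y * n + x) = 1}"
                                  by (intro card_mono) (use P5[OF y(1)] in auto)
                                then show "card {w. w < n \<and> (le w y \<and> A7 aBLK w = A7 aBLK y)} < q" using P6[OF y] by linarith
                              qed
                              show ?thesis
                                apply (rule vcut_sum[OF runs_dpass[where V = V7 and A = A7 and P = "\<lambda>z w. le w z \<and> A7 aBLK w = A7 aBLK z"
                                    and sb = "\<lambda>w. A7 aSUB w - 1", OF v7(1,2,3) d1 d2 d3]])
                                subgoal premises p8 for V8 A8
                                proof -
                                  note f8 = p8(1)[simplified, unfolded frame_def]
                                  have v8: "V8 vn = n" "V8 vp = p" "V8 vN = N" "V8 vr = V2 vr" "V8 vnb = V7 vnb" using f8 v7 by simp_all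
                                  have a8: "A8 aINV = A aINV" "A8 aLAB = A aLAB" "A8 aREP = A3 aREP"
                                    "A8 aBLK = A2 aBLK" "A8 aISH = A2 aISH" "A8 aLE = A2 aLE" "A8 aCD = A2 aCD" "A8 aLL = A2 aLL" using f8 a7 by simp_all
                                  have s8: "A8 aSUB = A7 aSUB" "A8 aBLK = A7 aBLK" "A8 aSG = A7 aSG" "A8 aBL = A7 aBL" "A8 aISH = A7 aISH"
                                    "A8 aGS = A7 aGS" "A8 aMEM = A7 aMEM" "A8 aIDX = A7 aIDX" "A8 aPM = A7 aPM" "A8 aNSL = A7 aNSL" "A8 aSL = A7 aSL" using f8 by simp_all
                                  have nbH: "V7 vnb < H" by (rule small_ltH(1)[OF subok_len[OF so7]])
                                  have dN: "N - n * n = N1" "n * n \<le> N" "40 * N1 < H" using N by linarith+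
                                  have rH: "Suc (V2 vr) < H" using rq pos small_ltH(2)[of "Suc (V2 vr)"] by simp
                                  have N3: "0 < N" "Suc 0 < N" "2 < N" using N1_def N1_le by auto
                                  have good: "\<exists>hd bl r. qstruct w H N1 n q p s N1 le hd A9 bl r"
                                    if A9: "A9 = A8(aPAR := (A8 aPAR)(0 := p, Suc 0 := V7 vnb, 2 := Suc (V2 vr)))" for A9
                                  proof -
                                    have o: "A9 a = A8 a" if "a \<noteq> aPAR" for a using that A9 by simp
                                    have e: "A9 aINV = A aINV" "A9 aLAB = A aLAB" "A9 aREP = A3 aREP"
                                      "A9 aBLK = A2 aBLK" "A9 aISH = A2 aISH" "A9 aLE = A2 aLE" "A9 aCD = A2 aCD" "A9 aLL = A2 aLL"
                                      "A9 aSUB = A7 aSUB" "A9 aBLK = A7 aBLK" "A9 aSG = A7 aSG" "A9 aBL = A7 aBL" "A9 aISH = A7 aISH"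
                                      "A9 aGS = A7 aGS" "A9 aMEM = A7 aMEM" "A9 aIDX = A7 aIDX" "A9 aPM = A7 aPM" "A9 aNSL = A7 aNSL" "A9 aSL = A7 aSL"
                                      "A9 aEE = A8 aEE" "A9 aDD = A8 aDD" "A9 aTT = A8 aTT" "A9 aVL = A8 aVL"
                                      by (rule trans[OF o], simp, rule a8 s8 refl)+
                                    have "\<exists>hd bl. qstruct w H N1 n q p s N1 le hd A9 bl (V2 vr)"
                                    proof (rule qstructI[where Vo = V2 and Vb = V7])
                                      show "binv n V2 A9" using b binv_cong[of A9 A2, OF e(4-8)] by simp
                                      show "subok V7 A9" using so7 subok_cong[of V7 V7 A9 A7, OF refl e(9-16)] by simp
                                      show "pmok A9" using pm7 pmok_cong[of A9 A7, OF e(9,16,17)] by simp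
                                      show "slok n A9" using p7(2) slok_cong[of A9 A7, OF e(13,18,19,10,11)] by simp
                                      show "\<forall>i\<le>V2 vr. \<forall>x<n. A9 aREP (x * p + i) = mxs (rpset A9 i x)"
                                        using rep unfolding rpset_def e(3,4) .
                                      have "dlook A9 z c = dlook A8 z c" for z c
                                        unfolding dlook_def slt_slot by (simp only: slt_def e)
                                      then show "\<forall>z<n. A9 aISH z \<noteq> 1 \<longrightarrow> (\<forall>c<n. dlook A9 z c =
                                          mxs {w. w < n \<and> (le w z \<and> A9 aBLK w = A9 aBLK z) \<and> A9 aSUB w - 1 = c})"
                                        using p8(2) unfolding e(9,10,13) by simp
                                      show "\<forall>j<n. A9 aINV j < n \<and> A9 aLAB (A9 aINV j) = Suc j" using inv unfolding e(1,2) .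
                                    qed (simp_all add: A9)
                                    then show ?thesis by blast
                                  qed
                                  show ?thesis
                                    unfolding wpar_def
                                    apply (intro vs)
                                    using good[OF refl] nbH rH N3 small_ltH(2)[OF order_refl] dN by (simp_all add: v8 a8 H_large)
                                qed
                                done
                            qed
                            done
                        qed
                        done
                    qed
                    done
                qed
                done
            qed
            done
        qed
        done
    qed
    done
qed

text \<open>The dominating terms are multiples of n * q^2, which rounding the root up keeps within
  O(n^2).\<close>

lemma tbuild_le: "q * q \<le> 4 * Suc n \<Longrightarrow> q \<le> Suc n \<Longrightarrow> tbuild \<le> 60000 * (Suc n * Suc n)"
proof -
  assume q: "q * q \<le> 4 * Suc n" "q \<le> Suc n"
  have "n * (q * q) \<le> n * (4 * Suc n)" "n * q \<le> n * Suc n" using q by (intro mult_le_mono2; simp)+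
  then show ?thesis using q unfolding tbuild_def by (simp add: algebra_simps)
qed

end

section \<open>Parameters\<close>

text \<open>The square root rounded up, except that its value at 0 is 1, which keeps thresholds and
  row lengths positive.\<close>

definition csqrt :: "nat \<Rightarrow> nat" where
  "csqrt m = (LEAST q. 0 < q \<and> m \<le> q * q)"

lemma csqrt: "0 < csqrt m" "m \<le> csqrt m * csqrt m"
proof -
  have "0 < Suc m \<and> m \<le> Suc m * Suc m" by simp
  from LeastI[of "\<lambda>q. 0 < q \<and> m \<le> q * q", OF this] show "0 < csqrt m" "m \<le> csqrt m * csqrt m"
    unfolding csqrt_def by blast+
qed

lemma csqrt_least: "0 < q \<Longrightarrow> m \<le> q * q \<Longrightarrow> csqrt m \<le> q"
  unfolding csqrt_def by (rule Least_le) simp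

lemma csqrt_le: "csqrt m \<le> Suc m"
  by (rule csqrt_least) simp_all

lemma csqrt_le': "0 < m \<Longrightarrow> csqrt m \<le> m"
  by (rule csqrt_least) simp_all

lemma csqrt_pred: "csqrt m = Suc k \<Longrightarrow> k * k \<le> m"
  using csqrt_least[of k m] by (cases "k = 0") force+

text \<open>If the root is k + 1 with k >= 1, then k^2 <= m by minimality and k + 1 <= 2k.\<close>

lemma csqrt_sq: "csqrt m * csqrt m \<le> 4 * Suc m"
proof -
  obtain k where k: "csqrt m = Suc k" using csqrt(1)[of m] gr0_implies_Suc by blast
  show ?thesis
  proof (cases k)
    case 0
    then show ?thesis by (simp add: k)
  next
    case (Suc j)
    then have "Suc k \<le> 2 * k" by simp
    from mult_le_mono[OF this this] have "Suc k * Suc k \<le> (2 * k) * (2 * k)" .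
    also have "(2 * k) * (2 * k) = 4 * (k * k)" by simp
    also have "\<dots> \<le> 4 * Suc m" by (rule mult_le_mono2, rule le_SucI, rule csqrt_pred[OF k])
    finally show ?thesis unfolding k .
  qed
qed

text \<open>Search by unit steps, affordable in linear time: the value grows until it reaches the
  root and then stays, so after i rounds it is the smaller of i + 1 and the root.\<close>

definition root :: "nat \<Rightarrow> nat \<Rightarrow> cmd" where
  "root a b = Asg a (Num 1) ;; For vi b (When Less (Var a |*| Var a) (Var b) (Asg a (Var a |+| Num 1)))"

lemma mods_root [simp]: "mv (root a b) = {a, vi}" "ma (root a b) = {}" by (auto simp: root_def)

lemma (in bmachine) runs_root:
  assumes V: "V b = m" "Suc (Suc m) < H" and ab: "a < 64" "b < 64" "a \<noteq> b" "a \<noteq> vi" "b \<noteq> vi"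
  shows "runs (root a b) V A (10 + m * 30) (\<lambda>V' A'. V' a = csqrt m)"
  unfolding root_def
  apply (intro vs)
  apply (rule vFor[where m = m and B = 25 and I = "\<lambda>i V' A'. V' a = min (Suc i) (csqrt m)"])
  subgoal premises pr for i V1 A1
  proof -
    have v: "V1 b = m" using pr(2)[simplified] ab V by (simp add: frame_def)
    define k where "k = min (Suc i) (csqrt m)"
    have kv: "V1 a = k" using pr(4) by (simp add: k_def)
    have kH: "Suc k < H" using pr(1) V(2) by (simp add: k_def)
    have 1: "Suc k = min (Suc (Suc i)) (csqrt m)" if "k * k < m"
    proof -
      have "k \<noteq> csqrt m" using csqrt(2)[of m] that by auto
      then show ?thesis by (simp add: k_def min_def split: if_splits)
    qed
    have 2: "k = min (Suc (Suc i)) (csqrt m)" if "\<not> k * k < m"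
    proof -
      have "0 < k" using csqrt(1)[of m] by (simp add: k_def)
      then have "csqrt m \<le> k" by (rule csqrt_least) (use that in simp)
      moreover have "k \<le> csqrt m" "k \<le> Suc i" by (simp_all add: k_def)
      ultimately show ?thesis by simp
    qed
    show ?thesis
      apply (intro vs)
      using 1 2 kH ab by (simp_all add: v kv)
  qed
  subgoal using csqrt_le[of m] by simp
  using V ab csqrt(1)[of m] H_large by (simp_all add: min_def Suc_le_eq)

definition build :: "nat \<Rightarrow> nat \<Rightarrow> cmd" where
  "build d d' = root vq vn ;; root vs vq ;; Asg vp (Num 2 |*| Var vq) ;;
     Asg vN (Var vn |*| Var vn |+| Var vn |*| Var vp |+| Var vn |+| Var vp |+| Num 10) ;;
     bmachine.clear ;; bmachine.rdg d d' ;; bmachine.topo ;; bplat.build2"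

section \<open>Orders\<close>

text \<open>A pair that is not an edge has an element strictly in between, which splits its interval
  into two smaller ones; the induction is on the size of the interval.\<close>

lemma tr_less:
  assumes po: "partial_lattice_on S r" and f: "\<And>u v. (u, v) \<in> transitive_reduction S r \<Longrightarrow> f u < (f v :: nat)"
    and xy: "(x, y) \<in> r" "x \<noteq> y"
  shows "f x < f y"
  using xy
proof (induction "card {z. (x, z) \<in> r \<and> (z, y) \<in> r}" arbitrary: x y rule: less_induct)
  case less
  have fin: "finite S" and sub: "r \<subseteq> S \<times> S" and tr: "trans r" and as: "antisym r" and rf: "refl_on S r"
    using po by (auto simp: partial_lattice_on_def partial_order_on_def preorder_on_def refl_on_def)
  have xy: "x \<in> S" "y \<in> S" using less.prems sub by auto
  show ?case
  proof (cases "(x, y) \<in> transitive_reduction S r")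
    case True then show ?thesis by (rule f)
  next
    case False
    then obtain z where z: "(x, z) \<in> r" "x \<noteq> z" "(z, y) \<in> r" "z \<noteq> y"
      using less.prems xy by (auto simp: transitive_reduction_def less_rel_def)
    have finI: "finite {z. (x, z) \<in> r \<and> (z, y) \<in> r}" by (rule finite_subset[OF _ fin]) (use sub in auto)
    have "{u. (x, u) \<in> r \<and> (u, z) \<in> r} \<subset> {u. (x, u) \<in> r \<and> (u, y) \<in> r}"
    proof (rule psubsetI)
      show "{u. (x, u) \<in> r \<and> (u, z) \<in> r} \<subseteq> {u. (x, u) \<in> r \<and> (u, y) \<in> r}" using z(3) tr by (auto dest: transD)
      have "y \<in> {u. (x, u) \<in> r \<and> (u, y) \<in> r}" using less.prems rf xy by (auto simp: refl_on_def)
      moreover have "y \<notin> {u. (x, u) \<in> r \<and> (u, z) \<in> r}" using z as by (auto dest: antisymD)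
      ultimately show "{u. (x, u) \<in> r \<and> (u, z) \<in> r} \<noteq> {u. (x, u) \<in> r \<and> (u, y) \<in> r}" by blast
    qed
    then have 1: "f x < f z" using less.hyps[OF psubset_card_mono[OF finI] z(1,2)] by blast
    have "{u. (z, u) \<in> r \<and> (u, y) \<in> r} \<subset> {u. (x, u) \<in> r \<and> (u, y) \<in> r}"
    proof (rule psubsetI)
      show "{u. (z, u) \<in> r \<and> (u, y) \<in> r} \<subseteq> {u. (x, u) \<in> r \<and> (u, y) \<in> r}" using z(1) tr by (auto dest: transD)
      have "x \<in> {u. (x, u) \<in> r \<and> (u, y) \<in> r}" using less.prems rf xy by (auto simp: refl_on_def)
      moreover have "x \<notin> {u. (z, u) \<in> r \<and> (u, y) \<in> r}" using z as by (auto dest: antisymD)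
      ultimately show "{u. (z, u) \<in> r \<and> (u, y) \<in> r} \<noteq> {u. (x, u) \<in> r \<and> (u, y) \<in> r}" by blast
    qed
    then have "f z < f y" using less.hyps[OF psubset_card_mono[OF finI] z(3,4)] by blast
    then show ?thesis using 1 by simp
  qed
qed

text \<open>A member of \<open>T\<close> with the fewest elements below it has no predecessor in
  \<open>T\<close>, as that would have fewer.\<close>

lemma tr_minimal:
  assumes po: "partial_lattice_on S r" and T: "T \<subseteq> S" "T \<noteq> {}"
  shows "\<exists>x\<in>T. \<forall>u\<in>T. (u, x) \<notin> transitive_reduction S r"
proof -
  have fin: "finite S" and sub: "r \<subseteq> S \<times> S" and tr: "trans r" and as: "antisym r" and rf: "refl_on S r"
    using po by (auto simp: partial_lattice_on_def partial_order_on_def preorder_on_def refl_on_def)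
  obtain t where "t \<in> T" using T by blast
  then obtain x where x: "x \<in> T" "\<forall>y. y \<in> T \<longrightarrow> card {z. (z, x) \<in> r} \<le> card {z. (z, y) \<in> r}"
    using ex_has_least_nat[of "\<lambda>x. x \<in> T" t "\<lambda>x. card {z. (z, x) \<in> r}"] by blast
  have "(u, x) \<notin> transitive_reduction S r" if "u \<in> T" for u
  proof
    assume "(u, x) \<in> transitive_reduction S r"
    then have u: "(u, x) \<in> r" "u \<noteq> x" "x \<in> S" by (auto simp: transitive_reduction_def less_rel_def)
    have "{z. (z, u) \<in> r} \<subseteq> {z. (z, x) \<in> r}" using u(1) tr by (auto dest: transD)
    moreover have "x \<in> {z. (z, x) \<in> r}" using rf u(3) by (auto simp: refl_on_def)
    moreover have "x \<notin> {z. (z, u) \<in> r}" using u as by (auto dest: antisymD)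
    ultimately have "{z. (z, u) \<in> r} \<subset> {z. (z, x) \<in> r}" by blast
    moreover have "finite {z. (z, x) \<in> r}" by (rule finite_subset[OF _ fin]) (use sub in auto)
    ultimately have "card {z. (z, u) \<in> r} < card {z. (z, x) \<in> r}" by (rule psubset_card_mono[rotated])
    then show False using x(2) that by fastforce
  qed
  then show ?thesis using x(1) by blast
qed

lemma partial_lattice_converse: "partial_lattice_on S r \<Longrightarrow> partial_lattice_on S (r\<inverse>)"
  unfolding partial_lattice_on_def partial_order_on_def preorder_on_def less_rel_def
  by (auto simp: refl_on_converse) metis

lemma transitive_reduction_converse: "transitive_reduction S (r\<inverse>) = (transitive_reduction S r)\<inverse>"
  by (auto simp: transitive_reduction_def less_rel_def)

lemma is_join_converse: "is_join S r = is_meet S (r\<inverse>)"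
  by (auto simp: is_join_def is_meet_def fun_eq_iff)

definition labelled :: "nat \<Rightarrow> nat rel \<Rightarrow> arrs \<Rightarrow> (nat \<Rightarrow> nat \<Rightarrow> bool) \<Rightarrow> bool" where
  "labelled n r A le \<longleftrightarrow> (\<forall>u v. le u v \<longleftrightarrow> u < n \<and> v < n \<and> (A aINV u, A aINV v) \<in> r)"

lemma inv_onto: "\<forall>j<n. A aINV j < (n :: nat) \<and> A aLAB (A aINV j) = Suc j \<Longrightarrow> x < n \<Longrightarrow> \<exists>j<n. x = A aINV j"
proof -
  assume inv: "\<forall>j<n. A aINV j < n \<and> A aLAB (A aINV j) = Suc j" and x: "x < n"
  have "inj_on (A aINV) {..<n}" using inv by (metis inj_onI lessThan_iff nat.inject)
  moreover have "A aINV ` {..<n} \<subseteq> {..<n}" using inv by auto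
  ultimately have "A aINV ` {..<n} = {..<n}" by (simp add: endo_inj_surj)
  then show ?thesis using x by (metis imageE lessThan_iff)
qed

text \<open>The labelling is only known to increase along edges of the graph; that the renumbered
  order is a \<open>plat\<close> is derived from this.\<close>

context
  fixes n :: nat and r :: "nat rel" and A :: arrs and le :: "nat \<Rightarrow> nat \<Rightarrow> bool"
  assumes po: "partial_lattice_on {..<n} r" and lb: "labelled n r A le"
    and inv: "\<forall>j<n. A aINV j < n \<and> A aLAB (A aINV j) = Suc j"
    and edge: "\<And>u v. (u, v) \<in> transitive_reduction {..<n} r \<Longrightarrow> A aLAB u < A aLAB v"
begin

lemma le_iff: "le u v \<longleftrightarrow> u < n \<and> v < n \<and> (A aINV u, A aINV v) \<in> r"
  using lb unfolding labelled_def by blast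

lemma inv_eq: "u < n \<Longrightarrow> v < n \<Longrightarrow> A aINV u = A aINV v \<longleftrightarrow> u = v"
  using inv by (metis nat.inject)

lemma plat: "plat n le"
proof
  have rf: "refl_on {..<n} r" and tr: "trans r"
    using po by (auto simp: partial_lattice_on_def partial_order_on_def preorder_on_def)
  show "x < n \<and> y < n" if "le x y" for x y using that le_iff by blast
  show "le x x" if "x < n" for x using that inv rf by (auto simp: le_iff refl_on_def)
  show "le x z" if "le x y" "le y z" for x y z using that tr unfolding le_iff by (blast dest: transD)
  show "x \<le> y" if "le x y" for x y
  proof (cases "x = y")
    case False
    then have "A aLAB (A aINV x) < A aLAB (A aINV y)"
      using that inv_eq by (intro tr_less[OF po edge]) (auto simp: le_iff)
    then show ?thesis using that inv by (auto simp: le_iff)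
  qed simp
  show "\<exists>z. le x1 z \<and> le x2 z \<and> le z y1 \<and> le z y2" if l: "le x1 y1" "le x1 y2" "le x2 y1" "le x2 y2" for x1 x2 y1 y2
  proof (cases "x1 = y1 \<or> x1 = y2 \<or> x2 = y1 \<or> x2 = y2")
    \<comment> \<open>A lower element that equals an upper one is itself the element in
      between.\<close>
    case True
    have "le x1 x1" "le x2 x2" using l inv rf by (auto simp: le_iff refl_on_def)
    then show ?thesis using True l by blast
  next
    case False
    have "less_rel r (A aINV a) (A aINV b)" if "le a b" "a \<noteq> b" for a b
      using that inv_eq by (auto simp: less_rel_def le_iff)
    then have s: "less_rel r (A aINV x1) (A aINV y1)" "less_rel r (A aINV x1) (A aINV y2)"
      "less_rel r (A aINV x2) (A aINV y1)" "less_rel r (A aINV x2) (A aINV y2)" using l False by blast+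
    have "A aINV x1 \<in> {..<n}" "A aINV x2 \<in> {..<n}" "A aINV y1 \<in> {..<n}" "A aINV y2 \<in> {..<n}" using l inv by (auto simp: le_iff)
    then obtain z where z: "z < n" "(A aINV x1, z) \<in> r" "(A aINV x2, z) \<in> r" "(z, A aINV y1) \<in> r" "(z, A aINV y2) \<in> r"
      using po s unfolding partial_lattice_on_def by blast
    obtain j where "j < n" "z = A aINV j" using inv_onto[OF inv z(1)] by blast
    then show ?thesis using z l by (intro exI[of _ j]) (auto simp: le_iff)
  qed
qed

lemma cov_iff: "u < n \<Longrightarrow> v < n \<Longrightarrow> plat.cov le u v \<longleftrightarrow> (A aINV u, A aINV v) \<in> transitive_reduction {..<n} r"
proof -
  assume uv: "u < n" "v < n"
  have "(\<exists>w. le u w \<and> le w v \<and> w \<noteq> u \<and> w \<noteq> v) \<longleftrightarrow> (\<exists>w\<in>{..<n}. less_rel r (A aINV u) w \<and> less_rel r w (A aINV v))"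
  proof
    assume "\<exists>w. le u w \<and> le w v \<and> w \<noteq> u \<and> w \<noteq> v"
    then obtain w where "le u w" "le w v" "w \<noteq> u" "w \<noteq> v" by blast
    then show "\<exists>w\<in>{..<n}. less_rel r (A aINV u) w \<and> less_rel r w (A aINV v)"
      using inv uv inv_eq by (intro bexI[of _ "A aINV w"]) (auto simp: le_iff less_rel_def)
  next
    assume "\<exists>w\<in>{..<n}. less_rel r (A aINV u) w \<and> less_rel r w (A aINV v)"
    then obtain x where x: "x < n" "less_rel r (A aINV u) x" "less_rel r x (A aINV v)" by auto
    obtain j where "j < n" "x = A aINV j" using inv_onto[OF inv x(1)] by blast
    then show "\<exists>w. le u w \<and> le w v \<and> w \<noteq> u \<and> w \<noteq> v" using x uv by (intro exI[of _ j]) (auto simp: le_iff less_rel_def)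
  qed
  then show ?thesis
    unfolding plat.cov_def[OF plat] transitive_reduction_def using uv inv inv_eq[OF uv]
    by (auto simp: le_iff less_rel_def)
qed

text \<open>The input stays in memory in front of the structures, so its length enters the space
  bound.\<close>

lemma edge_count:
  assumes "n \<le> q * q" "0 < q" shows "card (transitive_reduction {..<n} r) \<le> 2 * n * q"
proof -
  let ?C = "{(u, v). plat.cov le u v}"
  have C: "?C \<subseteq> {..<n} \<times> {..<n}" using plat.cov_lt[OF plat] by auto
  have "transitive_reduction {..<n} r \<subseteq> (\<lambda>(u, v). (A aINV u, A aINV v)) ` ?C"
  proof
    fix e assume e: "e \<in> transitive_reduction {..<n} r"
    then have lt: "fst e < n" "snd e < n" by (auto simp: transitive_reduction_def)
    obtain i j where ij: "i < n" "j < n" "fst e = A aINV i" "snd e = A aINV j" using inv_onto[OF inv lt(1)] inv_onto[OF inv lt(2)] by blast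
    then have "e = (A aINV i, A aINV j)" by (simp add: prod_eq_iff)
    then have "plat.cov le i j" using e cov_iff[OF ij(1,2)] by simp
    then show "e \<in> (\<lambda>(u, v). (A aINV u, A aINV v)) ` ?C"
      using \<open>e = _\<close> by (intro image_eqI[where x = "(i, j)"]) simp_all
  qed
  moreover have "finite ?C" by (rule finite_subset[OF C]) simp
  ultimately have "card (transitive_reduction {..<n} r) \<le> card ?C" by (intro surj_card_le)
  then show ?thesis using plat.cov_count[OF plat assms] by simp
qed

end

section \<open>Building one structure\<close>

lemma (in bmachine) runs_build:
  assumes qs: "q = csqrt n" "s = csqrt q" and N: "N = n * n + N1" "40 * N < H"
    and V: "V vn = n" "V ve = length es" and d: "d \<le> 1" "d' \<le> 1"
    and po: "partial_lattice_on {..<n} r" and es: "distinct es" "set es = transitive_reduction {..<n} r"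
      "\<forall>i<length es. 2 * i + 1 < length pre \<and> es ! i = (pre ! (2 * i + d), pre ! (2 * i + d'))"
  shows "runs (build d d') V A (200000 * (Suc n * Suc n)) (\<lambda>V' A'. V' vt = 40 * N1 \<and> V' vn = n \<and> V' ve = length es \<and> length es \<le> 2 * n * q \<and>
    (\<exists>le. labelled n r A' le \<and> (\<exists>hd bl r. qstruct w H N1 n q p s N1 le hd A' bl r)))"
proof -
  have q: "q \<le> Suc n" "q * q \<le> 4 * Suc n" using csqrt_le csqrt_sq unfolding qs by blast+
  let ?X = "Suc n * Suc n"
  have nq: "n * q \<le> n * Suc n" using q(1) by (rule mult_le_mono2)
  have NX: "N \<le> 20 * ?X" using nq q by (simp add: N(1) N1_def p_def algebra_simps)
  have E: "\<forall>(u, v)\<in>set es. u < n \<and> v < n" by (auto simp: es transitive_reduction_def)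
  have e: "length es \<le> n * n"
  proof -
    have "card (set es) \<le> card ({..<n} \<times> {..<n})" by (rule card_mono) (use E in auto)
    then show ?thesis using distinct_card[OF es(1)] by (simp add: card_cartesian_product)
  qed
  have nH: "Suc (Suc n) < H" using N1_def N1_le N_lt by simp
  have qH: "Suc (Suc q) < H" using N1_def N1_le N_lt by (simp add: p_def)
  have NH: "N < H" "40 * N < H" using N_lt N(2) by auto
  have Ne: "n * n + n * p + n + p + 10 = N" by (simp add: N(1) N1_def)
  have T: "(10 + n * 30) + ((10 + q * 30) + (20 + (20 + ((19 + N * 90) + ((2 + length es * 60) + ((2 + n * (n * 60 + 40)) + 60000 * ?X)))))) \<le> 200000 * ?X"
    using NX e q by (simp add: algebra_simps)
  have H2: "2 < H" "10 < H" using H_large by auto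
  let ?Q = "\<lambda>V' A'. V' vt = 40 * N1 \<and> V' vn = n \<and> V' ve = length es \<and> length es \<le> 2 * n * q \<and>
    (\<exists>le. labelled n r A' le \<and> (\<exists>hd bl r. qstruct w H N1 n q p s N1 le hd A' bl r))"
  have R: "runs (root vq vn) V A (10 + n * 30) (\<lambda>V' A'. V' vq = csqrt n)" by (rule runs_root) (use V nH in simp_all)
  have "runs (build d d') V A ((10 + n * 30) + ((10 + q * 30) + (20 + (20 + ((19 + N * 90) + ((2 + length es * 60) +
    ((2 + n * (n * 60 + 40)) + 60000 * ?X))))))) ?Q"
    unfolding build_def
    apply (rule vcut_sum[OF R])
    subgoal premises p1 for V1 A1
    proof -
      note f1 = p1(1)[simplified, unfolded frame_def]
      have v1: "V1 vn = n" "V1 ve = length es" "V1 vq = q" using f1 V p1(2) qs by simp_all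
      have R: "runs (root vs vq) V1 A1 (10 + q * 30) (\<lambda>V' A'. V' vs = csqrt q)" by (rule runs_root) (use v1 qH in simp_all)
      show ?thesis
        apply (rule vcut_sum[OF R])
        subgoal premises p2 for V2 A2
        proof -
          note f2 = p2(1)[simplified, unfolded frame_def]
          have v2: "V2 vn = n" "V2 ve = length es" "V2 vq = q" "V2 vs = s" using f2 v1 p2(2) qs by simp_all
          have R: "runs (Asg vp (Num 2 |*| Var vq)) V2 A2 20 (\<lambda>V' A'. V' vp = p)"
            by (rule vAsg) (use small_ltH(2)[OF order_refl] H2 in \<open>simp_all add: v2 p_def\<close>)
          show ?thesis
            apply (rule vcut_sum[OF R])
            subgoal premises p3 for V3 A3
            proof -
              note f3 = p3(1)[simplified, unfolded frame_def]
              have v3: "V3 vn = n" "V3 ve = length es" "V3 vq = q" "V3 vs = s" "V3 vp = p" using f3 v2 p3(2) by simp_all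
              have R: "runs (Asg vN (Var vn |*| Var vn |+| Var vn |*| Var vp |+| Var vn |+| Var vp |+| Num 10)) V3 A3 20 (\<lambda>V' A'. V' vN = N)"
                by (rule vAsg) (use NH(1) Ne in \<open>simp_all add: v3\<close>)
              show ?thesis
                apply (rule vcut_sum[OF R])
                subgoal premises p4 for V4 A4
                proof -
                  note f4 = p4(1)[simplified, unfolded frame_def]
                  have v4: "V4 vn = n" "V4 ve = length es" "V4 vq = q" "V4 vs = s" "V4 vp = p" "V4 vN = N" using f4 v3 p4(2) by simp_all
                  have R: "runs clear V4 A4 (19 + N * 90) (\<lambda>V' A'. zeroed A' N)" by (rule runs_clear) (rule v4(6))
                  show ?thesis
                    apply (rule vcut_sum[OF R])
                    subgoal premises p5 for V5 A5
                    proof -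
                      note f5 = p5(1)[simplified, unfolded frame_def]
                      have v5: "V5 vn = n" "V5 ve = length es" "V5 vq = q" "V5 vs = s" "V5 vp = p" "V5 vN = N" using f5 v4 by simp_all
                      have R: "runs (rdg d d') V5 A5 (2 + length es * 60) (\<lambda>V' A'.
                        (\<forall>u<n. \<forall>v<n. A' aADJ (u * n + v) = (if (u, v) \<in> set es then 1 else 0)) \<and>
                        (\<forall>v<n. A' aDEG v = card {u. (u, v) \<in> set es}))"
                        by (rule runs_rdg) (rule v5(1,2) d es(1,3) E p5(2))+
                      show ?thesis
                        apply (rule vcut_sum[OF R])
                        subgoal premises p6 for V6 A6
                        proof -
                          note f6 = p6(1)[simplified, unfolded frame_def]
                          have v6: "V6 vn = n" "V6 ve = length es" "V6 vq = q" "V6 vs = s" "V6 vp = p" "V6 vN = N" using f6 v5 by simp_all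
                          have a6: "A6 aLAB = A5 aLAB" "A6 aLE = A5 aLE" "A6 aBLK = A5 aBLK" "A6 aISH = A5 aISH" "A6 aSUB = A5 aSUB"
                            "A6 aSG = A5 aSG" "A6 aPM = A5 aPM" using f6 by simp_all
                          note zz = p5(2)[unfolded zeroed_def, rule_format]
                          have z0: "\<forall>x<n. A6 aLAB x = 0" using zz n_ltN(1) unfolding a6 by (meson less_imp_le)
                          have adj: "\<forall>u<n. \<forall>v<n. A6 aADJ (u * n + v) = (if (u, v) \<in> set es then 1 else 0)"
                            and deg: "\<forall>v<n. A6 aDEG v = card {u. (u, v) \<in> set es}" using p6(2) by blast+
                          have E1: "set es \<subseteq> {..<n} \<times> {..<n}" using E by auto
                          have E2: "\<exists>x\<in>S. \<forall>u\<in>S. (u, x) \<notin> set es" if "S \<subseteq> {..<n}" "S \<noteq> {}" for S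
                            unfolding es(2) by (rule tr_minimal[OF po that])
                          have R: "runs topo V6 A6 (2 + n * (n * 60 + 40)) (\<lambda>V' A'. tinv (set es) n A')"
                            by (rule runs_topo) (rule v6(1) E1 E2 adj deg z0 | assumption)+
                          show ?thesis
                            apply (rule vcut_sum[OF R])
                            subgoal premises p7 for V7 A7
                            proof -
                              note f7 = p7(1)[simplified, unfolded frame_def] and ti = p7(2)[unfolded tinv_def]
                              have v7: "V7 vn = n" "V7 ve = length es" "V7 vq = q" "V7 vs = s" "V7 vp = p" "V7 vN = N" using f7 v6 by simp_all
                              have a7: "A7 aADJ = A6 aADJ" "A7 aLE = A5 aLE" "A7 aBLK = A5 aBLK" "A7 aISH = A5 aISH" "A7 aSUB = A5 aSUB"
                                "A7 aSG = A5 aSG" "A7 aPM = A5 aPM" using f7 a6 by simp_all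
                              have inv: "\<forall>j<n. A7 aINV j < n \<and> A7 aLAB (A7 aINV j) = Suc j" using ti by blast
                              have edge: "A7 aLAB u < A7 aLAB v" if uv: "(u, v) \<in> transitive_reduction {..<n} r" for u v
                              proof -
                                have "v < n" using uv by (simp add: transitive_reduction_def)
                                then obtain j where "j < n" "v = A7 aINV j" using inv_onto[OF inv] by blast
                                then have "A7 aLAB v \<noteq> 0" using inv by simp
                                then show ?thesis using ti uv unfolding es(2) by blast
                              qed
                              define le where "le u v \<longleftrightarrow> u < n \<and> v < n \<and> (A7 aINV u, A7 aINV v) \<in> r" for u v
                              have lb: "labelled n r A7 le" by (simp add: labelled_def le_def)
                              have pl: "plat n le" by (rule plat[OF po lb inv]) (rule edge)
                              \<comment> \<open>The renumbered order exists only once the labels are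
                                computed, so its locale is entered in the middle of the symbolic
                                execution.\<close>
                              interpret bplat w H N pre n q p s N1 le by (intro bplat.intro pl bmachine_axioms)
                              have adj7: "\<forall>a<n. \<forall>b<n. A7 aADJ (A7 aINV a * n + A7 aINV b) = (if cov a b then 1 else 0)"
                              proof (intro allI impI)
                                fix a b assume ab: "a < n" "b < n"
                                have cv: "cov a b \<longleftrightarrow> (A7 aINV a, A7 aINV b) \<in> transitive_reduction {..<n} r"
                                  by (rule cov_iff[OF po lb inv _ ab]) (rule edge)
                                have "A7 aINV a < n" "A7 aINV b < n" using inv ab by blast+
                                then show "A7 aADJ (A7 aINV a * n + A7 aINV b) = (if cov a b then 1 else 0)"
                                  using adj cv unfolding a7 es(2) by simp
                              qed
                              have z7: "\<forall>j<N. A7 aLE j = 0 \<and> A7 aBLK j = 0 \<and> A7 aISH j = 0 \<and> A7 aSUB j = 0 \<and> A7 aSG j = 0 \<and> A7 aPM j = 0"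
                                using zz unfolding a7 by blast
                              have "card (transitive_reduction {..<n} r) \<le> 2 * n * q"
                                by (rule edge_count[OF po lb inv _ n_le q_pos]) (rule edge)
                              then have ec: "length es \<le> 2 * n * q" using distinct_card[OF es(1)] es(2) by simp
                              have bt: "tbuild \<le> 60000 * ?X" using tbuild_le[OF q(2,1)] .
                              show ?thesis
                              proof (rule runs_conseq[OF runs_build2[where V = V7 and A = A7, OF v7(1,5,3,4,6) N inv adj7 z7] bt])
                                fix V8 A8 assume f8: "frame (mv build2) (ma build2) V7 A7 V8 A8"
                                  and p8: "V8 vt = 40 * N1 \<and> A8 aINV = A7 aINV \<and> A8 aLAB = A7 aLAB \<and> (\<exists>hd bl r. qstruct w H N1 n q p s N1 le hd A8 bl r)"
                                have "V8 vn = n" "V8 ve = length es" using f8 mods_build2 v7 by (simp_all add: frame_def)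
                                moreover have "labelled n r A8 le" using lb p8 by (simp add: labelled_def)
                                ultimately show "?Q V8 A8" using p8 ec by blast
                              qed
                            qed
                            done
                        qed
                        done
                    qed
                    done
                qed
                done
            qed
            done
        qed
        done
    qed
    done
  then show ?thesis by (rule runs_time) (use T in simp)
qed

section \<open>Answers\<close>

context qstruct
begin

lemma mods_queries: "ma leqq = {}" "ma meetq = {}"
  by (simp_all add: leqq_def meetq_def)

lemma le_labels: "labelled n ord D le \<Longrightarrow> x < n \<Longrightarrow> y < n \<Longrightarrow> le (D aLAB x - 1) (D aLAB y - 1) \<longleftrightarrow> (x, y) \<in> ord"
  using lab[of x] lab[of y] by (auto simp: labelled_def)

text \<open>Translates the largest common lower bound from labels back to the original
  elements.\<close>

lemma meet_found:
  assumes l: "labelled n ord D le" and x: "x < n" "y < n"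
    and V: "V 0 = (if lb (D aLAB x - 1) (D aLAB y - 1) = {} then 0 else 1)"
      "lb (D aLAB x - 1) (D aLAB y - 1) \<noteq> {} \<longrightarrow> V 1 = D aINV (mxs (lb (D aLAB x - 1) (D aLAB y - 1)) - 1)"
  shows "finds (is_meet {..<n} ord x y) V"
proof -
  define a where "a = D aLAB x - 1"
  define b where "b = D aLAB y - 1"
  have mem: "D aLAB z - 1 \<in> lb a b \<longleftrightarrow> (z, x) \<in> ord \<and> (z, y) \<in> ord" if "z < n" for z
    using le_labels[OF l that x(1)] le_labels[OF l that x(2)] by (simp add: lb_def a_def b_def)
  show ?thesis
  proof (cases "lb a b = {}")
    case True
    then have "\<not> is_meet {..<n} ord x y z" for z using mem[of z] by (auto simp: is_meet_def)
    then show ?thesis using V(1) True by (simp add: finds_def a_def b_def)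
  next
    case False
    then obtain u where "u \<in> lb a b" by blast
    note M = lb_meet[OF this]
    define m where "m = mxs (lb a b) - 1"
    have m: "m \<in> lb a b" "\<forall>v\<in>lb a b. le v m" using M by (auto simp: m_def)
    then have mn: "m < n" using le_lt by (auto simp: lb_def)
    have lm: "D aLAB (D aINV m) - 1 = m" "D aINV m < n" using inv[OF mn] by auto
    have "is_meet {..<n} ord x y (D aINV m)"
      unfolding is_meet_def
    proof (intro conjI ballI impI)
      show "(D aINV m, x) \<in> ord" "(D aINV m, y) \<in> ord" using mem[OF lm(2)] m(1) lm(1) by auto
      fix z assume z: "z \<in> {..<n}" "(z, x) \<in> ord \<and> (z, y) \<in> ord"
      then have "le (D aLAB z - 1) m" using m(2) mem by blast
      then show "(z, D aINV m) \<in> ord" using le_labels[OF l _ lm(2), of z] lm(1) z(1) by simp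
    qed (use lm in auto)
    moreover have "V 0 = 1" "V 1 = D aINV m" using V False by (auto simp: a_def b_def m_def)
    ultimately show ?thesis unfolding finds_def by auto
  qed
qed

end

text \<open>Queries contain no store and leave the memory as it is, so no sequence of queries can
  reach any other memory.\<close>

fun pure :: "com \<Rightarrow> bool" where
  "pure (Store a b) = False"
| "pure (Seq c d) = (pure c \<and> pure d)"
| "pure (If p a b c d) = (pure c \<and> pure d)"
| "pure (While p a b c) = pure c"
| "pure _ = True"

lemma pure_exec: "exec w c z t z' \<Longrightarrow> pure c \<Longrightarrow> snd z' = snd z"
  by (induction rule: exec.induct) auto

lemma pure_cE: "pure (cE e d)"
  by (induction e arbitrary: d) auto

lemma pure_cC: "ma c = {} \<Longrightarrow> pure (cC c)"
  by (induction c) (auto simp: pure_cE)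

text \<open>A query finds the base address of its structure in cell \<open>k\<close> and treats
  everything in front of the base as \<open>pre\<close>. Cell 0 serves order tests and meets, cell 1
  joins.\<close>

lemma (in machine) exec_query:
  assumes rn: "runs c ((\<lambda>_. 0)(0 := x, 1 := y)) D T Q"
    and ok: "\<And>V' A' R'. Q V' A' \<Longrightarrow> R' 0 = V' 0 \<Longrightarrow> R' 1 = V' 1 \<Longrightarrow> ok R'" and xy: "x < H" "y < H" and k: "k \<le> 1"
    and M: "M ! k = length pre" "take (length pre) M = pre" "length pre + N * nA \<le> length M" "2 \<le> length M"
      "length M < H" "\<forall>z\<in>set M. z < H" "\<forall>a<nA. \<forall>i<N. M ! (length pre + i * nA + a) = D a i"
  shows "answers_within w (Seq (Load 64 (Imm k)) (cC c)) x y M (Suc T) ok"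
proof -
  let ?R = "(\<lambda>_. 0)(0 := x, 1 := y)"
  have kv: "val w ?R (Imm k) = k" using k H_large by (simp add: word_id)
  have L: "exec w (Load 64 (Imm k)) (?R, M) 1 (?R(64 := M ! k), M)"
    using exec.Load[of w ?R "Imm k" M 64] kv k M(4) by simp
  have "rel ?R D (?R(64 := M ! k)) M"
    unfolding rel_def using M xy H_large by (auto simp: nV_def)
  with rn obtain t R' M' V' A' where *: "exec w (cC c) (?R(64 := M ! k), M) t (R', M')" "t \<le> T" "rel V' A' R' M'" "Q V' A'"
    by (rule runsE)
  have "R' 0 = V' 0" "R' 1 = V' 1" using *(3) by (auto simp: rel_def nV_def)
  then have "ok R'" by (rule ok[OF *(4)])
  moreover have "exec w (Seq (Load 64 (Imm k)) (cC c)) (query_state x y M) (1 + t) (R', M')"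
    unfolding query_state_def by (rule exec.Seq[OF L *(1)])
  moreover have "1 + t \<le> Suc T" using *(2) by simp
  ultimately show ?thesis unfolding answers_within_def by blast
qed

definition par_p :: "nat \<Rightarrow> nat" where "par_p n = 2 * csqrt n"
definition par_N :: "nat \<Rightarrow> nat" where "par_N n = n * par_p n + n + par_p n + 10"
definition par_s :: "nat \<Rightarrow> nat" where "par_s n = csqrt (csqrt n)"

text \<open>At address \<open>b\<close> the memory holds the surviving cells of a structure for
  \<open>r\<close>. Only these cells are mentioned, so the property is preserved when the scratch
  behind them is overwritten or cut off.\<close>

definition stored :: "nat \<Rightarrow> nat \<Rightarrow> nat \<Rightarrow> nat rel \<Rightarrow> mem \<Rightarrow> nat \<Rightarrow> bool" where
  "stored w H n r M b \<longleftrightarrow> (\<exists>A le. labelled n r A le \<and>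
     (\<exists>hd bl k. qstruct w H (par_N n) n (csqrt n) (par_p n) (par_s n) (par_N n) le hd A bl k) \<and>
     (\<forall>a<nA. \<forall>i<par_N n. M ! (b + i * nA + a) = A a i))"

definition leq_com :: com where "leq_com = Seq (Load 64 (Imm 0)) (cC qstruct.leqq)"
definition meet_com :: "nat \<Rightarrow> com" where "meet_com k = Seq (Load 64 (Imm k)) (cC qstruct.meetq)"

definition qtime :: "nat \<Rightarrow> nat" where
  "qtime n = 101 + (csqrt n * par_s n * 402 + Suc (csqrt n) * (402 + par_s n * 302))"

lemma stored_pure: "stored w H n r M b \<Longrightarrow> pure leq_com \<and> pure (meet_com k)"
proof -
  assume "stored w H n r M b"
  then obtain A le hd bl k' where q: "qstruct w H (par_N n) n (csqrt n) (par_p n) (par_s n) (par_N n) le hd A bl k'"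
    unfolding stored_def by blast
  show ?thesis unfolding leq_com_def meet_com_def using pure_cC qstruct.mods_queries[OF q] by simp
qed

lemma stored_answers:
  assumes st: "stored w H n r M b" and x: "x < n" "y < n" and k: "k \<le> 1"
    and M: "M ! k = b" "b + par_N n * nA \<le> length M" "2 \<le> length M" "length M < H" "\<forall>z\<in>set M. z < H"
  shows "k = 0 \<Longrightarrow> answers_within w leq_com x y M 252 (decides ((x, y) \<in> r))"
    and "answers_within w (meet_com k) x y M (qtime n) (finds (is_meet {..<n} r x y))"
proof -
  from st obtain A le hd bl m where l: "labelled n r A le"
    and q: "qstruct w H (par_N n) n (csqrt n) (par_p n) (par_s n) (par_N n) le hd A bl m"
    and c: "\<forall>a<nA. \<forall>i<par_N n. M ! (b + i * nA + a) = A a i" unfolding stored_def by blast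
  define pre where "pre = take b M"
  have lp: "length pre = b" using M(2) by (simp add: pre_def)
  interpret qstruct w H "par_N n" pre n "csqrt n" "par_p n" "par_s n" "par_N n" le hd A bl m by (rule q)
  have xH: "x < H" "y < H" using x bnd by auto
  have M1: "M ! k = length pre" "take (length pre) M = pre" "length pre + par_N n * nA \<le> length M"
    "\<forall>a<nA. \<forall>i<par_N n. M ! (length pre + i * nA + a) = A a i" using M c by (auto simp: lp pre_def)
  show "answers_within w leq_com x y M 252 (decides ((x, y) \<in> r))" if k0: "k = 0"
  proof -
    have rn: "runs leqq ((\<lambda>_. 0)(0 := x, 1 := y)) A 250 (\<lambda>V' A'. V' 0 = (if le (A aLAB x - 1) (A aLAB y - 1) then 1 else 0))"
      by (rule runs_leqq) (use x in simp_all)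
    have "runs leqq ((\<lambda>_. 0)(0 := x, 1 := y)) A 251 (\<lambda>V' A'. V' 0 = (if le (A aLAB x - 1) (A aLAB y - 1) then 1 else 0))"
      by (rule runs_time[OF rn]) simp
    from exec_query[OF this, of "decides ((x, y) \<in> r)", OF _ xH k M1(1-3) M(3-5) M1(4)]
    have "answers_within w (Seq (Load 64 (Imm k)) (cC leqq)) x y M (Suc 251) (decides ((x, y) \<in> r))"
      using le_labels[OF l x] by (simp add: decides_def)
    then show ?thesis using k0 by (simp add: leq_com_def)
  qed
  have rn: "runs meetq ((\<lambda>_. 0)(0 := x, 1 := y)) A (100 + length bl * 402 + Suc m * (402 + par_s n * 302)) (\<lambda>V' A'.
    V' 0 = (if lb (A aLAB x - 1) (A aLAB y - 1) = {} then 0 else 1) \<and> (lb (A aLAB x - 1) (A aLAB y - 1) \<noteq> {} \<longrightarrow> V' 1 = A aINV (mxs (lb (A aLAB x - 1) (A aLAB y - 1)) - 1)))"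
    by (rule runs_meetq) (use x in simp_all)
  have "answers_within w (Seq (Load 64 (Imm k)) (cC meetq)) x y M (Suc (100 + (csqrt n * par_s n * 402 + Suc (csqrt n) * (402 + par_s n * 302))))
    (finds (is_meet {..<n} r x y))"
  proof (rule exec_query[OF runs_time[OF rn] _ xH k M1(1-3) M(3-5) M1(4)])
    show "100 + length bl * 402 + Suc m * (402 + par_s n * 302) \<le> 100 + (csqrt n * par_s n * 402 + Suc (csqrt n) * (402 + par_s n * 302))"
      using query_cost by linarith
  next
    fix V' :: vars and A' :: arrs and R' :: regs
    assume "V' 0 = (if lb (A aLAB x - 1) (A aLAB y - 1) = {} then 0 else 1) \<and>
      (lb (A aLAB x - 1) (A aLAB y - 1) \<noteq> {} \<longrightarrow> V' 1 = A aINV (mxs (lb (A aLAB x - 1) (A aLAB y - 1)) - 1))"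
      and "R' 0 = V' 0" "R' 1 = V' 1"
    then show "finds (is_meet {..<n} r x y) R'" by (intro meet_found[OF l x]) simp_all
  qed
  then show "answers_within w (meet_com k) x y M (qtime n) (finds (is_meet {..<n} r x y))"
    unfolding meet_com_def qtime_def by simp
qed

section \<open>Asymptotics\<close>

text \<open>In terms of x = n^(1/4) all quantities become polynomials: up to rounding, the root is
  x^2 and the root of the root is x.\<close>

lemma par_bounds:
  assumes "1 \<le> n"
  defines "x \<equiv> real n powr (1 / 4)"
  shows "1 \<le> x" "x ^ 4 = n" "x ^ 3 = real n powr (3 / 4)" "x ^ 6 = real n powr (3 / 2)"
    "real (csqrt n) \<le> 2 * x ^ 2" "real (par_s n) \<le> 3 * x"
proof -
  show x1: "1 \<le> x" unfolding x_def using assms(1) by (intro ge_one_powr_ge_zero) simp_all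
  have pw: "x ^ k = real n powr (1 / 4 * real k)" for k
  proof -
    have "x ^ k = x powr real k" using x1 by (subst powr_realpow) auto
    then show ?thesis unfolding x_def by (simp only: powr_powr)
  qed
  show x4: "x ^ 4 = n" "x ^ 3 = real n powr (3 / 4)" "x ^ 6 = real n powr (3 / 2)"
    using pw[of 4] pw[of 3] pw[of 6] assms(1) by simp_all
  have le: "real k \<le> y" if "real (k * k) \<le> y ^ 2" "0 \<le> y" for k y
  proof -
    have "real k ^ 2 \<le> y ^ 2" using that(1) by (simp only: power2_eq_square of_nat_mult)
    then show ?thesis using that(2) by (rule power2_le_imp_le)
  qed
  obtain k where k: "csqrt n = Suc k" using csqrt(1)[of n] gr0_implies_Suc by blast
  have xx: "(x ^ 2) ^ 2 = n" using x4(1) by simp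
  have "real (k * k) \<le> (x ^ 2) ^ 2" unfolding xx using csqrt_pred[OF k] by (simp only: of_nat_le_iff)
  then have "real k \<le> x ^ 2" by (rule le) simp
  moreover have "1 \<le> x ^ 2" using x1 by (rule one_le_power)
  ultimately show q: "real (csqrt n) \<le> 2 * x ^ 2" by (simp add: k)
  obtain j where j: "csqrt (csqrt n) = Suc j" using csqrt(1)[of "csqrt n"] gr0_implies_Suc by blast
  have "real (j * j) \<le> real (csqrt n)" using csqrt_pred[OF j] by (simp only: of_nat_le_iff)
  also have "\<dots> \<le> (2 * x) ^ 2" using q x1 by (simp add: power_mult_distrib)
  finally have "real j \<le> 2 * x" by (rule le) (use x1 in simp)
  then show "real (par_s n) \<le> 3 * x" using x1 by (simp add: par_s_def j)
qed

lemma qtime_asymp: "(\<lambda>n. real (qtime n)) \<in> O(\<lambda>n. real n powr (3 / 4))"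
proof (rule bigoI[of _ 8000])
  show "\<forall>\<^sub>F n in at_top. norm (real (qtime n)) \<le> 8000 * norm (real n powr (3 / 4))"
  proof (rule eventually_mono[OF eventually_ge_at_top[of "1 :: nat"]])
    fix n :: nat assume n: "1 \<le> n"
    define x where "x = real n powr (1 / 4)"
    note B = par_bounds[OF n, folded x_def]
    have p: "1 \<le> x ^ 3" "x ^ 2 \<le> x ^ 3" "x \<le> x ^ 3" using B(1) power_increasing[of 2 3 x] power_increasing[of 1 3 x] by (auto simp: one_le_power)
    have qs: "real (csqrt n) * real (par_s n) \<le> (2 * x ^ 2) * (3 * x)" using B by (intro mult_mono) auto
    have e: "(2 * x ^ 2) * (3 * x) = 6 * x ^ 3" by (simp add: power3_eq_cube power2_eq_square)
    have "real (qtime n) = 101 + 402 * (real (csqrt n) * real (par_s n)) + 402 * real (csqrt n) + 402 +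
      302 * real (par_s n) + 302 * (real (csqrt n) * real (par_s n))" by (simp add: qtime_def algebra_simps)
    also have "\<dots> \<le> 8000 * x ^ 3" using qs[unfolded e] B(5,6) p by linarith
    finally show "norm (real (qtime n)) \<le> 8000 * norm (real n powr (3 / 4))" using B(1,3) by simp
  qed
qed

text \<open>Two words for each of at most 2nq edges, two base addresses, and two structures of 40
  arrays each.\<close>

lemma space_asymp: "(\<lambda>n. real (4 * n * csqrt n + 2 + 80 * par_N n)) \<in> O(\<lambda>n. real n powr (3 / 2))"
proof (rule bigoI[of _ 4000])
  show "\<forall>\<^sub>F n in at_top. norm (real (4 * n * csqrt n + 2 + 80 * par_N n)) \<le> 4000 * norm (real n powr (3 / 2))"
  proof (rule eventually_mono[OF eventually_ge_at_top[of "1 :: nat"]])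
    fix n :: nat assume n: "1 \<le> n"
    define x where "x = real n powr (1 / 4)"
    note B = par_bounds[OF n, folded x_def]
    have p: "1 \<le> x ^ 6" "x ^ 2 \<le> x ^ 6" "x ^ 4 \<le> x ^ 6" using B(1) power_increasing[of 2 6 x] power_increasing[of 4 6 x] by (auto simp: one_le_power)
    have "real n * real (csqrt n) \<le> x ^ 4 * (2 * x ^ 2)" using B by (intro mult_mono) auto
    also have "x ^ 4 * (2 * x ^ 2) = 2 * x ^ 6" by (simp flip: power_add)
    finally have nq: "real n * real (csqrt n) \<le> 2 * x ^ 6" .
    have "real (4 * n * csqrt n + 2 + 80 * par_N n) = 164 * (real n * real (csqrt n)) + 802 + 80 * real n + 160 * real (csqrt n)"
      by (simp add: par_N_def par_p_def algebra_simps)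
    also have "\<dots> \<le> 4000 * x ^ 6" using nq B(2,5) p by linarith
    finally show "norm (real (4 * n * csqrt n + 2 + 80 * par_N n)) \<le> 4000 * norm (real n powr (3 / 2))" using B(1,4) by simp
  qed
qed

lemma prep_asymp: "(\<lambda>n. real (2 ^ 20 * (Suc n * Suc n))) \<in> O(\<lambda>n. real n ^ 2)"
proof (rule bigoI[of _ "2 ^ 22"])
  show "\<forall>\<^sub>F n in at_top. norm (real (2 ^ 20 * (Suc n * Suc n))) \<le> 2 ^ 22 * norm (real n ^ 2)"
  proof (rule eventually_mono[OF eventually_ge_at_top[of "1 :: nat"]])
    fix n :: nat assume "1 \<le> n"
    then have "Suc n * Suc n \<le> (2 * n) * (2 * n)" by (intro mult_le_mono) auto
    then have "real (Suc n * Suc n) \<le> real ((2 * n) * (2 * n))" by (simp only: of_nat_le_iff)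
    then show "norm (real (2 ^ 20 * (Suc n * Suc n))) \<le> 2 ^ 22 * norm (real n ^ 2)" by (simp add: power2_eq_square)
  qed
qed

section \<open>Preprocessing\<close>

text \<open>The arrays start two cells behind the input, so that cells 0 and 1 lie in front of them
  even if there are no edges. These cells receive the base addresses only after the graph has been
  read for the second time. Exchanging the arguments of \<open>build\<close> reverses the edges, and
  in between register 64 moves past the first structure.\<close>

definition prep :: com where
  "prep = Seq (Move 2 (Reg 0)) (Seq (Move 3 (Reg 1)) (Seq (Op 64 Times (Reg 3) (Imm 2)) (Seq (Op 64 Plus (Reg 64) (Imm 2))
     (Seq (cC (build 0 1)) (Seq (Op 64 Plus (Reg 64) (Reg vt)) (Seq (cC (build 1 0)) (Seq (Op 65 Minus (Reg 64) (Reg vt))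
     (Seq (Store (Imm 0) (Reg 65)) (Store (Imm 1) (Reg 64))))))))))"

lemma concat_pairs:
  "length (concat (map (\<lambda>(u, v). [u, v]) es)) = 2 * length es"
  "i < length es \<Longrightarrow> es ! i = (concat (map (\<lambda>(u, v). [u, v]) es) ! (2 * i), concat (map (\<lambda>(u, v). [u, v]) es) ! (2 * i + 1))"
proof -
  show "length (concat (map (\<lambda>(u, v). [u, v]) es)) = 2 * length es" by (induction es) auto
  show "i < length es \<Longrightarrow> es ! i = (concat (map (\<lambda>(u, v). [u, v]) es) ! (2 * i), concat (map (\<lambda>(u, v). [u, v]) es) ! (2 * i + 1))"
  proof (induction es arbitrary: i)
    case (Cons e es)
    show ?case
    proof (cases i)
      case (Suc j)
      then show ?thesis using Cons.IH[of j] Cons.prems by (cases e) auto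
    qed (cases e; simp)
  qed simp
qed

text \<open>\<open>H\<close> = (n + 2)^32 exceeds every address and value, and its eighth power fits
  into a word. The factor 2^20 is large enough both for the work space and for the time of the two
  constructions.\<close>

lemma prep_exec:
  assumes po: "partial_lattice_on {..<n} r" and es: "distinct es" "set es = transitive_reduction {..<n} r"
    and w: "(n + 2) ^ 256 \<le> (2 :: nat) ^ w"
  defines "H \<equiv> (n + 2) ^ 32"
  defines "e \<equiv> length es"
  shows "\<exists>t R M. exec w prep (input_state n es (2 ^ 20 * (Suc n * Suc n))) t (R, M) \<and> t \<le> 2 ^ 20 * (Suc n * Suc n) \<and>
    e \<le> 2 * n * csqrt n \<and> 2 * e + 2 + par_N n * nA + par_N n * nA \<le> length M \<and> length M < H \<and> (\<forall>x\<in>set M. x < H) \<and>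
    M ! 0 = 2 * e + 2 \<and> M ! 1 = 2 * e + 2 + par_N n * nA \<and>
    stored w H n r M (2 * e + 2) \<and> stored w H n (r\<inverse>) M (2 * e + 2 + par_N n * nA)"
proof -
  define X where "X = Suc n * Suc n"
  define q where "q = csqrt n"
  define p where "p = par_p n"
  define s where "s = par_s n"
  define m where "m = par_N n"
  define N where "N = n * n + m"
  define b where "b = 2 * e + 2"
  define b' where "b' = b + m * nA"
  have q: "q \<le> Suc n" "0 < q" "n \<le> q * q" "0 < s" "q \<le> s * s" "s \<le> q" "s = csqrt q"
    using csqrt_le csqrt csqrt_le' unfolding q_def s_def par_s_def by blast+
  have md: "m = n * p + n + p + 10" "p = 2 * q" by (simp_all add: m_def par_N_def p_def par_p_def q_def)
  have nq: "n * q \<le> n * Suc n" using q(1) by (rule mult_le_mono2)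
  have X: "n * n \<le> X" "n \<le> X" "1 \<le> X" "N \<le> 20 * X"
    using nq q(1) by (simp_all add: X_def N_def md algebra_simps)
  have eX: "e \<le> X"
  proof -
    have "card (set es) \<le> card ({..<n} \<times> {..<n})"
      by (rule card_mono) (use es(2) in \<open>auto simp: transitive_reduction_def\<close>)
    then show ?thesis using distinct_card[OF es(1)] X(1) by (simp add: card_cartesian_product e_def)
  qed
  have mN: "m \<le> N" by (simp add: N_def)
  \<comment> \<open>The exponent splits as 30 + 2: thirty factors of at least 2, and a square larger
    than \<open>X\<close>.\<close>
  have HX: "2 ^ 30 * X < H"
  proof -
    have "(2 :: nat) ^ 30 * X < (n + 2) ^ 30 * (n + 2) ^ 2"
    proof (rule mult_le_less_imp_less)
      show "(2 :: nat) ^ 30 \<le> (n + 2) ^ 30" by (rule power_mono) auto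
    qed (auto simp: X_def power2_eq_square)
    then show ?thesis by (simp add: H_def flip: power_add)
  qed
  have H: "H ^ 8 \<le> 2 ^ w" "64 < H" using w HX X(3) by (simp_all add: H_def flip: power_mult)
  have small: "k \<le> 2 ^ 22 * X \<Longrightarrow> k < H" for k using HX X(3) by simp
  have NH: "N < H" "40 * N < H" by (rule small; use X(3,4) in simp)+
  define l where "l = concat (map (\<lambda>(u, v). [u, v]) es)"
  have ll: "length l = 2 * e" by (simp add: l_def e_def concat_pairs(1))
  have lH: "x < H" if "x \<in> set l" for x
  proof -
    have "x < n" using that es(2) unfolding l_def by (auto simp: transitive_reduction_def)
    then show ?thesis using small[of x] X(2) by simp
  qed
  define mem where "mem = l @ replicate (2 ^ 20 * X) 0"
  have lm: "length mem = 2 * e + 2 ^ 20 * X" by (simp add: mem_def ll)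
  have lmH: "length mem < H" by (rule small) (use lm eX in simp)
  have nA: "nA = 40" by (simp add: nA_def)
  \<comment> \<open>The second construction starts only 40 * m words after the first and reuses its
    scratch, so the two overlap.\<close>
  have fit: "b' + N * nA \<le> length mem" "b + N * nA \<le> length mem" "b' + m * nA \<le> length mem"
    using X(3,4) mN by (simp_all add: lm b'_def b_def nA)
  define pre where "pre = take b mem"
  have lp: "length pre = b" using fit(2) by (simp add: pre_def)
  have prel: "pre ! i = l ! i" if "i < 2 * e" for i
    using that ll by (simp add: pre_def b_def mem_def nth_append)
  interpret B: bmachine w H N pre n q p s m
    by unfold_locales (use H NH q md mN in \<open>simp_all add: N_def\<close>)
  let ?R = "(\<lambda>_. 0)(0 := n, 1 := e) :: nat \<Rightarrow> nat"
  let ?V = "?R(2 := n, 3 := e, 64 := b)"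
  have bH: "b < H" "b' < H" "2 * e < H" using lmH fit(1,2) by (simp_all add: b_def)
  have H2: "2 < H" "0 < H" "Suc 0 < H" using H(2) by auto
  have imm: "val w R (Imm 2) = 2" for R by (simp only: val.simps B.word_id[OF H2(1)])
  have lt: "2 * e < 2 ^ w" "b < 2 ^ w" using bH B.small by blast+
  have i1: "exec w (Move 2 (Reg 0)) (?R, mem) 1 (?R(2 := n), mem)" using exec.Move[of w 2 "Reg 0" ?R mem] by simp
  have i2: "exec w (Move 3 (Reg 1)) (?R(2 := n), mem) 1 (?R(2 := n, 3 := e), mem)" using exec.Move[of w 3 "Reg 1" "?R(2 := n)" mem] by simp
  have i3: "exec w (Op 64 Times (Reg 3) (Imm 2)) (?R(2 := n, 3 := e), mem) 1 (?R(2 := n, 3 := e, 64 := 2 * e), mem)"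
    by (rule B.op_exec) (use lt in \<open>simp_all add: imm del: val.simps(1)\<close>)
  have i4: "exec w (Op 64 Plus (Reg 64) (Imm 2)) (?R(2 := n, 3 := e, 64 := 2 * e), mem) 1 (?R(2 := n, 3 := e, 64 := 2 * e, 64 := b), mem)"
    by (rule B.op_exec) (use lt in \<open>simp_all add: imm b_def del: val.simps(1)\<close>)
  have nH: "n < H" "e < H" by (rule small; use X eX in simp)+
  \<comment> \<open>The abstract arrays are read off whatever the memory contains.\<close>
  have r1: "B.rel ?V (\<lambda>a i. mem ! (length pre + i * nA + a)) ?V mem"
    unfolding B.rel_def lp using fit(2) lmH nH H2 bH
    by (auto simp: nV_def pre_def mem_def lH)
  have esn: "\<forall>i<length es. 2 * i + 1 < length pre \<and> es ! i = (pre ! (2 * i + 0), pre ! (2 * i + 1))"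
    using concat_pairs(2)[of _ es, folded l_def] by (auto simp: lp b_def prel e_def)
  have run1: "B.runs (build 0 1) ?V A (200000 * (Suc n * Suc n)) (\<lambda>V' A'. V' vt = 40 * m \<and> V' vn = n \<and> V' ve = length es \<and> length es \<le> 2 * n * q \<and>
    (\<exists>le. labelled n r A' le \<and> (\<exists>hd bl r. qstruct w H m n q p s m le hd A' bl r)))" for A
    by (rule B.runs_build) (use po es esn NH q(7) in \<open>simp_all add: q_def N_def e_def\<close>)
  from run1 r1 obtain t1 R1 M1 V1 A1 where ex1: "exec w (cC (build 0 1)) (?V, mem) t1 (R1, M1)" "t1 \<le> 200000 * X" "B.rel V1 A1 R1 M1"
    and pv1: "V1 vt = 40 * m" "V1 vn = n" "V1 ve = e" "e \<le> 2 * n * q"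
    and st1: "\<exists>le. labelled n r A1 le \<and> (\<exists>hd bl r. qstruct w H m n q p s m le hd A1 bl r)"
    unfolding X_def e_def by (rule B.runsE) blast
  have lM1: "length M1 = length mem" using exec_mem_length[OF ex1(1)] by simp
  note rel1 = ex1(3)[unfolded B.rel_def lp]
  have R1: "R1 64 = b" "R1 vt = 40 * m" "R1 vn = n" "R1 ve = e" using rel1 pv1 by (auto simp: nV_def)
  have M1p: "take b M1 = pre" "\<forall>x\<in>set M1. x < H" using rel1 by blast+
  have c1: "M1 ! (b + i * nA + a) = A1 a i" if "a < nA" "i < m" for a i using rel1 that mN by (meson order_less_le_trans)
  let ?S = "R1(64 := b')"
  have i5: "exec w (Op 64 Plus (Reg 64) (Reg vt)) (R1, M1) 1 (?S, M1)"
    by (rule B.op_exec) (use B.small bH H2 R1 in \<open>simp_all add: b'_def nA\<close>)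
  define pre' where "pre' = take b' M1"
  have lp': "length pre' = b'" using fit(1) lM1 by (simp add: pre'_def)
  have prel': "pre' ! i = l ! i" if "i < 2 * e" for i
  proof -
    have "pre' ! i = M1 ! i" using that by (simp add: pre'_def b'_def b_def)
    also have "\<dots> = pre ! i" unfolding M1p(1)[symmetric] using that by (simp add: b_def)
    finally show ?thesis using prel[OF that] by simp
  qed
  interpret C: bmachine w H N pre' n q p s m
    by unfold_locales (use H NH q md mN in \<open>simp_all add: N_def\<close>)
  have r2: "C.rel ?S (\<lambda>a i. M1 ! (length pre' + i * nA + a)) ?S M1"
    unfolding C.rel_def lp' using fit(1) lmH lM1 rel1 M1p(2) by (auto simp: nV_def pre'_def)
  define es' where "es' = map prod.swap es"
  have es': "distinct es'" "set es' = transitive_reduction {..<n} (r\<inverse>)" "length es' = e"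
  proof -
    have "inj_on prod.swap (set es)" by (rule inj_onI) (metis swap_swap)
    then show "distinct es'" unfolding es'_def distinct_map using es(1) by blast
    show "set es' = transitive_reduction {..<n} (r\<inverse>)"
      unfolding es'_def set_map es(2) transitive_reduction_converse
    proof (rule set_eqI)
      fix z :: "nat \<times> nat"
      obtain x y where z: "z = (x, y)" by (cases z)
      show "z \<in> prod.swap ` transitive_reduction {..<n} r \<longleftrightarrow> z \<in> (transitive_reduction {..<n} r)\<inverse>"
        unfolding z by (simp add: pair_in_swap_image)
    qed
    show "length es' = e" by (simp add: es'_def e_def)
  qed
  have esn': "\<forall>i<length es'. 2 * i + 1 < length pre' \<and> es' ! i = (pre' ! (2 * i + 1), pre' ! (2 * i + 0))"
  proof (intro allI impI)
    fix i assume "i < length es'"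
    then have i: "i < e" "2 * i < 2 * e" "2 * i + 1 < 2 * e" using es'(3) by auto
    have "es ! i = (l ! (2 * i), l ! (2 * i + 1))" using concat_pairs(2)[of i es, folded l_def] i(1) by (simp add: e_def)
    then have "es' ! i = (l ! (2 * i + 1), l ! (2 * i))" using i(1) by (simp add: es'_def e_def)
    then show "2 * i + 1 < length pre' \<and> es' ! i = (pre' ! (2 * i + 1), pre' ! (2 * i + 0))"
      using i prel' by (simp add: lp' b'_def b_def)
  qed
  have run2: "C.runs (build 1 0) ?S A (200000 * (Suc n * Suc n)) (\<lambda>V' A'. V' vt = 40 * m \<and> V' vn = n \<and> V' ve = length es' \<and> length es' \<le> 2 * n * q \<and>
    (\<exists>le. labelled n (r\<inverse>) A' le \<and> (\<exists>hd bl r. qstruct w H m n q p s m le hd A' bl r)))" for A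
    by (rule C.runs_build) (use partial_lattice_converse[OF po] es' esn' NH q(7) R1 in \<open>simp_all add: q_def N_def\<close>)
  from run2 r2 obtain t2 R2 M2 V2 A2 where ex2: "exec w (cC (build 1 0)) (?S, M1) t2 (R2, M2)" "t2 \<le> 200000 * X" "C.rel V2 A2 R2 M2"
    and pv2: "V2 vt = 40 * m" and st2: "\<exists>le. labelled n (r\<inverse>) A2 le \<and> (\<exists>hd bl r. qstruct w H m n q p s m le hd A2 bl r)"
    unfolding X_def by (rule C.runsE) blast
  have lM2: "length M2 = length mem" using exec_mem_length[OF ex2(1)] lM1 by simp
  note rel2 = ex2(3)[unfolded C.rel_def lp']
  have R2: "R2 64 = b'" "R2 vt = 40 * m" using rel2 pv2 by (auto simp: nV_def)
  have M2p: "take b' M2 = pre'" "\<forall>x\<in>set M2. x < H" using rel2 by blast+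
  have c2: "M2 ! (b' + i * nA + a) = A2 a i" if "a < nA" "i < m" for a i using rel2 that mN by (meson order_less_le_trans)
  have i6: "exec w (Op 65 Minus (Reg 64) (Reg vt)) (R2, M2) 1 (R2(65 := b), M2)"
    by (rule C.op_exec) (use C.small bH H2 R2 in \<open>simp_all add: b'_def nA\<close>)
  have "2 \<le> length M2" using fit(2) lM2 unfolding b_def by linarith
  then have l2: "0 < length M2" "Suc 0 < length M2" by linarith+
  have i7: "exec w (Store (Imm 0) (Reg 65)) (R2(65 := b), M2) 1 (R2(65 := b), M2[0 := b])"
    using exec.Store[of w "R2(65 := b)" "Imm 0" M2 "Reg 65"] l2 by simp
  have i8: "exec w (Store (Imm 1) (Reg 64)) (R2(65 := b), M2[0 := b]) 1 (R2(65 := b), M2[0 := b, 1 := b'])"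
  proof -
    have v: "val w (R2(65 := b)) (Imm 1) = 1" using C.w_pos by simp
    have "val w (R2(65 := b)) (Imm 1) < length (M2[0 := b])" unfolding v using l2 by simp
    from exec.Store[OF this, of "Reg 64"] show ?thesis unfolding v using R2(1) by simp
  qed
  let ?M = "M2[0 := b, 1 := b']"
  let ?t = "1 + (1 + (1 + (1 + (t1 + (1 + (t2 + (1 + (1 + 1))))))))"
  have ex: "exec w prep (?R, mem) ?t (R2(65 := b), ?M)"
    unfolding prep_def
    by (rule exec.Seq[OF i1], rule exec.Seq[OF i2], rule exec.Seq[OF i3], rule exec.Seq[OF i4[unfolded fun_upd_upd]],
        rule exec.Seq[OF ex1(1)], rule exec.Seq[OF i5], rule exec.Seq[OF ex2(1)], rule exec.Seq[OF i6], rule exec.Seq[OF i7], rule i8)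
  have inp: "input_state n es (2 ^ 20 * X) = (?R, mem)"
    unfolding input_state_def mem_def l_def e_def by (rule refl)
  have E: "exec w prep (input_state n es (2 ^ 20 * X)) ?t (R2(65 := b), ?M)" unfolding inp by (rule ex)
  have tm: "?t \<le> 2 ^ 20 * X" using ex1(2) ex2(2) X(3) by (simp | linarith)
  have cells: "\<forall>x\<in>set ?M. x < H"
  proof
    fix x assume "x \<in> set ?M"
    then have "x \<in> insert b' (insert b (set M2))"
      using set_update_subset_insert[of "M2[0 := b]" 1 b'] set_update_subset_insert[of M2 0 b] by blast
    then show "x < H" using M2p(2) bH(1,2) by blast
  qed
  have M01: "?M ! 0 = b" "?M ! 1 = b'" using l2 by simp_all
  have far: "?M ! k = M2 ! k" if "2 \<le> k" for k using that by simp
  \<comment> \<open>The first structure lies in the prefix that the second construction does not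
    write, and the two base cells lie in front of it.\<close>
  have S1: "stored w H n r ?M b"
  proof -
    have c: "?M ! (b + i * nA + a) = A1 a i" if ai: "a < nA" "i < m" for a i
    proof -
      have "i * nA + a < Suc i * nA" using ai(1) by simp
      also have "\<dots> \<le> m * nA" using ai(2) by (intro mult_le_mono1) simp
      finally have lt: "b + i * nA + a < b'" by (simp add: b'_def)
      have "?M ! (b + i * nA + a) = M2 ! (b + i * nA + a)" by (rule far) (simp add: b_def)
      also have "\<dots> = take b' M2 ! (b + i * nA + a)" using lt by (rule nth_take[symmetric])
      also have "\<dots> = take b' M1 ! (b + i * nA + a)" unfolding M2p(1) pre'_def ..
      also have "\<dots> = M1 ! (b + i * nA + a)" using lt by (rule nth_take)
      finally show ?thesis using c1[OF ai] by (rule trans)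
    qed
    from st1 obtain le where le: "labelled n r A1 le" "\<exists>hd bl k. qstruct w H m n q p s m le hd A1 bl k" by blast
    have "\<forall>a<nA. \<forall>i<m. ?M ! (b + i * nA + a) = A1 a i" using c by blast
    then show ?thesis unfolding stored_def m_def[symmetric] q_def[symmetric] p_def[symmetric] s_def[symmetric]
      by (intro exI[of _ A1] exI[of _ le] conjI le)
  qed
  have S2: "stored w H n (r\<inverse>) ?M b'"
  proof -
    have c: "?M ! (b' + i * nA + a) = A2 a i" if ai: "a < nA" "i < m" for a i
    proof -
      have "?M ! (b' + i * nA + a) = M2 ! (b' + i * nA + a)" by (rule far) (simp add: b_def b'_def)
      then show ?thesis using c2[OF ai] by (rule trans)
    qed
    from st2 obtain le where le: "labelled n (r\<inverse>) A2 le" "\<exists>hd bl k. qstruct w H m n q p s m le hd A2 bl k" by blast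
    have "\<forall>a<nA. \<forall>i<m. ?M ! (b' + i * nA + a) = A2 a i" using c by blast
    then show ?thesis unfolding stored_def m_def[symmetric] q_def[symmetric] p_def[symmetric] s_def[symmetric]
      by (intro exI[of _ A2] exI[of _ le] conjI le)
  qed
  have F: "b' + m * nA \<le> length ?M" "length ?M < H" using fit(3) lM2 lmH by simp_all
  show ?thesis
    unfolding X_def[symmetric] q_def[symmetric] m_def[symmetric] b_def[symmetric] b'_def[symmetric]
    by (intro exI[of _ ?t] exI[of _ "R2(65 := b)"] exI[of _ ?M] conjI E tm pv1(4) F cells M01 S1 S2)
qed

lemma word_length_pow: "word_length k W \<Longrightarrow> (n + 2) ^ k \<le> (2 :: nat) ^ W n"
proof -
  assume "word_length k W"
  then have "real k * log 2 (real n + 2) \<le> real (W n)" by (simp add: word_length_def)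
  then have "2 powr (log 2 (real n + 2) * real k) \<le> 2 powr real (W n)" by (intro powr_mono) (simp_all add: mult.commute)
  moreover have "2 powr (log 2 (real n + 2) * real k) = (real n + 2) ^ k"
    by (simp add: powr_powr[symmetric] powr_log_cancel powr_realpow)
  moreover have "2 powr real (W n) = (2 :: real) ^ W n" by (simp add: powr_realpow)
  ultimately have "real ((n + 2) ^ k) \<le> real (2 ^ W n)" by (simp add: add.commute)
  then show ?thesis by (simp only: of_nat_le_iff)
qed

text \<open>Purity of the queries reduces the reachable memories to \<open>M\<close>, and joins are
  answered as meets of the converse order.\<close>

lemma represents_stored:
  assumes st: "stored w H n r M (M ! 0)" "stored w H n (r\<inverse>) M (M ! 1)"
    and M: "M ! 0 + par_N n * nA \<le> length M" "M ! 1 + par_N n * nA \<le> length M" "2 \<le> length M" "length M < H" "\<forall>z\<in>set M. z < H"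
  shows "represents w leq_com (meet_com 0) (meet_com 1) n r 252 (qtime n) M"
proof -
  have "M' = M" if "M' \<in> reachable w n {leq_com, meet_com 0, meet_com 1} M" for M'
    using that
  proof induction
    case (query M' c x y t R M'')
    then have "pure c" using stored_pure[OF st(1)] by auto
    then show ?case using pure_exec[OF query.hyps(5)] query.IH by (simp add: query_state_def)
  qed simp
  then show ?thesis
    unfolding represents_def is_join_converse
    using stored_answers[OF st(1) _ _ _ refl M(1,3-5)] stored_answers[OF st(2) _ _ _ refl M(2-5)] by fastforce
qed

theorem theorem9:
  shows "\<exists>k\<ge>2. \<forall>W. word_length k W \<longrightarrow>
    (\<exists>(preprocess :: com) (leq_query :: com) (meet_query :: com) (join_query :: com)
        (S :: nat \<Rightarrow> nat) (P :: nat \<Rightarrow> nat) (U :: nat \<Rightarrow> nat) (V :: nat \<Rightarrow> nat).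
       (\<lambda>n. real (S n)) \<in> O(\<lambda>n. real n powr (3 / 2)) \<and>
       (\<lambda>n. real (P n)) \<in> O(\<lambda>n. real n ^ 2) \<and>
       (\<lambda>n. real (U n)) \<in> O(\<lambda>n. 1) \<and>
       (\<lambda>n. real (V n)) \<in> O(\<lambda>n. real n powr (3 / 4)) \<and>
       (\<forall>n r es. partial_lattice_on {..<n} r \<longrightarrow>
          distinct es \<longrightarrow> set es = transitive_reduction {..<n} r \<longrightarrow>
          (\<exists>t R M s. exec (W n) preprocess (input_state n es (P n)) t (R, M) \<and>
             t \<le> P n \<and> s \<le> S n \<and>
             represents (W n) leq_query meet_query join_query n r (U n) (V n) (take s M))))"
proof (intro exI[of _ "256 :: nat"] conjI allI impI)
  \<comment> \<open>256 = 32 * 8: values stay below (n + 2)^32 and expressions have degree at most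
    8.\<close>
  fix W assume W: "word_length 256 W"
  have main: "\<exists>t R M s. exec (W n) prep (input_state n es (2 ^ 20 * (Suc n * Suc n))) t (R, M) \<and>
      t \<le> 2 ^ 20 * (Suc n * Suc n) \<and> s \<le> 4 * n * csqrt n + 2 + 80 * par_N n \<and>
      represents (W n) leq_com (meet_com 0) (meet_com 1) n r 252 (qtime n) (take s M)"
    if po: "partial_lattice_on {..<n} r" and es: "distinct es" "set es = transitive_reduction {..<n} r" for n r es
  proof -
    define H where "H = (n + 2) ^ 32"
    define b where "b = 2 * length es + 2"
    define b' where "b' = b + par_N n * nA"
    obtain t R M where *: "exec (W n) prep (input_state n es (2 ^ 20 * (Suc n * Suc n))) t (R, M)" "t \<le> 2 ^ 20 * (Suc n * Suc n)"
      "length es \<le> 2 * n * csqrt n" "b' + par_N n * nA \<le> length M" "length M < H" "\<forall>x\<in>set M. x < H"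
      "M ! 0 = b" "M ! 1 = b'" "stored (W n) H n r M b" "stored (W n) H n (r\<inverse>) M b'"
      using prep_exec[OF po es word_length_pow[OF W]] unfolding H_def b_def b'_def by blast
    \<comment> \<open>The end of the second structure; everything behind it is scratch.\<close>
    define z where "z = b' + par_N n * nA"
    have lt: "c + i * nA + a < z" if "a < nA" "i < par_N n" "c \<le> b'" for a i c
    proof -
      have "i * nA + a < Suc i * nA" using that(1) by simp
      also have "\<dots> \<le> par_N n * nA" using that(2) by (intro mult_le_mono1) simp
      finally show ?thesis using that(3) by (simp add: z_def)
    qed
    have z2: "2 \<le> z" by (simp add: z_def b'_def b_def)
    have lz: "length (take z M) = z" using *(4) by (simp add: z_def)
    have st: "stored (W n) H n ord (take z M) c" if s: "stored (W n) H n ord M c" and c: "c \<le> b'" for ord c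
    proof -
      obtain A le where A: "labelled n ord A le" "\<exists>hd bl k. qstruct (W n) H (par_N n) n (csqrt n) (par_p n) (par_s n) (par_N n) le hd A bl k"
        "\<forall>a<nA. \<forall>i<par_N n. M ! (c + i * nA + a) = A a i" using s unfolding stored_def by blast
      have "\<forall>a<nA. \<forall>i<par_N n. take z M ! (c + i * nA + a) = A a i" using A(3) lt c by simp
      then show ?thesis unfolding stored_def using A(1,2) by blast
    qed
    have t01: "take z M ! 0 = b" "take z M ! 1 = b'" using *(7,8) z2 by simp_all
    have "represents (W n) leq_com (meet_com 0) (meet_com 1) n r 252 (qtime n) (take z M)"
    proof (rule represents_stored)
      show "\<forall>x\<in>set (take z M). x < H" using *(6) in_set_takeD by fast
    qed (use st[OF *(9)] st[OF *(10)] t01 lz z2 *(4,5) in \<open>simp_all add: z_def b'_def\<close>)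
    moreover have "z \<le> 4 * n * csqrt n + 2 + 80 * par_N n" using *(3) by (simp add: z_def b'_def b_def nA_def)
    ultimately show ?thesis using *(1,2) by blast
  qed
  show "\<exists>(preprocess :: com) (leq_query :: com) (meet_query :: com) (join_query :: com)
        (S :: nat \<Rightarrow> nat) (P :: nat \<Rightarrow> nat) (U :: nat \<Rightarrow> nat) (V :: nat \<Rightarrow> nat).
       (\<lambda>n. real (S n)) \<in> O(\<lambda>n. real n powr (3 / 2)) \<and>
       (\<lambda>n. real (P n)) \<in> O(\<lambda>n. real n ^ 2) \<and>
       (\<lambda>n. real (U n)) \<in> O(\<lambda>n. 1) \<and>
       (\<lambda>n. real (V n)) \<in> O(\<lambda>n. real n powr (3 / 4)) \<and>
       (\<forall>n r es. partial_lattice_on {..<n} r \<longrightarrow>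
          distinct es \<longrightarrow> set es = transitive_reduction {..<n} r \<longrightarrow>
          (\<exists>t R M s. exec (W n) preprocess (input_state n es (P n)) t (R, M) \<and>
             t \<le> P n \<and> s \<le> S n \<and>
             represents (W n) leq_query meet_query join_query n r (U n) (V n) (take s M)))"
    apply (rule exI[of _ prep], rule exI[of _ leq_com], rule exI[of _ "meet_com 0"], rule exI[of _ "meet_com 1"])
    apply (rule exI[of _ "\<lambda>n. 4 * n * csqrt n + 2 + 80 * par_N n"], rule exI[of _ "\<lambda>n. 2 ^ 20 * (Suc n * Suc n)"])
    apply (rule exI[of _ "\<lambda>_. 252"], rule exI[of _ qtime])
    using space_asymp prep_asymp qtime_asymp main by (intro conjI allI impI) (assumption | rule bigoI[of _ 252] | simp)+
qed simp

end
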